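(* The functor $(-)^{\mathcal{O}}:\mathrm{Map}(\mathcal{S})_{\mathrm{eq}}\to\mathcal{S}^{\mathcal{S}^{\mathrm{op}}}$, $X\mapsto X^{\mathcal{O}}$, and its left adjoint, the realization functor $Y\mapsto|Y|$, form a Quillen pair, which gives a Quillen equivalence between $\mathcal{S}^{\mathcal{S}^{\mathrm{op}}}$ and $\mathrm{Map}(\mathcal{S})_{\mathrm{eq}}$.
   Context: $\mathcal{S}$ is the category of simplicial sets with its usual simplicial enrichment and usual (Kan–Quillen) model structure. All functors are simplicial (enriched). The category $\mathcal{S}^{\mathcal{S}^{\mathrm{op}}}$: its objects are the small functors $\mathcal{S}^{\mathrm{op}}\to\mathcal{S}$, where a functor is small if it is a small weighted colimit of representables $R^A=\hom_{\mathcal{S}}(-,A)$ (equivalently, it is the enriched left Kan extension of its restriction to some small full simplicial subcategory of $\mathcal{S}^{\mathrm{op}}$); its morphisms are natural transformations. It carries the model structure in which weak equivalences and fibrations are defined objectwise (a map $F\to G$ is a weak equivalence, resp. fibration, iff $F(A)\to G(A)$ is a weak equivalence, resp. Kan fibration, for every $A$), and cofibrations are the maps with the left lifting property with respect to acyclic fibrations. The existence of this model structure is taken as known. The category $\mathrm{Map}(\mathcal{S})$: its objects are the maps $A\to B$ in $\mathcal{S}$ and its morphisms are commutative squares. It is simplicially enriched and tensored, with $(A\to B)\otimes K=(A\times K\to B\times K)$ and $\hom(X,Y)_n=\mathrm{Map}(\mathcal{S})(X\otimes\Delta^n,Y)$. For a simplicial set $A$, let $O_A=(A\to * )$ with $*=\Delta^0$;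 the objects $O_A$ are called orbits, and the full subcategory $\mathcal{O}$ of orbits is equivalent to $\mathcal{S}$ via $O_A\mapsto A$. $\mathrm{Map}(\mathcal{S})_{\mathrm{eq}}$ is $\mathrm{Map}(\mathcal{S})$ with Farjoun's equivariant (fine) model structure: a map $X\to Y$ is a weak equivalence (resp. fibration) iff for every $A\in\mathcal{S}$ the map $\hom(O_A,X)\to\hom(O_A,Y)$ is a weak equivalence (resp. fibration) of simplicial sets, and cofibrations are the maps with the left lifting property with respect to acyclic fibrations. The existence of this model structure is taken as known. For $X\in\mathrm{Map}(\mathcal{S})$, $X^{\mathcal{O}}:\mathcal{S}^{\mathrm{op}}\to\mathcal{S}$ is the functor $A\mapsto\hom(O_A,X)$; it is a small functor. The functor $X\mapsto X^{\mathcal{O}}$ has a left adjoint, called realization and denoted $Y\mapsto|Y|$; explicitly $|Y|$ is the coend $\int^{A}O_A\otimes Y(A)$ in $\mathrm{Map}(\mathcal{S})$, which can be computed over a small full subcategory of $\mathcal{S}$ from which $Y$ is left Kan extended. *)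

theory Defs
  imports Main "HOL-Library.FuncSet"
begin

unbundle cardinal_syntax

text \<open>
  Size.  HOL has no type of all small sets, so ``small'' is relative to a type \<open>'u\<close> whose
  cardinality is strongly inaccessible (a Grothendieck universe): a set is small if its
  cardinality is below that of \<open>'u\<close>, and the category \<open>SS\<close> of simplicial sets has as objects
  the simplicial sets whose sets of simplices are small subsets of \<open>'u\<close>.
\<close>

definition inaccessible :: "'u set \<Rightarrow> bool" where
  "inaccessible U \<longleftrightarrow>
     |UNIV :: nat set| <o |U| \<and>
     (\<forall>A \<subseteq> U. |A| <o |U| \<longrightarrow> |Pow A| <o |U| ) \<and>
     (\<forall>A \<subseteq> U. \<forall>f. |A| <o |U| \<and> (\<forall>x\<in>A. f x \<subseteq> U \<and> |f x| <o |U| ) \<longrightarrow> |\<Union>x\<in>A. f x| <o |U| )"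


section \<open>Categories, limits, adjunctions\<close>

text \<open>
  Hom sets of different pairs of objects need not be disjoint, so composition takes the three
  objects involved: \<open>Cmp C X Y Z g f\<close> is the composite of \<open>f : X \<rightarrow> Y\<close> and \<open>g : Y \<rightarrow> Z\<close>.
\<close>

record ('o, 'm) category =
  Ob :: "'o set"
  Hm :: "'o \<Rightarrow> 'o \<Rightarrow> 'm set"
  Idm :: "'o \<Rightarrow> 'm"
  Cmp :: "'o \<Rightarrow> 'o \<Rightarrow> 'o \<Rightarrow> 'm \<Rightarrow> 'm \<Rightarrow> 'm"

definition is_category :: "('o, 'm, 'z) category_scheme \<Rightarrow> bool" where
  "is_category C \<longleftrightarrow>
     (\<forall>X\<in>Ob C. Idm C X \<in> Hm C X X) \<and>
     (\<forall>X\<in>Ob C. \<forall>Y\<in>Ob C. \<forall>Z\<in>Ob C. \<forall>f\<in>Hm C X Y. \<forall>g\<in>Hm C Y Z. Cmp C X Y Z g f \<in> Hm C X Z) \<and>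
     (\<forall>X\<in>Ob C. \<forall>Y\<in>Ob C. \<forall>f\<in>Hm C X Y.
        Cmp C X X Y f (Idm C X) = f \<and> Cmp C X Y Y (Idm C Y) f = f) \<and>
     (\<forall>W\<in>Ob C. \<forall>X\<in>Ob C. \<forall>Y\<in>Ob C. \<forall>Z\<in>Ob C. \<forall>f\<in>Hm C W X. \<forall>g\<in>Hm C X Y. \<forall>h\<in>Hm C Y Z.
        Cmp C W Y Z h (Cmp C W X Y g f) = Cmp C W X Z (Cmp C X Y Z h g) f)"

definition opp :: "('o, 'm, 'z) category_scheme \<Rightarrow> ('o, 'm) category" where
  "opp C = \<lparr> Ob = Ob C, Hm = (\<lambda>X Y. Hm C Y X), Idm = Idm C,
             Cmp = (\<lambda>X Y Z g f. Cmp C Z Y X f g) \<rparr>"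

record ('o, 'm, 'p, 'n) cfunctor =
  onO :: "'o \<Rightarrow> 'p"
  onM :: "'o \<Rightarrow> 'o \<Rightarrow> 'm \<Rightarrow> 'n"

definition is_functor ::
  "('o, 'm, 'y) category_scheme \<Rightarrow> ('p, 'n, 'z) category_scheme \<Rightarrow> ('o, 'm, 'p, 'n) cfunctor \<Rightarrow> bool"
where
  "is_functor C D F \<longleftrightarrow>
     (\<forall>X\<in>Ob C. onO F X \<in> Ob D) \<and>
     (\<forall>X\<in>Ob C. \<forall>Y\<in>Ob C. \<forall>f\<in>Hm C X Y. onM F X Y f \<in> Hm D (onO F X) (onO F Y)) \<and>
     (\<forall>X\<in>Ob C. onM F X X (Idm C X) = Idm D (onO F X)) \<and>
     (\<forall>X\<in>Ob C. \<forall>Y\<in>Ob C. \<forall>Z\<in>Ob C. \<forall>f\<in>Hm C X Y. \<forall>g\<in>Hm C Y Z.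
        onM F X Z (Cmp C X Y Z g f)
          = Cmp D (onO F X) (onO F Y) (onO F Z) (onM F Y Z g) (onM F X Y f))"

definition is_cone ::
  "('j, 'k, 'y) category_scheme \<Rightarrow> ('o, 'm, 'z) category_scheme \<Rightarrow> ('j, 'k, 'o, 'm) cfunctor
     \<Rightarrow> 'o \<Rightarrow> ('j \<Rightarrow> 'm) \<Rightarrow> bool"
where
  "is_cone J C D L p \<longleftrightarrow>
     L \<in> Ob C \<and> (\<forall>j\<in>Ob J. p j \<in> Hm C L (onO D j)) \<and>
     (\<forall>i\<in>Ob J. \<forall>j\<in>Ob J. \<forall>m\<in>Hm J i j.
        Cmp C L (onO D i) (onO D j) (onM D i j m) (p i) = p j)"

definition is_limit ::
  "('j, 'k, 'y) category_scheme \<Rightarrow> ('o, 'm, 'z) category_scheme \<Rightarrow> ('j, 'k, 'o, 'm) cfunctor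
     \<Rightarrow> 'o \<Rightarrow> ('j \<Rightarrow> 'm) \<Rightarrow> bool"
where
  "is_limit J C D L p \<longleftrightarrow>
     is_cone J C D L p \<and>
     (\<forall>K q. is_cone J C D K q \<longrightarrow>
        (\<exists>!h. h \<in> Hm C K L \<and> (\<forall>j\<in>Ob J. Cmp C K L (onO D j) (p j) h = q j)))"

definition small_category :: "('u, 'u) category \<Rightarrow> bool" where
  "small_category J \<longleftrightarrow>
     is_category J \<and> |Ob J| <o |UNIV :: 'u set| \<and>
     (\<forall>i\<in>Ob J. \<forall>j\<in>Ob J. |Hm J i j| <o |UNIV :: 'u set| )"

definition has_small_limits :: "'u itself \<Rightarrow> ('o, 'm, 'z) category_scheme \<Rightarrow> bool" where
  "has_small_limits u C \<longleftrightarrow>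
     (\<forall>J :: ('u, 'u) category. \<forall>D. small_category J \<and> is_functor J C D \<longrightarrow>
        (\<exists>L p. is_limit J C D L p))"

definition has_small_colimits :: "'u itself \<Rightarrow> ('o, 'm, 'z) category_scheme \<Rightarrow> bool" where
  "has_small_colimits u C \<longleftrightarrow> has_small_limits u (opp C)"

definition is_initial :: "('o, 'm, 'z) category_scheme \<Rightarrow> 'o \<Rightarrow> bool" where
  "is_initial C I \<longleftrightarrow> I \<in> Ob C \<and> (\<forall>X\<in>Ob C. \<exists>!f. f \<in> Hm C I X)"

definition is_terminal :: "('o, 'm, 'z) category_scheme \<Rightarrow> 'o \<Rightarrow> bool" where
  "is_terminal C T \<longleftrightarrow> T \<in> Ob C \<and> (\<forall>X\<in>Ob C. \<exists>!f. f \<in> Hm C X T)"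

text \<open>\<open>\<phi> X Y : D(L X, Y) \<cong> C(X, R Y)\<close>, natural in \<open>X\<close> and \<open>Y\<close>.\<close>

definition is_adjunction ::
  "('o, 'm, 'y) category_scheme \<Rightarrow> ('p, 'n, 'z) category_scheme
     \<Rightarrow> ('o, 'm, 'p, 'n) cfunctor \<Rightarrow> ('p, 'n, 'o, 'm) cfunctor \<Rightarrow> ('o \<Rightarrow> 'p \<Rightarrow> 'n \<Rightarrow> 'm) \<Rightarrow> bool"
where
  "is_adjunction C D L R \<phi> \<longleftrightarrow>
     is_functor C D L \<and> is_functor D C R \<and>
     (\<forall>X\<in>Ob C. \<forall>Y\<in>Ob D. bij_betw (\<phi> X Y) (Hm D (onO L X) Y) (Hm C X (onO R Y))) \<and>
     (\<forall>X'\<in>Ob C. \<forall>X\<in>Ob C. \<forall>Y\<in>Ob D. \<forall>f\<in>Hm C X' X. \<forall>g\<in>Hm D (onO L X) Y.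
        \<phi> X' Y (Cmp D (onO L X') (onO L X) Y g (onM L X' X f))
          = Cmp C X' X (onO R Y) (\<phi> X Y g) f) \<and>
     (\<forall>X\<in>Ob C. \<forall>Y\<in>Ob D. \<forall>Y'\<in>Ob D. \<forall>g\<in>Hm D (onO L X) Y. \<forall>k\<in>Hm D Y Y'.
        \<phi> X Y' (Cmp D (onO L X) Y Y' k g)
          = Cmp C X (onO R Y) (onO R Y') (onM R Y Y' k) (\<phi> X Y g))"


section \<open>Model categories and Quillen equivalences\<close>

record ('o, 'm) model = "('o, 'm) category" +
  weq :: "'o \<Rightarrow> 'o \<Rightarrow> 'm set"
  fib :: "'o \<Rightarrow> 'o \<Rightarrow> 'm set"
  cof :: "'o \<Rightarrow> 'o \<Rightarrow> 'm set"

definition has_lifting ::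
  "('o, 'm, 'z) category_scheme \<Rightarrow> 'o \<Rightarrow> 'o \<Rightarrow> 'm \<Rightarrow> 'o \<Rightarrow> 'o \<Rightarrow> 'm \<Rightarrow> bool"
where
  "has_lifting C A B i X Y p \<longleftrightarrow>
     (\<forall>u\<in>Hm C A X. \<forall>v\<in>Hm C B Y. Cmp C A X Y p u = Cmp C A B Y v i \<longrightarrow>
        (\<exists>h\<in>Hm C B X. Cmp C A B X h i = u \<and> Cmp C B X Y p h = v))"

definition is_retract_of ::
  "('o, 'm, 'z) category_scheme \<Rightarrow> 'o \<Rightarrow> 'o \<Rightarrow> 'm \<Rightarrow> 'o \<Rightarrow> 'o \<Rightarrow> 'm \<Rightarrow> bool"
where
  "is_retract_of C A B f X Y g \<longleftrightarrow>
     (\<exists>i\<in>Hm C A X. \<exists>r\<in>Hm C X A. \<exists>j\<in>Hm C B Y. \<exists>s\<in>Hm C Y B.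
        Cmp C A X A r i = Idm C A \<and> Cmp C B Y B s j = Idm C B \<and>
        Cmp C A X Y g i = Cmp C A B Y j f \<and> Cmp C X A B f r = Cmp C X Y B s g)"

definition retract_closed ::
  "('o, 'm, 'z) category_scheme \<Rightarrow> ('o \<Rightarrow> 'o \<Rightarrow> 'm set) \<Rightarrow> bool"
where
  "retract_closed C P \<longleftrightarrow>
     (\<forall>A\<in>Ob C. \<forall>B\<in>Ob C. \<forall>X\<in>Ob C. \<forall>Y\<in>Ob C. \<forall>f\<in>Hm C A B. \<forall>g\<in>P X Y.
        is_retract_of C A B f X Y g \<longrightarrow> f \<in> P A B)"

definition two_of_three ::
  "('o, 'm, 'z) category_scheme \<Rightarrow> ('o \<Rightarrow> 'o \<Rightarrow> 'm set) \<Rightarrow> bool"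
where
  "two_of_three C W \<longleftrightarrow>
     (\<forall>X\<in>Ob C. \<forall>Y\<in>Ob C. \<forall>Z\<in>Ob C. \<forall>f\<in>Hm C X Y. \<forall>g\<in>Hm C Y Z.
        (f \<in> W X Y \<and> g \<in> W Y Z \<longrightarrow> Cmp C X Y Z g f \<in> W X Z) \<and>
        (f \<in> W X Y \<and> Cmp C X Y Z g f \<in> W X Z \<longrightarrow> g \<in> W Y Z) \<and>
        (g \<in> W Y Z \<and> Cmp C X Y Z g f \<in> W X Z \<longrightarrow> f \<in> W X Y))"

definition factors ::
  "('o, 'm, 'z) category_scheme \<Rightarrow> ('o \<Rightarrow> 'o \<Rightarrow> 'm set) \<Rightarrow> ('o \<Rightarrow> 'o \<Rightarrow> 'm set) \<Rightarrow> bool"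
where
  "factors C P Q \<longleftrightarrow>
     (\<forall>X\<in>Ob C. \<forall>Y\<in>Ob C. \<forall>f\<in>Hm C X Y.
        \<exists>Z\<in>Ob C. \<exists>i\<in>P X Z. \<exists>p\<in>Q Z Y. Cmp C X Z Y p i = f)"

definition model_category :: "'u itself \<Rightarrow> ('o, 'm) model \<Rightarrow> bool" where
  "model_category u M \<longleftrightarrow>
     is_category M \<and> has_small_limits u M \<and> has_small_colimits u M \<and>
     (\<forall>X\<in>Ob M. \<forall>Y\<in>Ob M. weq M X Y \<subseteq> Hm M X Y \<and> fib M X Y \<subseteq> Hm M X Y \<and> cof M X Y \<subseteq> Hm M X Y) \<and>
     two_of_three M (weq M) \<and>
     retract_closed M (weq M) \<and> retract_closed M (fib M) \<and> retract_closed M (cof M) \<and>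
     (\<forall>A\<in>Ob M. \<forall>B\<in>Ob M. \<forall>X\<in>Ob M. \<forall>Y\<in>Ob M. \<forall>i\<in>cof M A B. \<forall>p\<in>fib M X Y.
        i \<in> weq M A B \<or> p \<in> weq M X Y \<longrightarrow> has_lifting M A B i X Y p) \<and>
     factors M (cof M) (\<lambda>X Y. fib M X Y \<inter> weq M X Y) \<and>
     factors M (\<lambda>X Y. cof M X Y \<inter> weq M X Y) (fib M)"

definition cofibrant :: "('o, 'm) model \<Rightarrow> 'o \<Rightarrow> bool" where
  "cofibrant M X \<longleftrightarrow> X \<in> Ob M \<and> (\<exists>I f. is_initial M I \<and> f \<in> cof M I X)"

definition fibrant :: "('o, 'm) model \<Rightarrow> 'o \<Rightarrow> bool" where
  "fibrant M X \<longleftrightarrow> X \<in> Ob M \<and> (\<exists>T f. is_terminal M T \<and> f \<in> fib M X T)"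

definition quillen_pair ::
  "'u itself \<Rightarrow> ('o, 'm) model \<Rightarrow> ('p, 'n) model
     \<Rightarrow> ('o, 'm, 'p, 'n) cfunctor \<Rightarrow> ('p, 'n, 'o, 'm) cfunctor \<Rightarrow> ('o \<Rightarrow> 'p \<Rightarrow> 'n \<Rightarrow> 'm) \<Rightarrow> bool"
where
  "quillen_pair u M N L R \<phi> \<longleftrightarrow>
     model_category u M \<and> model_category u N \<and> is_adjunction M N L R \<phi> \<and>
     (\<forall>X\<in>Ob M. \<forall>Y\<in>Ob M. \<forall>f\<in>cof M X Y.
        onM L X Y f \<in> cof N (onO L X) (onO L Y) \<and>
        (f \<in> weq M X Y \<longrightarrow> onM L X Y f \<in> weq N (onO L X) (onO L Y))) \<and>
     (\<forall>X\<in>Ob N. \<forall>Y\<in>Ob N. \<forall>f\<in>fib N X Y.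
        onM R X Y f \<in> fib M (onO R X) (onO R Y) \<and>
        (f \<in> weq N X Y \<longrightarrow> onM R X Y f \<in> weq M (onO R X) (onO R Y)))"

definition quillen_equivalence ::
  "'u itself \<Rightarrow> ('o, 'm) model \<Rightarrow> ('p, 'n) model
     \<Rightarrow> ('o, 'm, 'p, 'n) cfunctor \<Rightarrow> ('p, 'n, 'o, 'm) cfunctor \<Rightarrow> ('o \<Rightarrow> 'p \<Rightarrow> 'n \<Rightarrow> 'm) \<Rightarrow> bool"
where
  "quillen_equivalence u M N L R \<phi> \<longleftrightarrow>
     quillen_pair u M N L R \<phi> \<and>
     (\<forall>X Y. \<forall>g \<in> Hm N (onO L X) Y. cofibrant M X \<and> fibrant N Y \<longrightarrow>
        (g \<in> weq N (onO L X) Y \<longleftrightarrow> \<phi> X Y g \<in> weq M X (onO R Y)))"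

text \<open>The structure with given weak equivalences and fibrations in which the cofibrations are the
  maps with the left lifting property against the acyclic fibrations.\<close>

definition model_of ::
  "('o, 'm) category \<Rightarrow> ('o \<Rightarrow> 'o \<Rightarrow> 'm set) \<Rightarrow> ('o \<Rightarrow> 'o \<Rightarrow> 'm set) \<Rightarrow> ('o, 'm) model"
where
  "model_of C W F =
     \<lparr> Ob = Ob C, Hm = Hm C, Idm = Idm C, Cmp = Cmp C, weq = W, fib = F,
       cof = (\<lambda>A B. {i \<in> Hm C A B. \<forall>X\<in>Ob C. \<forall>Y\<in>Ob C. \<forall>p \<in> F X Y \<inter> W X Y.
                       has_lifting C A B i X Y p}) \<rparr>"


section \<open>Simplicial sets\<close>

text \<open>\<open>Dmap m n\<close> is the set of order preserving maps \<open>[m] \<rightarrow> [n]\<close>.  In a simplicial set \<open>X\<close>,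
  \<open>opr X m n \<alpha> : X\<^sub>n \<rightarrow> X\<^sub>m\<close> is the operator induced by \<open>\<alpha> : [m] \<rightarrow> [n]\<close>.\<close>

definition Dmap :: "nat \<Rightarrow> nat \<Rightarrow> (nat \<Rightarrow> nat) set" where
  "Dmap m n = {\<alpha> \<in> {..m} \<rightarrow>\<^sub>E {..n}. mono_on {..m} \<alpha>}"

definition Did :: "nat \<Rightarrow> nat \<Rightarrow> nat" where
  "Did n = (\<lambda>i\<in>{..n}. i)"

record 'a simp =
  spx :: "nat \<Rightarrow> 'a set"
  opr :: "nat \<Rightarrow> nat \<Rightarrow> (nat \<Rightarrow> nat) \<Rightarrow> 'a \<Rightarrow> 'a"

definition simplicial_set :: "'a simp \<Rightarrow> bool" where
  "simplicial_set X \<longleftrightarrow>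
     (\<forall>m n. \<forall>\<alpha>\<in>Dmap m n. \<forall>x\<in>spx X n. opr X m n \<alpha> x \<in> spx X m) \<and>
     (\<forall>n. \<forall>x\<in>spx X n. opr X n n (Did n) x = x) \<and>
     (\<forall>k m n. \<forall>\<beta>\<in>Dmap k m. \<forall>\<alpha>\<in>Dmap m n. \<forall>x\<in>spx X n.
        opr X k n (compose {..k} \<alpha> \<beta>) x = opr X k m \<beta> (opr X m n \<alpha> x))"

definition SS :: "'u simp set" where
  "SS = {X. simplicial_set X \<and> (\<forall>n. |spx X n| <o |UNIV :: 'u set| )}"

definition smap :: "'a simp \<Rightarrow> 'b simp \<Rightarrow> (nat \<Rightarrow> 'a \<Rightarrow> 'b) set" where
  "smap X Y = {f. (\<forall>n. f n \<in> spx X n \<rightarrow>\<^sub>E spx Y n) \<and>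
     (\<forall>m n. \<forall>\<alpha>\<in>Dmap m n. \<forall>x\<in>spx X n. f m (opr X m n \<alpha> x) = opr Y m n \<alpha> (f n x))}"

definition sid :: "'a simp \<Rightarrow> nat \<Rightarrow> 'a \<Rightarrow> 'a" where
  "sid X = (\<lambda>n. \<lambda>x\<in>spx X n. x)"

definition scomp :: "'a simp \<Rightarrow> (nat \<Rightarrow> 'b \<Rightarrow> 'c) \<Rightarrow> (nat \<Rightarrow> 'a \<Rightarrow> 'b) \<Rightarrow> nat \<Rightarrow> 'a \<Rightarrow> 'c" where
  "scomp X g f = (\<lambda>n. compose (spx X n) (g n) (f n))"

definition sprod :: "'a simp \<Rightarrow> 'b simp \<Rightarrow> ('a \<times> 'b) simp" where
  "sprod X Y = \<lparr> spx = (\<lambda>n. spx X n \<times> spx Y n),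
                 opr = (\<lambda>m n \<alpha> (x, y). (opr X m n \<alpha> x, opr Y m n \<alpha> y)) \<rparr>"

text \<open>The one-point simplicial set.\<close>

definition pt :: "'a simp" where
  "pt = \<lparr> spx = (\<lambda>n. {undefined}), opr = (\<lambda>m n \<alpha> x. undefined) \<rparr>"

definition to_pt :: "'a simp \<Rightarrow> nat \<Rightarrow> 'a \<Rightarrow> 'b" where
  "to_pt X = (\<lambda>n. \<lambda>x\<in>spx X n. undefined)"

definition Delta :: "nat \<Rightarrow> (nat \<Rightarrow> nat) simp" where
  "Delta n = \<lparr> spx = (\<lambda>m. Dmap m n), opr = (\<lambda>k m \<beta> \<alpha>. compose {..k} \<alpha> \<beta>) \<rparr>"

text \<open>The horn: the union of all codimension one faces but the \<open>k\<close>-th, the \<open>i\<close>-th face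
  consisting of the simplices \<open>\<alpha>\<close> that miss the vertex \<open>i\<close>.\<close>

definition horn :: "nat \<Rightarrow> nat \<Rightarrow> (nat \<Rightarrow> nat) simp" where
  "horn n k = \<lparr> spx = (\<lambda>m. {\<alpha> \<in> Dmap m n. \<exists>i\<le>n. i \<noteq> k \<and> i \<notin> \<alpha> ` {..m}}),
                opr = opr (Delta n) \<rparr>"

definition kan_fibration :: "'a simp \<Rightarrow> 'b simp \<Rightarrow> (nat \<Rightarrow> 'a \<Rightarrow> 'b) \<Rightarrow> bool" where
  "kan_fibration X Y p \<longleftrightarrow>
     p \<in> smap X Y \<and>
     (\<forall>n k. 1 \<le> n \<and> k \<le> n \<longrightarrow>
        (\<forall>u\<in>smap (horn n k) X. \<forall>v\<in>smap (Delta n) Y.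
           scomp (horn n k) p u = scomp (horn n k) v (sid (horn n k)) \<longrightarrow>
           (\<exists>h\<in>smap (Delta n) X.
              scomp (horn n k) h (sid (horn n k)) = u \<and> scomp (Delta n) p h = v)))"

definition kan_complex :: "'a simp \<Rightarrow> bool" where
  "kan_complex K \<longleftrightarrow> simplicial_set K \<and> kan_fibration K (pt :: 'a simp) (to_pt K)"

text \<open>
  The simplicial function complex: an \<open>n\<close>-simplex of \<open>shom A B\<close> is a map \<open>A \<times> \<Delta>\<^sup>n \<rightarrow> B\<close>.
  Its elements are functions, so \<open>shom A B\<close> has an element type different from \<open>'u\<close>;
  \<open>small_copy\<close> below moves it into \<open>SS\<close> where this is needed.
\<close>

definition pull :: "'a simp \<Rightarrow> nat \<Rightarrow> (nat \<Rightarrow> nat)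
    \<Rightarrow> (nat \<Rightarrow> 'a \<times> (nat \<Rightarrow> nat) \<Rightarrow> 'b) \<Rightarrow> nat \<Rightarrow> 'a \<times> (nat \<Rightarrow> nat) \<Rightarrow> 'b" where
  "pull A m \<alpha> f = (\<lambda>k. \<lambda>(a, \<beta>)\<in>spx (sprod A (Delta m)) k. f k (a, compose {..k} \<alpha> \<beta>))"

definition shom :: "'a simp \<Rightarrow> 'b simp \<Rightarrow> (nat \<Rightarrow> 'a \<times> (nat \<Rightarrow> nat) \<Rightarrow> 'b) simp" where
  "shom A B = \<lparr> spx = (\<lambda>n. smap (sprod A (Delta n)) B), opr = (\<lambda>m n \<alpha>. pull A m \<alpha>) \<rparr>"

text \<open>Identities and composition of the simplicially enriched category of simplicial sets,
  on \<open>n\<close>-simplices.\<close>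

definition hid :: "'a simp \<Rightarrow> nat \<Rightarrow> nat \<Rightarrow> 'a \<times> (nat \<Rightarrow> nat) \<Rightarrow> 'a" where
  "hid A n = (\<lambda>k. \<lambda>(a, \<beta>)\<in>spx (sprod A (Delta n)) k. a)"

definition hcomp :: "'a simp \<Rightarrow> nat \<Rightarrow> (nat \<Rightarrow> 'b \<times> (nat \<Rightarrow> nat) \<Rightarrow> 'c)
    \<Rightarrow> (nat \<Rightarrow> 'a \<times> (nat \<Rightarrow> nat) \<Rightarrow> 'b) \<Rightarrow> nat \<Rightarrow> 'a \<times> (nat \<Rightarrow> nat) \<Rightarrow> 'c" where
  "hcomp A n g f = (\<lambda>k. \<lambda>(a, \<beta>)\<in>spx (sprod A (Delta n)) k. g k (f k (a, \<beta>), \<beta>))"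

text \<open>
  Weak equivalences of simplicial sets, in their purely simplicial definition:
  \<open>f : X \<rightarrow> Y\<close> is a weak homotopy equivalence if for every Kan complex \<open>K\<close> it induces a bijection
  \<open>\<pi>\<^sub>0 hom(Y, K) \<rightarrow> \<pi>\<^sub>0 hom(X, K)\<close> (Joyal--Tierney; Kerodon, Definition 3.1.6.12).
\<close>

definition pi0_rel :: "'a simp \<Rightarrow> ('a \<times> 'a) set" where
  "pi0_rel S = (let E = {(opr S 0 1 (\<lambda>i\<in>{..0}. 0) e, opr S 0 1 (\<lambda>i\<in>{..0}. 1) e) | e. e \<in> spx S 1}
                in (E \<union> E\<inverse>)\<^sup>*)"

definition pi0 :: "'a simp \<Rightarrow> 'a set set" where
  "pi0 S = spx S 0 // pi0_rel S"

definition pi0_map :: "'b simp \<Rightarrow> (nat \<Rightarrow> 'a \<Rightarrow> 'b) \<Rightarrow> 'a set \<Rightarrow> 'b set" where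
  "pi0_map T f c = pi0_rel T `` (f 0 ` c)"

definition precomp :: "'a simp \<Rightarrow> 'b simp \<Rightarrow> 'c simp \<Rightarrow> (nat \<Rightarrow> 'a \<Rightarrow> 'b)
    \<Rightarrow> nat \<Rightarrow> (nat \<Rightarrow> 'b \<times> (nat \<Rightarrow> nat) \<Rightarrow> 'c) \<Rightarrow> (nat \<Rightarrow> 'a \<times> (nat \<Rightarrow> nat) \<Rightarrow> 'c)" where
  "precomp X Y K f = (\<lambda>n. \<lambda>h\<in>spx (shom Y K) n.
     (\<lambda>k. \<lambda>(x, \<beta>)\<in>spx (sprod X (Delta n)) k. h k (f k x, \<beta>)))"

definition weak_equivalence :: "'u simp \<Rightarrow> 'u simp \<Rightarrow> (nat \<Rightarrow> 'u \<Rightarrow> 'u) \<Rightarrow> bool" where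
  "weak_equivalence X Y f \<longleftrightarrow>
     f \<in> smap X Y \<and>
     (\<forall>K :: 'u simp. K \<in> SS \<and> kan_complex K \<longrightarrow>
        bij_betw (pi0_map (shom X K) (precomp X Y K f)) (pi0 (shom Y K)) (pi0 (shom X K)))"

text \<open>
  Transport of a simplicial set with small sets of simplices along chosen injections into \<open>'u\<close>;
  for \<open>'u\<close> inaccessible such injections exist for all the function complexes used below.
\<close>

definition enc :: "'b simp \<Rightarrow> nat \<Rightarrow> 'b \<Rightarrow> 'u" where
  "enc X n = (SOME e. inj_on e (spx X n))"

definition dec :: "'b simp \<Rightarrow> nat \<Rightarrow> 'u \<Rightarrow> 'b" where
  "dec X n = inv_into (spx X n) (enc X n)"

definition small_copy :: "'b simp \<Rightarrow> 'u simp" where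
  "small_copy X = \<lparr> spx = (\<lambda>n. enc X n ` spx X n),
                    opr = (\<lambda>m n \<alpha> z. enc X m (opr X m n \<alpha> (dec X n z))) \<rparr>"


section \<open>Small simplicial functors\<close>

text \<open>
  A simplicial functor \<open>F\<close> from the opposite of \<open>SS\<close> to \<open>SS\<close>; \<open>fmor F A B\<close> is its
  action \<open>hom(A, B) \<rightarrow> hom(F B, F A)\<close>, a map of simplicial sets.
\<close>

record 'u sfunctor =
  fob :: "'u simp \<Rightarrow> 'u simp"
  fmor :: "'u simp \<Rightarrow> 'u simp \<Rightarrow> nat \<Rightarrow> (nat \<Rightarrow> 'u \<times> (nat \<Rightarrow> nat) \<Rightarrow> 'u)
             \<Rightarrow> (nat \<Rightarrow> 'u \<times> (nat \<Rightarrow> nat) \<Rightarrow> 'u)"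

definition simplicial_functor :: "'u sfunctor \<Rightarrow> bool" where
  "simplicial_functor F \<longleftrightarrow>
     (\<forall>A\<in>SS. fob F A \<in> SS) \<and>
     (\<forall>A\<in>SS. \<forall>B\<in>SS. fmor F A B \<in> smap (shom A B) (shom (fob F B) (fob F A))) \<and>
     (\<forall>A\<in>SS. \<forall>n. fmor F A A n (hid A n) = hid (fob F A) n) \<and>
     (\<forall>A\<in>SS. \<forall>B\<in>SS. \<forall>C\<in>SS. \<forall>n. \<forall>f\<in>spx (shom A B) n. \<forall>g\<in>spx (shom B C) n.
        fmor F A C n (hcomp A n g f) = hcomp (fob F C) n (fmor F A B n f) (fmor F B C n g))"

text \<open>The adjoint form \<open>hom(A, B) \<times> F B \<rightarrow> F A\<close> of the action, on \<open>n\<close>-simplices.\<close>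

definition act :: "'u sfunctor \<Rightarrow> 'u simp \<Rightarrow> 'u simp \<Rightarrow> nat
    \<Rightarrow> (nat \<Rightarrow> 'u \<times> (nat \<Rightarrow> nat) \<Rightarrow> 'u) \<Rightarrow> 'u \<Rightarrow> 'u" where
  "act F A B n f y = fmor F A B n f n (y, Did n)"

text \<open>
  \<open>F\<close> is the enriched left Kan extension of its restriction to the full subcategory \<open>\<C>\<close>
  if for every \<open>A\<close> the canonical map from the coend over \<open>C \<in> \<C>\<close> of \<open>hom(A, C) \<times> F C\<close> to \<open>F A\<close>
  is an isomorphism.  The coend is formed degreewise: in degree \<open>n\<close> it is the quotient of
  \<open>coend_pts\<close> by the equivalence relation generated by \<open>coend_step\<close>.
\<close>

definition coend_pts :: "'u simp set \<Rightarrow> 'u sfunctor \<Rightarrow> 'u simp \<Rightarrow> nat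
    \<Rightarrow> ('u simp \<times> (nat \<Rightarrow> 'u \<times> (nat \<Rightarrow> nat) \<Rightarrow> 'u) \<times> 'u) set" where
  "coend_pts \<C> F A n = {(C, h, x). C \<in> \<C> \<and> h \<in> spx (shom A C) n \<and> x \<in> spx (fob F C) n}"

definition coend_step :: "'u simp set \<Rightarrow> 'u sfunctor \<Rightarrow> 'u simp \<Rightarrow> nat
    \<Rightarrow> (('u simp \<times> (nat \<Rightarrow> 'u \<times> (nat \<Rightarrow> nat) \<Rightarrow> 'u) \<times> 'u)
       \<times> ('u simp \<times> (nat \<Rightarrow> 'u \<times> (nat \<Rightarrow> nat) \<Rightarrow> 'u) \<times> 'u)) set" where
  "coend_step \<C> F A n =
     {((C, h, act F C D n g x), (D, hcomp A n g h, x)) | C D h g x.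
        C \<in> \<C> \<and> D \<in> \<C> \<and> h \<in> spx (shom A C) n \<and> g \<in> spx (shom C D) n \<and> x \<in> spx (fob F D) n}"

definition coend_eval :: "'u sfunctor \<Rightarrow> 'u simp \<Rightarrow> nat
    \<Rightarrow> 'u simp \<times> (nat \<Rightarrow> 'u \<times> (nat \<Rightarrow> nat) \<Rightarrow> 'u) \<times> 'u \<Rightarrow> 'u" where
  "coend_eval F A n = (\<lambda>(C, h, x). act F A C n h x)"

definition kan_extended_from :: "'u simp set \<Rightarrow> 'u sfunctor \<Rightarrow> bool" where
  "kan_extended_from \<C> F \<longleftrightarrow>
     (\<forall>A\<in>SS. \<forall>n.
        coend_eval F A n ` coend_pts \<C> F A n = spx (fob F A) n \<and>
        (\<forall>p\<in>coend_pts \<C> F A n. \<forall>q\<in>coend_pts \<C> F A n.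
           coend_eval F A n p = coend_eval F A n q \<longrightarrow>
           (p, q) \<in> (coend_step \<C> F A n \<union> (coend_step \<C> F A n)\<inverse>)\<^sup>*))"

definition small_functor :: "'u sfunctor \<Rightarrow> bool" where
  "small_functor F \<longleftrightarrow>
     simplicial_functor F \<and>
     (\<exists>\<C> \<subseteq> SS. |\<C>| <o |UNIV :: 'u set| \<and> kan_extended_from \<C> F)"

definition nat_trans :: "'u sfunctor \<Rightarrow> 'u sfunctor \<Rightarrow> ('u simp \<Rightarrow> nat \<Rightarrow> 'u \<Rightarrow> 'u) set" where
  "nat_trans F G = {\<eta> \<in> extensional SS.
     (\<forall>A\<in>SS. \<eta> A \<in> smap (fob F A) (fob G A)) \<and>
     (\<forall>A\<in>SS. \<forall>B\<in>SS. \<forall>n. \<forall>f\<in>spx (shom A B) n. \<forall>k. \<forall>y\<in>spx (fob F B) k. \<forall>\<beta>\<in>Dmap k n.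
        fmor G A B n f k (\<eta> B k y, \<beta>) = \<eta> A k (fmor F A B n f k (y, \<beta>)))}"

definition Fun_cat :: "('u sfunctor, 'u simp \<Rightarrow> nat \<Rightarrow> 'u \<Rightarrow> 'u) category" where
  "Fun_cat = \<lparr> Ob = {F. small_functor F}, Hm = nat_trans,
               Idm = (\<lambda>F. \<lambda>A\<in>SS. sid (fob F A)),
               Cmp = (\<lambda>F G H \<theta> \<eta>. \<lambda>A\<in>SS. scomp (fob F A) (\<theta> A) (\<eta> A)) \<rparr>"

definition Fun_model :: "('u sfunctor, 'u simp \<Rightarrow> nat \<Rightarrow> 'u \<Rightarrow> 'u) model" where
  "Fun_model = model_of Fun_cat
     (\<lambda>F G. {\<eta> \<in> nat_trans F G. \<forall>A\<in>SS. weak_equivalence (fob F A) (fob G A) (\<eta> A)})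
     (\<lambda>F G. {\<eta> \<in> nat_trans F G. \<forall>A\<in>SS. kan_fibration (fob F A) (fob G A) (\<eta> A)})"


section \<open>The category of maps of simplicial sets\<close>

record 'a arrow =
  src :: "'a simp"
  tgt :: "'a simp"
  arr :: "nat \<Rightarrow> 'a \<Rightarrow> 'a"

definition squares :: "'a arrow \<Rightarrow> 'b arrow \<Rightarrow> ((nat \<Rightarrow> 'a \<Rightarrow> 'b) \<times> (nat \<Rightarrow> 'a \<Rightarrow> 'b)) set" where
  "squares X Y = {(u, v). u \<in> smap (src X) (src Y) \<and> v \<in> smap (tgt X) (tgt Y) \<and>
                          scomp (src X) (arr Y) u = scomp (src X) v (arr X)}"

definition sqid :: "'a arrow \<Rightarrow> (nat \<Rightarrow> 'a \<Rightarrow> 'a) \<times> (nat \<Rightarrow> 'a \<Rightarrow> 'a)" where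
  "sqid X = (sid (src X), sid (tgt X))"

definition sqcomp :: "'a arrow \<Rightarrow> (nat \<Rightarrow> 'b \<Rightarrow> 'c) \<times> (nat \<Rightarrow> 'b \<Rightarrow> 'c)
    \<Rightarrow> (nat \<Rightarrow> 'a \<Rightarrow> 'b) \<times> (nat \<Rightarrow> 'a \<Rightarrow> 'b) \<Rightarrow> (nat \<Rightarrow> 'a \<Rightarrow> 'c) \<times> (nat \<Rightarrow> 'a \<Rightarrow> 'c)" where
  "sqcomp X g f = (scomp (src X) (fst g) (fst f), scomp (tgt X) (snd g) (snd f))"

definition Map_cat :: "('u arrow, (nat \<Rightarrow> 'u \<Rightarrow> 'u) \<times> (nat \<Rightarrow> 'u \<Rightarrow> 'u)) category" where
  "Map_cat = \<lparr> Ob = {X. src X \<in> SS \<and> tgt X \<in> SS \<and> arr X \<in> smap (src X) (tgt X)},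
               Hm = squares, Idm = sqid, Cmp = (\<lambda>X Y Z g f. sqcomp X g f) \<rparr>"

text \<open>The tensor \<open>X \<otimes> K\<close>, and \<open>X \<otimes> k\<close> for a map \<open>k : K \<rightarrow> L\<close>.\<close>

definition tensor :: "'a arrow \<Rightarrow> 'k simp \<Rightarrow> ('a \<times> 'k) arrow" where
  "tensor X K = \<lparr> src = sprod (src X) K, tgt = sprod (tgt X) K,
     arr = (\<lambda>n. \<lambda>(x, c)\<in>spx (sprod (src X) K) n. (arr X n x, c)) \<rparr>"

definition tensor_map :: "'a arrow \<Rightarrow> 'k simp \<Rightarrow> (nat \<Rightarrow> 'k \<Rightarrow> 'l)
    \<Rightarrow> (nat \<Rightarrow> 'a \<times> 'k \<Rightarrow> 'a \<times> 'l) \<times> (nat \<Rightarrow> 'a \<times> 'k \<Rightarrow> 'a \<times> 'l)" where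
  "tensor_map X K t =
     ((\<lambda>n. \<lambda>(x, c)\<in>spx (sprod (src X) K) n. (x, t n c)),
      (\<lambda>n. \<lambda>(x, c)\<in>spx (sprod (tgt X) K) n. (x, t n c)))"

text \<open>The mapping space with \<open>n\<close>-simplices the squares \<open>X \<otimes> \<Delta>\<^sup>n \<rightarrow> Y\<close>, and its copy in \<open>SS\<close>.\<close>

definition ahom :: "'u arrow \<Rightarrow> 'u arrow
    \<Rightarrow> ((nat \<Rightarrow> 'u \<times> (nat \<Rightarrow> nat) \<Rightarrow> 'u) \<times> (nat \<Rightarrow> 'u \<times> (nat \<Rightarrow> nat) \<Rightarrow> 'u)) simp" where
  "ahom X Y = \<lparr> spx = (\<lambda>n. squares (tensor X (Delta n)) Y),
                opr = (\<lambda>m n \<alpha> (u, v). (pull (src X) m \<alpha> u, pull (tgt X) m \<alpha> v)) \<rparr>"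

definition HOM :: "'u arrow \<Rightarrow> 'u arrow \<Rightarrow> 'u simp" where
  "HOM X Y = small_copy (ahom X Y)"

definition HOM_map :: "'u arrow \<Rightarrow> 'u arrow \<Rightarrow> 'u arrow
    \<Rightarrow> (nat \<Rightarrow> 'u \<Rightarrow> 'u) \<times> (nat \<Rightarrow> 'u \<Rightarrow> 'u) \<Rightarrow> nat \<Rightarrow> 'u \<Rightarrow> 'u" where
  "HOM_map X Y Z g = (\<lambda>n. \<lambda>z\<in>spx (HOM X Y) n.
     enc (ahom X Z) n (sqcomp (tensor X (Delta n)) g (dec (ahom X Y) n z)))"

definition orbit :: "'u simp \<Rightarrow> 'u arrow" where
  "orbit A = \<lparr> src = A, tgt = pt, arr = to_pt A \<rparr>"

definition Map_eq :: "('u arrow, (nat \<Rightarrow> 'u \<Rightarrow> 'u) \<times> (nat \<Rightarrow> 'u \<Rightarrow> 'u)) model" where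
  "Map_eq = model_of Map_cat
     (\<lambda>X Y. {g \<in> squares X Y. \<forall>A\<in>SS.
        weak_equivalence (HOM (orbit A) X) (HOM (orbit A) Y) (HOM_map (orbit A) X Y g)})
     (\<lambda>X Y. {g \<in> squares X Y. \<forall>A\<in>SS.
        kan_fibration (HOM (orbit A) X) (HOM (orbit A) Y) (HOM_map (orbit A) X Y g)})"


section \<open>Orbit points and realization\<close>

text \<open>
  The functor \<open>A \<mapsto> hom(O\<^sub>A, X)\<close>.  An \<open>n\<close>-simplex \<open>f : A \<times> \<Delta>\<^sup>n \<rightarrow> B\<close> of \<open>hom(A, B)\<close> induces
  \<open>O\<^sub>A \<otimes> \<Delta>\<^sup>n \<rightarrow> O\<^sub>B\<close>, which is \<open>f\<close> on sources and the unique map on targets; hence enriched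
  precomposition with it is \<open>hcomp\<close> on sources and does nothing on targets.
\<close>

definition orbit_points :: "'u arrow \<Rightarrow> 'u sfunctor" where
  "orbit_points X =
     \<lparr> fob = (\<lambda>A. HOM (orbit A) X),
       fmor = (\<lambda>A B n. \<lambda>f\<in>spx (shom A B) n.
         (\<lambda>k. \<lambda>(z, \<beta>)\<in>spx (sprod (HOM (orbit B) X) (Delta n)) k.
            let s = dec (ahom (orbit B) X) k z
            in enc (ahom (orbit A) X) k
                 (hcomp A k (fst s) (opr (shom A B) k n \<beta> f), snd s))) \<rparr>"

definition orbit_points_functor ::
  "('u arrow, (nat \<Rightarrow> 'u \<Rightarrow> 'u) \<times> (nat \<Rightarrow> 'u \<Rightarrow> 'u),
    'u sfunctor, 'u simp \<Rightarrow> nat \<Rightarrow> 'u \<Rightarrow> 'u) cfunctor"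
where
  "orbit_points_functor =
     \<lparr> onO = orbit_points, onM = (\<lambda>X Y g. \<lambda>A\<in>SS. HOM_map (orbit A) X Y g) \<rparr>"

text \<open>
  Families \<open>w A : O\<^sub>A \<otimes> Y A \<rightarrow> X\<close> for which the two maps
  \<open>O\<^sub>A \<otimes> (hom(A, B) \<times> Y B) \<rightarrow> X\<close>, through \<open>O\<^sub>B \<otimes> Y B\<close> and through \<open>O\<^sub>A \<otimes> Y A\<close>, agree.
\<close>

definition is_cowedge ::
  "'u sfunctor \<Rightarrow> 'u arrow \<Rightarrow> ('u simp \<Rightarrow> (nat \<Rightarrow> 'u \<times> 'u \<Rightarrow> 'u) \<times> (nat \<Rightarrow> 'u \<times> 'u \<Rightarrow> 'u)) \<Rightarrow> bool"
where
  "is_cowedge Y X w \<longleftrightarrow>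
     (\<forall>A\<in>SS. w A \<in> squares (tensor (orbit A) (fob Y A)) X) \<and>
     (\<forall>A\<in>SS. \<forall>B\<in>SS. \<forall>n. \<forall>f\<in>spx (shom A B) n. \<forall>y\<in>spx (fob Y B) n.
        (\<forall>a\<in>spx A n. fst (w B) n (f n (a, Did n), y) = fst (w A) n (a, act Y A B n f y)) \<and>
        (\<forall>c\<in>spx pt n. snd (w B) n (c, y) = snd (w A) n (c, act Y A B n f y)))"

definition is_coend ::
  "'u sfunctor \<Rightarrow> 'u arrow \<Rightarrow> ('u simp \<Rightarrow> (nat \<Rightarrow> 'u \<times> 'u \<Rightarrow> 'u) \<times> (nat \<Rightarrow> 'u \<times> 'u \<Rightarrow> 'u)) \<Rightarrow> bool"
where
  "is_coend Y R \<iota> \<longleftrightarrow>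
     R \<in> Ob Map_cat \<and> is_cowedge Y R \<iota> \<and>
     (\<forall>X\<in>Ob Map_cat. \<forall>w. is_cowedge Y X w \<longrightarrow>
        (\<exists>!g. g \<in> squares R X \<and>
              (\<forall>A\<in>SS. sqcomp (tensor (orbit A) (fob Y A)) g (\<iota> A) = w A)))"

text \<open>The realization \<open>|Y|\<close>, the coend of \<open>O\<^sub>A \<otimes> Y A\<close> over \<open>A\<close>, with its universal cowedge.\<close>

definition realization_data ::
  "'u sfunctor \<Rightarrow> 'u arrow \<times> ('u simp \<Rightarrow> (nat \<Rightarrow> 'u \<times> 'u \<Rightarrow> 'u) \<times> (nat \<Rightarrow> 'u \<times> 'u \<Rightarrow> 'u))"
where
  "realization_data Y = (SOME (R, \<iota>). is_coend Y R \<iota>)"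

definition realization :: "'u sfunctor \<Rightarrow> 'u arrow" where
  "realization Y = fst (realization_data Y)"

definition realization_in ::
  "'u sfunctor \<Rightarrow> 'u simp \<Rightarrow> (nat \<Rightarrow> 'u \<times> 'u \<Rightarrow> 'u) \<times> (nat \<Rightarrow> 'u \<times> 'u \<Rightarrow> 'u)"
where
  "realization_in Y = snd (realization_data Y)"

definition realization_functor ::
  "('u sfunctor, 'u simp \<Rightarrow> nat \<Rightarrow> 'u \<Rightarrow> 'u,
    'u arrow, (nat \<Rightarrow> 'u \<Rightarrow> 'u) \<times> (nat \<Rightarrow> 'u \<Rightarrow> 'u)) cfunctor"
where
  "realization_functor =
     \<lparr> onO = realization,
       onM = (\<lambda>Y Z \<eta>. THE g. g \<in> squares (realization Y) (realization Z) \<and>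
         (\<forall>A\<in>SS. sqcomp (tensor (orbit A) (fob Y A)) g (realization_in Y A)
               = sqcomp (tensor (orbit A) (fob Y A))
                   (realization_in Z A) (tensor_map (orbit A) (fob Y A) (\<eta> A)))) \<rparr>"

text \<open>
  The adjunct of \<open>g : |Y| \<rightarrow> X\<close> sends an \<open>n\<close>-simplex \<open>y\<close> of \<open>Y A\<close>, regarded as a map
  \<open>\<Delta>\<^sup>n \<rightarrow> Y A\<close>, to the composite \<open>O\<^sub>A \<otimes> \<Delta>\<^sup>n \<rightarrow> O\<^sub>A \<otimes> Y A \<rightarrow> |Y| \<rightarrow> X\<close>.
\<close>

definition yoneda :: "'a simp \<Rightarrow> nat \<Rightarrow> 'a \<Rightarrow> nat \<Rightarrow> (nat \<Rightarrow> nat) \<Rightarrow> 'a" where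
  "yoneda S n y = (\<lambda>k. \<lambda>\<beta>\<in>Dmap k n. opr S k n \<beta> y)"

definition adjunct ::
  "'u sfunctor \<Rightarrow> 'u arrow \<Rightarrow> (nat \<Rightarrow> 'u \<Rightarrow> 'u) \<times> (nat \<Rightarrow> 'u \<Rightarrow> 'u) \<Rightarrow> 'u simp \<Rightarrow> nat \<Rightarrow> 'u \<Rightarrow> 'u"
where
  "adjunct Y X g = (\<lambda>A\<in>SS. \<lambda>n. \<lambda>y\<in>spx (fob Y A) n.
     enc (ahom (orbit A) X) n
       (sqcomp (tensor (orbit A) (Delta n)) g
         (sqcomp (tensor (orbit A) (Delta n)) (realization_in Y A)
           (tensor_map (orbit A) (Delta n) (yoneda (fob Y A) n y)))))"

end

theory Submission
  imports Defs "HOL-Library.Countable_Set"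
begin

text \<open>
  An \<open>n\<close>-simplex of \<open>X\<^sup>\<O>(A)\<close>, for \<open>X = (X\<^sub>0 \<rightarrow> X\<^sub>1)\<close>, is a simplex \<open>v \<in> X\<^sub>1\<close> with a map
  \<open>A \<times> \<Delta>\<^sup>n \<rightarrow> X\<^sub>0\<close> over \<open>v\<close>; by co-Yoneda \<open>|Y|\<close> is \<open>Y(pt) \<rightarrow> Y(\<emptyset>)\<close>, so \<open>|X\<^sup>\<O>| \<cong> X\<close>.
  Orbit points create weak equivalences and fibrations, hence everything reduces to the unit
  \<open>Y \<rightarrow> |Y|\<^sup>\<O>\<close> being a weak equivalence for cofibrant \<open>Y\<close>.  As it is an isomorphism on every
  \<open>X\<^sup>\<O>\<close>, it suffices that every small functor \<open>Y\<close> is the target of an objectwise acyclic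
  fibration \<open>X\<^sup>\<O> \<rightarrow> Y\<close>: a cofibrant \<open>Y\<close> is then a retract of \<open>X\<^sup>\<O>\<close>.

  Such an \<open>X\<close> is built in one step.  A simplex of \<open>X\<^sub>1\<close> is a diagram of representables over \<open>Y\<close>
  indexed by the simplices of \<open>\<Delta>\<^sup>n\<close>, the representing objects \<open>C\<close> having size bounded by some
  \<open>\<lambda>\<close> with \<open>\<lambda>\<^bsup>\<aleph>\<^sub>0\<^esup> = \<lambda>\<close>; the fibre of \<open>X\<^sub>0\<close> is the representing object of the top simplex.  A map
  \<open>A \<times> \<Delta>\<^sup>n \<rightarrow> X\<^sub>0\<close> over such a diagram is determined by its values over surjective
  \<open>[k] \<rightarrow> [n]\<close>, so it is a map \<open>A \<times> \<Delta>\<^sup>n \<rightarrow> C\<close>.  Boundaries can be filled because countably many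
  maps out of \<open>A\<close> into objects of size at most \<open>\<lambda>\<close> factor through a quotient of size at most \<open>\<lambda>\<close>.
\<close>

section \<open>Simplicial sets and function complexes\<close>

text \<open>The objects \<open>A\<close> run through all of \<open>SS\<close>, whereas
  \<open>X\<close> has to be small. A boundary over a large \<open>A\<close> is therefore filled by
  a diagram whose new top object is a bounded quotient \<open>D\<close> of \<open>A\<close>. A
  simplex of \<open>A\<close> is remembered in \<open>D\<close> by the values of countably many maps
  on all its images under simplicial operators; hence the exponent in the condition on \<lambda>.
  Factoring the given maps through \<open>D\<close> is not enough: the new element of
  \<open>Y D\<close> must restrict to the given boundary elements, which is known in
  \<open>Y A\<close> only, and \<open>Y D \<rightarrow> Y A\<close> need not be injective. The
  equalities in \<open>Y A\<close> are therefore witnessed by finite chains of coend relations, and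
  the maps in these chains are made to descend to \<open>D\<close> as well. Transitions along
  degeneracies are identities so that one object \<open>C\<close> sits over all surjective
  \<open>[k] \<rightarrow> [n]\<close>; only then can a map over the diagram be rebuilt from its
  values there as a single map to \<open>C\<close>.\<close>

lemma Dmap_le: "\<alpha> \<in> Dmap m n \<Longrightarrow> i \<le> m \<Longrightarrow> \<alpha> i \<le> n"
  by (auto simp: Dmap_def)

lemma Dmap_mono: "\<alpha> \<in> Dmap m n \<Longrightarrow> i \<le> j \<Longrightarrow> j \<le> m \<Longrightarrow> \<alpha> i \<le> \<alpha> j"
  by (auto simp: Dmap_def mono_on_def)

lemma Dmap_ext: "\<alpha> \<in> Dmap m n \<Longrightarrow> \<not> i \<le> m \<Longrightarrow> \<alpha> i = undefined"
  by (auto simp: Dmap_def PiE_def extensional_def)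

lemma DmapI:
  "(\<And>i. i \<le> m \<Longrightarrow> \<alpha> i \<le> n) \<Longrightarrow> (\<And>i j. i \<le> j \<Longrightarrow> j \<le> m \<Longrightarrow> \<alpha> i \<le> \<alpha> j) \<Longrightarrow>
   (\<And>i. \<not> i \<le> m \<Longrightarrow> \<alpha> i = undefined) \<Longrightarrow> \<alpha> \<in> Dmap m n"
  by (auto simp: Dmap_def PiE_def extensional_def mono_on_def)

lemma restrict_DmapI:
  "(\<And>i. i \<le> m \<Longrightarrow> f i \<le> n) \<Longrightarrow> (\<And>i j. i \<le> j \<Longrightarrow> j \<le> m \<Longrightarrow> f i \<le> f j) \<Longrightarrow>
   restrict f {..m} \<in> Dmap m n"
  by (rule DmapI) auto

lemma Dmap_eqI:
  "\<alpha> \<in> Dmap m n \<Longrightarrow> \<beta> \<in> Dmap m n' \<Longrightarrow> (\<And>i. i \<le> m \<Longrightarrow> \<alpha> i = \<beta> i) \<Longrightarrow> \<alpha> = \<beta>"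
  by (rule ext) (metis Dmap_ext)

lemma finite_Dmap: "finite (Dmap m n)"
  unfolding Dmap_def by (rule finite_subset[of _ "{..m} \<rightarrow>\<^sub>E {..n}"]) (auto intro: finite_PiE)

lemma comp_Dmap [simp]:
  "\<beta> \<in> Dmap k m \<Longrightarrow> \<alpha> \<in> Dmap m n \<Longrightarrow> compose {..k} \<alpha> \<beta> \<in> Dmap k n"
  by (rule DmapI) (simp_all add: compose_def Dmap_le Dmap_mono)

lemma Did_Dmap [simp]: "Did n \<in> Dmap n n"
  by (rule DmapI) (auto simp: Did_def)

lemma comp_Did_right [simp]: "\<alpha> \<in> Dmap m n \<Longrightarrow> compose {..m} \<alpha> (Did m) = \<alpha>"
  by (rule ext) (auto simp: compose_def Did_def Dmap_ext)

lemma comp_Did_left [simp]: "\<alpha> \<in> Dmap m n \<Longrightarrow> compose {..m} (Did n) \<alpha> = \<alpha>"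
  by (rule ext) (auto simp: compose_def Did_def Dmap_ext Dmap_le)

lemma comp_comp_Dmap:
  "\<gamma> \<in> Dmap j k \<Longrightarrow> compose {..j} (compose {..k} \<alpha> \<beta>) \<gamma> = compose {..j} \<alpha> (compose {..j} \<beta> \<gamma>)"
  by (rule ext) (auto simp: compose_def Dmap_le)

lemma compose_app [simp]: "i \<le> k \<Longrightarrow> compose {..k} \<alpha> \<beta> i = \<alpha> (\<beta> i)"
  by (simp add: compose_def)

lemma opr_in [simp]:
  "simplicial_set X \<Longrightarrow> \<alpha> \<in> Dmap m n \<Longrightarrow> x \<in> spx X n \<Longrightarrow> opr X m n \<alpha> x \<in> spx X m"
  by (simp add: simplicial_set_def)

lemma opr_Did [simp]: "simplicial_set X \<Longrightarrow> x \<in> spx X n \<Longrightarrow> opr X n n (Did n) x = x"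
  by (simp add: simplicial_set_def)

lemma opr_opr:
  "simplicial_set X \<Longrightarrow> \<beta> \<in> Dmap k m \<Longrightarrow> \<alpha> \<in> Dmap m n \<Longrightarrow> x \<in> spx X n \<Longrightarrow>
   opr X k m \<beta> (opr X m n \<alpha> x) = opr X k n (compose {..k} \<alpha> \<beta>) x"
  unfolding simplicial_set_def by metis

lemma smap_in [simp]: "f \<in> smap X Y \<Longrightarrow> x \<in> spx X n \<Longrightarrow> f n x \<in> spx Y n"
  by (auto simp: smap_def)

lemma smap_opr:
  "f \<in> smap X Y \<Longrightarrow> \<alpha> \<in> Dmap m n \<Longrightarrow> x \<in> spx X n \<Longrightarrow> f m (opr X m n \<alpha> x) = opr Y m n \<alpha> (f n x)"
  unfolding smap_def by blast

lemma smap_undefined: "f \<in> smap X Y \<Longrightarrow> x \<notin> spx X n \<Longrightarrow> f n x = undefined"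
  unfolding smap_def by (blast intro: PiE_arb)

lemma smapI:
  "(\<And>n x. x \<in> spx X n \<Longrightarrow> f n x \<in> spx Y n) \<Longrightarrow> (\<And>n x. x \<notin> spx X n \<Longrightarrow> f n x = undefined) \<Longrightarrow>
   (\<And>m n \<alpha> x. \<alpha> \<in> Dmap m n \<Longrightarrow> x \<in> spx X n \<Longrightarrow> f m (opr X m n \<alpha> x) = opr Y m n \<alpha> (f n x)) \<Longrightarrow>
   f \<in> smap X Y"
  unfolding smap_def PiE_def Pi_def extensional_def by blast

lemma smap_eqI:
  "f \<in> smap X Y \<Longrightarrow> g \<in> smap X Z \<Longrightarrow> (\<And>n x. x \<in> spx X n \<Longrightarrow> f n x = g n x) \<Longrightarrow> f = g"
  by (intro ext) (metis smap_undefined)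

lemma sid_app [simp]: "x \<in> spx X n \<Longrightarrow> sid X n x = x"
  by (simp add: sid_def)

lemma sid_smap [simp]: "simplicial_set X \<Longrightarrow> sid X \<in> smap X X"
  by (rule smapI) (auto simp: sid_def)

lemma scomp_app [simp]: "x \<in> spx X n \<Longrightarrow> scomp X g f n x = g n (f n x)"
  by (simp add: scomp_def compose_def)

lemma scomp_undefined [simp]: "x \<notin> spx X n \<Longrightarrow> scomp X g f n x = undefined"
  by (simp add: scomp_def compose_def)

lemma scomp_smap [simp]:
  "simplicial_set X \<Longrightarrow> f \<in> smap X Y \<Longrightarrow> g \<in> smap Y Z \<Longrightarrow> scomp X g f \<in> smap X Z"
  by (rule smapI) (auto simp: smap_opr)

lemma scomp_eqI:
  "(\<And>n x. x \<in> spx X n \<Longrightarrow> g n (f n x) = g' n (f' n x)) \<Longrightarrow> scomp X g f = scomp X g' f'"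
  by (intro ext) (auto simp: scomp_def compose_def)

lemma scomp_sid_left [simp]: "f \<in> smap X Y \<Longrightarrow> scomp X (sid Y) f = f"
  by (intro ext) (metis scomp_app scomp_undefined sid_app smap_undefined smap_in)

lemma spx_sprod [simp]: "spx (sprod X Y) n = spx X n \<times> spx Y n"
  by (simp add: sprod_def)

lemma opr_sprod [simp]: "opr (sprod X Y) m n \<alpha> (x, y) = (opr X m n \<alpha> x, opr Y m n \<alpha> y)"
  by (simp add: sprod_def)

lemma simplicial_setI:
  "(\<And>m n \<alpha> x. \<alpha> \<in> Dmap m n \<Longrightarrow> x \<in> spx X n \<Longrightarrow> opr X m n \<alpha> x \<in> spx X m) \<Longrightarrow>
   (\<And>n x. x \<in> spx X n \<Longrightarrow> opr X n n (Did n) x = x) \<Longrightarrow>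
   (\<And>k m n \<alpha> \<beta> x. \<beta> \<in> Dmap k m \<Longrightarrow> \<alpha> \<in> Dmap m n \<Longrightarrow> x \<in> spx X n \<Longrightarrow>
      opr X k n (compose {..k} \<alpha> \<beta>) x = opr X k m \<beta> (opr X m n \<alpha> x)) \<Longrightarrow> simplicial_set X"
  unfolding simplicial_set_def by blast

lemma simplicial_set_sprod [simp]:
  "simplicial_set X \<Longrightarrow> simplicial_set Y \<Longrightarrow> simplicial_set (sprod X Y)"
  by (rule simplicial_setI) (auto simp: opr_opr)

lemma spx_Delta [simp]: "spx (Delta n) m = Dmap m n"
  by (simp add: Delta_def)

lemma opr_Delta [simp]: "opr (Delta n) k m \<beta> \<alpha> = compose {..k} \<alpha> \<beta>"
  by (simp add: Delta_def)

lemma simplicial_set_Delta [simp]: "simplicial_set (Delta n)"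
  by (rule simplicial_setI) (auto simp: comp_comp_Dmap)

lemma spx_pt [simp]: "spx pt n = {undefined}"
  by (simp add: pt_def)

lemma opr_pt [simp]: "opr pt m n \<alpha> x = undefined"
  by (simp add: pt_def)

lemma simplicial_set_pt [simp]: "simplicial_set pt"
  by (rule simplicial_setI) auto

lemma to_pt_app [simp]: "to_pt X n x = undefined"
  by (simp add: to_pt_def)

lemma spx_shom [simp]: "spx (shom A B) n = smap (sprod A (Delta n)) B"
  by (simp add: shom_def)

lemma opr_shom [simp]: "opr (shom A B) m n \<alpha> f = pull A m \<alpha> f"
  by (simp add: shom_def)

lemma pull_app [simp]:
  "a \<in> spx A k \<Longrightarrow> \<beta> \<in> Dmap k m \<Longrightarrow> pull A m \<alpha> f k (a, \<beta>) = f k (a, compose {..k} \<alpha> \<beta>)"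
  by (simp add: pull_def)

lemma pull_undefined: "x \<notin> spx (sprod A (Delta m)) k \<Longrightarrow> pull A m \<alpha> f k x = undefined"
  by (simp add: pull_def)

lemma shom_in [simp]:
  "f \<in> smap (sprod A (Delta n)) B \<Longrightarrow> a \<in> spx A k \<Longrightarrow> \<beta> \<in> Dmap k n \<Longrightarrow> f k (a, \<beta>) \<in> spx B k"
  by (rule smap_in) auto

lemma shom_opr:
  "f \<in> smap (sprod A (Delta n)) B \<Longrightarrow> \<gamma> \<in> Dmap j k \<Longrightarrow> a \<in> spx A k \<Longrightarrow> \<beta> \<in> Dmap k n \<Longrightarrow>
   f j (opr A j k \<gamma> a, compose {..j} \<beta> \<gamma>) = opr B j k \<gamma> (f k (a, \<beta>))"
  using smap_opr[of f "sprod A (Delta n)" B \<gamma> j k "(a, \<beta>)"] by simp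

lemma shomI:
  "(\<And>k a \<beta>. a \<in> spx A k \<Longrightarrow> \<beta> \<in> Dmap k n \<Longrightarrow> f k (a, \<beta>) \<in> spx B k) \<Longrightarrow>
   (\<And>k x. x \<notin> spx A k \<times> Dmap k n \<Longrightarrow> f k x = undefined) \<Longrightarrow>
   (\<And>j k \<gamma> a \<beta>. \<gamma> \<in> Dmap j k \<Longrightarrow> a \<in> spx A k \<Longrightarrow> \<beta> \<in> Dmap k n \<Longrightarrow>
      f j (opr A j k \<gamma> a, compose {..j} \<beta> \<gamma>) = opr B j k \<gamma> (f k (a, \<beta>))) \<Longrightarrow>
   f \<in> smap (sprod A (Delta n)) B"
  by (rule smapI) auto

lemma shom_eqI:
  "f \<in> smap (sprod A (Delta n)) B \<Longrightarrow> g \<in> smap (sprod A (Delta n)) B' \<Longrightarrow>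
   (\<And>k a \<beta>. a \<in> spx A k \<Longrightarrow> \<beta> \<in> Dmap k n \<Longrightarrow> f k (a, \<beta>) = g k (a, \<beta>)) \<Longrightarrow> f = g"
  by (rule smap_eqI) auto

lemma pull_smap [simp]:
  "f \<in> smap (sprod A (Delta n)) B \<Longrightarrow> \<alpha> \<in> Dmap m n \<Longrightarrow> simplicial_set A \<Longrightarrow>
   pull A m \<alpha> f \<in> smap (sprod A (Delta m)) B"
  by (rule shomI) (auto simp: pull_undefined shom_opr comp_comp_Dmap[symmetric])

lemma pull_pull:
  "\<alpha> \<in> Dmap m n \<Longrightarrow> \<beta> \<in> Dmap k m \<Longrightarrow>
   pull A k \<beta> (pull A m \<alpha> f) = pull A k (compose {..k} \<alpha> \<beta>) f"
  by (intro ext) (auto simp: pull_def comp_comp_Dmap)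

lemma pull_Did [simp]: "f \<in> smap (sprod A (Delta n)) B \<Longrightarrow> pull A n (Did n) f = f"
  by (intro ext) (auto simp: pull_def smap_undefined)

lemma hid_app [simp]: "a \<in> spx A k \<Longrightarrow> \<beta> \<in> Dmap k n \<Longrightarrow> hid A n k (a, \<beta>) = a"
  by (simp add: hid_def)

lemma hid_smap [simp]: "simplicial_set A \<Longrightarrow> hid A n \<in> smap (sprod A (Delta n)) A"
  by (rule shomI) (auto simp: hid_def)

lemma pull_hid [simp]: "\<alpha> \<in> Dmap m n \<Longrightarrow> pull A m \<alpha> (hid A n) = hid A m"
  by (intro ext) (auto simp: pull_def hid_def)

lemma hcomp_app [simp]:
  "a \<in> spx A k \<Longrightarrow> \<beta> \<in> Dmap k n \<Longrightarrow> hcomp A n g f k (a, \<beta>) = g k (f k (a, \<beta>), \<beta>)"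
  by (simp add: hcomp_def)

lemma hcomp_undefined: "x \<notin> spx A k \<times> Dmap k n \<Longrightarrow> hcomp A n g f k x = undefined"
  by (simp add: hcomp_def)

lemma hcomp_smap [simp]:
  "f \<in> smap (sprod A (Delta n)) B \<Longrightarrow> g \<in> smap (sprod B (Delta n)) C \<Longrightarrow> simplicial_set A \<Longrightarrow>
   hcomp A n g f \<in> smap (sprod A (Delta n)) C"
  by (rule shomI) (auto simp: hcomp_undefined shom_opr)

lemma hcomp_assoc:
  "f \<in> smap (sprod A (Delta n)) B \<Longrightarrow>
   hcomp A n h (hcomp A n g f) = hcomp A n (hcomp B n h g) f"
  by (intro ext) (auto simp: hcomp_def)

lemma hcomp_hid_right [simp]: "f \<in> smap (sprod A (Delta n)) B \<Longrightarrow> hcomp A n f (hid A n) = f"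
  by (intro ext) (auto simp: hcomp_def smap_undefined)

lemma hcomp_hid_left [simp]: "f \<in> smap (sprod A (Delta n)) B \<Longrightarrow> hcomp A n (hid B n) f = f"
  by (intro ext) (auto simp: hcomp_def smap_undefined)

lemma pull_hcomp:
  "f \<in> smap (sprod A (Delta n)) B \<Longrightarrow> \<alpha> \<in> Dmap m n \<Longrightarrow>
   pull A m \<alpha> (hcomp A n g f) = hcomp A m (pull B m \<alpha> g) (pull A m \<alpha> f)"
  by (intro ext) (auto simp: hcomp_def pull_def)

text \<open>The degenerate \<open>n\<close>-simplex of \<open>hom(A, B)\<close> on the vertex
  \<open>q\<close>. In this form a quotient map \<open>A \<rightarrow> D\<close> acts on every
  degree of a simplicial functor.\<close>

definition hconst :: "'a simp \<Rightarrow> nat \<Rightarrow> (nat \<Rightarrow> 'a \<Rightarrow> 'b) \<Rightarrow> nat \<Rightarrow> 'a \<times> (nat \<Rightarrow> nat) \<Rightarrow> 'b" where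
  "hconst A n q = (\<lambda>k. \<lambda>(a, \<beta>)\<in>spx (sprod A (Delta n)) k. q k a)"

lemma hconst_app [simp]: "a \<in> spx A k \<Longrightarrow> \<beta> \<in> Dmap k n \<Longrightarrow> hconst A n q k (a, \<beta>) = q k a"
  by (simp add: hconst_def)

lemma hconst_smap [simp]: "simplicial_set A \<Longrightarrow> q \<in> smap A B \<Longrightarrow> hconst A n q \<in> smap (sprod A (Delta n)) B"
  by (rule shomI) (auto simp: hconst_def smap_opr)

lemma pull_hconst [simp]: "\<alpha> \<in> Dmap m n \<Longrightarrow> pull A m \<alpha> (hconst A n q) = hconst A m q"
  by (intro ext) (auto simp: pull_def hconst_def)

section \<open>Simplicial functors\<close>

lemma sfunD:
  assumes "simplicial_functor F"
  shows "A \<in> SS \<Longrightarrow> fob F A \<in> SS"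
    and "A \<in> SS \<Longrightarrow> B \<in> SS \<Longrightarrow> fmor F A B \<in> smap (shom A B) (shom (fob F B) (fob F A))"
    and "A \<in> SS \<Longrightarrow> fmor F A A n (hid A n) = hid (fob F A) n"
    and "A \<in> SS \<Longrightarrow> B \<in> SS \<Longrightarrow> C \<in> SS \<Longrightarrow> f \<in> smap (sprod A (Delta n)) B \<Longrightarrow>
         g \<in> smap (sprod B (Delta n)) C \<Longrightarrow>
         fmor F A C n (hcomp A n g f) = hcomp (fob F C) n (fmor F A B n f) (fmor F B C n g)"
  using assms by (auto simp: simplicial_functor_def)

lemma SS_simplicial [simp]: "A \<in> SS \<Longrightarrow> simplicial_set A"
  by (simp add: SS_def)

lemma fmor_in:
  "simplicial_functor F \<Longrightarrow> A \<in> SS \<Longrightarrow> B \<in> SS \<Longrightarrow> f \<in> smap (sprod A (Delta n)) B \<Longrightarrow>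
   fmor F A B n f \<in> smap (sprod (fob F B) (Delta n)) (fob F A)"
  using smap_in[OF sfunD(2), of F A B f n] by simp

text \<open>Naturality of \<open>fmor\<close> in the simplicial degree moves every argument
  \<open>(y, \<beta>)\<close> to the diagonal position \<open>Did\<close>, after restriction of
  \<open>f\<close> along \<beta>. A simplicial functor is thus controlled by \<open>act\<close>, in
  which the coend relations and naturality are expressed.\<close>

lemma fmor_act:
  assumes F: "simplicial_functor F" and A: "A \<in> SS" "B \<in> SS"
    and f: "f \<in> smap (sprod A (Delta n)) B" and y: "y \<in> spx (fob F B) k" and b: "\<beta> \<in> Dmap k n"
  shows "fmor F A B n f k (y, \<beta>) = act F A B k (pull A k \<beta> f) y"
proof -
  have "fmor F A B k (pull A k \<beta> f) = pull (fob F B) k \<beta> (fmor F A B n f)"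
    using smap_opr[OF sfunD(2)[OF F A] b, of f] f by simp
  then show ?thesis using y b by (simp add: act_def)
qed

lemma act_in [simp]:
  "simplicial_functor F \<Longrightarrow> A \<in> SS \<Longrightarrow> B \<in> SS \<Longrightarrow> f \<in> smap (sprod A (Delta n)) B \<Longrightarrow>
   y \<in> spx (fob F B) n \<Longrightarrow> act F A B n f y \<in> spx (fob F A) n"
  unfolding act_def by (rule shom_in[OF fmor_in]) auto

lemma act_opr:
  assumes F: "simplicial_functor F" and A: "A \<in> SS" "B \<in> SS"
    and f: "f \<in> smap (sprod A (Delta n)) B" and y: "y \<in> spx (fob F B) n" and a: "\<alpha> \<in> Dmap m n"
  shows "opr (fob F A) m n \<alpha> (act F A B n f y) = act F A B m (pull A m \<alpha> f) (opr (fob F B) m n \<alpha> y)"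
proof -
  have "opr (fob F A) m n \<alpha> (act F A B n f y) = fmor F A B n f m (opr (fob F B) m n \<alpha> y, \<alpha>)"
    using shom_opr[OF fmor_in[OF F A f] a y Did_Dmap] a by (simp add: act_def)
  also have "\<dots> = act F A B m (pull A m \<alpha> f) (opr (fob F B) m n \<alpha> y)"
    using fmor_act[OF F A f _ a] opr_in[OF SS_simplicial[OF sfunD(1)[OF F A(2)]] a y] by simp
  finally show ?thesis .
qed

lemma act_hid [simp]:
  "simplicial_functor F \<Longrightarrow> A \<in> SS \<Longrightarrow> y \<in> spx (fob F A) n \<Longrightarrow> act F A A n (hid A n) y = y"
  by (simp add: act_def sfunD(3))

lemma act_hcomp:
  assumes F: "simplicial_functor F" and A: "A \<in> SS" "B \<in> SS" "C \<in> SS"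
    and f: "f \<in> smap (sprod A (Delta n)) B" and g: "g \<in> smap (sprod B (Delta n)) C"
    and y: "y \<in> spx (fob F C) n"
  shows "act F A C n (hcomp A n g f) y = act F A B n f (act F B C n g y)"
  using y by (simp add: act_def sfunD(4)[OF F A f g])

lemma nat_transD:
  assumes "\<eta> \<in> nat_trans F G"
  shows "A \<in> SS \<Longrightarrow> \<eta> A \<in> smap (fob F A) (fob G A)" and "A \<notin> SS \<Longrightarrow> \<eta> A = undefined"
    and "simplicial_functor F \<Longrightarrow> simplicial_functor G \<Longrightarrow> A \<in> SS \<Longrightarrow> B \<in> SS \<Longrightarrow>
      f \<in> smap (sprod A (Delta n)) B \<Longrightarrow> y \<in> spx (fob F B) n \<Longrightarrow>
      \<eta> A n (act F A B n f y) = act G A B n f (\<eta> B n y)"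
  using assms by (auto simp: nat_trans_def extensional_def act_def)

text \<open>By \<open>fmor_act\<close> the naturality square at \<open>(y, \<beta>)\<close> is the
  diagonal one for the restriction of \<open>f\<close> along \<beta>, so \<open>f\<close> and
  \<open>y\<close> may be taken in the same degree.\<close>

lemma nat_transI:
  assumes F: "simplicial_functor F" and G: "simplicial_functor G"
    and ext: "\<And>A. A \<notin> SS \<Longrightarrow> \<eta> A = undefined"
    and sm: "\<And>A. A \<in> SS \<Longrightarrow> \<eta> A \<in> smap (fob F A) (fob G A)"
    and nat: "\<And>A B n f y. A \<in> SS \<Longrightarrow> B \<in> SS \<Longrightarrow> f \<in> smap (sprod A (Delta n)) B \<Longrightarrow>
      y \<in> spx (fob F B) n \<Longrightarrow> \<eta> A n (act F A B n f y) = act G A B n f (\<eta> B n y)"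
  shows "\<eta> \<in> nat_trans F G"
  unfolding nat_trans_def
proof (intro CollectI conjI ballI allI)
  show "\<eta> \<in> extensional SS" using ext by (auto simp: extensional_def)
  show "\<eta> A \<in> smap (fob F A) (fob G A)" if "A \<in> SS" for A using sm that .
  fix A B :: "'a simp" and n f k y \<beta>
  assume *: "A \<in> SS" "B \<in> SS" "f \<in> spx (shom A B) n" "y \<in> spx (fob F B) k" "\<beta> \<in> Dmap k n"
  then have "pull A k \<beta> f \<in> smap (sprod A (Delta k)) B" by auto
  with * show "fmor G A B n f k (\<eta> B k y, \<beta>) = \<eta> A k (fmor F A B n f k (y, \<beta>))"
    using smap_in[OF sm[OF *(2)] *(4)] nat[of A B "pull A k \<beta> f" k y]
    by (simp add: fmor_act[OF F] fmor_act[OF G])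
qed

section \<open>Small sets\<close>

locale universe =
  fixes U :: "'u set"
  assumes inacc: "inaccessible U" and U_UNIV: "U = UNIV"
begin

text \<open>The locale parameter \<open>U\<close> gives the type \<open>'u\<close> a term to refer
  to; the set whose size is measured may then have any element type, in particular the functions
  that are the simplices of function complexes.\<close>

definition small :: "'a set \<Rightarrow> bool" where
  "small S \<longleftrightarrow> |S| <o |U|"

lemma small_inj_ex:
  assumes "small S" obtains g :: "'a \<Rightarrow> 'u" where "inj_on g S"
  using assms ordLess_imp_ordLeq[of "|S|" "|U|"] by (auto simp: small_def card_of_ordLeq[symmetric])

lemma small_le: "|S| \<le>o |T| \<Longrightarrow> small T \<Longrightarrow> small S"
  unfolding small_def by (rule ordLeq_ordLess_trans)

lemma small_inj: "inj_on f S \<Longrightarrow> f ` S \<subseteq> T \<Longrightarrow> small T \<Longrightarrow> small S"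
  by (rule small_le[of S T]) (auto simp: card_of_ordLeq[symmetric])

lemma small_subset: "S \<subseteq> T \<Longrightarrow> small T \<Longrightarrow> small S"
  by (rule small_inj[of id]) auto

lemma small_image [simp]: "small S \<Longrightarrow> small (f ` S)"
  by (rule small_le[OF card_of_image])

lemma infinite_U: "infinite U"
proof
  assume "finite U"
  moreover have "|UNIV :: nat set| \<le>o |U|"
    using inacc ordLess_imp_ordLeq unfolding inaccessible_def by blast
  ultimately show False
    using card_of_ordLeq_finite infinite_UNIV_nat by blast
qed

lemma small_countable: "countable S \<Longrightarrow> small S"
proof (rule small_inj[of "to_nat_on S" S UNIV])
  show "small (UNIV :: nat set)" using inacc by (simp add: inaccessible_def small_def)
qed (auto intro: inj_on_to_nat_on)

text \<open>Regularity in \<open>inaccessible\<close> speaks of subsets of \<open>U\<close> indexed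
  by a subset of \<open>U\<close>. The index set and the members are therefore carried into
  \<open>'u\<close> by chosen injections, and the pairing \<open>p\<close>, which exists because
  \<open>U\<close> is infinite, keeps the images of different members apart.\<close>

lemma small_Sigma:
  assumes I: "small I" and F: "\<And>i. i \<in> I \<Longrightarrow> small (F i)"
  shows "small (Sigma I F)"
proof -
  obtain g :: "_ \<Rightarrow> 'u" where g: "inj_on g I" using small_inj_ex[OF I] .
  have "\<exists>h :: _ \<Rightarrow> 'u. inj_on h (F i)" if "i \<in> I" for i using small_inj_ex[OF F[OF that]] by blast
  then obtain h :: "_ \<Rightarrow> _ \<Rightarrow> 'u" where h: "\<And>i. i \<in> I \<Longrightarrow> inj_on (h i) (F i)" by metis
  have "|U \<times> U| \<le>o |U|" using card_of_Times_same_infinite[OF infinite_U] ordIso_imp_ordLeq by blast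
  then obtain p :: "'u \<times> 'u \<Rightarrow> 'u" where p: "inj p"
    using U_UNIV by (auto simp: card_of_ordLeq[symmetric])
  define f where "f x = (\<lambda>y. p (x, h (inv_into I g x) y)) ` F (inv_into I g x)" for x
  have "|f x| <o |U|" if "x \<in> g ` I" for x
    using small_image[OF F[OF inv_into_into[OF that]]] by (simp add: f_def small_def)
  moreover have "|g ` I| <o |U|" using small_image[OF I] by (simp add: small_def)
  ultimately have "|\<Union>x\<in>g ` I. f x| <o |U|"
    using inacc U_UNIV unfolding inaccessible_def by blast
  then have s: "small (\<Union>x\<in>g ` I. f x)" by (simp add: small_def)
  show ?thesis
  proof (rule small_inj[OF _ _ s])
    show "inj_on (\<lambda>(i, y). p (g i, h i y)) (Sigma I F)"
    proof (rule inj_onI, clarify)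
      fix i y i' y' assume *: "i \<in> I" "y \<in> F i" "i' \<in> I" "y' \<in> F i'" "p (g i, h i y) = p (g i', h i' y')"
      then have e: "g i = g i'" "h i y = h i' y'" using injD[OF p *(5)] by auto
      have "i = i'" using inj_onD[OF g e(1)] * by blast
      with e(2) * show "i = i' \<and> y = y'" using inj_onD[OF h, of i y y'] by blast
    qed
    show "(\<lambda>(i, y). p (g i, h i y)) ` Sigma I F \<subseteq> (\<Union>x\<in>g ` I. f x)"
    proof clarify
      fix i y assume *: "i \<in> I" "y \<in> F i"
      then have "p (g i, h i y) \<in> f (g i)" unfolding f_def inv_into_f_f[OF g *(1)] by blast
      with * show "p (g i, h i y) \<in> (\<Union>x\<in>g ` I. f x)" by blast
    qed
  qed
qed

lemma small_UN:
  assumes "small I" "\<And>i. i \<in> I \<Longrightarrow> small (F i)"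
  shows "small (\<Union>i\<in>I. F i)"
proof -
  have "(\<Union>i\<in>I. F i) = snd ` Sigma I F" by force
  then show ?thesis using small_Sigma[OF assms] by simp
qed

lemma small_Times: "small A \<Longrightarrow> small B \<Longrightarrow> small (A \<times> B)"
  by (rule small_Sigma)

lemma small_Un: "small A \<Longrightarrow> small B \<Longrightarrow> small (A \<union> B)"
  using small_UN[of "{True, False}" "\<lambda>b. if b then A else B"] small_countable[of "{True, False}"]
  by (auto simp: Un_commute)

lemma small_Pow:
  assumes "small A" shows "small (Pow A)"
proof -
  obtain g :: "_ \<Rightarrow> 'u" where g: "inj_on g A" using small_inj_ex[OF assms] .
  have "|g ` A| <o |U|" using small_image[OF assms] by (simp add: small_def)
  then have "|Pow (g ` A)| <o |U|" using inacc U_UNIV unfolding inaccessible_def by blast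
  then have s: "small (Pow (g ` A))" by (simp add: small_def)
  show ?thesis
    by (rule small_inj[OF inj_on_image_Pow[OF g] _ s]) auto
qed

text \<open>Functions are coded by their graphs, which are subsets of
  \<open>Sigma I F\<close>.\<close>

lemma small_PiE:
  assumes "small I" "\<And>i. i \<in> I \<Longrightarrow> small (F i)"
  shows "small (PiE I F)"
proof (rule small_inj[OF _ _ small_Pow[OF small_Sigma[OF assms]]])
  show "inj_on (\<lambda>f. (\<lambda>i. (i, f i)) ` I) (PiE I F)"
  proof (rule inj_onI)
    fix f g assume *: "f \<in> PiE I F" "g \<in> PiE I F" "(\<lambda>i. (i, f i)) ` I = (\<lambda>i. (i, g i)) ` I"
    show "f = g"
    proof (rule PiE_ext[OF *(1,2)])
      fix i assume "i \<in> I"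
      then have "(i, f i) \<in> (\<lambda>i. (i, g i)) ` I" using *(3) by blast
      then show "f i = g i" by auto
    qed
  qed
  show "(\<lambda>f. (\<lambda>i. (i, f i)) ` I) ` PiE I F \<subseteq> Pow (Sigma I F)" by auto
qed

lemma small_fun:
  assumes "\<And>n. small (F n)" shows "small {f. \<forall>n::nat. f n \<in> F n}"
proof -
  have "{f. \<forall>n. f n \<in> F n} = PiE UNIV F" by auto
  then show ?thesis using small_PiE[OF small_countable[of "UNIV :: nat set"], of F] assms by simp
qed

lemma SS_small: "(X :: 'u simp) \<in> SS \<Longrightarrow> small (spx X n)"
  unfolding SS_def small_def unfolding U_UNIV by blast

lemma SSI: "simplicial_set X \<Longrightarrow> (\<And>n. small (spx X n)) \<Longrightarrow> (X :: 'u simp) \<in> SS"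
  unfolding SS_def small_def unfolding U_UNIV by blast

lemma small_smap:
  assumes "\<And>n. small (spx X n)" "\<And>n. small (spx Y n)"
  shows "small (smap X Y)"
proof (rule small_subset[OF _ small_fun])
  show "smap X Y \<subseteq> {f. \<forall>n. f n \<in> spx X n \<rightarrow>\<^sub>E spx Y n}" by (auto simp: smap_def)
qed (intro small_PiE assms)

lemma small_Dmap [simp]: "small (Dmap m n)"
  by (intro small_countable countable_finite finite_Dmap)

lemma pt_SS [simp]: "(pt :: 'u simp) \<in> SS"
  by (rule SSI) (auto intro: small_countable)

section \<open>Transport into the universe\<close>

lemma enc_inj:
  assumes "small (spx X n)" shows "inj_on (enc X n :: 'b \<Rightarrow> 'u) (spx X n)"
proof -
  obtain g :: "'b \<Rightarrow> 'u" where "inj_on g (spx X n)" using small_inj_ex[OF assms] .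
  then show ?thesis
    unfolding enc_def by (rule someI[of "\<lambda>e. inj_on e (spx X n)"])
qed

lemma dec_enc [simp]:
  "small (spx X n) \<Longrightarrow> x \<in> spx X n \<Longrightarrow> dec X n (enc X n x :: 'u) = x"
  unfolding dec_def by (rule inv_into_f_f[OF enc_inj])

lemma spx_small_copy [simp]: "spx (small_copy X) n = enc X n ` spx X n"
  by (simp add: small_copy_def)

lemma enc_dec [simp]: "z \<in> enc X n ` spx X n \<Longrightarrow> enc X n (dec X n z) = z"
  unfolding dec_def by (rule f_inv_into_f)

lemma dec_in [simp]: "z \<in> enc X n ` spx X n \<Longrightarrow> dec X n z \<in> spx X n"
  unfolding dec_def by (rule inv_into_into)

lemma opr_small_copy [simp]:
  "opr (small_copy X :: 'u simp) m n \<alpha> z = enc X m (opr X m n \<alpha> (dec X n z))"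
  by (simp add: small_copy_def)

lemma small_copy_SS [simp]:
  assumes X: "simplicial_set X" and s: "\<And>n. small (spx X n)"
  shows "(small_copy X :: 'u simp) \<in> SS"
proof (rule SSI)
  show "simplicial_set (small_copy X :: 'u simp)"
    by (rule simplicial_setI) (auto simp: s X opr_opr)
qed (simp add: s)

end

section \<open>Simplices of mapping spaces out of orbits\<close>

definition pts :: "'u simp \<Rightarrow> 'u arrow \<Rightarrow> nat
    \<Rightarrow> ((nat \<Rightarrow> 'u \<times> (nat \<Rightarrow> nat) \<Rightarrow> 'u) \<times> (nat \<Rightarrow> 'u \<times> (nat \<Rightarrow> nat) \<Rightarrow> 'u)) set" where
  "pts A X n = spx (ahom (orbit A) X) n"

lemma spx_ahom [simp]: "spx (ahom (orbit A) X) n = pts A X n"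
  by (simp add: pts_def)

text \<open>The target of \<open>O\<^sub>A \<otimes> \<Delta>\<^sup>n\<close> is
  \<open>pt \<times> \<Delta>\<^sup>n\<close>, so a point amounts to a simplex of
  \<open>tgt X\<close>, given by \<open>v\<close>, and a map on
  \<open>A \<times> \<Delta>\<^sup>n\<close> lying over it. The commuting square becomes a pointwise
  equation in which \<open>undefined\<close> is the only simplex of \<open>pt\<close>.\<close>

lemma pts_iff:
  "(u, v) \<in> pts A X n \<longleftrightarrow>
     u \<in> smap (sprod A (Delta n)) (src X) \<and> v \<in> smap (sprod pt (Delta n)) (tgt X) \<and>
     (\<forall>k. \<forall>a\<in>spx A k. \<forall>\<beta>\<in>Dmap k n. arr X k (u k (a, \<beta>)) = v k (undefined, \<beta>))"
proof -
  let ?T = "tensor (orbit A) (Delta n)"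
  have src: "src ?T = sprod A (Delta n)" and tgt: "tgt ?T = sprod pt (Delta n)"
    by (simp_all add: tensor_def orbit_def)
  have arr: "arr ?T k (a, \<beta>) = (undefined, \<beta>)" if "a \<in> spx A k" "\<beta> \<in> Dmap k n" for k a \<beta>
    using that by (simp add: tensor_def orbit_def)
  have "scomp (src ?T) (arr X) u = scomp (src ?T) v (arr ?T) \<longleftrightarrow>
      (\<forall>k. \<forall>a\<in>spx A k. \<forall>\<beta>\<in>Dmap k n. arr X k (u k (a, \<beta>)) = v k (undefined, \<beta>))" (is "?l = ?r")
  proof
    assume l: ?l
    show ?r
    proof (intro allI ballI)
      fix k a \<beta> assume *: "a \<in> spx A k" "\<beta> \<in> Dmap k n"
      have "scomp (src ?T) (arr X) u k (a, \<beta>) = scomp (src ?T) v (arr ?T) k (a, \<beta>)" using l by simp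
      then show "arr X k (u k (a, \<beta>)) = v k (undefined, \<beta>)" using * arr[OF *] by (simp add: src)
    qed
  next
    assume r: ?r
    show ?l
    proof (rule scomp_eqI)
      fix k x assume "x \<in> spx (src ?T) k"
      then obtain a \<beta> where "x = (a, \<beta>)" "a \<in> spx A k" "\<beta> \<in> Dmap k n" by (auto simp: src)
      then show "arr X k (u k x) = v k (arr ?T k x)" using r arr by simp
    qed
  qed
  then show ?thesis by (auto simp: pts_def ahom_def squares_def src tgt)
qed

lemma ptsD:
  assumes "s \<in> pts A X n"
  shows "fst s \<in> smap (sprod A (Delta n)) (src X)" "snd s \<in> smap (sprod pt (Delta n)) (tgt X)"
    "a \<in> spx A k \<Longrightarrow> \<beta> \<in> Dmap k n \<Longrightarrow> arr X k (fst s k (a, \<beta>)) = snd s k (undefined, \<beta>)"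
  using assms pts_iff[of "fst s" "snd s"] by auto

lemma opr_ahom [simp]:
  "opr (ahom (orbit A) X) m n \<alpha> s = (pull A m \<alpha> (fst s), pull pt m \<alpha> (snd s))"
  by (simp add: ahom_def orbit_def split: prod.split)

lemma pull_pts [simp]:
  "simplicial_set A \<Longrightarrow> s \<in> pts A X n \<Longrightarrow> \<alpha> \<in> Dmap m n \<Longrightarrow>
   (pull A m \<alpha> (fst s), pull pt m \<alpha> (snd s)) \<in> pts A X m"
  using ptsD[of s A X n] by (simp add: pts_iff)

lemma hcomp_pts [simp]:
  "s \<in> pts B X n \<Longrightarrow> f \<in> smap (sprod A (Delta n)) B \<Longrightarrow> simplicial_set A \<Longrightarrow>
   (hcomp A n (fst s) f, snd s) \<in> pts A X n"
  using ptsD[of s B X n] by (simp add: pts_iff)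

lemma simplicial_set_ahom [simp]:
  "simplicial_set A \<Longrightarrow> simplicial_set (ahom (orbit A) X)"
  by (rule simplicial_setI) (simp_all add: pull_pull pull_Did[OF ptsD(1)] pull_Did[OF ptsD(2)])

lemma Ob_Map_cat: "X \<in> Ob Map_cat \<longleftrightarrow> src X \<in> SS \<and> tgt X \<in> SS \<and> arr X \<in> smap (src X) (tgt X)"
  by (simp add: Map_cat_def)

lemma fob_orbit_points [simp]: "fob (orbit_points X) A = HOM (orbit A) X"
  by (simp add: orbit_points_def)

context universe begin

lemma small_pts:
  assumes "X \<in> Ob Map_cat" "(A :: 'u simp) \<in> SS" shows "small (pts A X n)"
proof (rule small_subset)
  show "pts A X n \<subseteq> smap (sprod A (Delta n)) (src X) \<times> smap (sprod pt (Delta n)) (tgt X)"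
    by (auto simp: pts_iff)
  show "small \<dots>"
    using assms unfolding Ob_Map_cat by (intro small_Times small_smap) (auto intro!: small_Times intro: SS_small SS_small[OF pt_SS, simplified])
qed

lemma HOM_SS [simp]: "X \<in> Ob Map_cat \<Longrightarrow> (A :: 'u simp) \<in> SS \<Longrightarrow> HOM (orbit A) X \<in> SS"
  unfolding HOM_def by (rule small_copy_SS) (simp_all add: small_pts)

lemma spx_HOM: "spx (HOM (orbit (A :: 'u simp)) X) n = enc (ahom (orbit A) X) n ` pts A X n"
  by (simp add: HOM_def)

text \<open>Since \<open>enc\<close> and \<open>dec\<close> are inverse to each other on small sets
  of simplices, this rule reduces statements about \<open>HOM\<close> to unencoded points.\<close>

lemma HOM_cases:
  assumes "X \<in> Ob Map_cat" "(A :: 'u simp) \<in> SS" "z \<in> spx (HOM (orbit A) X) n"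
  obtains s where "s \<in> pts A X n" "z = enc (ahom (orbit A) X) n s" "dec (ahom (orbit A) X) n z = s"
  using assms dec_enc[of "ahom (orbit A) X" n] by (auto simp: spx_HOM small_pts)

lemma dec_enc_pts [simp]:
  "X \<in> Ob Map_cat \<Longrightarrow> (A :: 'u simp) \<in> SS \<Longrightarrow> s \<in> pts A X n \<Longrightarrow>
   dec (ahom (orbit A) X) n (enc (ahom (orbit A) X) n s :: 'u) = s"
  by (simp add: small_pts)

lemma enc_HOM [simp]:
  "s \<in> pts A X n \<Longrightarrow> enc (ahom (orbit (A :: 'u simp)) X) n s \<in> spx (HOM (orbit A) X) n"
  by (simp add: spx_HOM)

lemma opr_HOM:
  "X \<in> Ob Map_cat \<Longrightarrow> (A :: 'u simp) \<in> SS \<Longrightarrow> s \<in> pts A X n \<Longrightarrow>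
   opr (HOM (orbit A) X) m n \<alpha> (enc (ahom (orbit A) X) n s)
     = enc (ahom (orbit A) X) m (pull A m \<alpha> (fst s), pull pt m \<alpha> (snd s))"
  by (simp add: HOM_def small_pts)

lemma fmor_orbit_points:
  assumes X: "X \<in> Ob Map_cat" and A: "(A :: 'u simp) \<in> SS" "B \<in> SS"
    and f: "f \<in> smap (sprod A (Delta n)) B" and s: "s \<in> pts B X k" and b: "\<beta> \<in> Dmap k n"
  shows "fmor (orbit_points X) A B n f k (enc (ahom (orbit B) X) k s, \<beta>)
    = enc (ahom (orbit A) X) k (hcomp A k (fst s) (pull A k \<beta> f), snd s)"
  using assms by (simp add: orbit_points_def Let_def)

lemma fmor_orbit_points_undefined:
  assumes f: "f \<in> smap (sprod A (Delta n)) B" and x: "x \<notin> spx (HOM (orbit B) X) k \<times> Dmap k n"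
  shows "fmor (orbit_points X) A B n f k x = undefined"
  using assms by (simp add: orbit_points_def)

lemma fmor_orbit_points_smap:
  assumes X: "X \<in> Ob Map_cat" and A: "(A :: 'u simp) \<in> SS" "B \<in> SS"
    and f: "f \<in> smap (sprod A (Delta n)) B"
  shows "fmor (orbit_points X) A B n f \<in> smap (sprod (HOM (orbit B) X) (Delta n)) (HOM (orbit A) X)"
proof (rule shomI)
  fix k z \<beta> assume z: "z \<in> spx (HOM (orbit B) X) k" and b: "\<beta> \<in> Dmap k n"
  obtain s where s: "s \<in> pts B X k" "z = enc (ahom (orbit B) X) k s"
    using HOM_cases[OF X A(2) z] .
  have p: "pull A k \<beta> f \<in> smap (sprod A (Delta k)) B" using f b A by simp
  show "fmor (orbit_points X) A B n f k (z, \<beta>) \<in> spx (HOM (orbit A) X) k"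
    unfolding s(2) fmor_orbit_points[OF X A f s(1) b] using s(1) p A by simp
  fix j \<gamma> assume g: "\<gamma> \<in> Dmap j k"
  have p2: "(pull B j \<gamma> (fst s), pull pt j \<gamma> (snd s)) \<in> pts B X j" using s g A by simp
  show "fmor (orbit_points X) A B n f j (opr (HOM (orbit B) X) j k \<gamma> z, compose {..j} \<beta> \<gamma>)
      = opr (HOM (orbit A) X) j k \<gamma> (fmor (orbit_points X) A B n f k (z, \<beta>))"
    using g b A s p fmor_orbit_points[OF X A f p2, of "compose {..j} \<beta> \<gamma>"]
    by (simp add: fmor_orbit_points[OF X A f s(1) b] opr_HOM[OF X] pull_pull pull_hcomp[OF p])
next
  fix k x assume "x \<notin> spx (HOM (orbit B) X) k \<times> Dmap k n"
  then show "fmor (orbit_points X) A B n f k x = undefined" by (rule fmor_orbit_points_undefined[OF f])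
qed

text \<open>Precomposition changes the source component only, so functoriality is associativity of
  \<open>hcomp\<close> together with its compatibility with \<open>pull\<close>.\<close>

lemma simplicial_functor_orbit_points:
  assumes X: "X \<in> Ob Map_cat"
  shows "simplicial_functor (orbit_points X :: 'u sfunctor)"
  unfolding simplicial_functor_def
proof (intro conjI ballI allI)
  show "fob (orbit_points X) A \<in> SS" if "(A :: 'u simp) \<in> SS" for A
    using X that by simp
next
  fix A B :: "'u simp" assume A: "A \<in> SS" "B \<in> SS"
  show "fmor (orbit_points X) A B \<in> smap (shom A B) (shom (fob (orbit_points X) B) (fob (orbit_points X) A))"
  proof (rule smapI)
    fix n f assume f: "f \<in> spx (shom A B) n"
    then have f': "f \<in> smap (sprod A (Delta n)) B" by simp
    show "fmor (orbit_points X) A B n f \<in> spx (shom (fob (orbit_points X) B) (fob (orbit_points X) A)) n"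
      using fmor_orbit_points_smap[OF X A f'] by simp
    fix m \<alpha> assume a: "\<alpha> \<in> Dmap m n"
    have p: "pull A m \<alpha> f \<in> smap (sprod A (Delta m)) B" using f' a A by simp
    have "fmor (orbit_points X) A B m (pull A m \<alpha> f)
        = pull (HOM (orbit B) X) m \<alpha> (fmor (orbit_points X) A B n f)"
    proof (rule shom_eqI[OF fmor_orbit_points_smap[OF X A p] pull_smap[OF fmor_orbit_points_smap[OF X A f'] a]])
      show "simplicial_set (HOM (orbit B) X)" using X A by simp
      fix k z \<beta> assume z: "z \<in> spx (HOM (orbit B) X) k" and b: "\<beta> \<in> Dmap k m"
      obtain s where s: "s \<in> pts B X k" "z = enc (ahom (orbit B) X) k s"
        using HOM_cases[OF X A(2) z] .
      show "fmor (orbit_points X) A B m (pull A m \<alpha> f) k (z, \<beta>)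
          = pull (HOM (orbit B) X) m \<alpha> (fmor (orbit_points X) A B n f) k (z, \<beta>)"
        using fmor_orbit_points[OF X A f' s(1), of "compose {..k} \<alpha> \<beta>"]
          fmor_orbit_points[OF X A p s(1) b] z a b s(2)
        by (simp add: pull_pull)
    qed
    then show "fmor (orbit_points X) A B m (opr (shom A B) m n \<alpha> f)
        = opr (shom (fob (orbit_points X) B) (fob (orbit_points X) A)) m n \<alpha> (fmor (orbit_points X) A B n f)"
      by simp
  qed (simp add: orbit_points_def)
next
  fix A :: "'u simp" and n assume A: "A \<in> SS"
  have h: "hid A n \<in> smap (sprod A (Delta n)) A" using A by simp
  show "fmor (orbit_points X) A A n (hid A n) = hid (fob (orbit_points X) A) n"
    unfolding fob_orbit_points
  proof (rule shom_eqI[OF fmor_orbit_points_smap[OF X A A h]])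
    show "hid (HOM (orbit A) X) n \<in> smap (sprod (HOM (orbit A) X) (Delta n)) (HOM (orbit A) X)"
      using X A by simp
    fix k z \<beta> assume z: "z \<in> spx (HOM (orbit A) X) k" and b: "\<beta> \<in> Dmap k n"
    obtain s where s: "s \<in> pts A X k" "z = enc (ahom (orbit A) X) k s" using HOM_cases[OF X A z] .
    show "fmor (orbit_points X) A A n (hid A n) k (z, \<beta>) = hid (HOM (orbit A) X) n k (z, \<beta>)"
      using fmor_orbit_points[OF X A A h s(1) b] z b s(2) ptsD(1)[OF s(1)] by simp
  qed
next
  fix A B C :: "'u simp" and n f g
  assume A: "A \<in> SS" and B: "B \<in> SS" and C: "C \<in> SS"
    and "f \<in> spx (shom A B) n" "g \<in> spx (shom B C) n"
  then have f: "f \<in> smap (sprod A (Delta n)) B" and g: "g \<in> smap (sprod B (Delta n)) C" by auto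
  have gf: "hcomp A n g f \<in> smap (sprod A (Delta n)) C" using f g A by simp
  show "fmor (orbit_points X) A C n (hcomp A n g f)
      = hcomp (fob (orbit_points X) C) n (fmor (orbit_points X) A B n f) (fmor (orbit_points X) B C n g)"
    unfolding fob_orbit_points
  proof (rule shom_eqI[OF fmor_orbit_points_smap[OF X A C gf]
          hcomp_smap[OF fmor_orbit_points_smap[OF X B C g] fmor_orbit_points_smap[OF X A B f]]])
    show "simplicial_set (HOM (orbit C) X)" using X C by simp
    fix k z \<beta> assume z: "z \<in> spx (HOM (orbit C) X) k" and b: "\<beta> \<in> Dmap k n"
    obtain s where s: "s \<in> pts C X k" "z = enc (ahom (orbit C) X) k s" using HOM_cases[OF X C z] .
    have pf: "pull A k \<beta> f \<in> smap (sprod A (Delta k)) B" and pg: "pull B k \<beta> g \<in> smap (sprod B (Delta k)) C"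
      using f g b A B by auto
    have sg: "(hcomp B k (fst s) (pull B k \<beta> g), snd s) \<in> pts B X k" using s(1) pg B by simp
    have "fmor (orbit_points X) A C n (hcomp A n g f) k (z, \<beta>)
        = enc (ahom (orbit A) X) k (hcomp A k (fst s) (pull A k \<beta> (hcomp A n g f)), snd s)"
      unfolding s(2) by (rule fmor_orbit_points[OF X A C gf s(1) b])
    also have "hcomp A k (fst s) (pull A k \<beta> (hcomp A n g f))
        = hcomp A k (hcomp B k (fst s) (pull B k \<beta> g)) (pull A k \<beta> f)"
      by (simp add: pull_hcomp[OF f b] hcomp_assoc[OF pf])
    also have "enc (ahom (orbit A) X) k (\<dots>, snd s)
        = fmor (orbit_points X) A B n f k (fmor (orbit_points X) B C n g k (z, \<beta>), \<beta>)"
      unfolding s(2) fmor_orbit_points[OF X B C g s(1) b] using fmor_orbit_points[OF X A B f sg b] by simp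
    finally show "fmor (orbit_points X) A C n (hcomp A n g f) k (z, \<beta>)
        = hcomp (HOM (orbit C) X) n (fmor (orbit_points X) A B n f) (fmor (orbit_points X) B C n g) k (z, \<beta>)"
      using z b by simp
  qed
qed

lemma act_orbit_points:
  assumes X: "X \<in> Ob Map_cat" and A: "(A :: 'u simp) \<in> SS" "B \<in> SS"
    and f: "f \<in> smap (sprod A (Delta n)) B" and s: "s \<in> pts B X n"
  shows "act (orbit_points X) A B n f (enc (ahom (orbit B) X) n s)
    = enc (ahom (orbit A) X) n (hcomp A n (fst s) f, snd s)"
  using fmor_orbit_points[OF X A f s Did_Dmap] f by (simp add: act_def)

end

section \<open>Squares and cowedges\<close>

lemma squaresD:
  assumes "g \<in> squares X Y"
  shows "fst g \<in> smap (src X) (src Y)" "snd g \<in> smap (tgt X) (tgt Y)"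
    "x \<in> spx (src X) n \<Longrightarrow> arr Y n (fst g n x) = snd g n (arr X n x)"
proof -
  have s: "scomp (src X) (arr Y) (fst g) = scomp (src X) (snd g) (arr X)"
    using assms by (auto simp: squares_def)
  show "fst g \<in> smap (src X) (src Y)" "snd g \<in> smap (tgt X) (tgt Y)"
    using assms by (auto simp: squares_def)
  assume "x \<in> spx (src X) n"
  then show "arr Y n (fst g n x) = snd g n (arr X n x)" using fun_cong[OF fun_cong[OF s], of n x] by simp
qed

lemma squaresI:
  "u \<in> smap (src X) (src Y) \<Longrightarrow> v \<in> smap (tgt X) (tgt Y) \<Longrightarrow>
   (\<And>n x. x \<in> spx (src X) n \<Longrightarrow> arr Y n (u n x) = v n (arr X n x)) \<Longrightarrow> (u, v) \<in> squares X Y"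
  unfolding squares_def by (auto intro!: scomp_eqI)

lemma squares_eqI:
  assumes "g \<in> squares X Y" "h \<in> squares X Y'"
    "\<And>n x. x \<in> spx (src X) n \<Longrightarrow> fst g n x = fst h n x"
    "\<And>n x. x \<in> spx (tgt X) n \<Longrightarrow> snd g n x = snd h n x"
  shows "g = h"
  using smap_eqI[OF squaresD(1)[OF assms(1)] squaresD(1)[OF assms(2)] assms(3)]
    smap_eqI[OF squaresD(2)[OF assms(1)] squaresD(2)[OF assms(2)] assms(4)]
  by (simp add: prod_eq_iff)

lemma sqcomp_sel [simp]:
  "fst (sqcomp X g f) = scomp (src X) (fst g) (fst f)"
  "snd (sqcomp X g f) = scomp (tgt X) (snd g) (snd f)"
  by (simp_all add: sqcomp_def)

lemma tensor_orbit [simp]: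
  "src (tensor (orbit A) K) = sprod A K" "tgt (tensor (orbit A) K) = sprod pt K"
  "a \<in> spx A k \<Longrightarrow> c \<in> spx K k \<Longrightarrow> arr (tensor (orbit A) K) k (a, c) = (undefined, c)"
  by (simp_all add: tensor_def orbit_def)

lemma sqcomp_squares:
  assumes "f \<in> squares X Y" "g \<in> squares Y Z" "simplicial_set (src X)" "simplicial_set (tgt X)"
    "\<And>n x. x \<in> spx (src X) n \<Longrightarrow> arr X n x \<in> spx (tgt X) n"
  shows "sqcomp X g f \<in> squares X Z"
  unfolding sqcomp_def
  by (rule squaresI)
    (use assms squaresD[OF assms(1)] squaresD[OF assms(2)] in \<open>auto simp: scomp_smap\<close>)

lemma cowedgeD:
  assumes "is_cowedge Y X w" "A \<in> SS"
  shows "w A \<in> squares (tensor (orbit A) (fob Y A)) X"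
    and "fst (w A) \<in> smap (sprod A (fob Y A)) (src X)"
    and "snd (w A) \<in> smap (sprod pt (fob Y A)) (tgt X)"
    and "a \<in> spx A n \<Longrightarrow> y \<in> spx (fob Y A) n \<Longrightarrow> arr X n (fst (w A) n (a, y)) = snd (w A) n (undefined, y)"
    and "B \<in> SS \<Longrightarrow> f \<in> smap (sprod A (Delta n)) B \<Longrightarrow> y' \<in> spx (fob Y B) n \<Longrightarrow> a \<in> spx A n \<Longrightarrow>
      fst (w A) n (a, act Y A B n f y') = fst (w B) n (f n (a, Did n), y')"
    and "B \<in> SS \<Longrightarrow> f \<in> smap (sprod A (Delta n)) B \<Longrightarrow> y' \<in> spx (fob Y B) n \<Longrightarrow>
      snd (w A) n (undefined, act Y A B n f y') = snd (w B) n (undefined, y')"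
proof -
  show w: "w A \<in> squares (tensor (orbit A) (fob Y A)) X" using assms by (auto simp: is_cowedge_def)
  show "fst (w A) \<in> smap (sprod A (fob Y A)) (src X)" "snd (w A) \<in> smap (sprod pt (fob Y A)) (tgt X)"
    using squaresD[OF w] by auto
  show "a \<in> spx A n \<Longrightarrow> y \<in> spx (fob Y A) n \<Longrightarrow> arr X n (fst (w A) n (a, y)) = snd (w A) n (undefined, y)"
    using squaresD(3)[OF w, of "(a, y)" n] by simp
  show "B \<in> SS \<Longrightarrow> f \<in> smap (sprod A (Delta n)) B \<Longrightarrow> y' \<in> spx (fob Y B) n \<Longrightarrow> a \<in> spx A n \<Longrightarrow>
      fst (w A) n (a, act Y A B n f y') = fst (w B) n (f n (a, Did n), y')"
    "B \<in> SS \<Longrightarrow> f \<in> smap (sprod A (Delta n)) B \<Longrightarrow> y' \<in> spx (fob Y B) n \<Longrightarrow>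
      snd (w A) n (undefined, act Y A B n f y') = snd (w B) n (undefined, y')"
    using assms unfolding is_cowedge_def spx_shom spx_pt by (metis insertI1)+
qed

lemma cowedgeI:
  assumes "\<And>A. A \<in> SS \<Longrightarrow> w A \<in> squares (tensor (orbit A) (fob Y A)) X"
    and "\<And>A B n f y a. A \<in> SS \<Longrightarrow> B \<in> SS \<Longrightarrow> f \<in> smap (sprod A (Delta n)) B \<Longrightarrow> y \<in> spx (fob Y B) n \<Longrightarrow>
      a \<in> spx A n \<Longrightarrow> fst (w A) n (a, act Y A B n f y) = fst (w B) n (f n (a, Did n), y)"
    and "\<And>A B n f y. A \<in> SS \<Longrightarrow> B \<in> SS \<Longrightarrow> f \<in> smap (sprod A (Delta n)) B \<Longrightarrow> y \<in> spx (fob Y B) n \<Longrightarrow>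
      snd (w A) n (undefined, act Y A B n f y) = snd (w B) n (undefined, y)"
  shows "is_cowedge Y X w"
  unfolding is_cowedge_def spx_shom spx_pt
proof (intro conjI ballI allI)
  fix A B :: "'a simp" and n f y
  assume *: "A \<in> SS" "B \<in> SS" "f \<in> smap (sprod A (Delta n)) B" "y \<in> spx (fob Y B) n"
  show "fst (w B) n (f n (a, Did n), y) = fst (w A) n (a, act Y A B n f y)" if "a \<in> spx A n" for a
    using assms(2)[OF * that] by simp
  show "snd (w B) n (c, y) = snd (w A) n (c, act Y A B n f y)" if "c \<in> {undefined}" for c
    using assms(3)[OF *] that by simp
qed (rule assms(1))

section \<open>The coend formula\<close>

definition empty_simp :: "'a simp" where
  "empty_simp = \<lparr>spx = (\<lambda>n. {}), opr = (\<lambda>m n \<alpha> x. undefined)\<rparr>"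

lemma spx_empty [simp]: "spx empty_simp n = {}"
  by (simp add: empty_simp_def)

lemma empty_simplicial [simp]: "simplicial_set empty_simp"
  by (rule simplicial_setI) auto

text \<open>Maps are extensional, so on an empty domain the constant function
  \<open>undefined\<close> is the only one; in every degree it is the unique simplex of
  \<open>hom(\<emptyset>, B)\<close>.\<close>

definition from_empty :: "nat \<Rightarrow> 'a \<times> (nat \<Rightarrow> nat) \<Rightarrow> 'b" where
  "from_empty = (\<lambda>k x. undefined)"

lemma from_empty_smap [simp]: "from_empty \<in> smap (sprod empty_simp (Delta n)) B"
  by (rule shomI) (auto simp: from_empty_def)

lemma smap_from_empty: "f \<in> smap (sprod empty_simp (Delta n)) B \<Longrightarrow> f = from_empty"
  by (erule shom_eqI[OF _ from_empty_smap]) auto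

lemma hcomp_from_empty [simp]: "hcomp empty_simp n f g = from_empty"
  by (intro ext) (auto simp: hcomp_def from_empty_def)

lemma pull_from_empty [simp]: "pull empty_simp m \<alpha> f = from_empty"
  by (intro ext) (auto simp: pull_def from_empty_def)

text \<open>The \<open>n\<close>-simplex of \<open>hom(pt, A)\<close> that corresponds to
  \<open>a\<close> under the isomorphism of \<open>A\<close> with \<open>hom(pt, A)\<close>.\<close>

definition point :: "'a simp \<Rightarrow> nat \<Rightarrow> 'a \<Rightarrow> nat \<Rightarrow> 'b \<times> (nat \<Rightarrow> nat) \<Rightarrow> 'a" where
  "point A n a = (\<lambda>k. \<lambda>(c, \<beta>)\<in>spx (sprod pt (Delta n)) k. opr A k n \<beta> a)"

lemma point_app [simp]: "\<beta> \<in> Dmap k n \<Longrightarrow> point A n a k (undefined, \<beta>) = opr A k n \<beta> a"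
  by (simp add: point_def)

lemma point_smap [simp]:
  "simplicial_set A \<Longrightarrow> a \<in> spx A n \<Longrightarrow> point A n a \<in> smap (sprod pt (Delta n)) A"
  by (rule shomI) (auto simp: point_def opr_opr)

lemma pull_point:
  "simplicial_set A \<Longrightarrow> a \<in> spx A n \<Longrightarrow> \<alpha> \<in> Dmap m n \<Longrightarrow>
   pull pt m \<alpha> (point A n a) = point A m (opr A m n \<alpha> a)"
  by (intro ext) (auto simp: point_def pull_def opr_opr)

lemma hcomp_point:
  "simplicial_set A \<Longrightarrow> a \<in> spx A n \<Longrightarrow> simplicial_set B \<Longrightarrow> f \<in> smap (sprod A (Delta n)) B \<Longrightarrow>
   hcomp pt n f (point A n a) = point B n (f n (a, Did n))"
  by (intro ext) (auto simp: point_def hcomp_def shom_opr[symmetric])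

lemma point_pt [simp]: "point pt n undefined = hid pt n"
  by (intro ext) (auto simp: point_def hid_def)

text \<open>The cowedge given by co-Yoneda: \<open>(a, y)\<close> goes to the restriction of
  \<open>y\<close> along \<open>a : pt \<rightarrow> A\<close>, and on targets \<open>y\<close> is
  restricted along \<open>\<emptyset> \<rightarrow> A\<close>. The maps \<open>e\<^sub>0\<close> and
  \<open>e\<^sub>1\<close> identify \<open>Y pt\<close> and \<open>Y \<emptyset>\<close> with the
  two ends of an arrow: they are identities when the existence of the coend is shown, and
  evaluations when \<open>Y\<close> is \<open>X\<^sup>\<O>\<close>.\<close>

definition iota :: "'u sfunctor \<Rightarrow> (nat \<Rightarrow> 'u \<Rightarrow> 'u) \<Rightarrow> (nat \<Rightarrow> 'u \<Rightarrow> 'u) \<Rightarrow> 'u simp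
    \<Rightarrow> (nat \<Rightarrow> 'u \<times> 'u \<Rightarrow> 'u) \<times> (nat \<Rightarrow> 'u \<times> 'u \<Rightarrow> 'u)" where
  "iota Y e\<^sub>0 e\<^sub>1 A =
     ((\<lambda>n. \<lambda>(a, y)\<in>spx (sprod A (fob Y A)) n. e\<^sub>0 n (act Y pt A n (point A n a) y)),
      (\<lambda>n. \<lambda>(c, y)\<in>spx (sprod pt (fob Y A)) n. e\<^sub>1 n (act Y empty_simp A n from_empty y)))"

lemma iota_app [simp]:
  "a \<in> spx A n \<Longrightarrow> y \<in> spx (fob Y A) n \<Longrightarrow>
     fst (iota Y e\<^sub>0 e\<^sub>1 A) n (a, y) = e\<^sub>0 n (act Y pt A n (point A n a) y)"
  "y \<in> spx (fob Y A) n \<Longrightarrow>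
     snd (iota Y e\<^sub>0 e\<^sub>1 A) n (undefined, y) = e\<^sub>1 n (act Y empty_simp A n from_empty y)"
  by (simp_all add: iota_def)

context universe begin

lemma empty_SS [simp]: "(empty_simp :: 'u simp) \<in> SS"
  by (rule SSI) (auto intro: small_countable)

text \<open>Since \<open>A = hom(pt, A)\<close> and \<open>pt = hom(\<emptyset>, A)\<close>, the co-Yoneda lemma identifies the coend of
  \<open>O\<^sub>A \<otimes> Y A\<close> with \<open>Y pt \<rightarrow> Y \<emptyset>\<close>.\<close>

lemma is_coend_iota:
  fixes Y :: "'u sfunctor"
  assumes Y: "simplicial_functor Y" and R: "R \<in> Ob Map_cat"
    and e0: "e\<^sub>0 \<in> smap (fob Y pt) (src R)" "\<And>n. bij_betw (e\<^sub>0 n) (spx (fob Y pt) n) (spx (src R) n)"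
    and e1: "e\<^sub>1 \<in> smap (fob Y empty_simp) (tgt R)"
      "\<And>n. bij_betw (e\<^sub>1 n) (spx (fob Y empty_simp) n) (spx (tgt R) n)"
    and e01: "\<And>n y. y \<in> spx (fob Y pt) n \<Longrightarrow>
      arr R n (e\<^sub>0 n y) = e\<^sub>1 n (act Y empty_simp pt n from_empty y)"
  shows "is_coend Y R (iota Y e\<^sub>0 e\<^sub>1)"
proof -
  have YS: "simplicial_set (fob Y A)" if "A \<in> SS" for A using sfunD(1)[OF Y that] by simp
  have sq: "iota Y e\<^sub>0 e\<^sub>1 A \<in> squares (tensor (orbit A) (fob Y A)) R" if A: "A \<in> SS" for A
  proof -
    have "(fst (iota Y e\<^sub>0 e\<^sub>1 A), snd (iota Y e\<^sub>0 e\<^sub>1 A)) \<in> squares (tensor (orbit A) (fob Y A)) R"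
    proof (rule squaresI)
      show "fst (iota Y e\<^sub>0 e\<^sub>1 A) \<in> smap (src (tensor (orbit A) (fob Y A))) (src R)"
        unfolding tensor_orbit
      proof (rule smapI)
        fix n x assume "x \<in> spx (sprod A (fob Y A)) n"
        then obtain a y where x: "x = (a, y)" "a \<in> spx A n" "y \<in> spx (fob Y A) n" by auto
        then have p: "act Y pt A n (point A n a) y \<in> spx (fob Y pt) n" using Y A by simp
        then show "fst (iota Y e\<^sub>0 e\<^sub>1 A) n x \<in> spx (src R) n" using x smap_in[OF e0(1)] by simp
        fix m \<alpha> assume a: "\<alpha> \<in> Dmap m n"
        show "fst (iota Y e\<^sub>0 e\<^sub>1 A) m (opr (sprod A (fob Y A)) m n \<alpha> x)
          = opr (src R) m n \<alpha> (fst (iota Y e\<^sub>0 e\<^sub>1 A) n x)"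
          using x a A p YS[OF A] Y
          by (simp add: smap_opr[OF e0(1), symmetric] act_opr pull_point)
      qed (auto simp: iota_def)
      show "snd (iota Y e\<^sub>0 e\<^sub>1 A) \<in> smap (tgt (tensor (orbit A) (fob Y A))) (tgt R)"
        unfolding tensor_orbit
      proof (rule smapI)
        fix n x assume "x \<in> spx (sprod (pt :: 'u simp) (fob Y A)) n"
        then obtain y where x: "x = (undefined, y)" "y \<in> spx (fob Y A) n" by auto
        then have p: "act Y empty_simp A n from_empty y \<in> spx (fob Y empty_simp) n" using Y A by simp
        then show "snd (iota Y e\<^sub>0 e\<^sub>1 A) n x \<in> spx (tgt R) n" using x smap_in[OF e1(1)] by simp
        fix m \<alpha> assume a: "\<alpha> \<in> Dmap m n"
        show "snd (iota Y e\<^sub>0 e\<^sub>1 A) m (opr (sprod pt (fob Y A)) m n \<alpha> x)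
          = opr (tgt R) m n \<alpha> (snd (iota Y e\<^sub>0 e\<^sub>1 A) n x)"
          using x a A p YS[OF A] Y
          by (simp add: smap_opr[OF e1(1), symmetric] act_opr)
      qed (auto simp: iota_def)
      fix n x assume "x \<in> spx (src (tensor (orbit A) (fob Y A))) n"
      then obtain a y where x: "x = (a, y)" "a \<in> spx A n" "y \<in> spx (fob Y A) n" by auto
      \<comment> \<open>Both sides restrict \<open>y\<close> along the unique map
        \<open>\<emptyset> \<rightarrow> A\<close>; on the left it passes through
        \<open>a : pt \<rightarrow> A\<close>.\<close>
      then show "arr R n (fst (iota Y e\<^sub>0 e\<^sub>1 A) n x)
        = snd (iota Y e\<^sub>0 e\<^sub>1 A) n (arr (tensor (orbit A) (fob Y A)) n x)"
        using Y A act_hcomp[OF Y empty_SS pt_SS A from_empty_smap, of "point A n a" n y]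
        by (simp add: e01)
    qed
    then show ?thesis by simp
  qed
  have cw: "is_cowedge Y R (iota Y e\<^sub>0 e\<^sub>1)"
  proof (rule cowedgeI[OF sq])
    fix A B :: "'u simp" and n f y
    assume AB: "A \<in> SS" "B \<in> SS" and f: "f \<in> smap (sprod A (Delta n)) B" and y: "y \<in> spx (fob Y B) n"
    show "fst (iota Y e\<^sub>0 e\<^sub>1 A) n (a, act Y A B n f y) = fst (iota Y e\<^sub>0 e\<^sub>1 B) n (f n (a, Did n), y)"
      if a: "a \<in> spx A n" for a
      using act_hcomp[OF Y pt_SS AB point_smap f, of a y] a f y AB Y
      unfolding hcomp_point[OF SS_simplicial[OF AB(1)] a SS_simplicial[OF AB(2)] f] by simp
    show "snd (iota Y e\<^sub>0 e\<^sub>1 A) n (undefined, act Y A B n f y) = snd (iota Y e\<^sub>0 e\<^sub>1 B) n (undefined, y)"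
      using act_hcomp[OF Y empty_SS AB from_empty_smap f y] f y AB Y by simp
  qed
  \<comment> \<open>At \<open>pt\<close> the cowedge is \<open>e\<^sub>0\<close> itself, because
    \<open>point\<close> of the only simplex of \<open>pt\<close> is the identity. Hence every
    simplex of \<open>src R\<close> is a value of the cowedge, which makes maps out of
    \<open>R\<close> unique; \<open>s1\<close> does the same for targets at
    \<open>empty_simp\<close>.\<close>
  have s0: "\<exists>y\<in>spx (fob Y pt) n. r = e\<^sub>0 n y \<and> fst (iota Y e\<^sub>0 e\<^sub>1 pt) n (undefined, y) = r"
    if "r \<in> spx (src R) n" for r n
    using that e0(2)[of n] Y by (auto simp: bij_betw_def image_iff)
  have s1: "\<exists>y\<in>spx (fob Y empty_simp) n. r = e\<^sub>1 n y \<and> snd (iota Y e\<^sub>0 e\<^sub>1 empty_simp) n (undefined, y) = r"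
    if "r \<in> spx (tgt R) n" for r n
  proof -
    have "hid empty_simp n = (from_empty :: _ \<Rightarrow> 'u \<times> _ \<Rightarrow> 'u)" by (rule smap_from_empty[OF hid_smap]) simp
    then have "act Y empty_simp empty_simp n from_empty y = y" if "y \<in> spx (fob Y empty_simp) n" for y
      using act_hid[OF Y empty_SS that] by simp
    then show ?thesis using that e1(2)[of n] by (auto simp: bij_betw_def image_iff)
  qed
  show ?thesis
    unfolding is_coend_def
  proof (intro conjI ballI allI impI R cw)
    fix X :: "'u arrow" and w assume X: "X \<in> Ob Map_cat" and w: "is_cowedge Y X w"
    note wD = cowedgeD[OF w]
    \<comment> \<open>The values forced by the components of \<open>w\<close> at \<open>pt\<close>
      and at \<open>empty_simp\<close>, read through the inverses of \<open>e\<^sub>0\<close> and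
      \<open>e\<^sub>1\<close>.\<close>
    define g0 where "g0 n = (\<lambda>r\<in>spx (src R) n. fst (w pt) n (undefined, inv_into (spx (fob Y pt) n) (e\<^sub>0 n) r))" for n
    define g1 where "g1 n = (\<lambda>r\<in>spx (tgt R) n. snd (w empty_simp) n (undefined, inv_into (spx (fob Y empty_simp) n) (e\<^sub>1 n) r))" for n
    have g0: "g0 n (e\<^sub>0 n y) = fst (w pt) n (undefined, y)" if "y \<in> spx (fob Y pt) n" for n y
      using that e0(2)[of n] smap_in[OF e0(1) that] by (simp add: g0_def bij_betw_def)
    have g1: "g1 n (e\<^sub>1 n y) = snd (w empty_simp) n (undefined, y)" if "y \<in> spx (fob Y empty_simp) n" for n y
      using that e1(2)[of n] smap_in[OF e1(1) that] by (simp add: g1_def bij_betw_def)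
    have g: "(g0, g1) \<in> squares R X"
    proof (rule squaresI)
      show "g0 \<in> smap (src R) (src X)"
      proof (rule smapI)
        fix n r assume "r \<in> spx (src R) n"
        then obtain y where y: "y \<in> spx (fob Y pt) n" "r = e\<^sub>0 n y" using s0 by blast
        then show "g0 n r \<in> spx (src X) n" using g0 smap_in[OF wD(2)[OF pt_SS], of "(undefined, y)" n] by simp
        fix m \<alpha> assume a: "\<alpha> \<in> Dmap m n"
        show "g0 m (opr (src R) m n \<alpha> r) = opr (src X) m n \<alpha> (g0 n r)"
          using y a smap_opr[OF wD(2)[OF pt_SS] a, of "(undefined, y)"] YS[OF pt_SS]
          by (simp add: smap_opr[OF e0(1) a y(1), symmetric] g0)
      qed (simp add: g0_def)
      show "g1 \<in> smap (tgt R) (tgt X)"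
      proof (rule smapI)
        fix n r assume "r \<in> spx (tgt R) n"
        then obtain y where y: "y \<in> spx (fob Y empty_simp) n" "r = e\<^sub>1 n y" using s1 by blast
        then show "g1 n r \<in> spx (tgt X) n" using g1 smap_in[OF wD(3)[OF empty_SS], of "(undefined, y)" n] by simp
        fix m \<alpha> assume a: "\<alpha> \<in> Dmap m n"
        show "g1 m (opr (tgt R) m n \<alpha> r) = opr (tgt X) m n \<alpha> (g1 n r)"
          using y a smap_opr[OF wD(3)[OF empty_SS] a, of "(undefined, y)"] YS[OF empty_SS]
          by (simp add: smap_opr[OF e1(1) a y(1), symmetric] g1)
      qed (simp add: g1_def)
      fix n r assume "r \<in> spx (src R) n"
      then obtain y where y: "y \<in> spx (fob Y pt) n" "r = e\<^sub>0 n y" using s0 by blast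
      then show "arr X n (g0 n r) = g1 n (arr R n r)"
        using wD(4)[OF pt_SS, of undefined n y] wD(6)[OF empty_SS pt_SS from_empty_smap y(1)]
        by (simp add: g0 g1 e01 Y)
    qed
    have ge: "sqcomp (tensor (orbit A) (fob Y A)) (g0, g1) (iota Y e\<^sub>0 e\<^sub>1 A) = w A" if A: "A \<in> SS" for A
    proof (rule squares_eqI[OF sqcomp_squares[OF sq[OF A] g] wD(1)[OF A]])
      fix n x
      { assume "x \<in> spx (src (tensor (orbit A) (fob Y A))) n"
        then obtain a y where x: "x = (a, y)" "a \<in> spx A n" "y \<in> spx (fob Y A) n" by auto
        \<comment> \<open>The cowedge condition for \<open>a : pt \<rightarrow> A\<close> expresses
          the component of \<open>w\<close> at \<open>A\<close> through the one at
          \<open>pt\<close>.\<close>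
        then show "fst (sqcomp (tensor (orbit A) (fob Y A)) (g0, g1) (iota Y e\<^sub>0 e\<^sub>1 A)) n x = fst (w A) n x"
          using wD(5)[OF pt_SS A, of "point A n a" n y undefined] A Y by (simp add: g0) }
      { assume "x \<in> spx (tgt (tensor (orbit A) (fob Y A))) n"
        then obtain y where x: "x = (undefined, y)" "y \<in> spx (fob Y A) n" by auto
        then show "snd (sqcomp (tensor (orbit A) (fob Y A)) (g0, g1) (iota Y e\<^sub>0 e\<^sub>1 A)) n x = snd (w A) n x"
          using wD(6)[OF empty_SS A from_empty_smap x(2)] A Y by (simp add: g1) }
    qed (use A YS in auto)
    show "\<exists>!g. g \<in> squares R X \<and> (\<forall>A\<in>SS. sqcomp (tensor (orbit A) (fob Y A)) g (iota Y e\<^sub>0 e\<^sub>1 A) = w A)"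
    proof (rule ex1I[of _ "(g0, g1)"])
      show "(g0, g1) \<in> squares R X \<and> (\<forall>A\<in>SS. sqcomp (tensor (orbit A) (fob Y A)) (g0, g1) (iota Y e\<^sub>0 e\<^sub>1 A) = w A)"
        using g ge by blast
      fix h assume h: "h \<in> squares R X \<and> (\<forall>A\<in>SS. sqcomp (tensor (orbit A) (fob Y A)) h (iota Y e\<^sub>0 e\<^sub>1 A) = w A)"
      show "h = (g0, g1)"
      proof (rule squares_eqI[OF conjunct1[OF h] g])
        fix n r
        { assume "r \<in> spx (src R) n"
          then obtain y where y: "y \<in> spx (fob Y pt) n" "fst (iota Y e\<^sub>0 e\<^sub>1 pt) n (undefined, y) = r"
            using s0 by blast
          have "fst (sqcomp (tensor (orbit pt) (fob Y pt)) h (iota Y e\<^sub>0 e\<^sub>1 pt)) n (undefined, y)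
            = fst (sqcomp (tensor (orbit pt) (fob Y pt)) (g0, g1) (iota Y e\<^sub>0 e\<^sub>1 pt)) n (undefined, y)"
            using h ge pt_SS by simp
          then show "fst h n r = fst (g0, g1) n r" using y by (simp del: iota_app) }
        { assume "r \<in> spx (tgt R) n"
          then obtain y where y: "y \<in> spx (fob Y empty_simp) n" "snd (iota Y e\<^sub>0 e\<^sub>1 empty_simp) n (undefined, y) = r"
            using s1 by blast
          have "snd (sqcomp (tensor (orbit empty_simp) (fob Y empty_simp)) h (iota Y e\<^sub>0 e\<^sub>1 empty_simp)) n (undefined, y)
            = snd (sqcomp (tensor (orbit empty_simp) (fob Y empty_simp)) (g0, g1) (iota Y e\<^sub>0 e\<^sub>1 empty_simp)) n (undefined, y)"
            using h ge empty_SS by simp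
          then show "snd h n r = snd (g0, g1) n r" using y by (simp del: iota_app) }
      qed
    qed
  qed
qed

lemma ex_coend:
  assumes Y: "simplicial_functor (Y :: 'u sfunctor)"
  shows "\<exists>R \<iota>. is_coend Y R \<iota>"
proof -
  define R where "R = \<lparr>src = fob Y pt, tgt = fob Y empty_simp,
    arr = (\<lambda>n. \<lambda>y\<in>spx (fob Y pt) n. act Y empty_simp pt n from_empty y)\<rparr>"
  have s: "fob Y pt \<in> SS" "fob Y empty_simp \<in> SS" using sfunD(1)[OF Y] by auto
  have "arr R \<in> smap (fob Y pt) (fob Y empty_simp)"
    by (rule smapI) (use s Y in \<open>auto simp: R_def act_opr\<close>)
  then have "R \<in> Ob Map_cat" unfolding Ob_Map_cat using s by (simp add: R_def)
  have b: "bij_betw (sid S n) (spx S n) (spx S n)" for S :: "'u simp" and n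
    by (auto simp: sid_def bij_betw_def inj_on_def)
  from \<open>R \<in> Ob Map_cat\<close> have "is_coend Y R (iota Y (sid (fob Y pt)) (sid (fob Y empty_simp)))"
    by (rule is_coend_iota[OF Y]) (use s Y b in \<open>auto simp: R_def\<close>)
  then show ?thesis by blast
qed

lemma is_coend_realization:
  assumes "simplicial_functor (Y :: 'u sfunctor)"
  shows "is_coend Y (realization Y) (realization_in Y)"
proof -
  have "case realization_data Y of (R, \<iota>) \<Rightarrow> is_coend Y R \<iota>"
    unfolding realization_data_def using ex_coend[OF assms]
    by (intro someI_ex[of "\<lambda>p. case p of (R, \<iota>) \<Rightarrow> is_coend Y R \<iota>"]) auto
  then show ?thesis by (simp add: realization_def realization_in_def split: prod.splits)
qed

end

section \<open>Cowedges and natural transformations\<close>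

definition transp_pt :: "'u sfunctor \<Rightarrow> 'u simp \<Rightarrow> (nat \<Rightarrow> 'u \<times> 'u \<Rightarrow> 'u) \<times> (nat \<Rightarrow> 'u \<times> 'u \<Rightarrow> 'u) \<Rightarrow> nat \<Rightarrow> 'u
    \<Rightarrow> (nat \<Rightarrow> 'u \<times> (nat \<Rightarrow> nat) \<Rightarrow> 'u) \<times> (nat \<Rightarrow> 'u \<times> (nat \<Rightarrow> nat) \<Rightarrow> 'u)" where
  "transp_pt Y A t n y =
     ((\<lambda>k. \<lambda>(a, \<beta>)\<in>spx (sprod A (Delta n)) k. fst t k (a, opr (fob Y A) k n \<beta> y)),
      (\<lambda>k. \<lambda>(c, \<beta>)\<in>spx (sprod pt (Delta n)) k. snd t k (c, opr (fob Y A) k n \<beta> y)))"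

text \<open>The transpose of a cowedge. In each \<open>A\<close> it is the adjunction between
  tensoring with \<open>O\<^sub>A\<close> and \<open>hom(O\<^sub>A, -)\<close>, since
  \<open>transp_pt\<close> restricts \<open>w A\<close> along the map
  \<open>\<Delta>\<^sup>n \<rightarrow> Y A\<close> classifying \<open>y\<close>. It is stated for
  cowedges so that it does not involve the chosen coend.\<close>

definition transp :: "'u sfunctor \<Rightarrow> 'u arrow \<Rightarrow> ('u simp \<Rightarrow> (nat \<Rightarrow> 'u \<times> 'u \<Rightarrow> 'u) \<times> (nat \<Rightarrow> 'u \<times> 'u \<Rightarrow> 'u))
    \<Rightarrow> 'u simp \<Rightarrow> nat \<Rightarrow> 'u \<Rightarrow> 'u" where
  "transp Y X w = (\<lambda>A\<in>SS. \<lambda>n. \<lambda>y\<in>spx (fob Y A) n. enc (ahom (orbit A) X) n (transp_pt Y A (w A) n y))"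

lemma transp_pt_app [simp]:
  "a \<in> spx A k \<Longrightarrow> \<beta> \<in> Dmap k n \<Longrightarrow>
     fst (transp_pt Y A t n y) k (a, \<beta>) = fst t k (a, opr (fob Y A) k n \<beta> y)"
  "\<beta> \<in> Dmap k n \<Longrightarrow>
     snd (transp_pt Y A t n y) k (undefined, \<beta>) = snd t k (undefined, opr (fob Y A) k n \<beta> y)"
  by (simp_all add: transp_pt_def)

lemma pts_eqI:
  assumes "s \<in> pts A X n" "t \<in> pts A X' n"
    "\<And>k a \<beta>. a \<in> spx A k \<Longrightarrow> \<beta> \<in> Dmap k n \<Longrightarrow> fst s k (a, \<beta>) = fst t k (a, \<beta>)"
    "\<And>k \<beta>. \<beta> \<in> Dmap k n \<Longrightarrow> snd s k (undefined, \<beta>) = snd t k (undefined, \<beta>)"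
  shows "s = t"
  using shom_eqI[OF ptsD(1)[OF assms(1)] ptsD(1)[OF assms(2)] assms(3)]
    shom_eqI[OF ptsD(2)[OF assms(1)] ptsD(2)[OF assms(2)]] assms(4)
  by (simp add: prod_eq_iff)

lemma ptsI:
  assumes "\<And>k a \<beta>. a \<in> spx A k \<Longrightarrow> \<beta> \<in> Dmap k n \<Longrightarrow> u k (a, \<beta>) \<in> spx (src X) k"
    and "\<And>k x. x \<notin> spx A k \<times> Dmap k n \<Longrightarrow> u k x = undefined"
    and "\<And>j k \<gamma> a \<beta>. \<gamma> \<in> Dmap j k \<Longrightarrow> a \<in> spx A k \<Longrightarrow> \<beta> \<in> Dmap k n \<Longrightarrow>
      u j (opr A j k \<gamma> a, compose {..j} \<beta> \<gamma>) = opr (src X) j k \<gamma> (u k (a, \<beta>))"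
    and "\<And>k \<beta>. \<beta> \<in> Dmap k n \<Longrightarrow> v k (undefined, \<beta>) \<in> spx (tgt X) k"
    and "\<And>k x. x \<notin> {undefined} \<times> Dmap k n \<Longrightarrow> v k x = undefined"
    and "\<And>j k \<gamma> \<beta>. \<gamma> \<in> Dmap j k \<Longrightarrow> \<beta> \<in> Dmap k n \<Longrightarrow>
      v j (undefined, compose {..j} \<beta> \<gamma>) = opr (tgt X) j k \<gamma> (v k (undefined, \<beta>))"
    and "\<And>k a \<beta>. a \<in> spx A k \<Longrightarrow> \<beta> \<in> Dmap k n \<Longrightarrow> arr X k (u k (a, \<beta>)) = v k (undefined, \<beta>)"
  shows "(u, v) \<in> pts A X n"
  unfolding pts_iff
proof (intro conjI allI ballI)
  show "u \<in> smap (sprod A (Delta n)) (src X)" by (rule shomI) (fact assms)+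
  show "v \<in> smap (sprod pt (Delta n)) (tgt X)"
    by (rule shomI) (use assms(4-6) in auto)
qed (fact assms(7))

lemma transp_pt_pts:
  assumes Y: "simplicial_functor Y" and w: "is_cowedge Y X w" and A: "A \<in> SS" and y: "y \<in> spx (fob Y A) n"
  shows "transp_pt Y A (w A) n y \<in> pts A X n"
proof -
  note wD = cowedgeD[OF w A]
  have S: "simplicial_set (fob Y A)" using sfunD(1)[OF Y A] by simp
  have "(fst (transp_pt Y A (w A) n y), snd (transp_pt Y A (w A) n y)) \<in> pts A X n"
  proof (rule ptsI)
    fix k a \<beta> assume *: "a \<in> spx A k" "\<beta> \<in> Dmap k n"
    have y': "opr (fob Y A) k n \<beta> y \<in> spx (fob Y A) k" using S y * by simp
    show "fst (transp_pt Y A (w A) n y) k (a, \<beta>) \<in> spx (src X) k"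
      using smap_in[OF wD(2), of "(a, opr (fob Y A) k n \<beta> y)" k] * y' by simp
    show "arr X k (fst (transp_pt Y A (w A) n y) k (a, \<beta>)) = snd (transp_pt Y A (w A) n y) k (undefined, \<beta>)"
      using wD(4)[OF *(1) y'] * by simp
    fix j \<gamma> assume g: "\<gamma> \<in> Dmap j k"
    show "fst (transp_pt Y A (w A) n y) j (opr A j k \<gamma> a, compose {..j} \<beta> \<gamma>) =
       opr (src X) j k \<gamma> (fst (transp_pt Y A (w A) n y) k (a, \<beta>))"
      using smap_opr[OF wD(2) g, of "(a, opr (fob Y A) k n \<beta> y)"] * y y' g S A by (simp add: opr_opr)
  next
    fix k \<beta> assume *: "\<beta> \<in> Dmap k n"
    have y': "opr (fob Y A) k n \<beta> y \<in> spx (fob Y A) k" using S y * by simp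
    show "snd (transp_pt Y A (w A) n y) k (undefined, \<beta>) \<in> spx (tgt X) k"
      using smap_in[OF wD(3), of "(undefined, opr (fob Y A) k n \<beta> y)" k] * y' by simp
    fix j \<gamma> assume g: "\<gamma> \<in> Dmap j k"
    show "snd (transp_pt Y A (w A) n y) j (undefined, compose {..j} \<beta> \<gamma>) =
       opr (tgt X) j k \<gamma> (snd (transp_pt Y A (w A) n y) k (undefined, \<beta>))"
      using smap_opr[OF wD(3) g, of "(undefined, opr (fob Y A) k n \<beta> y)"] * y y' g S A by (simp add: opr_opr)
  qed (auto simp: transp_pt_def)
  then show ?thesis by simp
qed

context universe begin

text \<open>The two halves of the cowedge condition, applied to the restrictions of \<open>f\<close>
  and \<open>y\<close> along \<beta>, are naturality in \<open>A\<close> of the source and the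
  target component.\<close>

lemma transp_nat_trans:
  fixes Y :: "'u sfunctor"
  assumes Y: "simplicial_functor Y" and X: "X \<in> Ob Map_cat" and w: "is_cowedge Y X w"
  shows "transp Y X w \<in> nat_trans Y (orbit_points X)"
proof (rule nat_transI[OF Y simplicial_functor_orbit_points[OF X]])
  note tp = transp_pt_pts[OF Y w]
  have YS: "simplicial_set (fob Y A)" if "A \<in> SS" for A using sfunD(1)[OF Y that] by simp
  show "transp Y X w A = undefined" if "A \<notin> SS" for A using that by (simp add: transp_def)
  show "transp Y X w A \<in> smap (fob Y A) (fob (orbit_points X) A)" if A: "A \<in> SS" for A
    unfolding fob_orbit_points
  proof (rule smapI)
    fix n y assume y: "y \<in> spx (fob Y A) n"
    show "transp Y X w A n y \<in> spx (HOM (orbit A) X) n" using y A tp[OF A y] by (simp add: transp_def)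
    fix m \<alpha> assume a: "\<alpha> \<in> Dmap m n"
    have y': "opr (fob Y A) m n \<alpha> y \<in> spx (fob Y A) m" using YS[OF A] a y by simp
    have "transp_pt Y A (w A) m (opr (fob Y A) m n \<alpha> y) =
      (pull A m \<alpha> (fst (transp_pt Y A (w A) n y)), pull pt m \<alpha> (snd (transp_pt Y A (w A) n y)))"
      by (rule pts_eqI[OF tp[OF A y'] pull_pts[OF SS_simplicial[OF A] tp[OF A y] a]])
        (use a y A YS[OF A] in \<open>auto simp: opr_opr\<close>)
    then show "transp Y X w A m (opr (fob Y A) m n \<alpha> y) = opr (HOM (orbit A) X) m n \<alpha> (transp Y X w A n y)"
      using A y y' by (simp add: transp_def opr_HOM[OF X A tp[OF A y]])
  qed (simp add: transp_def A)
  fix A B :: "'u simp" and n f y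
  assume A: "A \<in> SS" and B: "B \<in> SS" and f: "f \<in> smap (sprod A (Delta n)) B" and y: "y \<in> spx (fob Y B) n"
  have y': "act Y A B n f y \<in> spx (fob Y A) n" using Y A B f y by simp
  have "transp_pt Y A (w A) n (act Y A B n f y)
      = (hcomp A n (fst (transp_pt Y B (w B) n y)) f, snd (transp_pt Y B (w B) n y))"
  proof (rule pts_eqI[OF tp[OF A y'] hcomp_pts[OF tp[OF B y] f SS_simplicial[OF A]]])
    fix k \<beta> assume b: "\<beta> \<in> Dmap k n"
    have p: "pull A k \<beta> f \<in> smap (sprod A (Delta k)) B" using f b A by simp
    have y2: "opr (fob Y B) k n \<beta> y \<in> spx (fob Y B) k" using YS[OF B] b y by simp
    show "fst (transp_pt Y A (w A) n (act Y A B n f y)) k (a, \<beta>)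
        = fst (hcomp A n (fst (transp_pt Y B (w B) n y)) f, snd (transp_pt Y B (w B) n y)) k (a, \<beta>)"
      if a: "a \<in> spx A k" for a
      using cowedgeD(5)[OF w A B p y2 a] a b f by (simp add: act_opr[OF Y A B f y b])
    show "snd (transp_pt Y A (w A) n (act Y A B n f y)) k (undefined, \<beta>)
        = snd (hcomp A n (fst (transp_pt Y B (w B) n y)) f, snd (transp_pt Y B (w B) n y)) k (undefined, \<beta>)"
      using cowedgeD(6)[OF w A B p y2] b by (simp add: act_opr[OF Y A B f y b])
  qed
  then show "transp Y X w A n (act Y A B n f y) = act (orbit_points X) A B n f (transp Y X w B n y)"
    using A B y y' by (simp add: transp_def act_orbit_points[OF X A B f tp[OF B y]])
qed

text \<open>The value of the transpose at \<open>(a, Did n)\<close> gives back \<open>w A\<close> at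
  \<open>(a, y)\<close>.\<close>

lemma transp_inj:
  fixes Y :: "'u sfunctor"
  assumes Y: "simplicial_functor Y" and X: "X \<in> Ob Map_cat" and w: "is_cowedge Y X w" "is_cowedge Y X w'"
    and eq: "transp Y X w = transp Y X w'" and A: "A \<in> SS"
  shows "w A = w' A"
proof -
  have S: "simplicial_set (fob Y A)" using sfunD(1)[OF Y A] by simp
  have t: "transp_pt Y A (w A) n y = transp_pt Y A (w' A) n y" if y: "y \<in> spx (fob Y A) n" for n y
  proof -
    have "enc (ahom (orbit A) X) n (transp_pt Y A (w A) n y) = (enc (ahom (orbit A) X) n (transp_pt Y A (w' A) n y) :: 'u)"
      using fun_cong[OF fun_cong[OF fun_cong[OF eq]], of A n y] y A by (simp add: transp_def)
    then show ?thesis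
      using dec_enc_pts[OF X A transp_pt_pts[OF Y w(1) A y]] dec_enc_pts[OF X A transp_pt_pts[OF Y w(2) A y]]
      by metis
  qed
  show ?thesis
  proof (rule squares_eqI[OF cowedgeD(1)[OF w(1) A] cowedgeD(1)[OF w(2) A]])
    fix n x
    { assume "x \<in> spx (src (tensor (orbit A) (fob Y A))) n"
      then obtain a y where x: "x = (a, y)" "a \<in> spx A n" "y \<in> spx (fob Y A) n" by auto
      then show "fst (w A) n x = fst (w' A) n x"
        using arg_cong[OF t[OF x(3)], of "\<lambda>p. fst p n (a, Did n)"] S by simp }
    { assume "x \<in> spx (tgt (tensor (orbit A) (fob Y A))) n"
      then obtain y where x: "x = (undefined, y)" "y \<in> spx (fob Y A) n" by auto
      then show "snd (w A) n x = snd (w' A) n x"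
        using arg_cong[OF t[OF x(2)], of "\<lambda>p. snd p n (undefined, Did n)"] S by simp }
  qed
qed

lemma transp_surj:
  fixes Y :: "'u sfunctor"
  assumes Y: "simplicial_functor Y" and X: "X \<in> Ob Map_cat" and n: "\<eta> \<in> nat_trans Y (orbit_points X)"
  obtains w where "is_cowedge Y X w" "transp Y X w = \<eta>"
proof -
  note R = simplicial_functor_orbit_points[OF X]
  note \<eta>D = nat_transD[OF n]
  have YS: "simplicial_set (fob Y A)" if "A \<in> SS" for A using sfunD(1)[OF Y that] by simp
  define d where "d A k y = dec (ahom (orbit A) X) k (\<eta> A k y)" for A k y
  have dd: "d A k y \<in> pts A X k" "enc (ahom (orbit A) X) k (d A k y) = \<eta> A k y"
    if "A \<in> SS" "y \<in> spx (fob Y A) k" for A k y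
    using smap_in[OF \<eta>D(1)[OF that(1)] that(2)] HOM_cases[OF X that(1)] that
    unfolding d_def fob_orbit_points by metis+
  have dopr: "d A m (opr (fob Y A) m k \<alpha> y) = (pull A m \<alpha> (fst (d A k y)), pull pt m \<alpha> (snd (d A k y)))"
    if A: "A \<in> SS" and y: "y \<in> spx (fob Y A) k" and a: "\<alpha> \<in> Dmap m k" for A m k \<alpha> y
  proof -
    have "\<eta> A m (opr (fob Y A) m k \<alpha> y)
      = enc (ahom (orbit A) X) m (pull A m \<alpha> (fst (d A k y)), pull pt m \<alpha> (snd (d A k y)))"
      using smap_opr[OF \<eta>D(1)[OF A] a y] opr_HOM[OF X A dd(1)[OF A y], of m \<alpha>] dd(2)[OF A y] by simp
    then show ?thesis unfolding d_def[of A m]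
      using dec_enc_pts[OF X A pull_pts[OF SS_simplicial[OF A] dd(1)[OF A y] a]] by metis
  qed
  have dact: "d A k (act Y A B k f y) = (hcomp A k (fst (d B k y)) f, snd (d B k y))"
    if A: "A \<in> SS" and B: "B \<in> SS" and f: "f \<in> smap (sprod A (Delta k)) B" and y: "y \<in> spx (fob Y B) k" for A B k f y
  proof -
    have "\<eta> A k (act Y A B k f y)
      = enc (ahom (orbit A) X) k (hcomp A k (fst (d B k y)) f, snd (d B k y))"
      using \<eta>D(3)[OF Y R A B f y] act_orbit_points[OF X A B f dd(1)[OF B y]] dd(2)[OF B y] by simp
    then show ?thesis unfolding d_def[of A k]
      using dec_enc_pts[OF X A hcomp_pts[OF dd(1)[OF B y] f SS_simplicial[OF A]]] by metis
  qed
  \<comment> \<open>Inverse transposition: the value at \<open>(a, y)\<close> is that of the point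
    assigned to \<open>y\<close>, taken at the top simplex \<open>Did k\<close> of
    \<open>\<Delta>\<^sup>k\<close>.\<close>
  define w where "w A =
     ((\<lambda>k. \<lambda>(a, y)\<in>spx (sprod A (fob Y A)) k. fst (d A k y) k (a, Did k)),
      (\<lambda>k. \<lambda>(c, y)\<in>spx (sprod pt (fob Y A)) k. snd (d A k y) k (c, Did k)))" for A
  have w0: "fst (w A) k (a, y) = fst (d A k y) k (a, Did k)" if "a \<in> spx A k" "y \<in> spx (fob Y A) k" for A a k y
    using that by (simp add: w_def)
  have w1: "snd (w A) k (undefined, y) = snd (d A k y) k (undefined, Did k)" if "y \<in> spx (fob Y A) k" for A k y
    using that by (simp add: w_def)
  have sq: "w A \<in> squares (tensor (orbit A) (fob Y A)) X" if A: "A \<in> SS" for A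
  proof -
    have "(fst (w A), snd (w A)) \<in> squares (tensor (orbit A) (fob Y A)) X"
    proof (rule squaresI)
      show "fst (w A) \<in> smap (src (tensor (orbit A) (fob Y A))) (src X)"
        unfolding tensor_orbit
      proof (rule smapI)
        fix k x assume "x \<in> spx (sprod A (fob Y A)) k"
        then obtain a y where x: "x = (a, y)" "a \<in> spx A k" "y \<in> spx (fob Y A) k" by auto
        note f = ptsD(1)[OF dd(1)[OF A x(3)]]
        show "fst (w A) k x \<in> spx (src X) k"
          using shom_in[OF f x(2) Did_Dmap] x by (simp add: w0)
        fix m \<alpha> assume a: "\<alpha> \<in> Dmap m k"
        show "fst (w A) m (opr (sprod A (fob Y A)) m k \<alpha> x) = opr (src X) m k \<alpha> (fst (w A) k x)"
          using x a A YS[OF A] by (simp add: w0 dopr shom_opr[OF f a x(2) Did_Dmap, symmetric])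
      qed (auto simp: w_def)
      show "snd (w A) \<in> smap (tgt (tensor (orbit A) (fob Y A))) (tgt X)"
        unfolding tensor_orbit
      proof (rule smapI)
        fix k x assume "x \<in> spx (sprod (pt :: 'u simp) (fob Y A)) k"
        then obtain y where x: "x = (undefined, y)" "y \<in> spx (fob Y A) k" by auto
        note f = ptsD(2)[OF dd(1)[OF A x(2)]]
        show "snd (w A) k x \<in> spx (tgt X) k"
          using shom_in[OF f, of undefined k "Did k"] x by (simp add: w1)
        fix m \<alpha> assume a: "\<alpha> \<in> Dmap m k"
        show "snd (w A) m (opr (sprod pt (fob Y A)) m k \<alpha> x) = opr (tgt X) m k \<alpha> (snd (w A) k x)"
          using x a A YS[OF A] shom_opr[OF f a _ Did_Dmap, of undefined] by (simp add: w1 dopr)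
      qed (auto simp: w_def)
      fix k x assume "x \<in> spx (src (tensor (orbit A) (fob Y A))) k"
      then obtain a y where x: "x = (a, y)" "a \<in> spx A k" "y \<in> spx (fob Y A) k" by auto
      then show "arr X k (fst (w A) k x) = snd (w A) k (arr (tensor (orbit A) (fob Y A)) k x)"
        using ptsD(3)[OF dd(1)[OF A x(3)] x(2) Did_Dmap] by (simp add: w0 w1)
    qed
    then show ?thesis by simp
  qed
  have cw: "is_cowedge Y X w"
    by (rule cowedgeI[OF sq]) (use Y in \<open>simp_all add: w0 w1 dact shom_in\<close>)
  have "transp Y X w = \<eta>"
  proof (rule ext)
    fix A show "transp Y X w A = \<eta> A"
    proof (cases "A \<in> SS")
      case A: True
      have "transp Y X w A k y = \<eta> A k y" if y: "y \<in> spx (fob Y A) k" for k y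
      proof -
        have "transp_pt Y A (w A) k y = d A k y"
          by (rule pts_eqI[OF transp_pt_pts[OF Y cw A y] dd(1)[OF A y]])
            (use y YS[OF A] A in \<open>simp_all add: w0 w1 dopr\<close>)
        then show ?thesis using y A dd(2)[OF A y] by (simp add: transp_def)
      qed
      then show ?thesis
        using smap_eqI[OF nat_transD(1)[OF transp_nat_trans[OF Y X cw] A] \<eta>D(1)[OF A]] by blast
    next
      case False
      then show ?thesis using \<eta>D(2)[OF False] by (simp add: transp_def)
    qed
  qed
  with cw show thesis by (rule that)
qed

lemma cowedge_comp:
  fixes Y :: "'u sfunctor"
  assumes Y: "simplicial_functor Y" and w: "is_cowedge Y R w" and g: "g \<in> squares R X"
  shows "is_cowedge Y X (\<lambda>A. sqcomp (tensor (orbit A) (fob Y A)) g (w A))"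
proof (rule cowedgeI)
  fix A B :: "'u simp" and n f y
  assume AB: "A \<in> SS" "B \<in> SS" and f: "f \<in> smap (sprod A (Delta n)) B" and y: "y \<in> spx (fob Y B) n"
  show "fst (sqcomp (tensor (orbit A) (fob Y A)) g (w A)) n (a, act Y A B n f y) =
      fst (sqcomp (tensor (orbit B) (fob Y B)) g (w B)) n (f n (a, Did n), y)" if a: "a \<in> spx A n" for a
    using cowedgeD(5)[OF w AB f y a] a AB f y Y by (simp add: shom_in[OF f a Did_Dmap])
  show "snd (sqcomp (tensor (orbit A) (fob Y A)) g (w A)) n (undefined, act Y A B n f y) =
      snd (sqcomp (tensor (orbit B) (fob Y B)) g (w B)) n (undefined, y)"
    using cowedgeD(6)[OF w AB f y] AB f y Y by simp
next
  fix A :: "'u simp" assume A: "A \<in> SS"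
  show "sqcomp (tensor (orbit A) (fob Y A)) g (w A) \<in> squares (tensor (orbit A) (fob Y A)) X"
    by (rule sqcomp_squares[OF cowedgeD(1)[OF w A] g]) (use A sfunD(1)[OF Y A] in auto)
qed

text \<open>The composite in the definition of \<open>adjunct\<close> is pointwise the restriction
  of a composite cowedge, so the adjunction splits into the universal property of the coend and
  transposition.\<close>

lemma adjunct_transp:
  fixes Y :: "'u sfunctor"
  assumes Y: "simplicial_functor Y" and g: "g \<in> squares (realization Y) X"
  shows "adjunct Y X g = transp Y X (\<lambda>A. sqcomp (tensor (orbit A) (fob Y A)) g (realization_in Y A))"
proof -
  have "sqcomp (tensor (orbit A) (Delta n)) g (sqcomp (tensor (orbit A) (Delta n)) (realization_in Y A)
       (tensor_map (orbit A) (Delta n) (yoneda (fob Y A) n y)))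
    = transp_pt Y A (sqcomp (tensor (orbit A) (fob Y A)) g (realization_in Y A)) n y"
    if A: "A \<in> SS" and y: "y \<in> spx (fob Y A) n" for A n y
  proof -
    have S: "simplicial_set (fob Y A)" using sfunD(1)[OF Y A] by simp
    show ?thesis
      unfolding prod_eq_iff
      by (intro conjI ext) (use S y in
        \<open>auto simp: transp_pt_def scomp_def compose_def tensor_map_def yoneda_def orbit_def tensor_def\<close>)
  qed
  then show ?thesis unfolding adjunct_def transp_def by (intro restrict_ext ext) auto
qed

text \<open>Maps out of \<open>realization Y\<close> correspond to cowedges by universality, and
  cowedges, compared on \<open>SS\<close>, correspond to natural transformations by
  \<open>transp\<close>.\<close>

lemma adjunct_bij:
  fixes Y :: "'u sfunctor"
  assumes Y: "simplicial_functor Y" and X: "X \<in> Ob Map_cat"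
  shows "bij_betw (adjunct Y X) (squares (realization Y) X) (nat_trans Y (orbit_points X))"
proof -
  note c = is_coend_realization[OF Y]
  have cw: "is_cowedge Y (realization Y) (realization_in Y)" using c by (simp add: is_coend_def)
  have u: "\<exists>!g. g \<in> squares (realization Y) X \<and>
      (\<forall>A\<in>SS. sqcomp (tensor (orbit A) (fob Y A)) g (realization_in Y A) = w A)" if "is_cowedge Y X w" for w
    using c X that unfolding is_coend_def by blast
  let ?w = "\<lambda>g A. sqcomp (tensor (orbit A) (fob Y A)) g (realization_in Y A)"
  have wc: "is_cowedge Y X (?w g)" if "g \<in> squares (realization Y) X" for g
    by (rule cowedge_comp[OF Y cw that])
  show ?thesis
  proof (rule bij_betwI')
    fix g h assume gh: "g \<in> squares (realization Y) X" "h \<in> squares (realization Y) X"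
    show "(adjunct Y X g = adjunct Y X h) = (g = h)"
    proof
      assume "adjunct Y X g = adjunct Y X h"
      then have e: "transp Y X (?w g) = transp Y X (?w h)" using adjunct_transp[OF Y] gh by simp
      have "?w g A = ?w h A" if "A \<in> SS" for A
        by (rule transp_inj[OF Y X wc[OF gh(1)] wc[OF gh(2)] e that])
      then show "g = h" using u[OF wc[OF gh(2)]] gh by metis
    qed simp
  next
    fix g assume "g \<in> squares (realization Y) X"
    then show "adjunct Y X g \<in> nat_trans Y (orbit_points X)"
      using transp_nat_trans[OF Y X wc] adjunct_transp[OF Y] by simp
  next
    fix \<eta> assume "\<eta> \<in> nat_trans Y (orbit_points X)"
    then obtain w where w: "is_cowedge Y X w" "transp Y X w = \<eta>" using transp_surj[OF Y X] by blast
    obtain g where g: "g \<in> squares (realization Y) X" "\<And>A. A \<in> SS \<Longrightarrow> ?w g A = w A" using u[OF w(1)] by blast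
    have "adjunct Y X g = transp Y X w"
      unfolding adjunct_transp[OF Y g(1)] transp_def by (intro restrict_ext ext) (simp add: g(2))
    then show "\<exists>g\<in>squares (realization Y) X. \<eta> = adjunct Y X g" using w g by auto
  qed
qed

end

section \<open>Quotients of bounded size\<close>

definition quot :: "'a simp \<Rightarrow> 'a simp \<Rightarrow> (nat \<Rightarrow> 'a \<Rightarrow> 'a) \<Rightarrow> bool" where
  "quot A D q \<longleftrightarrow> simplicial_set A \<and> simplicial_set D \<and> q \<in> smap A D \<and> (\<forall>k. q k ` spx A k = spx D k)"

definition descends :: "'a simp \<Rightarrow> (nat \<Rightarrow> 'a \<Rightarrow> 'a) \<Rightarrow> nat \<Rightarrow> (nat \<Rightarrow> 'a \<times> (nat \<Rightarrow> nat) \<Rightarrow> 'b) \<Rightarrow> bool" where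
  "descends A q n f \<longleftrightarrow>
     (\<forall>k. \<forall>a\<in>spx A k. \<forall>a'\<in>spx A k. \<forall>\<beta>\<in>Dmap k n. q k a = q k a' \<longrightarrow> f k (a, \<beta>) = f k (a', \<beta>))"

text \<open>The induced map on the quotient, computed on arbitrary representatives;
  \<open>descends\<close> makes the values independent of their choice.\<close>

definition desc :: "'a simp \<Rightarrow> 'a simp \<Rightarrow> (nat \<Rightarrow> 'a \<Rightarrow> 'a) \<Rightarrow> nat \<Rightarrow> (nat \<Rightarrow> 'a \<times> (nat \<Rightarrow> nat) \<Rightarrow> 'b)
    \<Rightarrow> nat \<Rightarrow> 'a \<times> (nat \<Rightarrow> nat) \<Rightarrow> 'b" where
  "desc A D q n f = (\<lambda>k. \<lambda>(d, \<beta>)\<in>spx (sprod D (Delta n)) k. f k (inv_into (spx A k) (q k) d, \<beta>))"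

lemma quotD:
  assumes "quot A D q"
  shows "simplicial_set A" "simplicial_set D" "q \<in> smap A D" "a \<in> spx A k \<Longrightarrow> q k a \<in> spx D k"
    "d \<in> spx D k \<Longrightarrow> \<exists>a\<in>spx A k. d = q k a" "hconst A n q \<in> smap (sprod A (Delta n)) D"
  using assms by (auto simp: quot_def)

lemma desc_app:
  assumes "quot A D q" "descends A q n f" "a \<in> spx A k" "\<beta> \<in> Dmap k n"
  shows "desc A D q n f k (q k a, \<beta>) = f k (a, \<beta>)"
proof -
  have i: "q k a \<in> q k ` spx A k" using assms(3) by blast
  have "q k (inv_into (spx A k) (q k) (q k a)) = q k a" using f_inv_into_f[OF i] .
  moreover have "inv_into (spx A k) (q k) (q k a) \<in> spx A k" using inv_into_into[OF i] .
  ultimately have "f k (inv_into (spx A k) (q k) (q k a), \<beta>) = f k (a, \<beta>)"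
    using assms(2-4) unfolding descends_def by blast
  then show ?thesis using assms(4) quotD(4)[OF assms(1,3)] by (simp add: desc_def)
qed

lemma desc_smap:
  assumes q: "quot A D q" and d: "descends A q n f" and f: "f \<in> smap (sprod A (Delta n)) B"
  shows "desc A D q n f \<in> smap (sprod D (Delta n)) B"
proof (rule shomI)
  fix k d \<beta> assume "d \<in> spx D k" and b: "\<beta> \<in> Dmap k n"
  then obtain a where a: "a \<in> spx A k" "d = q k a" using quotD(5)[OF q] by blast
  show "desc A D q n f k (d, \<beta>) \<in> spx B k"
    unfolding a(2) desc_app[OF q d a(1) b] by (rule shom_in[OF f a(1) b])
  fix j \<gamma> assume g: "\<gamma> \<in> Dmap j k"
  have "opr D j k \<gamma> d = q j (opr A j k \<gamma> a)" using smap_opr[OF quotD(3)[OF q] g a(1)] a by simp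
  then show "desc A D q n f j (opr D j k \<gamma> d, compose {..j} \<beta> \<gamma>) = opr B j k \<gamma> (desc A D q n f k (d, \<beta>))"
    using desc_app[OF q d a(1) b] desc_app[OF q d opr_in[OF quotD(1)[OF q] g a(1)] comp_Dmap[OF g b]]
      shom_opr[OF f g a(1) b] a(2) by simp
qed (auto simp: desc_def)

lemma hcomp_desc:
  assumes q: "quot A D q" and d: "descends A q n f" and f: "f \<in> smap (sprod A (Delta n)) B"
  shows "hcomp A n (desc A D q n f) (hconst A n q) = f"
  by (rule shom_eqI[OF hcomp_smap[OF quotD(6)[OF q] desc_smap[OF q d f] quotD(1)[OF q]] f])
    (simp add: desc_app[OF q d])

text \<open>A quotient map is surjective in every degree, hence so is its product with
  \<open>\<Delta>\<^sup>n\<close>. Equations between maps out of \<open>D\<close> are reduced in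
  this way to equations over \<open>A\<close>.\<close>

lemma desc_unique:
  assumes q: "quot A D q" and g: "g \<in> smap (sprod D (Delta n)) B" "g' \<in> smap (sprod D (Delta n)) B'"
    and e: "hcomp A n g (hconst A n q) = hcomp A n g' (hconst A n q)"
  shows "g = g'"
proof (rule shom_eqI[OF g])
  fix k d \<beta> assume "d \<in> spx D k" and b: "\<beta> \<in> Dmap k n"
  then obtain a where a: "a \<in> spx A k" "d = q k a" using quotD(5)[OF q] by blast
  show "g k (d, \<beta>) = g' k (d, \<beta>)"
    using fun_cong[OF fun_cong[OF e], of k "(a, \<beta>)"] a b by simp
qed

text \<open>Operators are \<open>undefined\<close> off their domain so that an element is determined
  by its simplices and the values of its operators on them. Otherwise the arbitrary values elsewhere
  would already make the set too large to be small.\<close>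

definition bounded_simps :: "'u set \<Rightarrow> 'u simp set" where
  "bounded_simps U\<^sub>0 = {D. simplicial_set D \<and> (\<forall>n. spx D n \<subseteq> U\<^sub>0) \<and>
     (\<forall>m n \<alpha> x. \<not> (\<alpha> \<in> Dmap m n \<and> x \<in> spx D n) \<longrightarrow> opr D m n \<alpha> x = undefined)}"

context universe begin

text \<open>The cardinal equation on the size of \<open>U\<^sub>0\<close> is expressed by a code
  \<open>J\<close>, which turns sequences in \<open>U\<^sub>0\<close> into elements of
  \<open>U\<^sub>0\<close>.\<close>

definition absorbing :: "'u set \<Rightarrow> bool" where
  "absorbing U\<^sub>0 \<longleftrightarrow> small U\<^sub>0 \<and> U\<^sub>0 \<noteq> {} \<and>
     (\<exists>J :: (nat \<Rightarrow> 'u) \<Rightarrow> 'u. inj_on J (UNIV \<rightarrow> U\<^sub>0) \<and> J ` (UNIV \<rightarrow> U\<^sub>0) \<subseteq> U\<^sub>0)"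

text \<open>The witness has cardinality \<open>2\<^bsup>\<aleph>\<^sub>0 |M|\<^esup>\<close>, which countable powers do not increase.\<close>

lemma ex_absorbing:
  assumes "small (M\<^sub>0 :: 'u set)"
  obtains U\<^sub>0 where "absorbing U\<^sub>0" "M\<^sub>0 \<subseteq> U\<^sub>0"
proof -
  \<comment> \<open>One element is added so that \<open>nat \<times> M\<close>, and with it
    \<open>T\<close>, is infinite; then \<open>U0\<close> is no larger than
    \<open>T\<close>.\<close>
  define M where "M = insert undefined M\<^sub>0"
  define T where "T = Pow ((UNIV :: nat set) \<times> M)"
  have M: "small M"
    using small_Un[OF small_countable assms, of "{undefined}"] by (simp add: M_def)
  have sT: "small T" unfolding T_def by (intro small_Pow small_Times small_countable M) auto
  then obtain e :: "_ \<Rightarrow> 'u" where e: "inj_on e T" using small_inj_ex by blast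
  have "infinite ((UNIV :: nat set) \<times> M)" by (auto simp: finite_cartesian_product_iff M_def)
  then have inf: "infinite T" by (simp add: T_def)
  define U0 where "U0 = M \<union> e ` T"
  have "|M| \<le>o |T|"
    unfolding card_of_ordLeq[symmetric]
    by (rule exI[of _ "\<lambda>x. {(0, x)}"]) (auto simp: inj_on_def T_def)
  then have "|U0| \<le>o |T|" unfolding U0_def
    by (intro card_of_Un_ordLeq_infinite_Field card_of_image card_of_Card_order) (simp_all add: inf Field_card_of)
  then obtain i where i: "inj_on i U0" "i ` U0 \<subseteq> T" unfolding card_of_ordLeq[symmetric] by blast
  \<comment> \<open>A sequence of subsets of \<open>nat \<times> M\<close> is packed into a single
    such subset by \<open>prod_encode\<close>; this is why countable powers of \<open>T\<close> are
    no larger than \<open>T\<close>.\<close>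
  define P where "P f = {(prod_encode (n, k), x) | n k x. (k, x) \<in> i (f n)}" for f :: "nat \<Rightarrow> 'u"
  have PT: "P f \<in> T" if "f \<in> UNIV \<rightarrow> U0" for f
  proof -
    have "i (f n) \<in> T" for n using that i(2) by auto
    then have "x \<in> M" if "(k, x) \<in> i (f n)" for k x n using that unfolding T_def by blast
    then show ?thesis by (auto simp: P_def T_def)
  qed
  have "inj_on (\<lambda>f. e (P f)) (UNIV \<rightarrow> U0)"
  proof (rule inj_onI)
    fix f g assume fg: "f \<in> UNIV \<rightarrow> U0" "g \<in> UNIV \<rightarrow> U0" and "e (P f) = e (P g)"
    then have eq: "P f = P g" by (intro inj_onD[OF e _ PT PT])
    have "(k, x) \<in> i (f n) \<longleftrightarrow> (prod_encode (n, k), x) \<in> P f" for f n k x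
      by (auto simp: P_def)
    with eq have "i (f n) = i (g n)" for n by (intro set_eqI) (metis surj_pair)
    then have "f n = g n" for n using fg by (intro inj_onD[OF i(1)]) auto
    then show "f = g" by (rule ext)
  qed
  moreover have "(\<lambda>f. e (P f)) ` (UNIV \<rightarrow> U0) \<subseteq> U0" using PT by (auto simp: U0_def)
  moreover have "small U0" unfolding U0_def by (intro small_Un M small_image sT)
  ultimately have "absorbing U0"
    unfolding absorbing_def by (auto simp: U0_def M_def intro!: exI[of _ "\<lambda>f. e (P f)"])
  then show thesis by (rule that) (auto simp: U0_def M_def)
qed

text \<open>An enumeration of \<open>I\<close>, possibly with repetitions, embeds the functions on
  \<open>I\<close> into the sequences. The empty index set has no enumeration and is treated
  apart.\<close>

lemma absorbing_countable:
  assumes U: "absorbing U\<^sub>0" and I: "countable (I :: 'i set)"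
  obtains J :: "('i \<Rightarrow> 'u) \<Rightarrow> 'u" where "inj_on J (I \<rightarrow>\<^sub>E U\<^sub>0)" "J ` (I \<rightarrow>\<^sub>E U\<^sub>0) \<subseteq> U\<^sub>0"
proof (cases "I = {}")
  case True
  obtain x where "x \<in> U\<^sub>0" using U by (auto simp: absorbing_def)
  then show thesis using that[of "\<lambda>_. x"] True by auto
next
  case False
  obtain J0 :: "(nat \<Rightarrow> 'u) \<Rightarrow> 'u" where J0: "inj_on J0 (UNIV \<rightarrow> U\<^sub>0)" "J0 ` (UNIV \<rightarrow> U\<^sub>0) \<subseteq> U\<^sub>0"
    using U by (auto simp: absorbing_def)
  have r: "range (from_nat_into I) = I" using range_from_nat_into[OF False I] .
  have m: "f \<circ> from_nat_into I \<in> UNIV \<rightarrow> U\<^sub>0" if "f \<in> I \<rightarrow>\<^sub>E U\<^sub>0" for f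
    using that from_nat_into[OF False] by auto
  show thesis
  proof (rule that[of "\<lambda>f. J0 (f \<circ> from_nat_into I)"])
    show "inj_on (\<lambda>f. J0 (f \<circ> from_nat_into I)) (I \<rightarrow>\<^sub>E U\<^sub>0)"
    proof (rule inj_onI)
      fix f g assume fg: "f \<in> I \<rightarrow>\<^sub>E U\<^sub>0" "g \<in> I \<rightarrow>\<^sub>E U\<^sub>0"
        and e: "J0 (f \<circ> from_nat_into I) = J0 (g \<circ> from_nat_into I)"
      have "f \<circ> from_nat_into I = g \<circ> from_nat_into I"
        by (rule inj_onD[OF J0(1) e m[OF fg(1)] m[OF fg(2)]])
      then show "f = g"
        by (intro PiE_ext[OF fg]) (metis comp_apply r rangeE)
    qed
    show "(\<lambda>f. J0 (f \<circ> from_nat_into I)) ` (I \<rightarrow>\<^sub>E U\<^sub>0) \<subseteq> U\<^sub>0" using J0(2) m by blast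
  qed
qed

lemma bounded_simps_SS:
  assumes "small U\<^sub>0" "D \<in> bounded_simps U\<^sub>0" shows "(D :: 'u simp) \<in> SS"
  using assms by (intro SSI) (auto simp: bounded_simps_def intro: small_subset)

text \<open>The code of \<open>D\<close> is its family of simplex sets with the graph of its
  operators; it loses nothing because the operators are fixed off their domain.\<close>

lemma small_bounded_simps:
  assumes U: "small U\<^sub>0" shows "small (bounded_simps (U\<^sub>0 :: 'u set))"
proof -
  define g where "g D = (spx D, {(m, n, \<alpha>, x, y). \<alpha> \<in> Dmap m n \<and> x \<in> spx D n \<and> y = opr D m n \<alpha> x})"
    for D :: "'u simp"
  let ?R = "(UNIV :: nat set) \<times> (UNIV :: nat set) \<times> (\<Union>m\<in>(UNIV :: nat set). \<Union>n\<in>(UNIV :: nat set). Dmap m n) \<times> U\<^sub>0 \<times> U\<^sub>0"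
  show ?thesis
  proof (rule small_inj)
    show "small ({f. \<forall>n::nat. f n \<in> Pow U\<^sub>0} \<times> Pow ?R)"
      by (intro small_Times small_Pow small_UN small_fun U small_Dmap) (auto intro!: small_countable)
    show "g ` bounded_simps U\<^sub>0 \<subseteq> {f. \<forall>n::nat. f n \<in> Pow U\<^sub>0} \<times> Pow ?R"
    proof (intro subsetI)
      fix p assume "p \<in> g ` bounded_simps U\<^sub>0"
      then obtain D where D: "D \<in> bounded_simps U\<^sub>0" "p = g D" by blast
      have sD: "simplicial_set D" and uD: "\<And>n. spx D n \<subseteq> U\<^sub>0" using D(1) by (auto simp: bounded_simps_def)
      have "opr D m n \<alpha> x \<in> U\<^sub>0" if "\<alpha> \<in> Dmap m n" "x \<in> spx D n" for m n \<alpha> x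
        by (rule subsetD[OF uD opr_in[OF sD that]])
      with uD show "p \<in> {f. \<forall>n::nat. f n \<in> Pow U\<^sub>0} \<times> Pow ?R"
        unfolding D(2) g_def by blast
    qed
    show "inj_on g (bounded_simps U\<^sub>0)"
    proof (rule inj_onI)
      fix D E assume DE: "D \<in> bounded_simps U\<^sub>0" "E \<in> bounded_simps U\<^sub>0" and "g D = g E"
      then have s: "spx D = spx E"
        and r: "{(m, n, \<alpha>, x, y). \<alpha> \<in> Dmap m n \<and> x \<in> spx D n \<and> y = opr D m n \<alpha> x}
             = {(m, n, \<alpha>, x, y). \<alpha> \<in> Dmap m n \<and> x \<in> spx E n \<and> y = opr E m n \<alpha> x}" unfolding g_def prod.inject by blast+
      have "opr D m n \<alpha> x = opr E m n \<alpha> x" for m n \<alpha> x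
      proof (cases "\<alpha> \<in> Dmap m n \<and> x \<in> spx D n")
        case True
        then have "(m, n, \<alpha>, x, opr D m n \<alpha> x) \<in> {(m, n, \<alpha>, x, y). \<alpha> \<in> Dmap m n \<and> x \<in> spx D n \<and> y = opr D m n \<alpha> x}"
          by simp
        then show ?thesis unfolding r by simp
      next
        case False
        then have "opr D m n \<alpha> x = undefined" "opr E m n \<alpha> x = undefined"
          using DE s unfolding bounded_simps_def by auto
        then show ?thesis by simp
      qed
      then have "opr D = opr E" by (intro ext)
      with s show "D = E" by simp
    qed
  qed
qed

text \<open>The quotient identifies simplices which no map of \<open>F\<close> distinguishes.\<close>

lemma ex_quotient:
  fixes F :: "(nat \<times> (nat \<Rightarrow> 'u \<times> (nat \<Rightarrow> nat) \<Rightarrow> 'u)) set"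
  assumes U: "absorbing U\<^sub>0" and A: "(A :: 'u simp) \<in> SS" and F: "countable F"
    and FB: "\<And>n f. (n, f) \<in> F \<Longrightarrow> \<exists>B. f \<in> smap (sprod A (Delta n)) B \<and> (\<forall>k. spx B k \<subseteq> U\<^sub>0)"
  obtains D q where "D \<in> bounded_simps U\<^sub>0" "quot A D q" "\<forall>(n, f)\<in>F. descends A q n f"
proof -
  \<comment> \<open>A test applies a map of \<open>F\<close>, in a position \<theta>, to the image
    of a simplex under an operator \<gamma>. Allowing all \<gamma> makes indistinguishability stable
    under the operators, which is \<open>cong\<close>.\<close>
  define I where "I k = {(n, f, j, \<gamma>, \<theta>) | n f j \<gamma> \<theta>. (n, f) \<in> F \<and> \<gamma> \<in> Dmap j k \<and> \<theta> \<in> Dmap j n}" for k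
  have cI: "countable (I k)" for k
  proof -
    let ?D = "\<Union>m. \<Union>n. Dmap m n"
    have cD: "countable ?D" by (intro countable_UN[OF countableI_type] countable_finite finite_Dmap)
    have "countable ((\<lambda>((n, f), j, \<gamma>, \<theta>). (n, f, j, \<gamma>, \<theta>)) ` (F \<times> (UNIV :: nat set) \<times> ?D \<times> ?D))"
      by (intro countable_image countable_SIGMA F cD countableI_type)
    moreover have "I k \<subseteq> (\<lambda>((n, f), j, \<gamma>, \<theta>). (n, f, j, \<gamma>, \<theta>)) ` (F \<times> (UNIV :: nat set) \<times> ?D \<times> ?D)"
      unfolding I_def by force
    ultimately show ?thesis by (rule countable_subset[rotated])
  qed
  define \<Phi> where "\<Phi> k a = (\<lambda>(n, f, j, \<gamma>, \<theta>)\<in>I k. f j (opr A j k \<gamma> a, \<theta>))" for k a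
  have AS: "simplicial_set A" using A by simp
  have \<Phi>in: "\<Phi> k a \<in> I k \<rightarrow>\<^sub>E U\<^sub>0" if a: "a \<in> spx A k" for k a
  proof (rule PiE_I)
    fix i assume i: "i \<in> I k"
    then obtain n f j \<gamma> \<theta> where i': "i = (n, f, j, \<gamma>, \<theta>)" "(n, f) \<in> F" "\<gamma> \<in> Dmap j k" "\<theta> \<in> Dmap j n"
      unfolding I_def by blast
    obtain B where B: "f \<in> smap (sprod A (Delta n)) B" "\<And>k. spx B k \<subseteq> U\<^sub>0" using FB[OF i'(2)] by blast
    have "f j (opr A j k \<gamma> a, \<theta>) \<in> spx B j" by (rule shom_in[OF B(1) opr_in[OF AS i'(3) a] i'(4)])
    then show "\<Phi> k a i \<in> U\<^sub>0" using i i' B(2) by (auto simp: \<Phi>_def)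
  qed (simp add: \<Phi>_def)
  have \<Phi>app: "f j (opr A j k \<gamma> a, \<theta>) = f j (opr A j k \<gamma> a', \<theta>)"
    if "\<Phi> k a = \<Phi> k a'" "(n, f) \<in> F" "\<gamma> \<in> Dmap j k" "\<theta> \<in> Dmap j n" for n f j \<gamma> \<theta> k a a'
  proof -
    have "(n, f, j, \<gamma>, \<theta>) \<in> I k" using that by (simp add: I_def)
    then show ?thesis using fun_cong[OF that(1), of "(n, f, j, \<gamma>, \<theta>)"] by (simp add: \<Phi>_def)
  qed
  have cong: "\<Phi> m (opr A m k \<alpha> a) = \<Phi> m (opr A m k \<alpha> a')"
    if e: "\<Phi> k a = \<Phi> k a'" and al: "\<alpha> \<in> Dmap m k" and a: "a \<in> spx A k" "a' \<in> spx A k" for m k \<alpha> a a'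
  proof (rule PiE_ext[OF \<Phi>in \<Phi>in])
    fix i assume i: "i \<in> I m"
    then obtain n f j \<gamma> \<theta> where i': "i = (n, f, j, \<gamma>, \<theta>)" "(n, f) \<in> F" "\<gamma> \<in> Dmap j m" "\<theta> \<in> Dmap j n"
      unfolding I_def by blast
    show "\<Phi> m (opr A m k \<alpha> a) i = \<Phi> m (opr A m k \<alpha> a') i"
      using i i' \<Phi>app[OF e i'(2) comp_Dmap[OF i'(3) al] i'(4)] al a AS by (simp add: \<Phi>_def opr_opr)
  qed (use al a AS in auto)
  \<comment> \<open>Here absorption enters: the countably many test values of a simplex are coded by
    one element of \<open>U\<^sub>0\<close>, and this code becomes its class in the
    quotient.\<close>
  have "\<exists>J :: (_ \<Rightarrow> 'u) \<Rightarrow> 'u. inj_on J (I k \<rightarrow>\<^sub>E U\<^sub>0) \<and> J ` (I k \<rightarrow>\<^sub>E U\<^sub>0) \<subseteq> U\<^sub>0" for k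
    using absorbing_countable[OF U cI[of k]] by metis
  then obtain J :: "nat \<Rightarrow> (_ \<Rightarrow> 'u) \<Rightarrow> 'u"
    where J: "\<And>k. inj_on (J k) (I k \<rightarrow>\<^sub>E U\<^sub>0)" "\<And>k. J k ` (I k \<rightarrow>\<^sub>E U\<^sub>0) \<subseteq> U\<^sub>0" by metis
  define q where "q k = (\<lambda>a\<in>spx A k. J k (\<Phi> k a))" for k
  have q: "q k a = J k (\<Phi> k a)" if "a \<in> spx A k" for k a using that by (simp add: q_def)
  have qeq: "\<Phi> k a = \<Phi> k a'" if "q k a = q k a'" "a \<in> spx A k" "a' \<in> spx A k" for k a a'
    using that inj_onD[OF J(1) _ \<Phi>in \<Phi>in] by (simp add: q)
  define D where "D = \<lparr>spx = (\<lambda>k. q k ` spx A k), opr = (\<lambda>m k \<alpha> d.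
      if \<alpha> \<in> Dmap m k \<and> d \<in> q k ` spx A k then q m (opr A m k \<alpha> (inv_into (spx A k) (q k) d)) else undefined)\<rparr>"
  have Dopr: "opr D m k \<alpha> (q k a) = q m (opr A m k \<alpha> a)" if al: "\<alpha> \<in> Dmap m k" and a: "a \<in> spx A k" for m k \<alpha> a
  proof -
    have i: "q k a \<in> q k ` spx A k" using a by blast
    let ?b = "inv_into (spx A k) (q k) (q k a)"
    have b: "q k ?b = q k a" "?b \<in> spx A k" using f_inv_into_f[OF i] inv_into_into[OF i] .
    have "q m (opr A m k \<alpha> ?b) = q m (opr A m k \<alpha> a)"
      using cong[OF qeq[OF b(1,2) a] al b(2) a] AS al a b(2) by (simp add: q)
    then show ?thesis using i al by (simp add: D_def)
  qed
  have Dspx: "spx D k = q k ` spx A k" for k by (simp add: D_def)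
  have DS: "simplicial_set D"
    by (rule simplicial_setI) (auto simp: Dspx Dopr AS opr_opr)
  have "spx D k \<subseteq> U\<^sub>0" for k
    using subsetD[OF J(2) imageI[OF \<Phi>in]] by (auto simp: Dspx q)
  with DS have DB: "D \<in> bounded_simps U\<^sub>0" by (auto simp: bounded_simps_def D_def)
  have "q \<in> smap A D"
    by (rule smapI) (simp_all add: Dspx Dopr, simp add: q_def)
  then have Q: "quot A D q" unfolding quot_def using DS AS Dspx by simp
  have "descends A q n f" if "(n, f) \<in> F" for n f
    unfolding descends_def
  proof (intro allI ballI impI)
    fix k a a' \<beta> assume "a \<in> spx A k" "a' \<in> spx A k" "\<beta> \<in> Dmap k n" "q k a = q k a'"
    then show "f k (a, \<beta>) = f k (a', \<beta>)"
      using \<Phi>app[OF qeq that Did_Dmap, of k a a' \<beta>] AS by simp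
  qed
  with DB Q show thesis by (intro that) auto
qed

text \<open>Source components of points are maps out of \<open>A \<times> \<Delta>\<^sup>n\<close>,
  and the quotient map is an epimorphism there; target components are left unchanged. For a general
  small functor restriction along a quotient map may identify elements, and \<open>zigzag\<close>
  takes the place of this lemma.\<close>

lemma act_quot_inj:
  assumes X: "X \<in> Ob Map_cat" and q: "quot A D q" and AD: "(A :: 'u simp) \<in> SS" "D \<in> SS"
    and z: "z \<in> spx (HOM (orbit D) X) n" "z' \<in> spx (HOM (orbit D) X) n"
    and e: "act (orbit_points X) A D n (hconst A n q) z = act (orbit_points X) A D n (hconst A n q) z'"
  shows "z = z'"
proof -
  obtain s where s: "s \<in> pts D X n" "z = enc (ahom (orbit D) X) n s" using HOM_cases[OF X AD(2) z(1)] .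
  obtain s' where s': "s' \<in> pts D X n" "z' = enc (ahom (orbit D) X) n s'" using HOM_cases[OF X AD(2) z(2)] .
  note h = quotD(6)[OF q, of n]
  have "enc (ahom (orbit A) X) n (hcomp A n (fst s) (hconst A n q), snd s)
      = (enc (ahom (orbit A) X) n (hcomp A n (fst s') (hconst A n q), snd s') :: 'u)"
    using e by (simp add: s(2) s'(2) act_orbit_points[OF X AD h s(1)] act_orbit_points[OF X AD h s'(1)])
  then have "(hcomp A n (fst s) (hconst A n q), snd s) = (hcomp A n (fst s') (hconst A n q), snd s')"
    using dec_enc_pts[OF X AD(1) hcomp_pts[OF s(1) h quotD(1)[OF q]]]
      dec_enc_pts[OF X AD(1) hcomp_pts[OF s'(1) h quotD(1)[OF q]]] by metis
  then have "s = s'"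
    using desc_unique[OF q ptsD(1)[OF s(1)] ptsD(1)[OF s'(1)]] by (simp add: prod_eq_iff)
  then show ?thesis using s s' by simp
qed

text \<open>The source component of a point over \<open>A\<close> takes values in
  \<open>src X\<close>, so the point comes from a quotient of \<open>A\<close> bounded by a set
  containing all simplices of \<open>src X\<close>. Two presentations of one point descend to a
  common quotient, where \<open>act_quot_inj\<close> already identifies them; they are therefore two
  coend steps apart.\<close>

lemma small_functor_orbit_points:
  assumes X: "X \<in> Ob Map_cat" shows "small_functor (orbit_points X :: 'u sfunctor)"
proof -
  note R = simplicial_functor_orbit_points[OF X]
  have "small (\<Union>n. spx (src X) n)"
    using X by (intro small_UN small_countable SS_small) (auto simp: Ob_Map_cat)
  then obtain U0 where U0: "absorbing U0" "(\<Union>n. spx (src X) n) \<subseteq> U0" using ex_absorbing by blast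
  have sU: "small U0" using U0 by (simp add: absorbing_def)
  let ?C = "bounded_simps U0"
  have CS: "C \<in> SS" if "C \<in> ?C" for C using bounded_simps_SS[OF sU that] .
  have "kan_extended_from ?C (orbit_points X)"
    unfolding kan_extended_from_def
  proof (intro ballI allI conjI impI)
    fix A :: "'u simp" and n assume A: "A \<in> SS"
    show "coend_eval (orbit_points X) A n ` coend_pts ?C (orbit_points X) A n = spx (fob (orbit_points X) A) n"
    proof (intro equalityI subsetI)
      fix z assume "z \<in> coend_eval (orbit_points X) A n ` coend_pts ?C (orbit_points X) A n"
      then show "z \<in> spx (fob (orbit_points X) A) n"
        using R A CS by (auto simp: coend_eval_def coend_pts_def simp del: fob_orbit_points)
    next
      fix z assume "z \<in> spx (fob (orbit_points X) A) n"
      then have z: "z \<in> spx (HOM (orbit A) X) n" by simp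
      obtain s where s: "s \<in> pts A X n" "z = enc (ahom (orbit A) X) n s"
        using HOM_cases[OF X A z] .
      have c: "countable {(n, fst s)}" by simp
      have b: "\<exists>B. f \<in> smap (sprod A (Delta m)) B \<and> (\<forall>k. spx B k \<subseteq> U0)" if "(m, f) \<in> {(n, fst s)}" for m f
        using that ptsD(1)[OF s(1)] U0(2) by auto
      obtain D q where D0: "D \<in> ?C" "quot A D q" "\<forall>(m, f)\<in>{(n, fst s)}. descends A q m f"
        using ex_quotient[OF U0(1) A c b] .
      have D: "D \<in> ?C" "quot A D q" "descends A q n (fst s)" using D0 by auto
      note h = quotD(6)[OF D(2), of n]
      define s' where "s' = (desc A D q n (fst s), snd s)"
      have s': "s' \<in> pts D X n" unfolding s'_def pts_iff
      proof (intro conjI allI ballI)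
        show "desc A D q n (fst s) \<in> smap (sprod D (Delta n)) (src X)" by (rule desc_smap[OF D(2,3) ptsD(1)[OF s(1)]])
        show "snd s \<in> smap (sprod pt (Delta n)) (tgt X)" by (rule ptsD(2)[OF s(1)])
        fix k d \<beta> assume "d \<in> spx D k" and b: "\<beta> \<in> Dmap k n"
        then obtain a where a: "a \<in> spx A k" "d = q k a" using quotD(5)[OF D(2)] by blast
        show "arr X k (desc A D q n (fst s) k (d, \<beta>)) = snd s k (undefined, \<beta>)"
          unfolding a(2) desc_app[OF D(2,3) a(1) b] by (rule ptsD(3)[OF s(1) a(1) b])
      qed
      have "act (orbit_points X) A D n (hconst A n q) (enc (ahom (orbit D) X) n s') = z"
        unfolding act_orbit_points[OF X A CS[OF D(1)] h s'] s(2)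
        by (simp add: s'_def hcomp_desc[OF D(2,3) ptsD(1)[OF s(1)]])
      moreover have "(D, hconst A n q, enc (ahom (orbit D) X) n s') \<in> coend_pts ?C (orbit_points X) A n"
        unfolding coend_pts_def using D(1) h s' by simp
      ultimately show "z \<in> coend_eval (orbit_points X) A n ` coend_pts ?C (orbit_points X) A n"
        by (force simp: coend_eval_def)
    qed
    fix p p' assume "p \<in> coend_pts ?C (orbit_points X) A n" "p' \<in> coend_pts ?C (orbit_points X) A n"
      and e: "coend_eval (orbit_points X) A n p = coend_eval (orbit_points X) A n p'"
    then obtain C h x C' h' x' where p: "p = (C, h, x)" "C \<in> ?C" "h \<in> smap (sprod A (Delta n)) C" "x \<in> spx (HOM (orbit C) X) n"
      and p': "p' = (C', h', x')" "C' \<in> ?C" "h' \<in> smap (sprod A (Delta n)) C'" "x' \<in> spx (HOM (orbit C') X) n"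
      unfolding coend_pts_def by auto
    have c: "countable {(n, h), (n, h')}" by simp
    have b: "\<exists>B. f \<in> smap (sprod A (Delta m)) B \<and> (\<forall>k. spx B k \<subseteq> U0)" if "(m, f) \<in> {(n, h), (n, h')}" for m f
      using that p(2,3) p'(2,3) by (auto simp: bounded_simps_def)
    obtain D q where D0: "D \<in> ?C" "quot A D q" "\<forall>(m, f)\<in>{(n, h), (n, h')}. descends A q m f"
      using ex_quotient[OF U0(1) A c b] .
    have D: "D \<in> ?C" "quot A D q" "descends A q n h" "descends A q n h'" using D0 by auto
    note hq = quotD(6)[OF D(2), of n]
    let ?h = "desc A D q n h" and ?h' = "desc A D q n h'"
    have dh: "?h \<in> smap (sprod D (Delta n)) C" "?h' \<in> smap (sprod D (Delta n)) C'"
      using desc_smap[OF D(2,3) p(3)] desc_smap[OF D(2,4) p'(3)] .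
    have c: "hcomp A n ?h (hconst A n q) = h" "hcomp A n ?h' (hconst A n q) = h'"
      using hcomp_desc[OF D(2,3) p(3)] hcomp_desc[OF D(2,4) p'(3)] .
    have X': "x \<in> spx (fob (orbit_points X) C) n" "x' \<in> spx (fob (orbit_points X) C') n" using p p' by auto
    have e': "act (orbit_points X) A D n (hconst A n q) (act (orbit_points X) D C n ?h x)
        = act (orbit_points X) A D n (hconst A n q) (act (orbit_points X) D C' n ?h' x')"
      using act_hcomp[OF R A CS[OF D(1)] CS[OF p(2)] hq dh(1) X'(1)]
        act_hcomp[OF R A CS[OF D(1)] CS[OF p'(2)] hq dh(2) X'(2)] e
      unfolding c by (simp add: coend_eval_def p(1) p'(1))
    have eq: "act (orbit_points X) D C n ?h x = act (orbit_points X) D C' n ?h' x'"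
      using act_quot_inj[OF X D(2) A CS[OF D(1)] _ _ e']
        act_in[OF R CS[OF D(1)] CS[OF p(2)] dh(1) X'(1)] act_in[OF R CS[OF D(1)] CS[OF p'(2)] dh(2) X'(2)]
      unfolding fob_orbit_points by blast
    let ?y = "(D, hconst A n q, act (orbit_points X) D C n ?h x)"
    let ?S = "coend_step ?C (orbit_points X) A n"
    have "(?y, p) \<in> ?S"
      unfolding coend_step_def p(1) using D(1) p(2) hq dh(1) X'(1) c(1)
      by (intro CollectI exI[of _ D] exI[of _ C] exI[of _ "hconst A n q"] exI[of _ ?h] exI[of _ x]) simp
    moreover have "(?y, p') \<in> ?S"
      unfolding coend_step_def p'(1) eq using D(1) p'(2) hq dh(2) X'(2) c(2)
      by (intro CollectI exI[of _ D] exI[of _ C'] exI[of _ "hconst A n q"] exI[of _ ?h'] exI[of _ x']) simp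
    ultimately have "(p, ?y) \<in> ?S \<union> ?S\<inverse>" "(?y, p') \<in> ?S \<union> ?S\<inverse>" by auto
    then show "(p, p') \<in> (?S \<union> ?S\<inverse>)\<^sup>*" by (meson converse_rtrancl_into_rtrancl r_into_rtrancl)
  qed
  moreover have "?C \<subseteq> SS" using CS by blast
  moreover have "|?C| <o |UNIV :: 'u set|"
    using small_bounded_simps[OF sU] unfolding small_def unfolding U_UNIV .
  ultimately show ?thesis using R unfolding small_functor_def by blast
qed

end

section \<open>Quillen pairs and equivalences\<close>

lemma cat_comp:
  "is_category C \<Longrightarrow> X \<in> Ob C \<Longrightarrow> Y \<in> Ob C \<Longrightarrow> Z \<in> Ob C \<Longrightarrow> f \<in> Hm C X Y \<Longrightarrow> g \<in> Hm C Y Z \<Longrightarrow>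
   Cmp C X Y Z g f \<in> Hm C X Z"
  unfolding is_category_def by blast

lemma cat_id: "is_category C \<Longrightarrow> X \<in> Ob C \<Longrightarrow> Idm C X \<in> Hm C X X"
  unfolding is_category_def by blast

lemma cat_id_right: "is_category C \<Longrightarrow> X \<in> Ob C \<Longrightarrow> Y \<in> Ob C \<Longrightarrow> f \<in> Hm C X Y \<Longrightarrow> Cmp C X X Y f (Idm C X) = f"
  unfolding is_category_def by blast

lemma cat_id_left: "is_category C \<Longrightarrow> X \<in> Ob C \<Longrightarrow> Y \<in> Ob C \<Longrightarrow> f \<in> Hm C X Y \<Longrightarrow> Cmp C X Y Y (Idm C Y) f = f"
  unfolding is_category_def by blast

lemma adjD:
  assumes "is_adjunction C D L R \<phi>"
  shows "is_functor C D L" "is_functor D C R"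
    and "X \<in> Ob C \<Longrightarrow> Y \<in> Ob D \<Longrightarrow> bij_betw (\<phi> X Y) (Hm D (onO L X) Y) (Hm C X (onO R Y))"
    and "X' \<in> Ob C \<Longrightarrow> X \<in> Ob C \<Longrightarrow> Y \<in> Ob D \<Longrightarrow> f \<in> Hm C X' X \<Longrightarrow> g \<in> Hm D (onO L X) Y \<Longrightarrow>
        \<phi> X' Y (Cmp D (onO L X') (onO L X) Y g (onM L X' X f)) = Cmp C X' X (onO R Y) (\<phi> X Y g) f"
    and "X \<in> Ob C \<Longrightarrow> Y \<in> Ob D \<Longrightarrow> Y' \<in> Ob D \<Longrightarrow> g \<in> Hm D (onO L X) Y \<Longrightarrow> k \<in> Hm D Y Y' \<Longrightarrow>
        \<phi> X Y' (Cmp D (onO L X) Y Y' k g) = Cmp C X (onO R Y) (onO R Y') (onM R Y Y' k) (\<phi> X Y g)"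
  using assms unfolding is_adjunction_def by blast+

lemma functorD:
  assumes "is_functor C D F"
  shows "X \<in> Ob C \<Longrightarrow> onO F X \<in> Ob D"
    and "X \<in> Ob C \<Longrightarrow> Y \<in> Ob C \<Longrightarrow> f \<in> Hm C X Y \<Longrightarrow> onM F X Y f \<in> Hm D (onO F X) (onO F Y)"
    and "X \<in> Ob C \<Longrightarrow> onM F X X (Idm C X) = Idm D (onO F X)"
    and "X \<in> Ob C \<Longrightarrow> Y \<in> Ob C \<Longrightarrow> Z \<in> Ob C \<Longrightarrow> f \<in> Hm C X Y \<Longrightarrow> g \<in> Hm C Y Z \<Longrightarrow>
        onM F X Z (Cmp C X Y Z g f) = Cmp D (onO F X) (onO F Y) (onO F Z) (onM F Y Z g) (onM F X Y f)"
  using assms unfolding is_functor_def by blast+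

lemma modelD:
  assumes "model_category u M"
  shows "is_category M"
    and "X \<in> Ob M \<Longrightarrow> Y \<in> Ob M \<Longrightarrow> f \<in> weq M X Y \<Longrightarrow> f \<in> Hm M X Y"
    and "X \<in> Ob M \<Longrightarrow> Y \<in> Ob M \<Longrightarrow> f \<in> fib M X Y \<Longrightarrow> f \<in> Hm M X Y"
    and "X \<in> Ob M \<Longrightarrow> Y \<in> Ob M \<Longrightarrow> f \<in> cof M X Y \<Longrightarrow> f \<in> Hm M X Y"
    and "two_of_three M (weq M)" "retract_closed M (weq M)"
    and "factors M (\<lambda>X Y. cof M X Y \<inter> weq M X Y) (fib M)"
    and "A \<in> Ob M \<Longrightarrow> B \<in> Ob M \<Longrightarrow> X \<in> Ob M \<Longrightarrow> Y \<in> Ob M \<Longrightarrow> i \<in> cof M A B \<Longrightarrow> p \<in> fib M X Y \<Longrightarrow>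
        i \<in> weq M A B \<or> p \<in> weq M X Y \<Longrightarrow> has_lifting M A B i X Y p"
  using assms unfolding model_category_def by blast+

text \<open>Naturality of \<open>\<phi>\<close> in both variables carries squares to squares. A
  filler is brought back by surjectivity of \<open>\<phi>\<close>, and its two triangles by
  injectivity.\<close>

lemma adjunct_lifting:
  assumes adj: "is_adjunction M N L R \<phi>" and M: "is_category M" and N: "is_category N"
    and ob: "A \<in> Ob M" "B \<in> Ob M" "X \<in> Ob N" "Y \<in> Ob N"
    and i: "i \<in> Hm M A B" and p: "p \<in> Hm N X Y"
    and lift: "has_lifting M A B i (onO R X) (onO R Y) (onM R X Y p)"
  shows "has_lifting N (onO L A) (onO L B) (onM L A B i) X Y p"
  unfolding has_lifting_def
proof (intro ballI impI)
  note L = functorD[OF adjD(1)[OF adj]] and R = functorD[OF adjD(2)[OF adj]] and bij = adjD(3)[OF adj]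
  fix u v assume u: "u \<in> Hm N (onO L A) X" and v: "v \<in> Hm N (onO L B) Y"
    and eq: "Cmp N (onO L A) X Y p u = Cmp N (onO L A) (onO L B) Y v (onM L A B i)"
  have inj: "g = h" if "\<phi> Z W g = \<phi> Z W h" "Z \<in> Ob M" "W \<in> Ob N" "g \<in> Hm N (onO L Z) W" "h \<in> Hm N (onO L Z) W"
    for g h Z W using bij[OF that(2,3)] that by (meson bij_betw_def inj_onD)
  have \<phi>u: "\<phi> A X u \<in> Hm M A (onO R X)" and \<phi>v: "\<phi> B Y v \<in> Hm M B (onO R Y)"
    using bij ob u v by (meson bij_betwE)+
  have "Cmp M A (onO R X) (onO R Y) (onM R X Y p) (\<phi> A X u) = Cmp M A B (onO R Y) (\<phi> B Y v) i"
    using adjD(5)[OF adj ob(1,3,4) u p] adjD(4)[OF adj ob(1,2,4) i v] eq by simp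
  with lift \<phi>u \<phi>v obtain h where h: "h \<in> Hm M B (onO R X)" "Cmp M A B (onO R X) h i = \<phi> A X u"
      "Cmp M B (onO R X) (onO R Y) (onM R X Y p) h = \<phi> B Y v"
    unfolding has_lifting_def by blast
  obtain k where k: "k \<in> Hm N (onO L B) X" "\<phi> B X k = h"
    using bij[OF ob(2,3)] h(1) unfolding bij_betw_def by (metis imageE)
  have "\<phi> A X (Cmp N (onO L A) (onO L B) X k (onM L A B i)) = \<phi> A X u"
    using adjD(4)[OF adj ob(1,2,3) i k(1)] k(2) h(2) by simp
  then have 1: "Cmp N (onO L A) (onO L B) X k (onM L A B i) = u"
    by (rule inj[OF _ ob(1,3) cat_comp[OF N L(1)[OF ob(1)] L(1)[OF ob(2)] ob(3) L(2)[OF ob(1,2) i] k(1)] u])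
  have "\<phi> B Y (Cmp N (onO L B) X Y p k) = \<phi> B Y v"
    using adjD(5)[OF adj ob(2,3,4) k(1) p] k(2) h(3) by simp
  then have 2: "Cmp N (onO L B) X Y p k = v"
    by (rule inj[OF _ ob(2,4) cat_comp[OF N L(1)[OF ob(2)] ob(3,4) k(1) p] v])
  show "\<exists>h\<in>Hm N (onO L B) X. Cmp N (onO L A) (onO L B) X h (onM L A B i) = u \<and> Cmp N (onO L B) X Y p h = v"
    using k(1) 1 2 by blast
qed

text \<open>The left adjoint is tested by lifting problems, which \<open>adjunct_lifting\<close>
  moves to \<open>M\<close>. With \<open>cofN\<close> this settles cofibrations; for acyclic
  cofibrations the hypotheses contain no such test, and they are reached by the retract
  argument.\<close>

lemma quillen_pairI:
  assumes M: "model_category u M" and N: "model_category u N" and adj: "is_adjunction M N L R \<phi>"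
    and cofN: "\<And>A B i. A \<in> Ob N \<Longrightarrow> B \<in> Ob N \<Longrightarrow> i \<in> Hm N A B \<Longrightarrow>
      (\<And>X Y p. X \<in> Ob N \<Longrightarrow> Y \<in> Ob N \<Longrightarrow> p \<in> fib N X Y \<Longrightarrow> p \<in> weq N X Y \<Longrightarrow> has_lifting N A B i X Y p) \<Longrightarrow>
      i \<in> cof N A B"
    and Rfib: "\<And>X Y f. X \<in> Ob N \<Longrightarrow> Y \<in> Ob N \<Longrightarrow> f \<in> fib N X Y \<Longrightarrow> onM R X Y f \<in> fib M (onO R X) (onO R Y)"
    and Rweq: "\<And>X Y f. X \<in> Ob N \<Longrightarrow> Y \<in> Ob N \<Longrightarrow> f \<in> weq N X Y \<Longrightarrow> onM R X Y f \<in> weq M (onO R X) (onO R Y)"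
  shows "quillen_pair u M N L R \<phi>"
proof -
  note L = functorD[OF adjD(1)[OF adj]] and R = functorD[OF adjD(2)[OF adj]]
  note cM = modelD(1)[OF M] and cN = modelD(1)[OF N]
  have cof: "onM L A B i \<in> cof N (onO L A) (onO L B)"
    if ob: "A \<in> Ob M" "B \<in> Ob M" and i: "i \<in> cof M A B" for A B i
  proof (rule cofN[OF L(1)[OF ob(1)] L(1)[OF ob(2)] L(2)[OF ob modelD(4)[OF M ob i]]])
    fix X Y p assume X: "X \<in> Ob N" "Y \<in> Ob N" and p: "p \<in> fib N X Y" "p \<in> weq N X Y"
    show "has_lifting N (onO L A) (onO L B) (onM L A B i) X Y p"
      by (rule adjunct_lifting[OF adj cM cN ob X modelD(4)[OF M ob i] modelD(3)[OF N X p(1)]])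
        (use modelD(8)[OF M ob R(1)[OF X(1)] R(1)[OF X(2)] i Rfib[OF X p(1)]] Rweq[OF X p(2)] in blast)
  qed
  have acof: "onM L A B i \<in> weq N (onO L A) (onO L B)"
    if ob: "A \<in> Ob M" "B \<in> Ob M" and i: "i \<in> cof M A B" "i \<in> weq M A B" for A B i
  proof -
    let ?A = "onO L A" and ?B = "onO L B" and ?i = "onM L A B i"
    have iM: "i \<in> Hm M A B" by (rule modelD(4)[OF M ob i(1)])
    have AB: "?A \<in> Ob N" "?B \<in> Ob N" and iN: "?i \<in> Hm N ?A ?B" using L ob iM by auto
    \<comment> \<open>Retract argument: \<open>?i\<close> is factored as \<open>p\<close> after an
      acyclic cofibration \<open>j\<close>, and a lift of the identity of \<open>?B\<close> against
      \<open>p\<close> exhibits \<open>?i\<close> as a retract of \<open>j\<close>.\<close>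
    obtain Z j p where Z: "Z \<in> Ob N" and j: "j \<in> cof N ?A Z" "j \<in> weq N ?A Z" and p: "p \<in> fib N Z ?B"
      and pj: "Cmp N ?A Z ?B p j = ?i"
      using modelD(7)[OF N] AB iN unfolding factors_def by blast
    have jN: "j \<in> Hm N ?A Z" and pN: "p \<in> Hm N Z ?B"
      using modelD(4)[OF N AB(1) Z j(1)] modelD(3)[OF N Z AB(2) p] .
    have "has_lifting N ?A ?B ?i Z ?B p"
      by (rule adjunct_lifting[OF adj cM cN ob Z AB(2) iM pN])
        (use modelD(8)[OF M ob R(1)[OF Z] R(1)[OF AB(2)] i(1) Rfib[OF Z AB(2) p]] i(2) in blast)
    moreover have "Cmp N ?A Z ?B p j = Cmp N ?A ?B ?B (Idm N ?B) ?i"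
      using pj cat_id_left[OF cN AB iN] by simp
    ultimately obtain h where h: "h \<in> Hm N ?B Z" "Cmp N ?A ?B Z h ?i = j" "Cmp N ?B Z ?B p h = Idm N ?B"
      using jN cat_id[OF cN AB(2)] unfolding has_lifting_def by blast
    have "is_retract_of N ?A ?B ?i ?A Z j"
      unfolding is_retract_of_def
    proof (intro bexI conjI)
      show "Cmp N ?A ?A ?A (Idm N ?A) (Idm N ?A) = Idm N ?A"
        by (rule cat_id_right[OF cN AB(1,1) cat_id[OF cN AB(1)]])
      show "Cmp N ?B Z ?B p h = Idm N ?B" by (rule h(3))
      show "Cmp N ?A ?A Z j (Idm N ?A) = Cmp N ?A ?B Z h ?i"
        using h(2) cat_id_right[OF cN AB(1) Z jN] by simp
      show "Cmp N ?A ?A ?B ?i (Idm N ?A) = Cmp N ?A Z ?B p j"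
        using pj cat_id_right[OF cN AB iN] by simp
    qed (use cat_id[OF cN AB(1)] h(1) pN in auto)
    then show ?thesis
      using modelD(6)[OF N] AB Z iN j(2) unfolding retract_closed_def by blast
  qed
  show ?thesis
    unfolding quillen_pair_def using M N adj cof acof Rfib Rweq by blast
qed

text \<open>The adjunct of \<open>g\<close> is \<open>R g\<close> after the unit. As
  \<open>R\<close> preserves and reflects weak equivalences, two out of three reduces the claim to
  the unit on cofibrant objects.\<close>

lemma quillen_equivalenceI:
  assumes Q: "quillen_pair u M N L R \<phi>"
    and Rweq: "\<And>X Y f. X \<in> Ob N \<Longrightarrow> Y \<in> Ob N \<Longrightarrow> f \<in> Hm N X Y \<Longrightarrow>
      f \<in> weq N X Y \<longleftrightarrow> onM R X Y f \<in> weq M (onO R X) (onO R Y)"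
    and res: "\<And>Y. Y \<in> Ob M \<Longrightarrow> cofibrant M Y \<Longrightarrow>
      \<exists>P\<in>Ob M. \<exists>p. p \<in> fib M P Y \<and> p \<in> weq M P Y \<and> \<phi> P (onO L P) (Idm N (onO L P)) \<in> weq M P (onO R (onO L P))"
  shows "quillen_equivalence u M N L R \<phi>"
proof -
  have M: "model_category u M" and N: "model_category u N" and adj: "is_adjunction M N L R \<phi>"
    using Q unfolding quillen_pair_def by blast+
  note L = functorD[OF adjD(1)[OF adj]] and R = functorD[OF adjD(2)[OF adj]]
  note cM = modelD(1)[OF M] and cN = modelD(1)[OF N]
  let ?\<eta> = "\<lambda>Y. \<phi> Y (onO L Y) (Idm N (onO L Y))"
  have \<eta>in: "?\<eta> Y \<in> Hm M Y (onO R (onO L Y))" if Y: "Y \<in> Ob M" for Y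
    using adjD(3)[OF adj Y L(1)[OF Y]] cat_id[OF cN L(1)[OF Y]] by (meson bij_betwE)
  have \<eta>\<phi>: "\<phi> Y X g = Cmp M Y (onO R (onO L Y)) (onO R X) (onM R (onO L Y) X g) (?\<eta> Y)"
    if Y: "Y \<in> Ob M" and X: "X \<in> Ob N" and g: "g \<in> Hm N (onO L Y) X" for Y X g
    using adjD(5)[OF adj Y L(1)[OF Y] X cat_id[OF cN L(1)[OF Y]] g] cat_id_right[OF cN L(1)[OF Y] X g] by simp
  have \<eta>nat: "Cmp M Y Z (onO R (onO L Z)) (?\<eta> Z) f
      = Cmp M Y (onO R (onO L Y)) (onO R (onO L Z)) (onM R (onO L Y) (onO L Z) (onM L Y Z f)) (?\<eta> Y)"
    if Y: "Y \<in> Ob M" and Z: "Z \<in> Ob M" and f: "f \<in> Hm M Y Z" for Y Z f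
    using adjD(4)[OF adj Y Z L(1)[OF Z] f cat_id[OF cN L(1)[OF Z]]] \<eta>\<phi>[OF Y L(1)[OF Z] L(2)[OF Y Z f]]
      cat_id_left[OF cN L(1)[OF Y] L(1)[OF Z] L(2)[OF Y Z f]] by simp
  have unit: "?\<eta> Y \<in> weq M Y (onO R (onO L Y))" if Y: "Y \<in> Ob M" and c: "cofibrant M Y" for Y
  proof -
    obtain P p where P: "P \<in> Ob M" and p: "p \<in> fib M P Y" "p \<in> weq M P Y"
      and \<eta>P: "?\<eta> P \<in> weq M P (onO R (onO L P))" using res[OF Y c] by blast
    have pM: "p \<in> Hm M P Y" by (rule modelD(3)[OF M P Y p(1)])
    obtain I f where I: "is_initial M I" and f: "f \<in> cof M I Y" using c unfolding cofibrant_def by blast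
    have IO: "I \<in> Ob M" using I by (simp add: is_initial_def)
    have fM: "f \<in> Hm M I Y" by (rule modelD(4)[OF M IO Y f])
    obtain u where u: "u \<in> Hm M I P" using I P unfolding is_initial_def by blast
    have "Cmp M I P Y p u \<in> Hm M I Y" "Cmp M I Y Y (Idm M Y) f \<in> Hm M I Y"
      using cat_comp[OF cM IO P Y u pM] cat_comp[OF cM IO Y Y fM cat_id[OF cM Y]] .
    then have "Cmp M I P Y p u = Cmp M I Y Y (Idm M Y) f" using I Y unfolding is_initial_def by blast
    moreover have "has_lifting M I Y f P Y p" using modelD(8)[OF M IO Y P Y f p(1)] p(2) by blast
    \<comment> \<open>A section of the acyclic fibration \<open>p\<close>, obtained from cofibrancy.
      By naturality of the unit it makes the unit of \<open>Y\<close> a retract of the unit of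
      \<open>P\<close>.\<close>
    ultimately obtain s where s: "s \<in> Hm M Y P" "Cmp M Y P Y p s = Idm M Y"
      using u cat_id[OF cM Y] unfolding has_lifting_def by blast
    let ?RL = "\<lambda>X Y f. onM R (onO L X) (onO L Y) (onM L X Y f)"
    have "?RL Y Y (Cmp M Y P Y p s)
      = Cmp M (onO R (onO L Y)) (onO R (onO L P)) (onO R (onO L Y)) (?RL P Y p) (?RL Y P s)"
      using L(4)[OF Y P Y s(1) pM] R(4)[OF L(1)[OF Y] L(1)[OF P] L(1)[OF Y] L(2)[OF Y P s(1)] L(2)[OF P Y pM]]
      by simp
    then have RLps: "Cmp M (onO R (onO L Y)) (onO R (onO L P)) (onO R (onO L Y)) (?RL P Y p) (?RL Y P s)
        = Idm M (onO R (onO L Y))"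
      using s(2) L(3)[OF Y] R(3)[OF L(1)[OF Y]] by simp
    have "is_retract_of M Y (onO R (onO L Y)) (?\<eta> Y) P (onO R (onO L P)) (?\<eta> P)"
      unfolding is_retract_of_def
    proof (intro bexI conjI)
      show "Cmp M Y P Y p s = Idm M Y" by (rule s(2))
      show "Cmp M (onO R (onO L Y)) (onO R (onO L P)) (onO R (onO L Y)) (?RL P Y p) (?RL Y P s)
        = Idm M (onO R (onO L Y))" by (rule RLps)
      show "Cmp M Y P (onO R (onO L P)) (?\<eta> P) s = Cmp M Y (onO R (onO L Y)) (onO R (onO L P)) (?RL Y P s) (?\<eta> Y)"
        by (rule \<eta>nat[OF Y P s(1)])
      show "Cmp M P Y (onO R (onO L Y)) (?\<eta> Y) p = Cmp M P (onO R (onO L P)) (onO R (onO L Y)) (?RL P Y p) (?\<eta> P)"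
        by (rule \<eta>nat[OF P Y pM])
    qed (use s(1) pM R(2)[OF L(1)[OF Y] L(1)[OF P] L(2)[OF Y P s(1)]] R(2)[OF L(1)[OF P] L(1)[OF Y] L(2)[OF P Y pM]] in auto)
    then show ?thesis
      using modelD(6)[OF M] Y P R(1)[OF L(1)[OF Y]] R(1)[OF L(1)[OF P]] \<eta>in[OF Y] \<eta>P
      unfolding retract_closed_def by blast
  qed
  show ?thesis
    unfolding quillen_equivalence_def
  proof (intro conjI allI ballI impI Q)
    fix Y X g assume g: "g \<in> Hm N (onO L Y) X" and "cofibrant M Y \<and> fibrant N X"
    then have c: "cofibrant M Y" and Y: "Y \<in> Ob M" and X: "X \<in> Ob N"
      by (auto simp: cofibrant_def fibrant_def)
    note RL = R(1)[OF L(1)[OF Y]]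
    have Rg: "onM R (onO L Y) X g \<in> Hm M (onO R (onO L Y)) (onO R X)" by (rule R(2)[OF L(1)[OF Y] X g])
    have "onM R (onO L Y) X g \<in> weq M (onO R (onO L Y)) (onO R X) \<longleftrightarrow> \<phi> Y X g \<in> weq M Y (onO R X)"
      using modelD(5)[OF M] Y RL R(1)[OF X] \<eta>in[OF Y] Rg unit[OF Y c] unfolding two_of_three_def \<eta>\<phi>[OF Y X g] by blast
    moreover have "g \<in> weq N (onO L Y) X \<longleftrightarrow> onM R (onO L Y) X g \<in> weq M (onO R (onO L Y)) (onO R X)"
      by (rule Rweq[OF L(1)[OF Y] X g])
    ultimately show "g \<in> weq N (onO L Y) X \<longleftrightarrow> \<phi> Y X g \<in> weq M Y (onO R X)" by simp
  qed
qed

section \<open>The two functors and naturality of the adjunction\<close>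

lemma Fun_model_simps [simp]:
  "Ob Fun_model = {F. small_functor F}" "Hm Fun_model = nat_trans"
  "Idm Fun_model F = (\<lambda>A\<in>SS. sid (fob F A))"
  "Cmp Fun_model F G H \<theta> \<eta> = (\<lambda>A\<in>SS. scomp (fob F A) (\<theta> A) (\<eta> A))"
  by (simp_all add: Fun_model_def model_of_def Fun_cat_def)

lemma Map_eq_simps [simp]:
  "Ob Map_eq = Ob Map_cat" "Hm Map_eq = squares" "Idm Map_eq X = sqid X"
  "Cmp Map_eq X Y Z g f = sqcomp X g f"
  by (simp_all add: Map_eq_def model_of_def Map_cat_def)

lemma weq_fib_model [simp]:
  "weq Fun_model F G = {\<eta> \<in> nat_trans F G. \<forall>A\<in>SS. weak_equivalence (fob F A) (fob G A) (\<eta> A)}"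
  "fib Fun_model F G = {\<eta> \<in> nat_trans F G. \<forall>A\<in>SS. kan_fibration (fob F A) (fob G A) (\<eta> A)}"
  "weq Map_eq X Y = {g \<in> squares X Y. \<forall>A\<in>SS.
     weak_equivalence (HOM (orbit A) X) (HOM (orbit A) Y) (HOM_map (orbit A) X Y g)}"
  "fib Map_eq X Y = {g \<in> squares X Y. \<forall>A\<in>SS.
     kan_fibration (HOM (orbit A) X) (HOM (orbit A) Y) (HOM_map (orbit A) X Y g)}"
  by (simp_all add: Fun_model_def Map_eq_def model_of_def)

lemma small_functorD: "small_functor F \<Longrightarrow> simplicial_functor F"
  by (simp add: small_functor_def)

lemma nat_trans_eqI:
  assumes "\<eta> \<in> nat_trans F G" "\<theta> \<in> nat_trans F H"
    and "\<And>A n y. A \<in> SS \<Longrightarrow> y \<in> spx (fob F A) n \<Longrightarrow> \<eta> A n y = \<theta> A n y"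
  shows "\<eta> = \<theta>"
proof
  fix A show "\<eta> A = \<theta> A"
  proof (cases "A \<in> SS")
    case True
    then show ?thesis
      using smap_eqI[OF nat_transD(1)[OF assms(1)] nat_transD(1)[OF assms(2)]] assms(3) by blast
  qed (use nat_transD(2)[OF assms(1)] nat_transD(2)[OF assms(2)] in simp)
qed

lemma sqcomp_pts:
  assumes s: "s \<in> pts A X n" and g: "g \<in> squares X Z" and A: "simplicial_set A"
  shows "sqcomp (tensor (orbit A) (Delta n)) g s \<in> pts A Z n"
    and "sqcomp (tensor (orbit A) (Delta n)) g s =
      (scomp (sprod A (Delta n)) (fst g) (fst s), scomp (sprod pt (Delta n)) (snd g) (snd s))"
proof -
  show e: "sqcomp (tensor (orbit A) (Delta n)) g s =
      (scomp (sprod A (Delta n)) (fst g) (fst s), scomp (sprod pt (Delta n)) (snd g) (snd s))"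
    by (simp add: sqcomp_def)
  show "sqcomp (tensor (orbit A) (Delta n)) g s \<in> pts A Z n"
    unfolding e pts_iff
  proof (intro conjI allI ballI)
    fix k a \<beta> assume *: "a \<in> spx A k" "\<beta> \<in> Dmap k n"
    show "arr Z k (scomp (sprod A (Delta n)) (fst g) (fst s) k (a, \<beta>))
        = scomp (sprod pt (Delta n)) (snd g) (snd s) k (undefined, \<beta>)"
      using * squaresD(3)[OF g shom_in[OF ptsD(1)[OF s] *]] ptsD(3)[OF s *] by simp
  qed (use ptsD[OF s] squaresD[OF g] A in auto)
qed

context universe begin

lemma HOM_map_enc:
  assumes X: "X \<in> Ob Map_cat" and A: "(A :: 'u simp) \<in> SS" and s: "s \<in> pts A X n"
  shows "HOM_map (orbit A) X Z g n (enc (ahom (orbit A) X) n s)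
     = enc (ahom (orbit A) Z) n (sqcomp (tensor (orbit A) (Delta n)) g s)"
  using s by (simp add: HOM_map_def dec_enc_pts[OF X A s])

lemma onM_orbit_points:
  fixes X Z :: "'u arrow"
  assumes X: "X \<in> Ob Map_cat" and Z: "Z \<in> Ob Map_cat" and g: "g \<in> squares X Z"
  shows "onM orbit_points_functor X Z g \<in> nat_trans (orbit_points X) (orbit_points Z)"
proof (rule nat_transI[OF simplicial_functor_orbit_points[OF X] simplicial_functor_orbit_points[OF Z]])
  have e: "onM orbit_points_functor X Z g = (\<lambda>A\<in>SS. HOM_map (orbit A) X Z g)"
    by (simp add: orbit_points_functor_def)
  show "onM orbit_points_functor X Z g A = undefined" if "A \<notin> SS" for A using that by (simp add: e)
  show "onM orbit_points_functor X Z g A \<in> smap (fob (orbit_points X) A) (fob (orbit_points Z) A)"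
    if A: "A \<in> SS" for A
    unfolding fob_orbit_points
  proof (rule smapI)
    fix n z assume z: "z \<in> spx (HOM (orbit A) X) n"
    obtain s where s: "s \<in> pts A X n" "z = enc (ahom (orbit A) X) n s" using HOM_cases[OF X A z] .
    note gs = sqcomp_pts[OF s(1) g SS_simplicial[OF A]]
    show "onM orbit_points_functor X Z g A n z \<in> spx (HOM (orbit A) Z) n"
      using A gs(1) by (simp add: e s(2) HOM_map_enc[OF X A s(1)])
    fix m \<alpha> assume a: "\<alpha> \<in> Dmap m n"
    note ps = pull_pts[OF SS_simplicial[OF A] s(1) a]
    have "sqcomp (tensor (orbit A) (Delta m)) g (pull A m \<alpha> (fst s), pull pt m \<alpha> (snd s))
      = (pull A m \<alpha> (fst (sqcomp (tensor (orbit A) (Delta n)) g s)), pull pt m \<alpha> (snd (sqcomp (tensor (orbit A) (Delta n)) g s)))"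
      by (rule pts_eqI[OF sqcomp_pts(1)[OF ps g SS_simplicial[OF A]] pull_pts[OF SS_simplicial[OF A] gs(1) a]])
        (use a A in simp_all)
    then show "onM orbit_points_functor X Z g A m (opr (HOM (orbit A) X) m n \<alpha> z)
        = opr (HOM (orbit A) Z) m n \<alpha> (onM orbit_points_functor X Z g A n z)"
      using A by (simp add: e s(2) HOM_map_enc[OF X A s(1)] opr_HOM[OF X A s(1)] opr_HOM[OF Z A gs(1)]
        HOM_map_enc[OF X A ps])
  next
    fix n z assume "z \<notin> spx (HOM (orbit A) X) n"
    then show "onM orbit_points_functor X Z g A n z = undefined" using A by (simp add: e HOM_map_def)
  qed
  fix A B :: "'u simp" and n f y
  assume A: "A \<in> SS" and B: "B \<in> SS" and f: "f \<in> smap (sprod A (Delta n)) B" and "y \<in> spx (fob (orbit_points X) B) n"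
  then have y: "y \<in> spx (HOM (orbit B) X) n" by simp
  obtain s where s: "s \<in> pts B X n" "y = enc (ahom (orbit B) X) n s" using HOM_cases[OF X B y] .
  note gs = sqcomp_pts[OF s(1) g SS_simplicial[OF B]]
  note hs = hcomp_pts[OF s(1) f SS_simplicial[OF A]]
  have "sqcomp (tensor (orbit A) (Delta n)) g (hcomp A n (fst s) f, snd s)
      = (hcomp A n (fst (sqcomp (tensor (orbit B) (Delta n)) g s)) f, snd (sqcomp (tensor (orbit B) (Delta n)) g s))"
    by (rule pts_eqI[OF sqcomp_pts(1)[OF hs g SS_simplicial[OF A]] hcomp_pts[OF gs(1) f SS_simplicial[OF A]]])
      (use A B f in \<open>simp_all add: shom_in[OF f]\<close>)
  then show "onM orbit_points_functor X Z g A n (act (orbit_points X) A B n f y)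
      = act (orbit_points Z) A B n f (onM orbit_points_functor X Z g B n y)"
    using A B by (simp add: e s(2) HOM_map_enc[OF X B s(1)] act_orbit_points[OF X A B f s(1)]
        act_orbit_points[OF Z A B f gs(1)] HOM_map_enc[OF X A hs])
qed

lemma onM_orbit_points_enc:
  assumes X: "X \<in> Ob Map_cat" and A: "(A :: 'u simp) \<in> SS" and s: "s \<in> pts A X n"
  shows "onM orbit_points_functor X Z g A n (enc (ahom (orbit A) X) n s)
     = enc (ahom (orbit A) Z) n (sqcomp (tensor (orbit A) (Delta n)) g s)"
  using A by (simp add: orbit_points_functor_def HOM_map_enc[OF X A s])

text \<open>That identities and composites are natural transformations is read off from
  \<open>cF\<close>; it remains to compare values on encoded points.\<close>

lemma functor_orbit_points:
  assumes cF: "is_category (Fun_model :: ('u sfunctor, _) model)"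
  shows "is_functor (Map_eq :: ('u arrow, _) model) (Fun_model :: ('u sfunctor, _) model) orbit_points_functor"
  unfolding is_functor_def
proof (intro conjI ballI)
  have O: "onO orbit_points_functor X = orbit_points X" for X :: "'u arrow"
    by (simp add: orbit_points_functor_def)
  fix X :: "'u arrow" assume "X \<in> Ob Map_eq"
  then have X: "X \<in> Ob Map_cat" by simp
  show "onO orbit_points_functor X \<in> Ob Fun_model" using small_functor_orbit_points[OF X] by (simp add: O)
  have idX: "sqid X \<in> squares X X"
    using X unfolding sqid_def Ob_Map_cat by (intro squaresI) auto
  have FX: "orbit_points X \<in> Ob Fun_model" using small_functor_orbit_points[OF X] by simp
  show "onM orbit_points_functor X X (Idm Map_eq X) = Idm Fun_model (onO orbit_points_functor X)"
  proof (rule nat_trans_eqI[OF onM_orbit_points[OF X X]])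
    show "Idm Map_eq X \<in> squares X X" using idX by simp
    show "Idm Fun_model (onO orbit_points_functor X) \<in> nat_trans (orbit_points X) (orbit_points X)"
      using cat_id[OF cF FX] by (simp add: O)
    fix A :: "'u simp" and n y assume A: "A \<in> SS" and "y \<in> spx (fob (orbit_points X) A) n"
    then have y: "y \<in> spx (HOM (orbit A) X) n" by simp
    obtain s where s: "s \<in> pts A X n" "y = enc (ahom (orbit A) X) n s" using HOM_cases[OF X A y] .
    have "sqcomp (tensor (orbit A) (Delta n)) (sqid X) s = s"
      by (rule pts_eqI[OF sqcomp_pts(1)[OF s(1) idX SS_simplicial[OF A]] s(1)])
        (use shom_in[OF ptsD(1)[OF s(1)]] shom_in[OF ptsD(2)[OF s(1)]] in \<open>simp_all add: sqid_def\<close>)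
    then show "onM orbit_points_functor X X (Idm Map_eq X) A n y = Idm Fun_model (onO orbit_points_functor X) A n y"
      using y A by (simp add: O s(2) onM_orbit_points_enc[OF X A s(1)])
  qed
  fix Y :: "'u arrow" assume "Y \<in> Ob Map_eq"
  then have Y: "Y \<in> Ob Map_cat" by simp
  have FY: "orbit_points Y \<in> Ob Fun_model" using small_functor_orbit_points[OF Y] by simp
  fix f assume "f \<in> Hm Map_eq X Y"
  then have f: "f \<in> squares X Y" by simp
  show "onM orbit_points_functor X Y f \<in> Hm Fun_model (onO orbit_points_functor X) (onO orbit_points_functor Y)"
    using onM_orbit_points[OF X Y f] by (simp add: O)
  fix Z :: "'u arrow" assume "Z \<in> Ob Map_eq"
  then have Z: "Z \<in> Ob Map_cat" by simp
  have FZ: "orbit_points Z \<in> Ob Fun_model" using small_functor_orbit_points[OF Z] by simp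
  fix g assume "g \<in> Hm Map_eq Y Z"
  then have g: "g \<in> squares Y Z" by simp
  have gf: "sqcomp X g f \<in> squares X Z"
    by (rule sqcomp_squares[OF f g]) (use X in \<open>auto simp: Ob_Map_cat\<close>)
  have c: "Cmp Fun_model (orbit_points X) (orbit_points Y) (orbit_points Z)
      (onM orbit_points_functor Y Z g) (onM orbit_points_functor X Y f) \<in> nat_trans (orbit_points X) (orbit_points Z)"
    using cat_comp[OF cF FX FY FZ] onM_orbit_points[OF X Y f] onM_orbit_points[OF Y Z g] by simp
  show "onM orbit_points_functor X Z (Cmp Map_eq X Y Z g f) = Cmp Fun_model (onO orbit_points_functor X)
      (onO orbit_points_functor Y) (onO orbit_points_functor Z) (onM orbit_points_functor Y Z g) (onM orbit_points_functor X Y f)"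
    unfolding O
  proof (rule nat_trans_eqI[OF _ c])
    show "onM orbit_points_functor X Z (Cmp Map_eq X Y Z g f) \<in> nat_trans (orbit_points X) (orbit_points Z)"
      using onM_orbit_points[OF X Z gf] by simp
    fix A :: "'u simp" and n y assume A: "A \<in> SS" and "y \<in> spx (fob (orbit_points X) A) n"
    then have y: "y \<in> spx (HOM (orbit A) X) n" by simp
    obtain s where s: "s \<in> pts A X n" "y = enc (ahom (orbit A) X) n s" using HOM_cases[OF X A y] .
    note fs = sqcomp_pts(1)[OF s(1) f SS_simplicial[OF A]]
    have "sqcomp (tensor (orbit A) (Delta n)) (sqcomp X g f) s
        = sqcomp (tensor (orbit A) (Delta n)) g (sqcomp (tensor (orbit A) (Delta n)) f s)"
      by (rule pts_eqI[OF sqcomp_pts(1)[OF s(1) gf SS_simplicial[OF A]] sqcomp_pts(1)[OF fs g SS_simplicial[OF A]]])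
        (use shom_in[OF ptsD(1)[OF s(1)]] shom_in[OF ptsD(2)[OF s(1)]] in simp_all)
    then show "onM orbit_points_functor X Z (Cmp Map_eq X Y Z g f) A n y
        = Cmp Fun_model (orbit_points X) (orbit_points Y) (orbit_points Z)
           (onM orbit_points_functor Y Z g) (onM orbit_points_functor X Y f) A n y"
      using y A by (simp add: s(2) onM_orbit_points_enc[OF X A s(1)] onM_orbit_points_enc[OF Y A fs])
  qed
qed

lemma realization_props:
  assumes Y: "simplicial_functor (Y :: 'u sfunctor)"
  shows "realization Y \<in> Ob Map_cat" "is_cowedge Y (realization Y) (realization_in Y)"
    and "(X :: 'u arrow) \<in> Ob Map_cat \<Longrightarrow> is_cowedge Y X w \<Longrightarrow> \<exists>!g. g \<in> squares (realization Y) X \<and>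
      (\<forall>A\<in>SS. sqcomp (tensor (orbit A) (fob Y A)) g (realization_in Y A) = w A)"
  using is_coend_realization[OF Y] unfolding is_coend_def by blast+

text \<open>Uniqueness in the universal property, in pointwise form: the images of the cowedge are
  enough to distinguish maps out of a realization.\<close>

lemma realization_mor_eqI:
  assumes Y: "simplicial_functor (Y :: 'u sfunctor)" and X: "(X :: 'u arrow) \<in> Ob Map_cat"
    and g: "g \<in> squares (realization Y) X" and h: "h \<in> squares (realization Y) X"
    and e0: "\<And>A n a y. A \<in> SS \<Longrightarrow> a \<in> spx A n \<Longrightarrow> y \<in> spx (fob Y A) n \<Longrightarrow>
      fst g n (fst (realization_in Y A) n (a, y)) = fst h n (fst (realization_in Y A) n (a, y))"
    and e1: "\<And>A n y. A \<in> SS \<Longrightarrow> y \<in> spx (fob Y A) n \<Longrightarrow>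
      snd g n (snd (realization_in Y A) n (undefined, y)) = snd h n (snd (realization_in Y A) n (undefined, y))"
  shows "g = h"
proof -
  have "sqcomp (tensor (orbit A) (fob Y A)) g (realization_in Y A)
      = sqcomp (tensor (orbit A) (fob Y A)) h (realization_in Y A)" if "A \<in> SS" for A
    unfolding sqcomp_def by (auto intro!: scomp_eqI simp: e0[OF that] e1[OF that])
  then show ?thesis
    using realization_props(3)[OF Y X cowedge_comp[OF Y realization_props(2)[OF Y] h]] g h by blast
qed

text \<open>The cowedge of \<open>Z\<close> composed with \<eta> is a cowedge for \<open>Y\<close>,
  so exactly one map fits the description in \<open>realization_functor\<close>. The two equations
  compute this map on the images of the cowedge of \<open>Y\<close>.\<close>

lemma onM_realization:
  fixes Y Z :: "'u sfunctor"
  assumes Y: "simplicial_functor Y" and Z: "simplicial_functor Z" and n: "\<eta> \<in> nat_trans Y Z"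
  shows "onM realization_functor Y Z \<eta> \<in> squares (realization Y) (realization Z)"
    and "A \<in> SS \<Longrightarrow> a \<in> spx A n \<Longrightarrow> y \<in> spx (fob Y A) n \<Longrightarrow>
      fst (onM realization_functor Y Z \<eta>) n (fst (realization_in Y A) n (a, y))
        = fst (realization_in Z A) n (a, \<eta> A n y)"
    and "A \<in> SS \<Longrightarrow> y \<in> spx (fob Y A) n \<Longrightarrow>
      snd (onM realization_functor Y Z \<eta>) n (snd (realization_in Y A) n (undefined, y))
        = snd (realization_in Z A) n (undefined, \<eta> A n y)"
proof -
  let ?w = "\<lambda>A. sqcomp (tensor (orbit A) (fob Y A)) (realization_in Z A) (tensor_map (orbit A) (fob Y A) (\<eta> A))"
  note ZD = cowedgeD[OF realization_props(2)[OF Z]]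
  have YS: "simplicial_set (fob Y A)" if "A \<in> SS" for A using sfunD(1)[OF Y that] by simp
  have t0: "fst (tensor_map (orbit A) (fob Y A) (\<eta> A)) k (a, y) = (a, \<eta> A k y)"
    if "a \<in> spx A k" "y \<in> spx (fob Y A) k" for A k a y
    using that by (simp add: tensor_map_def orbit_def)
  have t1: "snd (tensor_map (orbit A) (fob Y A) (\<eta> A)) k (undefined, y) = (undefined, \<eta> A k y)"
    if "y \<in> spx (fob Y A) k" for A k y
    using that by (simp add: tensor_map_def orbit_def)
  have tu: "fst (tensor_map (orbit A) (fob Y A) (\<eta> A)) k x = undefined" if "x \<notin> spx A k \<times> spx (fob Y A) k" for A k x
    using that by (simp add: tensor_map_def orbit_def)
  have tu': "snd (tensor_map (orbit A) (fob Y A) (\<eta> A)) k x = undefined" if "x \<notin> {undefined} \<times> spx (fob Y A) k" for A k x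
    using that by (simp add: tensor_map_def orbit_def)
  have tsq: "tensor_map (orbit A) (fob Y A) (\<eta> A) \<in> squares (tensor (orbit A) (fob Y A)) (tensor (orbit A) (fob Z A))"
    if A: "A \<in> SS" for A
  proof -
    note e = nat_transD(1)[OF n A]
    have "(fst (tensor_map (orbit A) (fob Y A) (\<eta> A)), snd (tensor_map (orbit A) (fob Y A) (\<eta> A)))
      \<in> squares (tensor (orbit A) (fob Y A)) (tensor (orbit A) (fob Z A))"
    proof (rule squaresI)
      show "fst (tensor_map (orbit A) (fob Y A) (\<eta> A)) \<in> smap (src (tensor (orbit A) (fob Y A))) (src (tensor (orbit A) (fob Z A)))"
        unfolding tensor_orbit
        by (rule smapI) (use A e YS[OF A] in \<open>auto simp: t0 tu smap_in[OF e] smap_opr[OF e]\<close>)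
      show "snd (tensor_map (orbit A) (fob Y A) (\<eta> A)) \<in> smap (tgt (tensor (orbit A) (fob Y A))) (tgt (tensor (orbit A) (fob Z A)))"
        unfolding tensor_orbit
        by (rule smapI) (use A e YS[OF A] in \<open>auto simp: t1 tu' smap_in[OF e] smap_opr[OF e]\<close>)
    qed (auto simp: t0 t1 smap_in[OF e])
    then show ?thesis by simp
  qed
  have cw: "is_cowedge Y (realization Z) ?w"
  proof (rule cowedgeI)
    fix A B :: "'u simp" and n f y
    assume AB: "A \<in> SS" "B \<in> SS" and f: "f \<in> smap (sprod A (Delta n)) B" and y: "y \<in> spx (fob Y B) n"
    note ac = act_in[OF Y AB f y] and \<eta>y = smap_in[OF nat_transD(1)[OF n AB(2)] y] and nt = nat_transD(3)[OF n Y Z AB f y]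
    show "fst (?w A) n (a, act Y A B n f y) = fst (?w B) n (f n (a, Did n), y)" if a: "a \<in> spx A n" for a
      using ZD(5)[OF AB(1) AB(2) f \<eta>y a] a ac y by (simp add: t0 nt shom_in[OF f a Did_Dmap])
    show "snd (?w A) n (undefined, act Y A B n f y) = snd (?w B) n (undefined, y)"
      using ZD(6)[OF AB(1) AB(2) f \<eta>y] ac y by (simp add: t1 nt)
  next
    fix A :: "'u simp" assume A: "A \<in> SS"
    show "?w A \<in> squares (tensor (orbit A) (fob Y A)) (realization Z)"
      by (rule sqcomp_squares[OF tsq[OF A] ZD(1)[OF A]]) (use A YS[OF A] in auto)
  qed
  let ?P = "\<lambda>g. g \<in> squares (realization Y) (realization Z) \<and>
    (\<forall>A\<in>SS. sqcomp (tensor (orbit A) (fob Y A)) g (realization_in Y A) = ?w A)"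
  have "?P (THE g. ?P g)"
    by (rule theI') (rule realization_props(3)[OF Y realization_props(1)[OF Z] cw])
  then have P: "?P (onM realization_functor Y Z \<eta>)" by (simp add: realization_functor_def)
  then show "onM realization_functor Y Z \<eta> \<in> squares (realization Y) (realization Z)" by blast
  show "fst (onM realization_functor Y Z \<eta>) n (fst (realization_in Y A) n (a, y))
        = fst (realization_in Z A) n (a, \<eta> A n y)" if "A \<in> SS" "a \<in> spx A n" "y \<in> spx (fob Y A) n"
  proof -
    have "fst (sqcomp (tensor (orbit A) (fob Y A)) (onM realization_functor Y Z \<eta>) (realization_in Y A)) n (a, y) = fst (?w A) n (a, y)"
      using P that(1) by metis
    then show ?thesis using that by (simp add: t0)
  qed
  show "snd (onM realization_functor Y Z \<eta>) n (snd (realization_in Y A) n (undefined, y))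
        = snd (realization_in Z A) n (undefined, \<eta> A n y)" if "A \<in> SS" "y \<in> spx (fob Y A) n"
  proof -
    have "snd (sqcomp (tensor (orbit A) (fob Y A)) (onM realization_functor Y Z \<eta>) (realization_in Y A)) n (undefined, y) = snd (?w A) n (undefined, y)"
      using P that(1) by metis
    then show ?thesis using that by (simp add: t1)
  qed
qed

lemma functor_realization:
  assumes cF: "is_category (Fun_model :: ('u sfunctor, _) model)"
    and cM: "is_category (Map_eq :: ('u arrow, _) model)"
  shows "is_functor (Fun_model :: ('u sfunctor, _) model) (Map_eq :: ('u arrow, _) model) realization_functor"
  unfolding is_functor_def
proof (intro conjI ballI)
  have O: "onO realization_functor Y = realization Y" for Y :: "'u sfunctor"
    by (simp add: realization_functor_def)
  fix X :: "'u sfunctor" assume "X \<in> Ob Fun_model"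
  then have sX: "small_functor X" by simp
  note X = small_functorD[OF sX] and oX = realization_props(1)[OF small_functorD[OF sX]]
  note iX = cowedgeD[OF realization_props(2)[OF X]]
  show "onO realization_functor X \<in> Ob Map_eq" using oX by (simp add: O)
  have idX: "Idm Fun_model X \<in> nat_trans X X" using cat_id[OF cF] sX by simp
  show "onM realization_functor X X (Idm Fun_model X) = Idm Map_eq (onO realization_functor X)"
    unfolding O
  proof (rule realization_mor_eqI[OF X oX onM_realization(1)[OF X X idX]])
    show "Idm Map_eq (realization X) \<in> squares (realization X) (realization X)"
      using cat_id[OF cM] oX by simp
    fix A :: "'u simp" and n y assume A: "A \<in> SS" and y: "y \<in> spx (fob X A) n"
    show "fst (onM realization_functor X X (Idm Fun_model X)) n (fst (realization_in X A) n (a, y))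
       = fst (Idm Map_eq (realization X)) n (fst (realization_in X A) n (a, y))" if a: "a \<in> spx A n" for a
      using onM_realization(2)[OF X X idX A a y] A a y smap_in[OF iX(2)[OF A], of "(a, y)" n]
      by (simp add: sqid_def)
    show "snd (onM realization_functor X X (Idm Fun_model X)) n (snd (realization_in X A) n (undefined, y))
       = snd (Idm Map_eq (realization X)) n (snd (realization_in X A) n (undefined, y))"
      using onM_realization(3)[OF X X idX A y] A y smap_in[OF iX(3)[OF A], of "(undefined, y)" n]
      by (simp add: sqid_def)
  qed
  fix Y :: "'u sfunctor" assume "Y \<in> Ob Fun_model"
  then have sY: "small_functor Y" by simp
  note Y = small_functorD[OF sY] and oY = realization_props(1)[OF small_functorD[OF sY]]
  fix f assume "f \<in> Hm Fun_model X Y"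
  then have f: "f \<in> nat_trans X Y" by simp
  note Lf = onM_realization[OF X Y f]
  show "onM realization_functor X Y f \<in> Hm Map_eq (onO realization_functor X) (onO realization_functor Y)"
    using Lf(1) by (simp add: O)
  fix Z :: "'u sfunctor" assume "Z \<in> Ob Fun_model"
  then have sZ: "small_functor Z" by simp
  note Z = small_functorD[OF sZ] and oZ = realization_props(1)[OF small_functorD[OF sZ]]
  fix g assume "g \<in> Hm Fun_model Y Z"
  then have g: "g \<in> nat_trans Y Z" by simp
  note Lg = onM_realization[OF Y Z g]
  have gf: "Cmp Fun_model X Y Z g f \<in> nat_trans X Z" using cat_comp[OF cF] sX sY sZ f g by simp
  note Lgf = onM_realization[OF X Z gf]
  show "onM realization_functor X Z (Cmp Fun_model X Y Z g f) = Cmp Map_eq (onO realization_functor X)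
      (onO realization_functor Y) (onO realization_functor Z) (onM realization_functor Y Z g) (onM realization_functor X Y f)"
    unfolding O
  proof (rule realization_mor_eqI[OF X oZ Lgf(1)])
    show "Cmp Map_eq (realization X) (realization Y) (realization Z) (onM realization_functor Y Z g) (onM realization_functor X Y f)
      \<in> squares (realization X) (realization Z)"
      using cat_comp[OF cM] oX oY oZ Lf(1) Lg(1) by simp
    fix A :: "'u simp" and n y assume A: "A \<in> SS" and y: "y \<in> spx (fob X A) n"
    note fy = smap_in[OF nat_transD(1)[OF f A] y]
    show "fst (onM realization_functor X Z (Cmp Fun_model X Y Z g f)) n (fst (realization_in X A) n (a, y))
      = fst (Cmp Map_eq (realization X) (realization Y) (realization Z) (onM realization_functor Y Z g) (onM realization_functor X Y f)) n
         (fst (realization_in X A) n (a, y))" if a: "a \<in> spx A n" for a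
      using Lgf(2)[OF A a y] Lf(2)[OF A a y] Lg(2)[OF A a fy] A a y smap_in[OF iX(2)[OF A], of "(a, y)" n]
      by simp
    show "snd (onM realization_functor X Z (Cmp Fun_model X Y Z g f)) n (snd (realization_in X A) n (undefined, y))
      = snd (Cmp Map_eq (realization X) (realization Y) (realization Z) (onM realization_functor Y Z g) (onM realization_functor X Y f)) n
         (snd (realization_in X A) n (undefined, y))"
      using Lgf(3)[OF A y] Lf(3)[OF A y] Lg(3)[OF A fy] A y smap_in[OF iX(3)[OF A], of "(undefined, y)" n]
      by simp
  qed
qed

text \<open>Both naturality laws are compared on a simplex \<open>y\<close> of \<open>Y A\<close>.
  There \<open>adj_app\<close> turns them into equations between points, which are checked at every
  \<open>(a, \<beta>)\<close>.\<close>

lemma adjunction: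
  assumes cF: "is_category (Fun_model :: ('u sfunctor, _) model)"
    and cM: "is_category (Map_eq :: ('u arrow, _) model)"
  shows "is_adjunction (Fun_model :: ('u sfunctor, _) model) (Map_eq :: ('u arrow, _) model)
    realization_functor orbit_points_functor adjunct"
proof -
  note fL = functor_realization[OF cF cM] and fR = functor_orbit_points[OF cF]
  note L = functorD[OF fL] and R = functorD[OF fR]
  have OL: "onO realization_functor Y = realization Y" and OR: "onO orbit_points_functor X = orbit_points X"
    for Y :: "'u sfunctor" and X :: "'u arrow"
    by (simp_all add: realization_functor_def orbit_points_functor_def)
  have adj_app: "adjunct Y X g A n y = enc (ahom (orbit A) X) n
      (transp_pt Y A (sqcomp (tensor (orbit A) (fob Y A)) g (realization_in Y A)) n y)"
    if "simplicial_functor Y" "g \<in> squares (realization Y) X" "A \<in> SS" "y \<in> spx (fob Y A) n"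
    for Y :: "'u sfunctor" and X g A n y
    using that by (simp add: adjunct_transp transp_def)
  have adj_in: "adjunct Y X g \<in> nat_trans Y (orbit_points X)"
    if "simplicial_functor Y" "X \<in> Ob Map_cat" "g \<in> squares (realization Y) X" for Y :: "'u sfunctor" and X g
    using adjunct_bij[OF that(1,2)] that(3) by (meson bij_betwE)
  show ?thesis
    unfolding is_adjunction_def OL OR
  proof (intro conjI ballI fL fR)
    fix Y :: "'u sfunctor" assume "Y \<in> Ob Fun_model"
    then have sY: "small_functor Y" by simp
    note Y = small_functorD[OF sY]
    note oY = realization_props(1)[OF Y] and iY = cowedgeD[OF realization_props(2)[OF Y]]
    { fix X :: "'u arrow" assume "X \<in> Ob Map_eq"
      then have X: "X \<in> Ob Map_cat" by simp
      have oX: "orbit_points X \<in> Ob Fun_model" using small_functor_orbit_points[OF X] by simp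
      show "bij_betw (adjunct Y X) (Hm Map_eq (realization Y) X) (Hm Fun_model Y (orbit_points X))"
        using adjunct_bij[OF Y X] by simp
      fix Z :: "'u arrow" assume "Z \<in> Ob Map_eq"
      then have Z: "Z \<in> Ob Map_cat" by simp
      have oZ: "orbit_points Z \<in> Ob Fun_model" using small_functor_orbit_points[OF Z] by simp
      fix g k assume "g \<in> Hm Map_eq (realization Y) X" "k \<in> Hm Map_eq X Z"
      then have g: "g \<in> squares (realization Y) X" and k: "k \<in> squares X Z" by auto
      have kg: "sqcomp (realization Y) k g \<in> squares (realization Y) Z"
        using cat_comp[OF cM, of "realization Y" X Z g k] oY X Z g k by simp
      show "adjunct Y Z (Cmp Map_eq (realization Y) X Z k g)
          = Cmp Fun_model Y (orbit_points X) (orbit_points Z) (onM orbit_points_functor X Z k) (adjunct Y X g)"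
      proof (rule nat_trans_eqI)
        show "adjunct Y Z (Cmp Map_eq (realization Y) X Z k g) \<in> nat_trans Y (orbit_points Z)"
          using adj_in[OF Y Z kg] by simp
        show "Cmp Fun_model Y (orbit_points X) (orbit_points Z) (onM orbit_points_functor X Z k) (adjunct Y X g)
            \<in> nat_trans Y (orbit_points Z)"
          using cat_comp[OF cF _ oX oZ, of Y] sY adj_in[OF Y X g] onM_orbit_points[OF X Z k] by simp
        fix A :: "'u simp" and n y assume A: "A \<in> SS" and y: "y \<in> spx (fob Y A) n"
        have YS: "simplicial_set (fob Y A)" using sfunD(1)[OF Y A] by simp
        have c: "is_cowedge Y X (\<lambda>A. sqcomp (tensor (orbit A) (fob Y A)) g (realization_in Y A))"
          "is_cowedge Y Z (\<lambda>A. sqcomp (tensor (orbit A) (fob Y A)) (sqcomp (realization Y) k g) (realization_in Y A))"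
          using cowedge_comp[OF Y realization_props(2)[OF Y]] g kg by auto
        note t = transp_pt_pts[OF Y c(1) A y] and t' = transp_pt_pts[OF Y c(2) A y]
        have "transp_pt Y A (sqcomp (tensor (orbit A) (fob Y A)) (sqcomp (realization Y) k g) (realization_in Y A)) n y
          = sqcomp (tensor (orbit A) (Delta n)) k
             (transp_pt Y A (sqcomp (tensor (orbit A) (fob Y A)) g (realization_in Y A)) n y)"
        proof (rule pts_eqI[OF t' sqcomp_pts(1)[OF t k SS_simplicial[OF A]]])
          fix j \<beta> assume b: "\<beta> \<in> Dmap j n"
          have y': "opr (fob Y A) j n \<beta> y \<in> spx (fob Y A) j" using YS b y by simp
          show "fst (transp_pt Y A (sqcomp (tensor (orbit A) (fob Y A)) (sqcomp (realization Y) k g) (realization_in Y A)) n y) j (a, \<beta>)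
             = fst (sqcomp (tensor (orbit A) (Delta n)) k (transp_pt Y A (sqcomp (tensor (orbit A) (fob Y A)) g (realization_in Y A)) n y)) j (a, \<beta>)"
            if a: "a \<in> spx A j" for a
            using a b y' smap_in[OF iY(2)[OF A], of "(a, opr (fob Y A) j n \<beta> y)" j] by simp
          show "snd (transp_pt Y A (sqcomp (tensor (orbit A) (fob Y A)) (sqcomp (realization Y) k g) (realization_in Y A)) n y) j (undefined, \<beta>)
             = snd (sqcomp (tensor (orbit A) (Delta n)) k (transp_pt Y A (sqcomp (tensor (orbit A) (fob Y A)) g (realization_in Y A)) n y)) j (undefined, \<beta>)"
            using b y' smap_in[OF iY(3)[OF A], of "(undefined, opr (fob Y A) j n \<beta> y)" j] by simp
        qed
        then show "adjunct Y Z (Cmp Map_eq (realization Y) X Z k g) A n y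
          = Cmp Fun_model Y (orbit_points X) (orbit_points Z) (onM orbit_points_functor X Z k) (adjunct Y X g) A n y"
          using A y by (simp add: adj_app[OF Y kg A y] adj_app[OF Y g A y] onM_orbit_points_enc[OF X A t])
      qed }
    fix Y' :: "'u sfunctor" assume "Y' \<in> Ob Fun_model"
    then have sY': "small_functor Y'" by simp
    note Y' = small_functorD[OF sY'] and oY' = realization_props(1)[OF small_functorD[OF sY']]
    fix X :: "'u arrow" assume "X \<in> Ob Map_eq"
    then have X: "X \<in> Ob Map_cat" by simp
    have oX: "orbit_points X \<in> Ob Fun_model" using small_functor_orbit_points[OF X] by simp
    fix f g assume "f \<in> Hm Fun_model Y Y'" "g \<in> Hm Map_eq (realization Y') X"
    then have f: "f \<in> nat_trans Y Y'" and g: "g \<in> squares (realization Y') X" by auto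
    note Lf = onM_realization[OF Y Y' f]
    have gf: "sqcomp (realization Y) g (onM realization_functor Y Y' f) \<in> squares (realization Y) X"
      using cat_comp[OF cM, of "realization Y" "realization Y'" X] oY oY' X g Lf(1) by simp
    show "adjunct Y X (Cmp Map_eq (realization Y) (realization Y') X g (onM realization_functor Y Y' f))
        = Cmp Fun_model Y Y' (orbit_points X) (adjunct Y' X g) f"
    proof (rule nat_trans_eqI)
      show "adjunct Y X (Cmp Map_eq (realization Y) (realization Y') X g (onM realization_functor Y Y' f)) \<in> nat_trans Y (orbit_points X)"
        using adj_in[OF Y X gf] by simp
      show "Cmp Fun_model Y Y' (orbit_points X) (adjunct Y' X g) f \<in> nat_trans Y (orbit_points X)"
        using cat_comp[OF cF _ _ oX, of Y Y'] sY sY' adj_in[OF Y' X g] f by simp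
      fix A :: "'u simp" and n y assume A: "A \<in> SS" and y: "y \<in> spx (fob Y A) n"
      have YS: "simplicial_set (fob Y A)" using sfunD(1)[OF Y A] by simp
      note fA = nat_transD(1)[OF f A]
      have fy: "f A n y \<in> spx (fob Y' A) n" using smap_in[OF fA y] .
      have c: "is_cowedge Y' X (\<lambda>A. sqcomp (tensor (orbit A) (fob Y' A)) g (realization_in Y' A))"
        "is_cowedge Y X (\<lambda>A. sqcomp (tensor (orbit A) (fob Y A)) (sqcomp (realization Y) g (onM realization_functor Y Y' f)) (realization_in Y A))"
        using cowedge_comp[OF Y' realization_props(2)[OF Y'] g] cowedge_comp[OF Y realization_props(2)[OF Y] gf] by auto
      note t = transp_pt_pts[OF Y' c(1) A fy] and t' = transp_pt_pts[OF Y c(2) A y]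
      have "transp_pt Y A (sqcomp (tensor (orbit A) (fob Y A)) (sqcomp (realization Y) g (onM realization_functor Y Y' f)) (realization_in Y A)) n y
        = transp_pt Y' A (sqcomp (tensor (orbit A) (fob Y' A)) g (realization_in Y' A)) n (f A n y)"
      proof (rule pts_eqI[OF t' t])
        fix j \<beta> assume b: "\<beta> \<in> Dmap j n"
        have y': "opr (fob Y A) j n \<beta> y \<in> spx (fob Y A) j" using YS b y by simp
        note fy' = smap_in[OF fA y'] and fo = smap_opr[OF fA b y]
        show "fst (transp_pt Y A (sqcomp (tensor (orbit A) (fob Y A)) (sqcomp (realization Y) g (onM realization_functor Y Y' f)) (realization_in Y A)) n y) j (a, \<beta>)
           = fst (transp_pt Y' A (sqcomp (tensor (orbit A) (fob Y' A)) g (realization_in Y' A)) n (f A n y)) j (a, \<beta>)"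
          if a: "a \<in> spx A j" for a
          using a b y' fy' fo Lf(2)[OF A a y'] smap_in[OF iY(2)[OF A], of "(a, opr (fob Y A) j n \<beta> y)" j] by simp
        show "snd (transp_pt Y A (sqcomp (tensor (orbit A) (fob Y A)) (sqcomp (realization Y) g (onM realization_functor Y Y' f)) (realization_in Y A)) n y) j (undefined, \<beta>)
           = snd (transp_pt Y' A (sqcomp (tensor (orbit A) (fob Y' A)) g (realization_in Y' A)) n (f A n y)) j (undefined, \<beta>)"
          using b y' fy' fo Lf(3)[OF A y'] smap_in[OF iY(3)[OF A], of "(undefined, opr (fob Y A) j n \<beta> y)" j] by simp
      qed
      then show "adjunct Y X (Cmp Map_eq (realization Y) (realization Y') X g (onM realization_functor Y Y' f)) A n y
        = Cmp Fun_model Y Y' (orbit_points X) (adjunct Y' X g) f A n y"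
        using A y fy by (simp add: adj_app[OF Y gf A y] adj_app[OF Y' g A fy])
    qed
  qed
qed

end

section \<open>Lifting against boundary inclusions\<close>

text \<open>The maps that are not surjective are the simplices of the boundary of
  \<open>\<Delta>\<^sup>n\<close>; the surjective ones index the degeneracies of its top
  simplex.\<close>

definition dsurj :: "nat \<Rightarrow> nat \<Rightarrow> (nat \<Rightarrow> nat) \<Rightarrow> bool" where
  "dsurj k n \<theta> \<longleftrightarrow> \<theta> ` {..k} = {..n}"

lemma dsurjI: "\<theta> \<in> Dmap k n \<Longrightarrow> (\<And>t. t \<le> n \<Longrightarrow> \<exists>i\<le>k. \<theta> i = t) \<Longrightarrow> dsurj k n \<theta>"
  unfolding dsurj_def by (auto simp: Dmap_le image_iff)

lemma dsurjE: "dsurj k n \<theta> \<Longrightarrow> t \<le> n \<Longrightarrow> \<exists>i\<le>k. \<theta> i = t"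
  unfolding dsurj_def by (metis atMost_iff imageE)

lemma dsurj_comp: "dsurj j k \<gamma> \<Longrightarrow> dsurj k n \<theta> \<Longrightarrow> dsurj j n (compose {..j} \<theta> \<gamma>)"
  unfolding dsurj_def by (simp add: compose_def image_image[symmetric])

lemma dsurj_comp_left:
  "\<gamma> \<in> Dmap j k \<Longrightarrow> \<theta> \<in> Dmap k n \<Longrightarrow> dsurj j n (compose {..j} \<theta> \<gamma>) \<Longrightarrow> dsurj k n \<theta>"
  by (rule dsurjI) (auto dest!: dsurjE intro: Dmap_le)

lemma dsurj_Did [simp]: "dsurj n n (Did n)"
  by (auto simp: dsurj_def Did_def)

lemma not_dsurj_factor:
  assumes t: "\<theta> \<in> Dmap k n" and ns: "\<not> dsurj k n \<theta>"
  obtains m \<sigma> \<mu> where "m < n" "\<sigma> \<in> Dmap k m" "\<mu> \<in> Dmap m n" "\<theta> = compose {..k} \<mu> \<sigma>"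
proof -
  obtain i where i: "i \<le> n" "\<And>x. x \<le> k \<Longrightarrow> \<theta> x \<noteq> i" using dsurjI[OF t] ns by blast
  \<comment> \<open>A map to \<open>[0]\<close> is onto, so \<open>n - 1\<close> is a genuine
    predecessor.\<close>
  have "n \<noteq> 0" using i Dmap_le[OF t, of 0] by force
  define m where "m = n - 1"
  have n: "n = Suc m" using \<open>n \<noteq> 0\<close> by (simp add: m_def)
  \<comment> \<open>\<mu> is the coface that skips the missed value \<open>i\<close>, and \<sigma>
    is \<theta> renumbered in the remaining \<open>m + 1\<close> values.\<close>
  define \<mu> where "\<mu> = (\<lambda>x\<in>{..m}. if x < i then x else Suc x)"
  define \<sigma> where "\<sigma> = (\<lambda>x\<in>{..k}. if \<theta> x < i then \<theta> x else \<theta> x - 1)"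
  have le: "\<theta> x \<le> Suc m" "\<theta> x \<noteq> i" if "x \<le> k" for x using Dmap_le[OF t that] i(2)[OF that] n by auto
  have "\<mu> \<in> Dmap m n" unfolding \<mu>_def by (rule restrict_DmapI) (auto simp: n)
  moreover have "\<sigma> \<in> Dmap k m" unfolding \<sigma>_def
  proof (rule restrict_DmapI)
    show "(if \<theta> x < i then \<theta> x else \<theta> x - 1) \<le> m" if "x \<le> k" for x
      using le[OF that] i(1) n by auto
    show "(if \<theta> x < i then \<theta> x else \<theta> x - 1) \<le> (if \<theta> y < i then \<theta> y else \<theta> y - 1)"
      if "x \<le> y" "y \<le> k" for x y
      using Dmap_mono[OF t that] le[of x] le[of y] that by auto
  qed
  moreover have "\<theta> = compose {..k} \<mu> \<sigma>"
  proof (rule Dmap_eqI[OF t comp_Dmap[OF calculation(2,1)]])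
    fix x assume x: "x \<le> k"
    show "\<theta> x = compose {..k} \<mu> \<sigma> x"
      using x le[OF x] i(1) n by (auto simp: \<mu>_def \<sigma>_def)
  qed
  ultimately show thesis using that[of m \<sigma> \<mu>] n by simp
qed

text \<open>Any section of a monotone surjection is monotone, so its values may be chosen freely in
  the fibres. Passing through a prescribed \<open>i\<close> is what identifies two surjections in
  the Eilenberg--Zilber argument.\<close>

lemma dsurj_section:
  assumes s: "\<sigma> \<in> Dmap k n" and su: "dsurj k n \<sigma>" and i: "i \<le> k"
  obtains \<delta> where "\<delta> \<in> Dmap n k" "compose {..n} \<sigma> \<delta> = Did n" "\<delta> (\<sigma> i) = i"
proof -
  define d where "d t = (if t = \<sigma> i then i else (SOME x. x \<le> k \<and> \<sigma> x = t))" for t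
  have d: "d t \<le> k \<and> \<sigma> (d t) = t" if "t \<le> n" for t
    using someI_ex[OF dsurjE[OF su that]] i by (simp add: d_def)
  have dm: "d t \<le> d t'" if "t \<le> t'" "t' \<le> n" for t t'
  proof (rule ccontr)
    assume "\<not> d t \<le> d t'"
    then have "\<sigma> (d t') \<le> \<sigma> (d t)" using d[of t] that by (intro Dmap_mono[OF s]) auto
    then have "t = t'" using d[of t] d[of t'] that by auto
    then show False using \<open>\<not> d t \<le> d t'\<close> by simp
  qed
  have D: "restrict d {..n} \<in> Dmap n k" using d dm by (intro restrict_DmapI) auto
  show thesis
  proof (rule that[OF D])
    show "compose {..n} \<sigma> (restrict d {..n}) = Did n"
      using d by (intro Dmap_eqI[OF comp_Dmap[OF D s] Did_Dmap]) (simp add: Did_def)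
    show "restrict d {..n} (\<sigma> i) = i" using Dmap_le[OF s i] by (simp add: d_def)
  qed
qed

text \<open>A surjection of a finite chain onto itself is injective, hence strictly increasing.
  Counting from below gives \<open>x \<le> \<tau> x\<close>, and counting from the top the
  reverse.\<close>

lemma dsurj_endo:
  assumes t: "\<tau> \<in> Dmap n n" and su: "dsurj n n \<tau>"
  shows "\<tau> = Did n"
proof (rule Dmap_eqI[OF t Did_Dmap])
  have inj: "inj_on \<tau> {..n}" using su by (intro finite_surj_inj) (auto simp: dsurj_def)
  have lt: "\<tau> x < \<tau> (Suc x)" if "Suc x \<le> n" for x
    using Dmap_mono[OF t _ that, of x] inj_onD[OF inj, of x "Suc x"] that by force
  have ge: "x \<le> \<tau> x" if "x \<le> n" for x
    using that by (induction x) (auto dest!: lt)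
  have le: "d \<le> n \<Longrightarrow> \<tau> (n - d) \<le> n - d" for d
  proof (induction d)
    case 0 then show ?case using Dmap_le[OF t] by simp
  next
    case (Suc d) then show ?case using lt[of "n - Suc d"] by (simp add: Suc_diff_Suc)
  qed
  fix i assume "i \<le> n"
  then show "\<tau> i = Did n i" using ge[of i] le[of "n - i"] by (simp add: Did_def)
qed

text \<open>The right lifting property against all boundary inclusions, \<open>n = 0\<close>
  included. A map out of the boundary of \<open>\<Delta>\<^sup>n\<close> is written as a compatible
  family on the maps to \<open>[n]\<close> that are not surjective; the values of \<open>u\<close>
  elsewhere are arbitrary.\<close>

definition bdry_lift :: "'a simp \<Rightarrow> 'b simp \<Rightarrow> (nat \<Rightarrow> 'a \<Rightarrow> 'b) \<Rightarrow> bool" where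
  "bdry_lift E B p \<longleftrightarrow>
     (\<forall>n u. \<forall>y\<in>spx B n.
        (\<forall>k. \<forall>\<theta>\<in>Dmap k n. \<not> dsurj k n \<theta> \<longrightarrow>
           u k \<theta> \<in> spx E k \<and> p k (u k \<theta>) = opr B k n \<theta> y \<and>
           (\<forall>j. \<forall>\<gamma>\<in>Dmap j k. u j (compose {..j} \<theta> \<gamma>) = opr E j k \<gamma> (u k \<theta>))) \<longrightarrow>
        (\<exists>e\<in>spx E n. p n e = y \<and> (\<forall>k. \<forall>\<theta>\<in>Dmap k n. \<not> dsurj k n \<theta> \<longrightarrow> opr E k n \<theta> e = u k \<theta>)))"

text \<open>Zorn's lemma for graphs of partial lifts: a simplex of least dimension outside the domain
  has its boundary inside, and its degeneracies are distinct by the Eilenberg--Zilber argument.\<close>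

lemma bdry_lift_inclusion:
  assumes E: "simplicial_set E" and B: "simplicial_set B" and W: "simplicial_set W"
    and p: "p \<in> smap E B" and bl: "bdry_lift E B p"
    and Z: "\<And>n. Z n \<subseteq> spx W n" and Zo: "\<And>m n \<alpha> z. \<alpha> \<in> Dmap m n \<Longrightarrow> z \<in> Z n \<Longrightarrow> opr W m n \<alpha> z \<in> Z m"
    and v: "v \<in> smap W B"
    and u: "\<And>n z. z \<in> Z n \<Longrightarrow> u n z \<in> spx E n"
    and uo: "\<And>m n \<alpha> z. \<alpha> \<in> Dmap m n \<Longrightarrow> z \<in> Z n \<Longrightarrow> u m (opr W m n \<alpha> z) = opr E m n \<alpha> (u n z)"
    and pu: "\<And>n z. z \<in> Z n \<Longrightarrow> p n (u n z) = v n z"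
  obtains l where "l \<in> smap W E" "\<forall>n. \<forall>z\<in>Z n. l n z = u n z" "\<forall>n. \<forall>w\<in>spx W n. p n (l n w) = v n w"
proof -
  define ok where "ok G \<longleftrightarrow>
     (\<forall>n w e. (n, w, e) \<in> G \<longrightarrow> w \<in> spx W n \<and> e \<in> spx E n \<and> p n e = v n w) \<and>
     (\<forall>n w e e'. (n, w, e) \<in> G \<longrightarrow> (n, w, e') \<in> G \<longrightarrow> e = e') \<and>
     (\<forall>n w e m \<alpha>. (n, w, e) \<in> G \<longrightarrow> \<alpha> \<in> Dmap m n \<longrightarrow> (m, opr W m n \<alpha> w, opr E m n \<alpha> e) \<in> G)" for G
  have ok_sv: "e = e'" if "ok G" "(n, w, e) \<in> G" "(n, w, e') \<in> G" for G n w e e'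
  proof -
    have "\<forall>n w e e'. (n, w, e) \<in> G \<longrightarrow> (n, w, e') \<in> G \<longrightarrow> e = e'" using that(1) unfolding ok_def by (elim conjE)
    then show ?thesis using that(2,3) by blast
  qed
  define G0 where "G0 = {(n, z, u n z) | n z. z \<in> Z n}"
  let ?A = "{G. G0 \<subseteq> G \<and> ok G}"
  have "ok G0" unfolding ok_def G0_def using Z Zo u uo pu by (auto; blast)
  then have ne: "?A \<noteq> {}" by blast
  have ch: "\<Union>\<C> \<in> ?A" if C: "\<C> \<noteq> {}" "subset.chain ?A \<C>" for \<C>
  proof -
    have C1: "G0 \<subseteq> G" "ok G" if "G \<in> \<C>" for G using C(2) that unfolding subset.chain_def by auto
    have sv: "e = e'" if "(n, w, e) \<in> \<Union>\<C>" "(n, w, e') \<in> \<Union>\<C>" for n w e e'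
    proof -
      from that obtain G G' where G: "G \<in> \<C>" "(n, w, e) \<in> G" "G' \<in> \<C>" "(n, w, e') \<in> G'" by blast
      have "G \<subseteq> G' \<or> G' \<subseteq> G" using C(2) G unfolding subset.chain_def by blast
      then show ?thesis using ok_sv[OF C1(2)[OF G(1)]] ok_sv[OF C1(2)[OF G(3)]] G by blast
    qed
    have "ok (\<Union>\<C>)" unfolding ok_def
    proof (intro conjI allI impI)
      fix n w e assume "(n, w, e) \<in> \<Union>\<C>"
      then obtain G where G: "G \<in> \<C>" "(n, w, e) \<in> G" by blast
      then have o: "ok G" using C1 by blast
      show "w \<in> spx W n" "e \<in> spx E n" "p n e = v n w" using o G(2) unfolding ok_def by blast+
      show "(m, opr W m n \<alpha> w, opr E m n \<alpha> e) \<in> \<Union>\<C>" if "\<alpha> \<in> Dmap m n" for m \<alpha>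
        using o G that unfolding ok_def by blast
    qed (rule sv)
    moreover have "G0 \<subseteq> \<Union>\<C>" using C(1) C1(1) by blast
    ultimately show ?thesis by blast
  qed
  obtain M where M: "G0 \<subseteq> M" "ok M" and max: "\<And>G. ok G \<Longrightarrow> M \<subseteq> G \<Longrightarrow> G = M"
    using subset_Zorn_nonempty[OF ne ch] by (auto dest: subset_trans)
  have M1: "w \<in> spx W n" "e \<in> spx E n" "p n e = v n w" if "(n, w, e) \<in> M" for n w e
    using M(2) that unfolding ok_def by blast+
  have M2: "e = e'" if "(n, w, e) \<in> M" "(n, w, e') \<in> M" for n w e e' using ok_sv[OF M(2) that] .
  have M3: "(m, opr W m n \<alpha> w, opr E m n \<alpha> e) \<in> M" if "(n, w, e) \<in> M" "\<alpha> \<in> Dmap m n" for n w e m \<alpha>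
    using M(2) that unfolding ok_def by blast
  have total: "\<exists>e. (n, w, e) \<in> M" if w: "w \<in> spx W n" for n w
  proof (rule ccontr)
    assume no: "\<nexists>e. (n, w, e) \<in> M"
    define n0 where "n0 = (LEAST n. \<exists>w\<in>spx W n. \<nexists>e. (n, w, e) \<in> M)"
    have "\<exists>w\<in>spx W n0. \<nexists>e. (n0, w, e) \<in> M" unfolding n0_def by (rule LeastI[of _ n]) (use w no in blast)
    then obtain w0 where w0: "w0 \<in> spx W n0" "\<And>e. (n0, w0, e) \<notin> M" by blast
    have below: "\<exists>e. (m, x, e) \<in> M" if "m < n0" "x \<in> spx W m" for m x
      using not_less_Least[of m "\<lambda>n. \<exists>w\<in>spx W n. \<nexists>e. (n, w, e) \<in> M"] that unfolding n0_def by blast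
    \<comment> \<open>A map that is not surjective factors through some dimension
      \<open>m < n0\<close>, where by minimality of \<open>n0\<close> the domain of \<open>M\<close>
      is everything.\<close>
    have bd: "\<exists>e. (k, opr W k n0 \<theta> w0, e) \<in> M" if \<theta>: "\<theta> \<in> Dmap k n0" "\<not> dsurj k n0 \<theta>" for k \<theta>
    proof -
      obtain m \<sigma> \<mu> where f: "m < n0" "\<sigma> \<in> Dmap k m" "\<mu> \<in> Dmap m n0" "\<theta> = compose {..k} \<mu> \<sigma>"
        using not_dsurj_factor[OF \<theta>] .
      obtain e where "(m, opr W m n0 \<mu> w0, e) \<in> M" using below[OF f(1) opr_in[OF W f(3) w0(1)]] by blast
      then show ?thesis using M3[OF _ f(2)] opr_opr[OF W f(2,3) w0(1)] f(4) by force
    qed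
    define a where "a k \<theta> = (THE e. (k, opr W k n0 \<theta> w0, e) \<in> M)" for k \<theta>
    have a: "(k, opr W k n0 \<theta> w0, a k \<theta>) \<in> M" if "\<theta> \<in> Dmap k n0" "\<not> dsurj k n0 \<theta>" for k \<theta>
      unfolding a_def by (rule theI') (use bd[OF that] M2 in blast)
    have "\<exists>e\<in>spx E n0. p n0 e = v n0 w0 \<and> (\<forall>k. \<forall>\<theta>\<in>Dmap k n0. \<not> dsurj k n0 \<theta> \<longrightarrow> opr E k n0 \<theta> e = a k \<theta>)"
    proof (rule bl[unfolded bdry_lift_def, rule_format])
      show "v n0 w0 \<in> spx B n0" using smap_in[OF v w0(1)] .
      fix k \<theta> assume \<theta>: "\<theta> \<in> Dmap k n0" "\<not> dsurj k n0 \<theta>"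
      show "a k \<theta> \<in> spx E k \<and> p k (a k \<theta>) = opr B k n0 \<theta> (v n0 w0) \<and>
        (\<forall>j. \<forall>\<gamma>\<in>Dmap j k. a j (compose {..j} \<theta> \<gamma>) = opr E j k \<gamma> (a k \<theta>))"
      proof (intro conjI allI ballI)
        show "a k \<theta> \<in> spx E k" using M1[OF a[OF \<theta>]] by simp
        show "p k (a k \<theta>) = opr B k n0 \<theta> (v n0 w0)" using M1[OF a[OF \<theta>]] smap_opr[OF v \<theta>(1) w0(1)] by simp
        fix j \<gamma> assume g: "\<gamma> \<in> Dmap j k"
        have ns: "\<not> dsurj j n0 (compose {..j} \<theta> \<gamma>)" using dsurj_comp_left[OF g \<theta>(1)] \<theta>(2) by blast
        show "a j (compose {..j} \<theta> \<gamma>) = opr E j k \<gamma> (a k \<theta>)"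
          using M2[OF a[OF comp_Dmap[OF g \<theta>(1)] ns]] M3[OF a[OF \<theta>] g] opr_opr[OF W g \<theta>(1) w0(1)] by simp
      qed
    qed
    then obtain e where e: "e \<in> spx E n0" "p n0 e = v n0 w0"
        "\<And>k \<theta>. \<theta> \<in> Dmap k n0 \<Longrightarrow> \<not> dsurj k n0 \<theta> \<Longrightarrow> opr E k n0 \<theta> e = a k \<theta>" by blast
    \<comment> \<open>The subcomplex generated by \<open>w0\<close>, with the chosen lift. By
      \<open>sur\<close> it meets the domain of \<open>M\<close> only in boundary simplices, where
      the lifts agree; over surjections it is single valued by \<open>EZ\<close>.\<close>
    let ?N = "{(k, opr W k n0 \<sigma> w0, opr E k n0 \<sigma> e) | k \<sigma>. \<sigma> \<in> Dmap k n0}"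
    have sur: "(k, opr W k n0 \<sigma> w0, b) \<notin> M" if s: "\<sigma> \<in> Dmap k n0" "dsurj k n0 \<sigma>" for k \<sigma> b
    proof
      assume m: "(k, opr W k n0 \<sigma> w0, b) \<in> M"
      obtain \<delta> where d: "\<delta> \<in> Dmap n0 k" "compose {..n0} \<sigma> \<delta> = Did n0" using dsurj_section[OF s le0] by blast
      have "opr W n0 k \<delta> (opr W k n0 \<sigma> w0) = w0" using opr_opr[OF W d(1) s(1) w0(1)] d(2) W w0(1) by simp
      then show False using M3[OF m d(1)] w0(2) by simp
    qed
    have EZ: "\<sigma> = \<tau>" if s: "\<sigma> \<in> Dmap k n0" "dsurj k n0 \<sigma>" and t: "\<tau> \<in> Dmap k n0"
      and eq: "opr W k n0 \<sigma> w0 = opr W k n0 \<tau> w0" for k \<sigma> \<tau>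
    proof (rule Dmap_eqI[OF s(1) t])
      fix i assume i: "i \<le> k"
      obtain \<delta> where d: "\<delta> \<in> Dmap n0 k" "compose {..n0} \<sigma> \<delta> = Did n0" "\<delta> (\<sigma> i) = i"
        using dsurj_section[OF s i] by blast
      have td: "compose {..n0} \<tau> \<delta> \<in> Dmap n0 n0" using d(1) t by simp
      have w: "opr W n0 n0 (compose {..n0} \<tau> \<delta>) w0 = w0"
        using opr_opr[OF W d(1) s(1) w0(1)] opr_opr[OF W d(1) t w0(1)] eq d(2) W w0(1) by simp
      \<comment> \<open>Otherwise \<open>w0\<close> would itself be a simplex of its boundary and
        lie in the domain of \<open>M\<close>.\<close>
      have "dsurj n0 n0 (compose {..n0} \<tau> \<delta>)"
        using bd[OF td] w w0(2) by (metis)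
      then have "compose {..n0} \<tau> \<delta> = Did n0" by (rule dsurj_endo[OF td])
      then have "compose {..n0} \<tau> \<delta> (\<sigma> i) = Did n0 (\<sigma> i)" by simp
      then show "\<sigma> i = \<tau> i" using d(3) Dmap_le[OF s(1) i] by (simp add: Did_def)
    qed
    have MN: "b = opr E k n0 \<sigma> e" if m: "(k, opr W k n0 \<sigma> w0, b) \<in> M" and s: "\<sigma> \<in> Dmap k n0" for k \<sigma> b
    proof -
      have ns: "\<not> dsurj k n0 \<sigma>" using sur[OF s] m by blast
      then show ?thesis using M2[OF m a[OF s ns]] e(3)[OF s ns] by simp
    qed
    have NN: "opr E k n0 \<sigma> e = opr E k n0 \<tau> e"
      if s: "\<sigma> \<in> Dmap k n0" and t: "\<tau> \<in> Dmap k n0" and eq: "opr W k n0 \<sigma> w0 = opr W k n0 \<tau> w0" for k \<sigma> \<tau>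
    proof (cases "dsurj k n0 \<sigma>")
      case True
      then show ?thesis using EZ[OF s True t eq] by simp
    next
      case False
      have "(k, opr W k n0 \<tau> w0, a k \<sigma>) \<in> M" using a[OF s False] eq by simp
      from MN[OF this t] show ?thesis using e(3)[OF s False] by simp
    qed
    have "ok (M \<union> ?N)" unfolding ok_def
    proof (intro conjI allI impI)
      fix k x b assume "(k, x, b) \<in> M \<union> ?N"
      then have "(k, x, b) \<in> M \<or> (\<exists>\<sigma>\<in>Dmap k n0. x = opr W k n0 \<sigma> w0 \<and> b = opr E k n0 \<sigma> e)" by blast
      then show "x \<in> spx W k" "b \<in> spx E k" "p k b = v k x"
        using M1 e W E w0(1) smap_opr[OF p] smap_opr[OF v] by auto
    next
      fix k x b b' assume "(k, x, b) \<in> M \<union> ?N" "(k, x, b') \<in> M \<union> ?N"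
      then show "b = b'" using M2 MN NN by blast
    next
      fix k x b m \<alpha> assume "(k, x, b) \<in> M \<union> ?N" and al: "\<alpha> \<in> Dmap m k"
      then consider "(k, x, b) \<in> M" | \<sigma> where "\<sigma> \<in> Dmap k n0" "x = opr W k n0 \<sigma> w0" "b = opr E k n0 \<sigma> e" by blast
      then show "(m, opr W m k \<alpha> x, opr E m k \<alpha> b) \<in> M \<union> ?N"
      proof cases
        case 1 then show ?thesis using M3[OF _ al] by blast
      next
        case 2
        then have "opr W m k \<alpha> x = opr W m n0 (compose {..m} \<sigma> \<alpha>) w0" "opr E m k \<alpha> b = opr E m n0 (compose {..m} \<sigma> \<alpha>) e"
          using opr_opr[OF W al _ w0(1)] opr_opr[OF E al _ e(1)] by auto
        then show ?thesis using comp_Dmap[OF al 2(1)] by blast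
      qed
    qed
    then have "M \<union> ?N = M" by (rule max) simp
    moreover have "(n0, w0, e) \<in> ?N" using opr_Did[OF W w0(1)] opr_Did[OF E e(1)]
      by (intro CollectI exI[of _ n0] exI[of _ "Did n0"]) simp
    ultimately show False using w0(2) by blast
  qed
  define l where "l n = (\<lambda>w\<in>spx W n. THE e. (n, w, e) \<in> M)" for n
  have l: "(n, w, l n w) \<in> M" if "w \<in> spx W n" for n w
  proof -
    have "(n, w, THE e. (n, w, e) \<in> M) \<in> M" by (rule theI') (use total[OF that] M2 in blast)
    then show ?thesis using that by (simp add: l_def)
  qed
  show thesis
  proof (rule that)
    show "l \<in> smap W E"
    proof (rule smapI)
      fix n w assume w: "w \<in> spx W n"
      show "l n w \<in> spx E n" using M1[OF l[OF w]] by simp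
      fix m \<alpha> assume al: "\<alpha> \<in> Dmap m n"
      show "l m (opr W m n \<alpha> w) = opr E m n \<alpha> (l n w)"
        using M2[OF l[OF opr_in[OF W al w]] M3[OF l[OF w] al]] .
    qed (simp add: l_def)
    show "\<forall>n. \<forall>z\<in>Z n. l n z = u n z"
    proof (intro allI ballI)
      fix n z assume z: "z \<in> Z n"
      have "(n, z, u n z) \<in> M" using z M(1) by (auto simp: G0_def)
      then show "l n z = u n z" using M2[OF l] Z[of n] z by blast
    qed
    show "\<forall>n. \<forall>w\<in>spx W n. p n (l n w) = v n w" using M1[OF l] by simp
  qed
qed

text \<open>A horn is closed under the operators of \<open>\<Delta>\<^sup>n\<close>, so it can serve
  as the partial domain \<open>Z\<close> in \<open>bdry_lift_inclusion\<close>.\<close>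

lemma bdry_lift_kan_fibration:
  assumes E: "simplicial_set E" and B: "simplicial_set B" and p: "p \<in> smap E B" and bl: "bdry_lift E B p"
  shows "kan_fibration E B p"
  unfolding kan_fibration_def
proof (intro conjI allI impI ballI p)
  fix n k u v
  assume u: "u \<in> smap (horn n k) E" and v: "v \<in> smap (Delta n) B"
    and eq: "scomp (horn n k) p u = scomp (horn n k) v (sid (horn n k))"
  have hs: "spx (horn n k) m \<subseteq> spx (Delta n) m" for m by (auto simp: horn_def)
  have ho: "opr (horn n k) = opr (Delta n)" by (simp add: horn_def)
  have hc: "opr (Delta n) m j \<alpha> z \<in> spx (horn n k) m" if "\<alpha> \<in> Dmap m j" "z \<in> spx (horn n k) j" for m j \<alpha> z
  proof -
    from that(2) obtain i where z: "z \<in> Dmap j n" and i: "i \<le> n" "i \<noteq> k" "i \<notin> z ` {..j}"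
      by (auto simp: horn_def)
    have "i \<notin> compose {..m} z \<alpha> ` {..m}" using i(3) Dmap_le[OF that(1)] by (auto simp: compose_def)
    then show ?thesis using i z that(1) by (auto simp: horn_def)
  qed
  have pu: "p j (u j z) = v j z" if "z \<in> spx (horn n k) j" for j z
    using fun_cong[OF fun_cong[OF eq], of j z] that by simp
  obtain l where l: "l \<in> smap (Delta n) E" "\<forall>j. \<forall>z\<in>spx (horn n k) j. l j z = u j z"
      "\<forall>j. \<forall>w\<in>spx (Delta n) j. p j (l j w) = v j w"
    by (rule bdry_lift_inclusion[where Z = "spx (horn n k)" and u = u,
          OF E B simplicial_set_Delta p bl hs hc v smap_in[OF u]
          smap_opr[OF u, unfolded ho] pu])
  show "\<exists>h\<in>smap (Delta n) E. scomp (horn n k) h (sid (horn n k)) = u \<and> scomp (Delta n) p h = v"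
  proof (intro bexI[of _ l] conjI)
    show "scomp (horn n k) l (sid (horn n k)) = u"
    proof (intro ext)
      fix m x show "scomp (horn n k) l (sid (horn n k)) m x = u m x"
        by (cases "x \<in> spx (horn n k) m") (simp_all add: l(2) smap_undefined[OF u])
    qed
    show "scomp (Delta n) p l = v"
      by (rule smap_eqI[OF scomp_smap[OF simplicial_set_Delta l(1) p] v]) (simp add: l(3))
  qed (rule l(1))
qed

section \<open>Components and weak equivalences\<close>

lemma symcl_equiv:
  fixes E :: "('a \<times> 'a) set"
  defines "R \<equiv> (E \<union> E\<inverse>)\<^sup>*"
  shows "(x, y) \<in> R \<Longrightarrow> R `` {x} = R `` {y}" and "R `` {x} = R `` {y} \<Longrightarrow> (x, y) \<in> R"
proof -
  have "sym R" unfolding R_def by (intro sym_rtrancl sym_Un_converse)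
  moreover have "trans R" unfolding R_def by (rule trans_rtrancl)
  ultimately show "(x, y) \<in> R \<Longrightarrow> R `` {x} = R `` {y}" by (blast dest: symD transD)
  show "R `` {x} = R `` {y} \<Longrightarrow> (x, y) \<in> R" unfolding R_def by blast
qed

text \<open>This is \<open>\<pi>\<^sub>0\<close> of a deformation retraction: one composite is the
  identity, and at each point the other is joined to the identity by a single generating
  edge.\<close>

lemma quotient_bij:
  fixes D :: "('a \<times> 'a) set" and E :: "('b \<times> 'b) set"
  defines "R \<equiv> (D \<union> D\<inverse>)\<^sup>*" and "Q \<equiv> (E \<union> E\<inverse>)\<^sup>*"
  assumes f: "\<And>x. x \<in> S \<Longrightarrow> f x \<in> T" "\<And>x y. (x, y) \<in> D \<Longrightarrow> (f x, f y) \<in> E"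
    and g: "\<And>y. y \<in> T \<Longrightarrow> g y \<in> S" "\<And>x y. (x, y) \<in> E \<Longrightarrow> (g x, g y) \<in> D"
    and gf: "\<And>x. x \<in> S \<Longrightarrow> g (f x) = x" and fg: "\<And>y. y \<in> T \<Longrightarrow> (f (g y), y) \<in> E"
  shows "bij_betw (\<lambda>c. Q `` (f ` c)) (S // R) (T // Q)"
proof -
  have fR: "(f x, f y) \<in> Q" if "(x, y) \<in> R" for x y
    using that unfolding R_def Q_def
    by induction (auto intro: rtrancl.rtrancl_into_rtrancl dest!: f(2))
  have gR: "(g x, g y) \<in> R" if "(x, y) \<in> Q" for x y
    using that unfolding R_def Q_def
    by induction (auto intro: rtrancl.rtrancl_into_rtrancl dest!: g(2))
  have cl: "Q `` (f ` (R `` {x})) = Q `` {f x}" for x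
  proof -
    have "Q `` {f y} = Q `` {f x}" if "(x, y) \<in> R" for y
      using symcl_equiv(1)[of "f x" "f y" E] fR[OF that] unfolding Q_def by simp
    moreover have "(x, x) \<in> R" by (simp add: R_def)
    ultimately show ?thesis by blast
  qed
  show ?thesis
  proof (rule bij_betw_imageI)
    show "inj_on (\<lambda>c. Q `` (f ` c)) (S // R)"
    proof (rule inj_onI)
      fix c c' assume "c \<in> S // R" "c' \<in> S // R" and e: "Q `` (f ` c) = Q `` (f ` c')"
      then obtain x x' where x: "x \<in> S" "c = R `` {x}" "x' \<in> S" "c' = R `` {x'}" by (auto simp: quotient_def)
      have "Q `` {f x} = Q `` {f x'}" using e unfolding x cl .
      then have "(f x, f x') \<in> Q" unfolding Q_def by (rule symcl_equiv(2))
      then have "(x, x') \<in> R" using gR gf x by metis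
      then show "c = c'" unfolding x R_def by (rule symcl_equiv(1))
    qed
    show "(\<lambda>c. Q `` (f ` c)) ` (S // R) = T // Q"
    proof (intro equalityI subsetI)
      fix d assume "d \<in> (\<lambda>c. Q `` (f ` c)) ` (S // R)"
      then obtain x where "x \<in> S" "d = Q `` {f x}" by (auto simp: quotient_def cl)
      then show "d \<in> T // Q" using f(1) by (auto simp: quotient_def)
    next
      fix d assume "d \<in> T // Q"
      then obtain y where y: "y \<in> T" "d = Q `` {y}" by (auto simp: quotient_def)
      have "(f (g y), y) \<in> Q" using fg[OF y(1)] by (auto simp: Q_def)
      then have "Q `` {f (g y)} = Q `` {y}" unfolding Q_def by (rule symcl_equiv(1))
      then have "d = Q `` (f ` (R `` {g y}))" unfolding cl y(2) by (rule sym)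
      then show "d \<in> (\<lambda>c. Q `` (f ` c)) ` (S // R)" using g(1)[OF y(1)] by (auto simp: quotient_def)
    qed
  qed
qed

lemma precomp_app [simp]:
  "h \<in> smap (sprod Y (Delta n)) K \<Longrightarrow> x \<in> spx X k \<Longrightarrow> \<beta> \<in> Dmap k n \<Longrightarrow>
   precomp X Y K f n h k (x, \<beta>) = h k (f k x, \<beta>)"
  by (simp add: precomp_def)

lemma precomp_smap:
  assumes "h \<in> smap (sprod Y (Delta n)) K" "f \<in> smap X Y" "simplicial_set X"
  shows "precomp X Y K f n h \<in> smap (sprod X (Delta n)) K"
proof (rule shomI)
  fix k x \<beta> assume x: "x \<in> spx X k" and b: "\<beta> \<in> Dmap k n"
  note fx = smap_in[OF assms(2) x]
  show "precomp X Y K f n h k (x, \<beta>) \<in> spx K k" using x b shom_in[OF assms(1) fx b] assms(1) by simp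
  fix j \<gamma> assume g: "\<gamma> \<in> Dmap j k"
  show "precomp X Y K f n h j (opr X j k \<gamma> x, compose {..j} \<beta> \<gamma>) = opr K j k \<gamma> (precomp X Y K f n h k (x, \<beta>))"
    using x b g assms shom_opr[OF assms(1) g fx b] by (simp add: smap_opr[OF assms(2)])
qed (use assms(1) in \<open>auto simp: precomp_def\<close>)

lemma pull_precomp:
  assumes "h \<in> smap (sprod Y (Delta n)) K" "f \<in> smap X Y" "simplicial_set X" "simplicial_set Y" "\<alpha> \<in> Dmap m n"
  shows "pull X m \<alpha> (precomp X Y K f n h) = precomp X Y K f m (pull Y m \<alpha> h)"
proof (rule shom_eqI[OF pull_smap[OF precomp_smap[OF assms(1-3)] assms(5,3)]
      precomp_smap[OF pull_smap[OF assms(1,5,4)] assms(2,3)]])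
  fix k x \<beta> assume x: "x \<in> spx X k" and b: "\<beta> \<in> Dmap k m"
  show "pull X m \<alpha> (precomp X Y K f n h) k (x, \<beta>) = precomp X Y K f m (pull Y m \<alpha> h) k (x, \<beta>)"
    using x b assms smap_in[OF assms(2) x] pull_smap[OF assms(1,5,4)] by simp
qed

definition vertex :: "nat \<Rightarrow> nat \<Rightarrow> nat \<Rightarrow> nat" where
  "vertex k i = (\<lambda>x\<in>{..k}. i)"

lemma vertex_Dmap [simp]: "i \<le> n \<Longrightarrow> vertex k i \<in> Dmap k n"
  unfolding vertex_def by (rule restrict_DmapI) auto

lemma comp_vertex [simp]: "\<beta> \<in> Dmap j k \<Longrightarrow> compose {..j} (vertex k i) \<beta> = vertex j i"
  by (rule ext) (auto simp: compose_def vertex_def Dmap_le)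

lemma vertex_inj: "vertex k i = vertex k j \<Longrightarrow> i = j"
  by (drule fun_cong[of _ _ 0]) (simp add: vertex_def)

lemma Dmap_0: "\<beta> \<in> Dmap k 0 \<Longrightarrow> \<beta> = vertex k 0"
  by (rule Dmap_eqI[OF _ vertex_Dmap[of 0 0]]) (auto simp: vertex_def dest: Dmap_le)

text \<open>A lift of the identity is a section \<open>s\<close>, and a lift along \<open>E \<times> \<partial>\<Delta>\<^sup>1 \<subseteq> E \<times> \<Delta>\<^sup>1\<close> is a
  homotopy from \<open>s p\<close> to the identity.\<close>

lemma bdry_lift_weak_equivalence:
  fixes E B :: "'u simp"
  assumes E: "simplicial_set E" and B: "simplicial_set B" and p: "p \<in> smap E B" and bl: "bdry_lift E B p"
  shows "weak_equivalence E B p"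
proof -
  obtain s where s: "s \<in> smap B E" and "\<forall>n. \<forall>b\<in>spx B n. p n (s n b) = sid B n b"
    by (rule bdry_lift_inclusion[where Z = "\<lambda>_. {}" and v = "sid B" and u = undefined, OF E B B p bl])
      (use B in auto)
  then have ps: "p n (s n b) = b" if "b \<in> spx B n" for n b using that by simp
  \<comment> \<open>The two ends of the cylinder \<open>E \<times> \<Delta>\<^sup>1\<close>, which
    consist of the simplices with constant second coordinate. On the end 0 the map \<open>u\<close>
    is \<open>s p\<close>, on the end 1 it is the identity.\<close>
  define Z where "Z n = {(x, \<beta>). x \<in> spx E n \<and> (\<beta> = vertex n 0 \<or> \<beta> = vertex n 1)}" for n
  define u where "u n z = (if snd z = vertex n 0 then s n (p n (fst z)) else fst z)" for n z
  define v where "v n = (\<lambda>z\<in>spx (sprod E (Delta 1)) n. p n (fst z))" for n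
  have W: "simplicial_set (sprod E (Delta 1))" using E by simp
  have Zs: "Z n \<subseteq> spx (sprod E (Delta 1)) n" for n by (auto simp: Z_def)
  have Zo: "opr (sprod E (Delta 1)) m n \<alpha> z \<in> Z m" if "\<alpha> \<in> Dmap m n" "z \<in> Z n" for m n \<alpha> z
    using that E by (auto simp: Z_def)
  have v: "v \<in> smap (sprod E (Delta 1)) B"
    by (rule smapI) (use E in \<open>auto simp: v_def smap_in[OF p] smap_opr[OF p]\<close>)
  have u: "u n z \<in> spx E n" if "z \<in> Z n" for n z
    using that smap_in[OF s smap_in[OF p]] by (auto simp: Z_def u_def)
  have n01: "vertex k (Suc 0) \<noteq> vertex k 0" for k using vertex_inj[of k "Suc 0" 0] by auto
  have uo: "u m (opr (sprod E (Delta 1)) m n \<alpha> z) = opr E m n \<alpha> (u n z)" if "\<alpha> \<in> Dmap m n" "z \<in> Z n" for m n \<alpha> z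
    using that smap_opr[OF p that(1)] smap_opr[OF s that(1) smap_in[OF p]] n01 by (auto simp: Z_def u_def)
  have pu: "p n (u n z) = v n z" if "z \<in> Z n" for n z
    using that ps[OF smap_in[OF p]] by (auto simp: Z_def u_def v_def)
  obtain H where H: "H \<in> smap (sprod E (Delta 1)) E" and Hu: "\<forall>n. \<forall>z\<in>Z n. H n z = u n z"
    by (rule bdry_lift_inclusion[where Z = Z and u = u, OF E B W p bl Zs Zo v u uo pu])
  have H0: "H n (x, vertex n 0) = s n (p n x)" and H1: "H n (x, vertex n 1) = x" if "x \<in> spx E n" for n x
    using that Hu n01 by (auto simp: Z_def u_def)
  \<comment> \<open>Contravariance turns the roles round: since \<open>p s\<close> is the identity,
    so is precomposition with \<open>p\<close> followed by precomposition with \<open>s\<close>, and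
    \<open>H\<close> joins the other composite to the identity.\<close>
  have "bij_betw (pi0_map (shom E K) (precomp E B K p)) (pi0 (shom B K)) (pi0 (shom E K))" for K :: "'u simp"
  proof -
    define D where "D S = {(opr S 0 1 (vertex 0 0) e, opr S 0 1 (vertex 0 1) e) | e. e \<in> spx S 1}"
      for S :: "(nat \<Rightarrow> 'u \<times> (nat \<Rightarrow> nat) \<Rightarrow> 'u) simp"
    have rel: "pi0_rel S = (D S \<union> (D S)\<inverse>)\<^sup>*" for S :: "(nat \<Rightarrow> 'u \<times> (nat \<Rightarrow> nat) \<Rightarrow> 'u) simp"
      unfolding pi0_rel_def D_def vertex_def Let_def ..
    have pe: "(precomp X Y K f 0 a, precomp X Y K f 0 b) \<in> D (shom X K)"
      if "(a, b) \<in> D (shom Y K)" "f \<in> smap X Y" "simplicial_set X" "simplicial_set Y" for X Y :: "'u simp" and f a b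
    proof -
      from that(1) obtain e where e: "e \<in> smap (sprod Y (Delta 1)) K"
          "a = pull Y 0 (vertex 0 0) e" "b = pull Y 0 (vertex 0 1) e"
        by (auto simp: D_def)
      show ?thesis unfolding D_def
        using precomp_smap[OF e(1) that(2,3)] pull_precomp[OF e(1) that(2-4)]
        by (intro CollectI exI[of _ "precomp X Y K f 1 e"]) (simp add: e(2,3))
    qed
    show ?thesis
      unfolding pi0_map_def pi0_def rel
    proof (rule quotient_bij[where g = "precomp B E K s 0"])
      show "precomp E B K p 0 h \<in> spx (shom E K) 0" if "h \<in> spx (shom B K) 0" for h
        using precomp_smap[OF _ p E] that by simp
      show "precomp B E K s 0 h \<in> spx (shom B K) 0" if "h \<in> spx (shom E K) 0" for h
        using precomp_smap[OF _ s B] that by simp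
      show "(precomp E B K p 0 x, precomp E B K p 0 y) \<in> D (shom E K)" if "(x, y) \<in> D (shom B K)" for x y
        by (rule pe[OF that p E B])
      show "(precomp B E K s 0 x, precomp B E K s 0 y) \<in> D (shom B K)" if "(x, y) \<in> D (shom E K)" for x y
        by (rule pe[OF that s B E])
      show "precomp B E K s 0 (precomp E B K p 0 h) = h" if "h \<in> spx (shom B K) 0" for h
      proof -
        have h: "h \<in> smap (sprod B (Delta 0)) K" using that by simp
        note ph = precomp_smap[OF h p E]
        show ?thesis
          by (rule shom_eqI[OF precomp_smap[OF ph s B] h]) (simp add: precomp_app[OF ph] precomp_app[OF h] smap_in[OF s] ps)
      qed
      show "(precomp E B K p 0 (precomp B E K s 0 h), h) \<in> D (shom E K)" if "h \<in> spx (shom E K) 0" for h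
      proof -
        have h: "h \<in> smap (sprod E (Delta 0)) K" using that by simp
        note sh = precomp_smap[OF h s B]
        \<comment> \<open>The homotopy \<open>h\<close> after \<open>H\<close>. As \<open>h\<close>
          is a vertex of \<open>hom(E, K)\<close>, its second coordinate has to be the constant map
          \<open>vertex k 0\<close>.\<close>
        define e where "e k = (\<lambda>z\<in>spx (sprod E (Delta 1)) k. h k (H k z, vertex k 0))" for k
        have e: "e \<in> smap (sprod E (Delta 1)) K"
        proof (rule smapI)
          fix k z assume z: "z \<in> spx (sprod E (Delta 1)) k"
          note Hz = smap_in[OF H z]
          show "e k z \<in> spx K k" using z shom_in[OF h Hz vertex_Dmap] by (simp add: e_def)
          fix j \<gamma> assume g: "\<gamma> \<in> Dmap j k"
          show "e j (opr (sprod E (Delta 1)) j k \<gamma> z) = opr K j k \<gamma> (e k z)"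
            using shom_opr[OF h g Hz vertex_Dmap, of 0] z g opr_in[OF W g z]
            by (simp add: e_def smap_opr[OF H g z] del: spx_sprod One_nat_def)
        qed (simp add: e_def)
        have e01: "pull E 0 (vertex 0 0) e = precomp E B K p 0 (precomp B E K s 0 h)" "pull E 0 (vertex 0 1) e = h"
        proof (rule shom_eqI[OF pull_smap[OF e vertex_Dmap E] precomp_smap[OF sh p E]])
          fix k x \<beta> assume x: "x \<in> spx E k" and b: "\<beta> \<in> Dmap k 0"
          show "pull E 0 (vertex 0 0) e k (x, \<beta>) = precomp E B K p 0 (precomp B E K s 0 h) k (x, \<beta>)"
            using x b Dmap_0[OF b] by (simp add: e_def H0 precomp_app[OF sh] precomp_app[OF h] smap_in[OF p])
        next
          show "pull E 0 (vertex 0 1) e = h"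
          proof (rule shom_eqI[OF pull_smap[OF e vertex_Dmap E] h])
            fix k x \<beta> assume x: "x \<in> spx E k" and b: "\<beta> \<in> Dmap k 0"
            show "pull E 0 (vertex 0 1) e k (x, \<beta>) = h k (x, \<beta>)"
              using x b Dmap_0[OF b] H1[OF x] by (simp add: e_def)
          qed simp
        qed simp
        show ?thesis unfolding D_def using e e01 by (intro CollectI exI[of _ e]) simp
      qed
    qed
  qed
  then show ?thesis unfolding weak_equivalence_def using p by blast
qed

section \<open>Extension from the interior of a prism\<close>

text \<open>The default 0 keeps the set nonempty, so that \<open>Max\<close> is meaningful; it is
  also the wanted value at positions before the first index with the property.\<close>

definition lst :: "nat \<Rightarrow> (nat \<Rightarrow> bool) \<Rightarrow> nat" where
  "lst j P = Max {x. x \<le> j \<and> (x = 0 \<or> P x)}"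

lemma lst: "lst j P \<le> j" "lst j P = 0 \<or> P (lst j P)" "x \<le> j \<Longrightarrow> P x \<Longrightarrow> x \<le> lst j P"
proof -
  let ?S = "{x. x \<le> j \<and> (x = 0 \<or> P x)}"
  have f: "finite ?S" and ne: "0 \<in> ?S" by auto
  have "lst j P \<in> ?S" unfolding lst_def by (rule Max_in[OF f]) (use ne in blast)
  then show "lst j P \<le> j" "lst j P = 0 \<or> P (lst j P)" by auto
  show "x \<le> lst j P" if "x \<le> j" "P x" unfolding lst_def by (rule Max_ge[OF f]) (use that in blast)
qed

lemma lst_mono: "(\<And>x. P x \<Longrightarrow> Q x) \<Longrightarrow> lst j P \<le> lst j Q"
  using lst(1,2)[of j P] lst(3)[of _ j Q] by (metis le0)

text \<open>The maximal chain of \<open>[j] \<times> [n]\<close> through the graph of \<open>\<beta>\<close> that goes up before it goes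
  right; its point on \<open>x + t = m\<close> is \<open>(stair_x j n \<beta> m, stair_y j n \<beta> m)\<close>.\<close>

definition stair_x :: "nat \<Rightarrow> nat \<Rightarrow> (nat \<Rightarrow> nat) \<Rightarrow> nat \<Rightarrow> nat" where
  "stair_x j n \<beta> = (\<lambda>m\<in>{..j + n}. lst j (\<lambda>x. x + \<beta> x \<le> m))"

definition stair_y :: "nat \<Rightarrow> nat \<Rightarrow> (nat \<Rightarrow> nat) \<Rightarrow> nat \<Rightarrow> nat" where
  "stair_y j n \<beta> = (\<lambda>m\<in>{..j + n}. m - lst j (\<lambda>x. x + \<beta> x \<le> m))"

definition stair_graph :: "nat \<Rightarrow> (nat \<Rightarrow> nat) \<Rightarrow> nat \<Rightarrow> nat" where
  "stair_graph j \<beta> = (\<lambda>x\<in>{..j}. x + \<beta> x)"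

text \<open>Every simplex \<open>(a, \<beta>)\<close> of \<open>A \<times> \<Delta>\<^sup>n\<close>
  is a face, along \<open>stair_graph\<close>, of the simplex formed by the pullback of
  \<open>a\<close> along \<open>stair_x\<close> and by \<open>stair_y\<close>, whose second
  coordinate is surjective. So the interior simplices generate the prism. The dimension
  \<open>j + n\<close> provides one point on each antidiagonal of
  \<open>[j] \<times> [n]\<close>.\<close>

lemma stair:
  assumes b: "\<beta> \<in> Dmap j n"
  shows stair_x_Dmap: "stair_x j n \<beta> \<in> Dmap (j + n) j"
    and stair_y_Dmap: "stair_y j n \<beta> \<in> Dmap (j + n) n"
    and stair_graph_Dmap: "stair_graph j \<beta> \<in> Dmap j (j + n)"
    and stair_y_dsurj: "dsurj (j + n) n (stair_y j n \<beta>)"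
    and stair_x_graph: "compose {..j} (stair_x j n \<beta>) (stair_graph j \<beta>) = Did j"
    and stair_y_graph: "compose {..j} (stair_y j n \<beta>) (stair_graph j \<beta>) = \<beta>"
proof -
  let ?r = "\<lambda>m. lst j (\<lambda>x. x + \<beta> x \<le> m)"
  have rm: "?r m \<le> ?r m'" if "m \<le> m'" for m m' by (rule lst_mono) (use that in auto)
  have rle: "?r m \<le> m" for m using lst(2)[of j "\<lambda>x. x + \<beta> x \<le> m"] by auto
  \<comment> \<open>The chain goes right by at most one step at a time; hence its second coordinate
    never decreases.\<close>
  have rS: "?r (Suc m) \<le> Suc (?r m)" for m
  proof (rule ccontr)
    assume a: "\<not> ?thesis"
    let ?x = "?r (Suc m) - 1"
    have le: "?r (Suc m) \<le> j" by (rule lst(1))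
    have "?r (Suc m) + \<beta> (?r (Suc m)) \<le> Suc m" using lst(2)[of j "\<lambda>x. x + \<beta> x \<le> Suc m"] a by auto
    moreover have "\<beta> ?x \<le> \<beta> (?r (Suc m))" by (rule Dmap_mono[OF b _ le]) simp
    ultimately have "?x + \<beta> ?x \<le> m" using a by linarith
    then have "?x \<le> ?r m" by (intro lst(3)) (use le in auto)
    then show False using a by linarith
  qed
  have top: "?r (j + n) = j"
    using lst(1)[of j] lst(3)[of j j "\<lambda>x. x + \<beta> x \<le> j + n"] Dmap_le[OF b, of j] by (simp add: le_antisym)
  have ym: "m - ?r m \<le> m' - ?r m'" if "m \<le> m'" for m m'
  proof (use that in \<open>induction rule: dec_induct\<close>)
    case (step k) then show ?case using rS[of k] rle[of "Suc k"] by linarith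
  qed simp
  have gr: "?r (x + \<beta> x) = x" if "x \<le> j" for x
  proof (rule le_antisym)
    show "x \<le> ?r (x + \<beta> x)" by (rule lst(3)) (use that in auto)
    show "?r (x + \<beta> x) \<le> x"
    proof (rule ccontr)
      assume a: "\<not> ?thesis"
      have le: "?r (x + \<beta> x) \<le> j" by (rule lst(1))
      have "\<beta> x \<le> \<beta> (?r (x + \<beta> x))" by (rule Dmap_mono[OF b _ le]) (use a in simp)
      then show False using lst(2)[of j "\<lambda>y. y + \<beta> y \<le> x + \<beta> x"] a by auto
    qed
  qed
  show X: "stair_x j n \<beta> \<in> Dmap (j + n) j"
    unfolding stair_x_def by (rule restrict_DmapI) (use rm lst(1) in auto)
  show Y: "stair_y j n \<beta> \<in> Dmap (j + n) n"
    unfolding stair_y_def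
  proof (rule restrict_DmapI)
    show "m - ?r m \<le> n" if "m \<le> j + n" for m using ym[OF that] top by simp
  qed (use ym in auto)
  have xb: "x + \<beta> x \<le> j + n" if "x \<le> j" for x using Dmap_le[OF b that] that by simp
  show G: "stair_graph j \<beta> \<in> Dmap j (j + n)"
    unfolding stair_graph_def
    by (rule restrict_DmapI) (use xb in auto, meson Dmap_mono[OF b] add_mono)
  show "dsurj (j + n) n (stair_y j n \<beta>)"
  proof (rule dsurjI[OF Y])
    fix t assume t: "t \<le> n"
    have "\<exists>m\<le>j + n. m - ?r m = t"
    proof -
      \<comment> \<open>The second coordinate rises by at most one at a time, so the first point at
        which it reaches \<open>t\<close> has it equal to \<open>t\<close>.\<close>
      let ?m = "LEAST m. t \<le> m - ?r m"
      have N: "t \<le> (j + n) - ?r (j + n)" using t top by simp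
      have m: "t \<le> ?m - ?r ?m" by (rule LeastI[of _ "j + n"]) (rule N)
      have "?m \<le> j + n" by (rule Least_le) (rule N)
      moreover have "?m - ?r ?m = t"
      proof (cases ?m)
        case (Suc m')
        have "\<not> t \<le> m' - ?r m'" using not_less_Least[of m' "\<lambda>m. t \<le> m - ?r m"] Suc by simp
        then show ?thesis using m rm[of m' "Suc m'"] rle[of m'] unfolding Suc by linarith
      qed (use m in simp)
      ultimately show ?thesis by blast
    qed
    then show "\<exists>i\<le>j + n. stair_y j n \<beta> i = t" by (auto simp: stair_y_def)
  qed
  show "compose {..j} (stair_x j n \<beta>) (stair_graph j \<beta>) = Did j"
    by (rule Dmap_eqI[OF comp_Dmap[OF G X] Did_Dmap]) (use xb gr in \<open>simp add: stair_x_def stair_graph_def Did_def\<close>)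
  show "compose {..j} (stair_y j n \<beta>) (stair_graph j \<beta>) = \<beta>"
    by (rule Dmap_eqI[OF comp_Dmap[OF G Y] b]) (use xb gr in \<open>simp add: stair_y_def stair_graph_def\<close>)
qed

text \<open>The value at \<open>(a, \<beta>)\<close> is a face of the value at its staircase
  simplex, which is interior; the common operators then give the same face on both sides.\<close>

lemma interior_unique:
  assumes A: "simplicial_set A" and h: "h \<in> smap (sprod A (Delta n)) C" "h' \<in> smap (sprod A (Delta n)) C'"
    and e: "\<And>k a \<beta>. a \<in> spx A k \<Longrightarrow> \<beta> \<in> Dmap k n \<Longrightarrow> dsurj k n \<beta> \<Longrightarrow> h k (a, \<beta>) = h' k (a, \<beta>)"
    and opr: "opr C = opr C'"
  shows "h = h'"
proof (rule shom_eqI[OF h])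
  fix j a \<beta> assume a: "a \<in> spx A j" and b: "\<beta> \<in> Dmap j n"
  note s = stair[OF b]
  let ?a = "opr A (j + n) j (stair_x j n \<beta>) a"
  have a': "?a \<in> spx A (j + n)" "opr A j (j + n) (stair_graph j \<beta>) ?a = a"
    using A s a by (auto simp: opr_opr)
  show "h j (a, \<beta>) = h' j (a, \<beta>)"
    using shom_opr[OF h(1) s(3) a'(1) s(2)] shom_opr[OF h(2) s(3) a'(1) s(2)] e[OF a'(1) s(2,4)] a'(2) s(6) opr
    by simp
qed

text \<open>The value at \<open>(a, \<beta>)\<close> is forced: it must be a face of the datum on
  the staircase simplex of \<open>(a, \<beta>)\<close>. What has to be shown is that faces of data
  depend only on the faces of the interior simplices and not on the simplices themselves. This is
  \<open>main\<close>, and naturality of \<open>h\<close> is an instance of it.\<close>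

lemma interior_extension:
  assumes A: "simplicial_set A" and C: "simplicial_set C"
    and w: "\<And>k a \<beta>. a \<in> spx A k \<Longrightarrow> \<beta> \<in> Dmap k n \<Longrightarrow> dsurj k n \<beta> \<Longrightarrow> w k a \<beta> \<in> spx C k"
    and wo: "\<And>j k \<gamma> a \<beta>. \<gamma> \<in> Dmap j k \<Longrightarrow> a \<in> spx A k \<Longrightarrow> \<beta> \<in> Dmap k n \<Longrightarrow> dsurj k n \<beta> \<Longrightarrow>
      dsurj j n (compose {..j} \<beta> \<gamma>) \<Longrightarrow> w j (opr A j k \<gamma> a) (compose {..j} \<beta> \<gamma>) = opr C j k \<gamma> (w k a \<beta>)"
  obtains h where "h \<in> smap (sprod A (Delta n)) C"
    "\<forall>k. \<forall>a\<in>spx A k. \<forall>\<beta>\<in>Dmap k n. dsurj k n \<beta> \<longrightarrow> h k (a, \<beta>) = w k a \<beta>"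
proof -
  text \<open>A chain and the chain with one point moved up are faces of a common chain.\<close>
  have step: "opr C j K \<delta> (w K (opr A K K \<pi> c) \<kappa>) = opr C j K \<delta> (w K (opr A K K \<pi>' c) \<kappa>)"
    if \<kappa>: "\<kappa> \<in> Dmap K n" "dsurj K n \<kappa>" and c: "c \<in> spx A K" and \<delta>: "\<delta> \<in> Dmap j K"
      and \<pi>: "\<pi> \<in> Dmap K K" "\<pi>' \<in> Dmap K K" and ne: "\<And>i. i \<le> K \<Longrightarrow> i \<noteq> s \<Longrightarrow> \<pi> i = \<pi>' i"
      and s: "s \<le> K" "\<pi> s \<le> \<pi>' s" "\<And>x. x \<le> j \<Longrightarrow> \<delta> x \<noteq> s"
    for K j \<kappa> c \<delta> \<pi> \<pi>' s
  proof -
    \<comment> \<open>\<omega> runs through \<pi> up to \<open>s\<close> and continues with \<pi>'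
      from \<open>s\<close> on. Omitting its point \<open>s + 1\<close>, by \<open>d\<close>,
      returns \<pi>; omitting the point \<open>s\<close>, by \<open>d'\<close>, returns \<pi>'. As
      \<delta> misses \<open>s\<close>, it does not see the difference.\<close>
    define \<omega> where "\<omega> = (\<lambda>i\<in>{..Suc K}. if i \<le> s then \<pi> i else \<pi>' (i - 1))"
    define \<sigma> where "\<sigma> = (\<lambda>i\<in>{..Suc K}. if i \<le> s then i else i - 1)"
    define d where "d = (\<lambda>i\<in>{..K}. if i \<le> s then i else Suc i)"
    define d' where "d' = (\<lambda>i\<in>{..K}. if i < s then i else Suc i)"
    have le: "\<pi> i \<le> \<pi>' i'" if "i \<le> i'" "i' \<le> K" for i i'
    proof -
      have "\<pi> i' \<le> \<pi>' i'" using s(2) ne[OF that(2)] by (cases "i' = s") auto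
      then show ?thesis using Dmap_mono[OF \<pi>(1) that] by (rule le_trans[rotated])
    qed
    have \<omega>: "\<omega> \<in> Dmap (Suc K) K" unfolding \<omega>_def
    proof (rule restrict_DmapI)
      show "(if i \<le> s then \<pi> i else \<pi>' (i - 1)) \<le> K" if "i \<le> Suc K" for i
        using that s(1) Dmap_le[OF \<pi>(1), of i] Dmap_le[OF \<pi>(2), of "i - 1"] by auto
      show "(if i \<le> s then \<pi> i else \<pi>' (i - 1)) \<le> (if i' \<le> s then \<pi> i' else \<pi>' (i' - 1))"
        if "i \<le> i'" "i' \<le> Suc K" for i i'
        using that s(1) Dmap_mono[OF \<pi>(1), of i i'] Dmap_mono[OF \<pi>(2), of "i - 1" "i' - 1"] le[of i "i' - 1"] by auto
    qed
    have \<sigma>: "\<sigma> \<in> Dmap (Suc K) K" unfolding \<sigma>_def by (rule restrict_DmapI) (use s(1) in auto)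
    have d: "d \<in> Dmap K (Suc K)" "d' \<in> Dmap K (Suc K)" unfolding d_def d'_def by (rule restrict_DmapI; auto)+
    have \<sigma>d: "compose {..K} \<sigma> d = Did K" "compose {..K} \<sigma> d' = Did K"
      by (rule Dmap_eqI[OF comp_Dmap[OF d(1) \<sigma>] Did_Dmap], use s(1) in \<open>simp add: \<sigma>_def d_def Did_def\<close>)
        (rule Dmap_eqI[OF comp_Dmap[OF d(2) \<sigma>] Did_Dmap], use s(1) in \<open>auto simp: \<sigma>_def d'_def Did_def\<close>)
    have \<omega>d: "compose {..K} \<omega> d = \<pi>"
      by (rule Dmap_eqI[OF comp_Dmap[OF d(1) \<omega>] \<pi>(1)]) (use s(1) ne in \<open>simp add: \<omega>_def d_def\<close>)
    have \<omega>d': "compose {..K} \<omega> d' = \<pi>'"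
      by (rule Dmap_eqI[OF comp_Dmap[OF d(2) \<omega>] \<pi>(2)]) (use s(1) ne in \<open>simp add: \<omega>_def d'_def\<close>)
    have dd: "compose {..j} d \<delta> = compose {..j} d' \<delta>"
      by (rule Dmap_eqI[OF comp_Dmap[OF \<delta> d(1)] comp_Dmap[OF \<delta> d(2)]])
        (use s(3) Dmap_le[OF \<delta>] in \<open>force simp: d_def d'_def\<close>)
    let ?\<kappa> = "compose {..Suc K} \<kappa> \<sigma>" and ?c = "opr A (Suc K) K \<omega> c"
    have \<sigma>s: "dsurj (Suc K) K \<sigma>"
      by (rule dsurj_comp_left[OF d(1) \<sigma>]) (simp add: \<sigma>d)
    have \<kappa>': "?\<kappa> \<in> Dmap (Suc K) n" "dsurj (Suc K) n ?\<kappa>" using \<sigma> \<kappa> dsurj_comp[OF \<sigma>s \<kappa>(2)] by auto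
    have c': "?c \<in> spx A (Suc K)" using A \<omega> c by simp
    have kd: "compose {..K} ?\<kappa> d = \<kappa>" "compose {..K} ?\<kappa> d' = \<kappa>"
      using \<sigma>d \<kappa>(1) by (simp_all add: comp_comp_Dmap[OF d(1)] comp_comp_Dmap[OF d(2)])
    have cd: "opr A K (Suc K) d ?c = opr A K K \<pi> c" "opr A K (Suc K) d' ?c = opr A K K \<pi>' c"
      using opr_opr[OF A d(1) \<omega> c] opr_opr[OF A d(2) \<omega> c] \<omega>d \<omega>d' by auto
    have wc: "w (Suc K) ?c ?\<kappa> \<in> spx C (Suc K)" by (rule w[OF c' \<kappa>'])
    have "opr C j K \<delta> (w K (opr A K K \<pi> c) \<kappa>) = opr C j K \<delta> (opr C K (Suc K) d (w (Suc K) ?c ?\<kappa>))"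
      using wo[OF d(1) c' \<kappa>'] \<kappa>(2) kd(1) cd(1) by simp
    also have "\<dots> = opr C j K \<delta> (opr C K (Suc K) d' (w (Suc K) ?c ?\<kappa>))"
      using opr_opr[OF C \<delta> d(1) wc] opr_opr[OF C \<delta> d(2) wc] dd by simp
    also have "\<dots> = opr C j K \<delta> (w K (opr A K K \<pi>' c) \<kappa>)"
      using wo[OF d(2) c' \<kappa>'] \<kappa>(2) kd(2) cd(2) by simp
    finally show ?thesis .
  qed
  \<comment> \<open>The points missed by \<delta> are moved from \<pi> to \<pi>' one at a time; at
    the points met by \<delta> the two maps agree anyway.\<close>
  have sweep: "opr C j K \<delta> (w K (opr A K K \<pi> c) \<kappa>) = opr C j K \<delta> (w K (opr A K K \<pi>' c) \<kappa>)"
    if \<kappa>: "\<kappa> \<in> Dmap K n" "dsurj K n \<kappa>" and c: "c \<in> spx A K" and \<delta>: "\<delta> \<in> Dmap j K"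
      and \<pi>: "\<pi> \<in> Dmap K K" "\<pi>' \<in> Dmap K K" and le: "\<And>i. i \<le> K \<Longrightarrow> \<pi> i \<le> \<pi>' i"
      and e: "\<And>x. x \<le> j \<Longrightarrow> \<pi> (\<delta> x) = \<pi>' (\<delta> x)"
    for K j \<kappa> c \<delta> \<pi> \<pi>'
  proof -
    define P where "P t = (\<lambda>i\<in>{..K}. if i < t then \<pi> i else \<pi>' i)" for t
    have P: "P t \<in> Dmap K K" for t unfolding P_def
    proof (rule restrict_DmapI)
      show "(if i < t then \<pi> i else \<pi>' i) \<le> (if i' < t then \<pi> i' else \<pi>' i')" if "i \<le> i'" "i' \<le> K" for i i'
        using Dmap_mono[OF \<pi>(1) that] Dmap_mono[OF \<pi>(2) that] le[of i'] that by auto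
    qed (use Dmap_le[OF \<pi>(1)] Dmap_le[OF \<pi>(2)] in auto)
    have "opr C j K \<delta> (w K (opr A K K (P t) c) \<kappa>) = opr C j K \<delta> (w K (opr A K K (P 0) c) \<kappa>)" if "t \<le> Suc K" for t
      using that
    proof (induction t)
      case (Suc t)
      then have t: "t \<le> K" by simp
      have "opr C j K \<delta> (w K (opr A K K (P (Suc t)) c) \<kappa>) = opr C j K \<delta> (w K (opr A K K (P t) c) \<kappa>)"
      proof (cases "\<exists>x\<le>j. \<delta> x = t")
        case True
        then have "\<pi> t = \<pi>' t" using e by auto
        then have "P (Suc t) = P t" unfolding P_def by (intro restrict_ext) (auto simp: less_Suc_eq)
        then show ?thesis by simp
      next
        case False
        show ?thesis
          by (rule step[OF \<kappa> c \<delta> P P, of t]) (use False t le in \<open>auto simp: P_def\<close>)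
      qed
      with Suc show ?case by simp
    qed simp
    moreover have "P 0 = \<pi>'" by (rule Dmap_eqI[OF P \<pi>(2)]) (simp add: P_def)
    moreover have "P (Suc K) = \<pi>" by (rule Dmap_eqI[OF P \<pi>(1)]) (simp add: P_def)
    ultimately show ?thesis by (metis order_refl)
  qed
  define h where "h j = (\<lambda>(a, \<beta>)\<in>spx (sprod A (Delta n)) j.
    opr C j (j + n) (stair_graph j \<beta>) (w (j + n) (opr A (j + n) j (stair_x j n \<beta>) a) (stair_y j n \<beta>)))" for j
  have h: "h j (a, \<beta>) = opr C j (j + n) (stair_graph j \<beta>) (w (j + n) (opr A (j + n) j (stair_x j n \<beta>) a) (stair_y j n \<beta>))"
    if "a \<in> spx A j" "\<beta> \<in> Dmap j n" for j a \<beta> using that by (simp add: h_def)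
  have hinj: "opr C j K \<delta> (w K c \<kappa>) = h j (opr A j K \<delta> c, compose {..j} \<kappa> \<delta>)"
    if \<kappa>: "\<kappa> \<in> Dmap K n" "dsurj K n \<kappa>" and c: "c \<in> spx A K" and \<delta>: "\<delta> \<in> Dmap j K"
      and st: "\<And>x y. x < y \<Longrightarrow> y \<le> j \<Longrightarrow> \<delta> x < \<delta> y" for K j \<kappa> c \<delta>
  proof -
    \<comment> \<open>\<rho> is a retraction of \<open>[K]\<close> onto \<open>[j]\<close>, left
      inverse to \<delta>. The pullback of \<open>c\<close> along \<open>\<delta> \<rho>\<close>
      depends only on the face of \<open>c\<close> along \<delta>, so the aim is to replace
      \<open>c\<close> by it.\<close>
    define r where "r i = lst j (\<lambda>x. \<delta> x \<le> i)" for i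
    define \<rho> where "\<rho> = restrict r {..K}"
    have r: "r i \<le> j" "r i = 0 \<or> \<delta> (r i) \<le> i" "x \<le> j \<Longrightarrow> \<delta> x \<le> i \<Longrightarrow> x \<le> r i" for i x
      unfolding r_def using lst[where j = j and P = "\<lambda>x. \<delta> x \<le> i"] by auto
    have rm: "r i \<le> r i'" if "i \<le> i'" for i i' unfolding r_def by (rule lst_mono) (use that in auto)
    have \<rho>: "\<rho> \<in> Dmap K j" unfolding \<rho>_def by (rule restrict_DmapI) (use r(1) rm in auto)
    have r\<delta>: "r (\<delta> x) = x" if "x \<le> j" for x
      using r(3)[OF that, of "\<delta> x"] r(2)[of "\<delta> x"] st[of x "r (\<delta> x)"] r(1)[of "\<delta> x"]
      by (metis le_antisym le_zero_eq leD linorder_le_less_linear order_refl)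
    define p where "p = compose {..K} \<delta> \<rho>"
    \<comment> \<open>Before \<open>\<delta> 0\<close> the map \<open>p\<close> lies above the
      identity, from there on below it. Neither can be swept directly to the other, so both are
      swept up to their common bound \<open>q\<close>.\<close>
    define q where "q = (\<lambda>i\<in>{..K}. max i (\<delta> 0))"
    have p: "p \<in> Dmap K K" unfolding p_def using \<rho> \<delta> by simp
    have q: "q \<in> Dmap K K" unfolding q_def by (rule restrict_DmapI) (use Dmap_le[OF \<delta>] in auto)
    have \<delta>0: "\<delta> 0 \<le> \<delta> x" if "x \<le> j" for x using Dmap_mono[OF \<delta> _ that] by simp
    have \<delta>K: "\<delta> x \<le> K" if "x \<le> j" for x using Dmap_le[OF \<delta> that] .
    have 1: "opr C j K \<delta> (w K c \<kappa>) = opr C j K \<delta> (w K (opr A K K q c) \<kappa>)"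
    proof -
      have "opr C j K \<delta> (w K (opr A K K (Did K) c) \<kappa>) = opr C j K \<delta> (w K (opr A K K q c) \<kappa>)"
        by (rule sweep[OF \<kappa> c \<delta> Did_Dmap q]) (use \<delta>0 \<delta>K in \<open>auto simp: q_def Did_def\<close>)
      then show ?thesis using A c by simp
    qed
    have 2: "opr C j K \<delta> (w K (opr A K K p c) \<kappa>) = opr C j K \<delta> (w K (opr A K K q c) \<kappa>)"
    proof (rule sweep[OF \<kappa> c \<delta> p q])
      show "p i \<le> q i" if "i \<le> K" for i
        using that r(2)[of i] by (auto simp: p_def q_def \<rho>_def)
      show "p (\<delta> x) = q (\<delta> x)" if "x \<le> j" for x
        using \<delta>0[OF that] \<delta>K[OF that] r\<delta>[OF that] by (simp add: p_def q_def \<rho>_def)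
    qed
    let ?b = "opr A j K \<delta> c" and ?\<theta> = "compose {..j} \<kappa> \<delta>"
    have b: "?b \<in> spx A j" using A \<delta> c by simp
    have \<theta>: "?\<theta> \<in> Dmap j n" using \<delta> \<kappa>(1) by simp
    note S = stair[OF \<theta>]
    \<comment> \<open>The interior simplex given by \<rho> and \<kappa> is pulled back from the
      staircase simplex of the face: its \<open>i\<close>-th point lies on the antidiagonal
      \<open>\<rho> i + \<kappa> i\<close>, and \<open>key\<close> says that the staircase passes
      through it.\<close>
    define \<nu> where "\<nu> = (\<lambda>i\<in>{..K}. \<rho> i + \<kappa> i)"
    have \<nu>: "\<nu> \<in> Dmap K (j + n)" unfolding \<nu>_def
      by (rule restrict_DmapI) (use Dmap_le[OF \<rho>] Dmap_le[OF \<kappa>(1)] Dmap_mono[OF \<rho>] Dmap_mono[OF \<kappa>(1)] in \<open>auto intro: add_mono\<close>)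
    have key: "lst j (\<lambda>x. x + ?\<theta> x \<le> \<rho> i + \<kappa> i) = \<rho> i" if i: "i \<le> K" for i
    proof -
      let ?l = "lst j (\<lambda>x. x + ?\<theta> x \<le> \<rho> i + \<kappa> i)"
      note l = lst[where j = j and P = "\<lambda>x. x + ?\<theta> x \<le> \<rho> i + \<kappa> i"]
      have ri: "\<rho> i = r i" using i by (simp add: \<rho>_def)
      have "\<rho> i \<le> ?l"
      proof (cases "\<rho> i = 0")
        case False
        then have "\<kappa> (\<delta> (\<rho> i)) \<le> \<kappa> i" using r(2)[of i] ri by (intro Dmap_mono[OF \<kappa>(1) _ i]) auto
        then show ?thesis using r(1)[of i] ri by (intro l(3)) auto
      qed simp
      moreover have "?l \<le> \<rho> i"
      proof (rule ccontr)
        assume a: "\<not> ?l \<le> \<rho> i"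
        have "\<not> \<delta> ?l \<le> i" using r(3)[OF l(1), of i] a ri by auto
        then have "\<kappa> i \<le> \<kappa> (\<delta> ?l)" by (intro Dmap_mono[OF \<kappa>(1) _ \<delta>K[OF l(1)]]) simp
        then show False using l(1,2) a by auto
      qed
      ultimately show ?thesis by simp
    qed
    have x\<nu>: "compose {..K} (stair_x j n ?\<theta>) \<nu> = \<rho>"
      by (rule Dmap_eqI[OF comp_Dmap[OF \<nu> S(1)] \<rho>])
        (use Dmap_le[OF \<nu>] key in \<open>simp add: stair_x_def \<nu>_def\<close>)
    have y\<nu>: "compose {..K} (stair_y j n ?\<theta>) \<nu> = \<kappa>"
      by (rule Dmap_eqI[OF comp_Dmap[OF \<nu> S(2)] \<kappa>(1)])
        (use Dmap_le[OF \<nu>] key in \<open>simp add: stair_y_def \<nu>_def\<close>)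
    have g\<nu>: "compose {..j} \<nu> \<delta> = stair_graph j ?\<theta>"
      by (rule Dmap_eqI[OF comp_Dmap[OF \<delta> \<nu>] S(3)])
        (use \<delta>K r\<delta> in \<open>simp add: stair_graph_def \<nu>_def \<rho>_def\<close>)
    let ?c = "opr A (j + n) j (stair_x j n ?\<theta>) ?b"
    have c': "?c \<in> spx A (j + n)" using A S(1) b by simp
    have "opr A K K p c = opr A K (j + n) \<nu> ?c"
      using opr_opr[OF A \<rho> \<delta> c] opr_opr[OF A \<nu> S(1) b] x\<nu> by (simp add: p_def)
    then have "w K (opr A K K p c) \<kappa> = opr C K (j + n) \<nu> (w (j + n) ?c (stair_y j n ?\<theta>))"
      using wo[OF \<nu> c' S(2,4)] \<kappa>(2) y\<nu> by simp
    then have "opr C j K \<delta> (w K (opr A K K p c) \<kappa>) = h j (?b, ?\<theta>)"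
      using opr_opr[OF C \<delta> \<nu> w[OF c' S(2,4)]] g\<nu> h[OF b \<theta>] by simp
    then show ?thesis using 1 2 by simp
  qed
  \<comment> \<open>A general \<delta> is the injection \<open>stair_graph\<close> followed by the
    degeneracy \<open>stair_y\<close>. The degeneracy keeps second coordinates surjective, so it can
    be absorbed into the interior simplex and \<open>hinj\<close> applies.\<close>
  have main: "opr C j K \<delta> (w K c \<kappa>) = h j (opr A j K \<delta> c, compose {..j} \<kappa> \<delta>)"
    if \<kappa>: "\<kappa> \<in> Dmap K n" "dsurj K n \<kappa>" and c: "c \<in> spx A K" and \<delta>: "\<delta> \<in> Dmap j K" for K j \<kappa> c \<delta>
  proof -
    note S = stair[OF \<delta>]
    let ?\<mu> = "stair_y j K \<delta>" and ?\<delta> = "stair_graph j \<delta>"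
    have ks: "dsurj (j + K) n (compose {..j + K} \<kappa> ?\<mu>)" by (rule dsurj_comp[OF S(4) \<kappa>(2)])
    have c': "opr A (j + K) K ?\<mu> c \<in> spx A (j + K)" using A S(2) c by simp
    have inj: "?\<delta> x < ?\<delta> y" if "x < y" "y \<le> j" for x y
      using that Dmap_mono[OF \<delta>, of x y] by (simp add: stair_graph_def add_less_le_mono)
    have "opr C j K \<delta> (w K c \<kappa>) = opr C j (j + K) ?\<delta> (opr C (j + K) K ?\<mu> (w K c \<kappa>))"
      using opr_opr[OF C S(3,2) w[OF c \<kappa>]] S(6) by simp
    also have "\<dots> = opr C j (j + K) ?\<delta> (w (j + K) (opr A (j + K) K ?\<mu> c) (compose {..j + K} \<kappa> ?\<mu>))"
      using wo[OF S(2) c \<kappa> ks] by simp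
    also have "\<dots> = h j (opr A j (j + K) ?\<delta> (opr A (j + K) K ?\<mu> c), compose {..j} (compose {..j + K} \<kappa> ?\<mu>) ?\<delta>)"
      by (rule hinj[OF comp_Dmap[OF S(2) \<kappa>(1)] ks c' S(3) inj])
    also have "\<dots> = h j (opr A j K \<delta> c, compose {..j} \<kappa> \<delta>)"
      using opr_opr[OF A S(3,2) c] S(6) by (simp add: comp_comp_Dmap[OF S(3)])
    finally show ?thesis .
  qed
  show thesis
  proof (rule that[of h])
    show "h \<in> smap (sprod A (Delta n)) C"
    proof (rule shomI)
      fix k a \<beta> assume a: "a \<in> spx A k" and b: "\<beta> \<in> Dmap k n"
      note S = stair[OF b]
      let ?a = "opr A (k + n) k (stair_x k n \<beta>) a"
      have a': "?a \<in> spx A (k + n)" using A S(1) a by simp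
      show "h k (a, \<beta>) \<in> spx C k" unfolding h[OF a b] by (rule opr_in[OF C S(3) w[OF a' S(2,4)]])
      fix j \<gamma> assume g: "\<gamma> \<in> Dmap j k"
      have "opr C j k \<gamma> (h k (a, \<beta>)) = opr C j (k + n) (compose {..j} (stair_graph k \<beta>) \<gamma>) (w (k + n) ?a (stair_y k n \<beta>))"
        unfolding h[OF a b] by (rule opr_opr[OF C g S(3) w[OF a' S(2,4)]])
      also have "\<dots> = h j (opr A j (k + n) (compose {..j} (stair_graph k \<beta>) \<gamma>) ?a,
          compose {..j} (stair_y k n \<beta>) (compose {..j} (stair_graph k \<beta>) \<gamma>))"
        by (rule main[OF S(2,4) a' comp_Dmap[OF g S(3)]])
      also have "compose {..j} (stair_y k n \<beta>) (compose {..j} (stair_graph k \<beta>) \<gamma>) = compose {..j} \<beta> \<gamma>"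
        using comp_comp_Dmap[OF g, of "stair_y k n \<beta>" "stair_graph k \<beta>"] S(6) by simp
      also have "opr A j (k + n) (compose {..j} (stair_graph k \<beta>) \<gamma>) ?a = opr A j k \<gamma> a"
        using opr_opr[OF A comp_Dmap[OF g S(3)] S(1) a] comp_comp_Dmap[OF g, of "stair_x k n \<beta>" "stair_graph k \<beta>"] S(5) g
        by simp
      finally show "h j (opr A j k \<gamma> a, compose {..j} \<beta> \<gamma>) = opr C j k \<gamma> (h k (a, \<beta>))" by simp
    qed (auto simp: h_def)
    show "\<forall>k. \<forall>a\<in>spx A k. \<forall>\<beta>\<in>Dmap k n. dsurj k n \<beta> \<longrightarrow> h k (a, \<beta>) = w k a \<beta>"
    proof (intro allI ballI impI)
      fix k a \<beta> assume *: "a \<in> spx A k" "\<beta> \<in> Dmap k n" "dsurj k n \<beta>"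
      show "h k (a, \<beta>) = w k a \<beta>" using main[OF *(2,3,1) Did_Dmap] A C * w[OF *] by simp
    qed
  qed
qed

section \<open>The resolution of a small functor\<close>

text \<open>\<open>fC v k \<theta>\<close> is the representing object at \<theta>.
  \<open>fY v k \<theta>\<close> is a \<open>k\<close>-simplex of \<open>Y\<close> at this object,
  that is, by Yoneda a map from the representable tensored with \<open>\<Delta>\<^sup>k\<close> to
  \<open>Y\<close>. \<open>fF v k \<theta> j \<gamma>\<close> is the transition, a
  \<open>j\<close>-simplex of the function complex between the objects at \<theta> and at
  \<open>\<theta> \<gamma>\<close>.\<close>

record 'u family =
  fC :: "nat \<Rightarrow> (nat \<Rightarrow> nat) \<Rightarrow> 'u simp"
  fF :: "nat \<Rightarrow> (nat \<Rightarrow> nat) \<Rightarrow> nat \<Rightarrow> (nat \<Rightarrow> nat) \<Rightarrow> nat \<Rightarrow> 'u \<times> (nat \<Rightarrow> nat) \<Rightarrow> 'u"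
  fY :: "nat \<Rightarrow> (nat \<Rightarrow> nat) \<Rightarrow> 'u"

text \<open>Diagrams on the category of simplices \<open>\<theta> : [k] \<rightarrow> [n]\<close> of \<open>\<Delta>\<^sup>n\<close>: representables
  \<open>C\<^sub>\<theta> \<in> \<C>\<close> over \<open>Y\<close>, with transition maps \<open>C\<^sub>\<theta> \<rightarrow> C\<^sub>\<theta>\<^sub>\<gamma>\<close> of degree \<open>j\<close> for \<open>\<gamma> : [j] \<rightarrow> [k]\<close>
  which are identities if \<open>\<gamma>\<close> is a degeneracy.\<close>

definition fams :: "'u simp set \<Rightarrow> 'u sfunctor \<Rightarrow> nat \<Rightarrow> 'u family set" where
  "fams \<C> Y n = {v.
     (\<forall>k \<theta>. \<theta> \<notin> Dmap k n \<longrightarrow> fC v k \<theta> = undefined \<and> fY v k \<theta> = undefined) \<and>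
     (\<forall>k \<theta> j \<gamma>. \<not> (\<theta> \<in> Dmap k n \<and> \<gamma> \<in> Dmap j k) \<longrightarrow> fF v k \<theta> j \<gamma> = undefined) \<and>
     (\<forall>k. \<forall>\<theta>\<in>Dmap k n. fC v k \<theta> \<in> \<C> \<and> fY v k \<theta> \<in> spx (fob Y (fC v k \<theta>)) k) \<and>
     (\<forall>k j. \<forall>\<theta>\<in>Dmap k n. \<forall>\<gamma>\<in>Dmap j k.
        fF v k \<theta> j \<gamma> \<in> smap (sprod (fC v k \<theta>) (Delta j)) (fC v j (compose {..j} \<theta> \<gamma>)) \<and>
        (dsurj j k \<gamma> \<longrightarrow> fC v j (compose {..j} \<theta> \<gamma>) = fC v k \<theta> \<and> fF v k \<theta> j \<gamma> = hid (fC v k \<theta>) j) \<and>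
        opr (fob Y (fC v k \<theta>)) j k \<gamma> (fY v k \<theta>)
          = act Y (fC v k \<theta>) (fC v j (compose {..j} \<theta> \<gamma>)) j (fF v k \<theta> j \<gamma>) (fY v j (compose {..j} \<theta> \<gamma>))) \<and>
     (\<forall>k j i. \<forall>\<theta>\<in>Dmap k n. \<forall>\<gamma>\<in>Dmap j k. \<forall>\<delta>\<in>Dmap i j.
        hcomp (fC v k \<theta>) i (fF v j (compose {..j} \<theta> \<gamma>) i \<delta>) (pull (fC v k \<theta>) i \<delta> (fF v k \<theta> j \<gamma>))
          = fF v k \<theta> i (compose {..i} \<gamma> \<delta>))}"

text \<open>Restriction of a diagram along composition with \<alpha>, which sends simplices of
  \<open>\<Delta>\<^sup>m\<close> to simplices of \<open>\<Delta>\<^sup>n\<close>.\<close>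

definition fopr :: "nat \<Rightarrow> nat \<Rightarrow> (nat \<Rightarrow> nat) \<Rightarrow> 'u family \<Rightarrow> 'u family" where
  "fopr m n \<alpha> v = \<lparr>
     fC = (\<lambda>k \<theta>. if \<theta> \<in> Dmap k m then fC v k (compose {..k} \<alpha> \<theta>) else undefined),
     fF = (\<lambda>k \<theta> j \<gamma>. if \<theta> \<in> Dmap k m \<and> \<gamma> \<in> Dmap j k then fF v k (compose {..k} \<alpha> \<theta>) j \<gamma> else undefined),
     fY = (\<lambda>k \<theta>. if \<theta> \<in> Dmap k m then fY v k (compose {..k} \<alpha> \<theta>) else undefined)\<rparr>"

lemma fopr_app [simp]:
  "\<theta> \<in> Dmap k m \<Longrightarrow> fC (fopr m n \<alpha> v) k \<theta> = fC v k (compose {..k} \<alpha> \<theta>)"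
  "\<theta> \<in> Dmap k m \<Longrightarrow> \<gamma> \<in> Dmap j k \<Longrightarrow> fF (fopr m n \<alpha> v) k \<theta> j \<gamma> = fF v k (compose {..k} \<alpha> \<theta>) j \<gamma>"
  "\<theta> \<in> Dmap k m \<Longrightarrow> fY (fopr m n \<alpha> v) k \<theta> = fY v k (compose {..k} \<alpha> \<theta>)"
  by (simp_all add: fopr_def)

lemma famsD:
  assumes "v \<in> fams \<C> Y n"
  shows "\<theta> \<notin> Dmap k n \<Longrightarrow> fC v k \<theta> = undefined" "\<theta> \<notin> Dmap k n \<Longrightarrow> fY v k \<theta> = undefined"
    and "\<not> (\<theta> \<in> Dmap k n \<and> \<gamma> \<in> Dmap j k) \<Longrightarrow> fF v k \<theta> j \<gamma> = undefined"
    and "\<theta> \<in> Dmap k n \<Longrightarrow> fC v k \<theta> \<in> \<C>" "\<theta> \<in> Dmap k n \<Longrightarrow> fY v k \<theta> \<in> spx (fob Y (fC v k \<theta>)) k"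
    and "\<theta> \<in> Dmap k n \<Longrightarrow> \<gamma> \<in> Dmap j k \<Longrightarrow>
        fF v k \<theta> j \<gamma> \<in> smap (sprod (fC v k \<theta>) (Delta j)) (fC v j (compose {..j} \<theta> \<gamma>))"
    and "\<theta> \<in> Dmap k n \<Longrightarrow> \<gamma> \<in> Dmap j k \<Longrightarrow> dsurj j k \<gamma> \<Longrightarrow> fC v j (compose {..j} \<theta> \<gamma>) = fC v k \<theta>"
    and "\<theta> \<in> Dmap k n \<Longrightarrow> \<gamma> \<in> Dmap j k \<Longrightarrow> dsurj j k \<gamma> \<Longrightarrow> fF v k \<theta> j \<gamma> = hid (fC v k \<theta>) j"
    and "\<theta> \<in> Dmap k n \<Longrightarrow> \<gamma> \<in> Dmap j k \<Longrightarrow> opr (fob Y (fC v k \<theta>)) j k \<gamma> (fY v k \<theta>)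
          = act Y (fC v k \<theta>) (fC v j (compose {..j} \<theta> \<gamma>)) j (fF v k \<theta> j \<gamma>) (fY v j (compose {..j} \<theta> \<gamma>))"
    and "\<theta> \<in> Dmap k n \<Longrightarrow> \<gamma> \<in> Dmap j k \<Longrightarrow> \<delta> \<in> Dmap i j \<Longrightarrow>
        hcomp (fC v k \<theta>) i (fF v j (compose {..j} \<theta> \<gamma>) i \<delta>) (pull (fC v k \<theta>) i \<delta> (fF v k \<theta> j \<gamma>))
          = fF v k \<theta> i (compose {..i} \<gamma> \<delta>)"
  using assms unfolding fams_def by blast+

lemma family_eqI:
  assumes "v \<in> fams \<C> Y n" "w \<in> fams \<C>' Y' n"
    and "\<And>k \<theta>. \<theta> \<in> Dmap k n \<Longrightarrow> fC v k \<theta> = fC w k \<theta>"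
    and "\<And>k \<theta> j \<gamma>. \<theta> \<in> Dmap k n \<Longrightarrow> \<gamma> \<in> Dmap j k \<Longrightarrow> fF v k \<theta> j \<gamma> = fF w k \<theta> j \<gamma>"
    and "\<And>k \<theta>. \<theta> \<in> Dmap k n \<Longrightarrow> fY v k \<theta> = fY w k \<theta>"
  shows "v = w"
proof -
  have "fC v k \<theta> = fC w k \<theta>" for k \<theta>
    using assms(3) famsD(1)[OF assms(1)] famsD(1)[OF assms(2)] by (cases "\<theta> \<in> Dmap k n") auto
  moreover have "fY v k \<theta> = fY w k \<theta>" for k \<theta>
    using assms(5) famsD(2)[OF assms(1)] famsD(2)[OF assms(2)] by (cases "\<theta> \<in> Dmap k n") auto
  moreover have "fF v k \<theta> j \<gamma> = fF w k \<theta> j \<gamma>" for k \<theta> j \<gamma>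
    using assms(4) famsD(3)[OF assms(1)] famsD(3)[OF assms(2)]
    by (cases "\<theta> \<in> Dmap k n \<and> \<gamma> \<in> Dmap j k") auto
  ultimately have "fC v = fC w" "fF v = fF w" "fY v = fY w" by (auto intro!: ext)
  then show ?thesis by (intro family.equality) auto
qed

lemma fopr_fams:
  assumes v: "v \<in> fams \<C> Y n" and a: "\<alpha> \<in> Dmap m n"
  shows "fopr m n \<alpha> v \<in> fams \<C> Y m"
proof -
  note D = famsD[OF v]
  have c: "compose {..k} \<alpha> \<theta> \<in> Dmap k n" if "\<theta> \<in> Dmap k m" for k \<theta> using that a by simp
  have cc: "compose {..j} \<alpha> (compose {..j} \<theta> \<gamma>) = compose {..j} (compose {..k} \<alpha> \<theta>) \<gamma>"
    if "\<gamma> \<in> Dmap j k" for j k \<gamma> and \<theta> :: "nat \<Rightarrow> nat" by (rule comp_comp_Dmap[OF that, symmetric])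
  show ?thesis
    unfolding fams_def
  proof (intro CollectI conjI allI ballI impI)
    fix k \<theta> assume t: "\<theta> \<in> Dmap k m"
    show "fC (fopr m n \<alpha> v) k \<theta> \<in> \<C>" "fY (fopr m n \<alpha> v) k \<theta> \<in> spx (fob Y (fC (fopr m n \<alpha> v) k \<theta>)) k"
      using D(4,5)[OF c[OF t]] t by auto
    fix j \<gamma> assume g: "\<gamma> \<in> Dmap j k"
    have tg: "compose {..j} \<theta> \<gamma> \<in> Dmap j m" using t g by simp
    show "fF (fopr m n \<alpha> v) k \<theta> j \<gamma> \<in> smap (sprod (fC (fopr m n \<alpha> v) k \<theta>) (Delta j)) (fC (fopr m n \<alpha> v) j (compose {..j} \<theta> \<gamma>))"
      using D(6)[OF c[OF t] g] t g tg by (simp add: cc[OF g])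
    show "fC (fopr m n \<alpha> v) j (compose {..j} \<theta> \<gamma>) = fC (fopr m n \<alpha> v) k \<theta>"
      "fF (fopr m n \<alpha> v) k \<theta> j \<gamma> = hid (fC (fopr m n \<alpha> v) k \<theta>) j" if "dsurj j k \<gamma>"
      using D(7,8)[OF c[OF t] g that] t g tg by (simp_all add: cc[OF g])
    show "opr (fob Y (fC (fopr m n \<alpha> v) k \<theta>)) j k \<gamma> (fY (fopr m n \<alpha> v) k \<theta>)
        = act Y (fC (fopr m n \<alpha> v) k \<theta>) (fC (fopr m n \<alpha> v) j (compose {..j} \<theta> \<gamma>)) j (fF (fopr m n \<alpha> v) k \<theta> j \<gamma>)
          (fY (fopr m n \<alpha> v) j (compose {..j} \<theta> \<gamma>))"
      using D(9)[OF c[OF t] g] t g tg by (simp add: cc[OF g])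
    fix i \<delta> assume d: "\<delta> \<in> Dmap i j"
    show "hcomp (fC (fopr m n \<alpha> v) k \<theta>) i (fF (fopr m n \<alpha> v) j (compose {..j} \<theta> \<gamma>) i \<delta>)
           (pull (fC (fopr m n \<alpha> v) k \<theta>) i \<delta> (fF (fopr m n \<alpha> v) k \<theta> j \<gamma>))
        = fF (fopr m n \<alpha> v) k \<theta> i (compose {..i} \<gamma> \<delta>)"
      using D(10)[OF c[OF t] g d] t g tg d by (simp add: cc[OF g])
  qed (auto simp: fopr_def)
qed

lemma fopr_fopr:
  assumes v: "v \<in> fams \<C> Y n" and a: "\<alpha> \<in> Dmap m n" and b: "\<beta> \<in> Dmap k m"
  shows "fopr k m \<beta> (fopr m n \<alpha> v) = fopr k n (compose {..k} \<alpha> \<beta>) v"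
  by (rule family_eqI[OF fopr_fams[OF fopr_fams[OF v a] b] fopr_fams[OF v comp_Dmap[OF b a]]])
    (use a b in \<open>simp_all add: comp_comp_Dmap\<close>)

lemma fopr_Did:
  assumes v: "v \<in> fams \<C> Y n" shows "fopr n n (Did n) v = v"
  by (rule family_eqI[OF fopr_fams[OF v Did_Dmap] v]) simp_all

definition X1raw :: "'u simp set \<Rightarrow> 'u sfunctor \<Rightarrow> 'u family simp" where
  "X1raw \<C> Y = \<lparr>spx = fams \<C> Y, opr = fopr\<rparr>"

text \<open>The operators first act inside the top object and then apply the transition to the
  object at \<alpha>, which is the top object of the restricted diagram. The transition is itself a
  simplex of degree \<open>m\<close>, whence its evaluation at \<open>Did m\<close>.\<close>

definition X0raw :: "'u simp set \<Rightarrow> 'u sfunctor \<Rightarrow> ('u family \<times> 'u) simp" where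
  "X0raw \<C> Y = \<lparr>spx = (\<lambda>n. {(v, c). v \<in> fams \<C> Y n \<and> c \<in> spx (fC v n (Did n)) n}),
     opr = (\<lambda>m n \<alpha> (v, c). (fopr m n \<alpha> v, fF v n (Did n) m \<alpha> m (opr (fC v n (Did n)) m n \<alpha> c, Did m)))\<rparr>"

lemma X1raw_simps [simp]: "spx (X1raw \<C> Y) n = fams \<C> Y n" "opr (X1raw \<C> Y) = fopr"
  by (simp_all add: X1raw_def)

lemma spx_X0raw: "(v, c) \<in> spx (X0raw \<C> Y) n \<longleftrightarrow> v \<in> fams \<C> Y n \<and> c \<in> spx (fC v n (Did n)) n"
  by (simp add: X0raw_def)

lemma opr_X0raw [simp]: "opr (X0raw \<C> Y) m n \<alpha> (v, c)
   = (fopr m n \<alpha> v, fF v n (Did n) m \<alpha> m (opr (fC v n (Did n)) m n \<alpha> c, Did m))"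
  by (simp add: X0raw_def)

lemma simplicial_set_X1raw: "simplicial_set (X1raw \<C> Y)"
  by (rule simplicial_setI) (simp_all add: fopr_fams fopr_Did fopr_fopr)

text \<open>\<open>\<C>\<^sub>0\<close> only presents \<open>Y\<close>. The diagrams use all
  simplicial sets on \<open>U\<^sub>0\<close>, so that bounded quotients of an arbitrary
  \<open>A\<close> are available as representing objects.\<close>

locale resolution = universe U for U :: "'u set" +
  fixes Y :: "'u sfunctor" and \<C>\<^sub>0 :: "'u simp set" and U\<^sub>0 :: "'u set"
  assumes Y: "simplicial_functor Y" and C0: "\<C>\<^sub>0 \<subseteq> SS" and kan: "kan_extended_from \<C>\<^sub>0 Y"
    and U0: "absorbing U\<^sub>0" and C0U0: "C \<in> \<C>\<^sub>0 \<Longrightarrow> spx C n \<subseteq> U\<^sub>0"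
begin

abbreviation "\<C> \<equiv> bounded_simps U\<^sub>0"

abbreviation "F \<equiv> fams \<C> Y"

lemma small_U0: "small U\<^sub>0"
  using U0 by (simp add: absorbing_def)

lemma CSS: "C \<in> \<C> \<Longrightarrow> C \<in> SS"
  by (rule bounded_simps_SS[OF small_U0])

lemma Y_SS: "C \<in> SS \<Longrightarrow> fob Y C \<in> SS"
  by (rule sfunD(1)[OF Y])

abbreviation "vtop n v \<equiv> fC v n (Did n)"
abbreviation "tr n v k \<beta> \<equiv> fF v n (Did n) k \<beta>"

lemma fam_SS [simp]: "v \<in> F n \<Longrightarrow> \<theta> \<in> Dmap k n \<Longrightarrow> fC v k \<theta> \<in> SS"
  using CSS famsD(4) by blast

lemma tr_smap: "v \<in> F n \<Longrightarrow> \<beta> \<in> Dmap k n \<Longrightarrow> tr n v k \<beta> \<in> smap (sprod (vtop n v) (Delta k)) (fC v k \<beta>)"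
  using famsD(6)[of v \<C> Y n "Did n" n \<beta> k] by simp

lemma tr_in:
  assumes v: "v \<in> F n" and b: "\<beta> \<in> Dmap k n" and c: "c \<in> spx (vtop n v) k"
  shows "tr n v k \<beta> k (c, Did k) \<in> spx (fC v k \<beta>) k"
  by (rule shom_in[OF tr_smap[OF v b] c Did_Dmap])

text \<open>The composition law of the diagram, evaluated on the diagonal; it is what makes the
  operators of \<open>X0raw\<close> compose.\<close>

lemma tr_opr:
  assumes v: "v \<in> F n" and b: "\<beta> \<in> Dmap k n" and g: "\<gamma> \<in> Dmap j k" and c: "c \<in> spx (vtop n v) k"
  shows "fF v k \<beta> j \<gamma> j (opr (fC v k \<beta>) j k \<gamma> (tr n v k \<beta> k (c, Did k)), Did j)
    = tr n v j (compose {..j} \<beta> \<gamma>) j (opr (vtop n v) j k \<gamma> c, Did j)"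
proof -
  have T: "simplicial_set (vtop n v)" using v by simp
  have gc: "opr (vtop n v) j k \<gamma> c \<in> spx (vtop n v) j" using T g c by simp
  have "opr (fC v k \<beta>) j k \<gamma> (tr n v k \<beta> k (c, Did k)) = tr n v k \<beta> j (opr (vtop n v) j k \<gamma> c, \<gamma>)"
    using shom_opr[OF tr_smap[OF v b] g c Did_Dmap] g by simp
  moreover have "hcomp (vtop n v) j (fF v k \<beta> j \<gamma>) (pull (vtop n v) j \<gamma> (tr n v k \<beta>)) = tr n v j (compose {..j} \<beta> \<gamma>)"
    using famsD(10)[OF v Did_Dmap b g] b by simp
  then have "hcomp (vtop n v) j (fF v k \<beta> j \<gamma>) (pull (vtop n v) j \<gamma> (tr n v k \<beta>)) j (opr (vtop n v) j k \<gamma> c, Did j)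
      = tr n v j (compose {..j} \<beta> \<gamma>) j (opr (vtop n v) j k \<gamma> c, Did j)" by simp
  ultimately show ?thesis using gc g by simp
qed

lemma simplicial_set_X0raw: "simplicial_set (X0raw \<C> Y)"
proof (rule simplicial_setI)
  fix n x assume "x \<in> spx (X0raw \<C> Y) n"
  then obtain v c where x: "x = (v, c)" and v: "v \<in> F n" and c: "c \<in> spx (vtop n v) n"
    by (metis prod.exhaust spx_X0raw)
  have T: "simplicial_set (vtop n v)" using v by simp
  show "opr (X0raw \<C> Y) n n (Did n) x = x"
    using famsD(8)[OF v Did_Dmap Did_Dmap dsurj_Did] c T by (simp add: x fopr_Did[OF v])
  fix m \<alpha> assume a: "\<alpha> \<in> Dmap m n"
  have ac: "opr (vtop n v) m n \<alpha> c \<in> spx (vtop n v) m" using T a c by simp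
  show "opr (X0raw \<C> Y) m n \<alpha> x \<in> spx (X0raw \<C> Y) m"
    using tr_in[OF v a ac] fopr_fams[OF v a] a by (simp add: x spx_X0raw)
  fix k \<beta> assume b: "\<beta> \<in> Dmap k m"
  show "opr (X0raw \<C> Y) k n (compose {..k} \<alpha> \<beta>) x = opr (X0raw \<C> Y) k m \<beta> (opr (X0raw \<C> Y) m n \<alpha> x)"
    using tr_opr[OF v a b ac] a b by (simp add: x fopr_fopr[OF v a b] opr_opr[OF T b a c])
qed

text \<open>A diagram consists of three extensional functions on countable index sets, with values
  in small sets.\<close>

lemma small_F: "small (F n)"
proof -
  let ?I = "SIGMA k:(UNIV :: nat set). Dmap k n"
  let ?J = "SIGMA k:(UNIV :: nat set). SIGMA \<theta>:Dmap k n. SIGMA j:(UNIV :: nat set). Dmap j k"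
  let ?V = "\<Union>C\<in>\<C>. \<Union>k. spx (fob Y C) k"
  let ?W = "\<Union>C\<in>\<C>. \<Union>D\<in>\<C>. \<Union>j. smap (sprod C (Delta j)) D"
  have N: "small (UNIV :: nat set)" by (rule small_countable) simp
  note sC = small_bounded_simps[OF small_U0]
  have sV: "small ?V" using CSS Y_SS by (intro small_UN sC N SS_small) auto
  have sW: "small ?W" using CSS by (intro small_UN sC N small_smap) (auto intro: SS_small intro!: small_Times)
  define g where "g v = ((\<lambda>(k, \<theta>)\<in>?I. fC v k \<theta>), (\<lambda>(k, \<theta>, j, \<gamma>)\<in>?J. fF v k \<theta> j \<gamma>), (\<lambda>(k, \<theta>)\<in>?I. fY v k \<theta>))"
    for v :: "'u family"
  show ?thesis
  proof (rule small_inj)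
    show "small ((?I \<rightarrow>\<^sub>E \<C>) \<times> (?J \<rightarrow>\<^sub>E ?W) \<times> (?I \<rightarrow>\<^sub>E ?V))"
      by (intro small_Times small_PiE small_Sigma N small_Dmap sC sV sW)
    show "g ` F n \<subseteq> (?I \<rightarrow>\<^sub>E \<C>) \<times> (?J \<rightarrow>\<^sub>E ?W) \<times> (?I \<rightarrow>\<^sub>E ?V)"
    proof (rule image_subsetI)
      fix v assume v: "v \<in> F n"
      obtain a b c where g: "(a, b, c) = g v" by (cases "g v") auto
      have "a \<in> ?I \<rightarrow>\<^sub>E \<C>" using g famsD(4)[OF v] by (auto simp: g_def)
      moreover have "c \<in> ?I \<rightarrow>\<^sub>E ?V"
      proof (rule PiE_I)
        fix i assume "i \<in> ?I"
        then obtain k \<theta> where i: "i = (k, \<theta>)" "\<theta> \<in> Dmap k n" by auto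
        then show "c i \<in> ?V" using g famsD(4,5)[OF v i(2)] by (auto simp: g_def)
      qed (use g in \<open>simp add: g_def\<close>)
      moreover have "b \<in> ?J \<rightarrow>\<^sub>E ?W"
      proof (rule PiE_I)
        fix i assume "i \<in> ?J"
        then obtain k \<theta> j \<gamma> where i: "i = (k, \<theta>, j, \<gamma>)" "\<theta> \<in> Dmap k n" "\<gamma> \<in> Dmap j k" by auto
        have "b i = fF v k \<theta> j \<gamma>" using g i by (simp add: g_def)
        then show "b i \<in> ?W"
          using famsD(6)[OF v i(2,3)]
          by (intro UN_I[OF famsD(4)[OF v i(2)]] UN_I[OF famsD(4)[OF v comp_Dmap[OF i(3,2)]]] UN_I[of j]) auto
      qed (use g in \<open>simp add: g_def\<close>)
      ultimately show "g v \<in> (?I \<rightarrow>\<^sub>E \<C>) \<times> (?J \<rightarrow>\<^sub>E ?W) \<times> (?I \<rightarrow>\<^sub>E ?V)" unfolding g[symmetric] by blast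
    qed
    show "inj_on g (F n)"
    proof (rule inj_onI)
      fix v w assume v: "v \<in> F n" and w: "w \<in> F n" and "g v = g w"
      then have e: "(\<lambda>(k, \<theta>)\<in>?I. fC v k \<theta>) = (\<lambda>(k, \<theta>)\<in>?I. fC w k \<theta>)"
        "(\<lambda>(k, \<theta>, j, \<gamma>)\<in>?J. fF v k \<theta> j \<gamma>) = (\<lambda>(k, \<theta>, j, \<gamma>)\<in>?J. fF w k \<theta> j \<gamma>)"
        "(\<lambda>(k, \<theta>)\<in>?I. fY v k \<theta>) = (\<lambda>(k, \<theta>)\<in>?I. fY w k \<theta>)"
        unfolding g_def prod.inject by blast+
      show "v = w"
      proof (rule family_eqI[OF v w])
        fix k \<theta> assume t: "\<theta> \<in> Dmap k n"
        show "fC v k \<theta> = fC w k \<theta>" using fun_cong[OF e(1), of "(k, \<theta>)"] t by simp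
        show "fY v k \<theta> = fY w k \<theta>" using fun_cong[OF e(3), of "(k, \<theta>)"] t by simp
        show "fF v k \<theta> j \<gamma> = fF w k \<theta> j \<gamma>" if "\<gamma> \<in> Dmap j k" for j \<gamma>
          using fun_cong[OF e(2), of "(k, \<theta>, j, \<gamma>)"] t that by simp
      qed
    qed
  qed
qed

lemma small_X0raw: "small (spx (X0raw \<C> Y) n)"
proof -
  have "spx (X0raw \<C> Y) n = Sigma (F n) (\<lambda>v. spx (vtop n v) n)" by (auto simp: X0raw_def)
  then show ?thesis using small_Sigma[OF small_F, of n "\<lambda>v. spx (vtop n v) n"] SS_small by simp
qed

section \<open>The resolving arrow and its orbit points\<close>

definition X :: "'u arrow" where
  "X = \<lparr>src = small_copy (X0raw \<C> Y), tgt = small_copy (X1raw \<C> Y),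
     arr = (\<lambda>n. \<lambda>z\<in>spx (small_copy (X0raw \<C> Y)) n. enc (X1raw \<C> Y) n (fst (dec (X0raw \<C> Y) n z)))\<rparr>"

abbreviation "e0 \<equiv> (enc (X0raw \<C> Y) :: nat \<Rightarrow> _ \<Rightarrow> 'u)"
abbreviation "e1 \<equiv> (enc (X1raw \<C> Y) :: nat \<Rightarrow> _ \<Rightarrow> 'u)"

lemma X_simps [simp]:
  "spx (src X) n = e0 n ` spx (X0raw \<C> Y) n" "spx (tgt X) n = e1 n ` F n"
  by (simp_all add: X_def)

lemma dec0 [simp]: "x \<in> spx (X0raw \<C> Y) n \<Longrightarrow> dec (X0raw \<C> Y) n (e0 n x) = x"
  by (rule dec_enc[OF small_X0raw])

lemma dec1 [simp]: "v \<in> F n \<Longrightarrow> dec (X1raw \<C> Y) n (e1 n v) = v"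
  using dec_enc[of "X1raw \<C> Y" n v] small_F by simp

lemma opr_src_X [simp]: "x \<in> spx (X0raw \<C> Y) n \<Longrightarrow> opr (src X) m n \<alpha> (e0 n x) = e0 m (opr (X0raw \<C> Y) m n \<alpha> x)"
  by (simp add: X_def)

lemma opr_tgt_X [simp]: "v \<in> F n \<Longrightarrow> opr (tgt X) m n \<alpha> (e1 n v) = e1 m (fopr m n \<alpha> v)"
  by (simp add: X_def)

lemma arr_X [simp]: "x \<in> spx (X0raw \<C> Y) n \<Longrightarrow> arr X n (e0 n x) = e1 n (fst x)"
  by (simp add: X_def)

lemma e0_eq: "x \<in> spx (X0raw \<C> Y) n \<Longrightarrow> x' \<in> spx (X0raw \<C> Y) n \<Longrightarrow> e0 n x = e0 n x' \<Longrightarrow> x = x'"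
  by (metis dec0)

lemma e1_eq: "v \<in> F n \<Longrightarrow> v' \<in> F n \<Longrightarrow> e1 n v = e1 n v' \<Longrightarrow> v = v'"
  by (metis dec1)

lemma X_Ob: "X \<in> Ob Map_cat"
  unfolding Ob_Map_cat
proof (intro conjI)
  show s: "src X \<in> SS"
    using small_copy_SS[OF simplicial_set_X0raw small_X0raw] by (simp add: X_def)
  show "tgt X \<in> SS"
    using small_copy_SS[OF simplicial_set_X1raw[of \<C> Y]] small_F by (simp add: X_def)
  show "arr X \<in> smap (src X) (tgt X)"
  proof (rule smapI)
    fix n z assume "z \<in> spx (src X) n"
    then obtain x where x: "x \<in> spx (X0raw \<C> Y) n" "z = e0 n x" by auto
    obtain v c where vc: "x = (v, c)" by (cases x)
    show "arr X n z \<in> spx (tgt X) n" using x by (auto simp: vc spx_X0raw)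
    fix m \<alpha> assume a: "\<alpha> \<in> Dmap m n"
    show "arr X m (opr (src X) m n \<alpha> z) = opr (tgt X) m n \<alpha> (arr X n z)"
      using x a opr_in[OF simplicial_set_X0raw a x(1)] by (simp add: vc spx_X0raw)
  next
    fix n x assume "x \<notin> spx (src X) n"
    then show "arr X n x = undefined" by (simp add: X_def)
  qed
qed

text \<open>The point given by a diagram \<open>v\<close> and a map \<open>h\<close> to its top
  object: over each \<beta> the value of \<open>h\<close> is pushed along the transition to the
  object at \<beta>. With \<open>mk_inj\<close> and \<open>mk_surj\<close> this makes every degree
  of \<open>X\<^sup>\<O>\<close> a disjoint union of representables.\<close>

definition mk :: "'u simp \<Rightarrow> nat \<Rightarrow> 'u family \<Rightarrow> (nat \<Rightarrow> 'u \<times> (nat \<Rightarrow> nat) \<Rightarrow> 'u)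
    \<Rightarrow> (nat \<Rightarrow> 'u \<times> (nat \<Rightarrow> nat) \<Rightarrow> 'u) \<times> (nat \<Rightarrow> 'u \<times> (nat \<Rightarrow> nat) \<Rightarrow> 'u)" where
  "mk A n v h =
     ((\<lambda>k. \<lambda>(a, \<beta>)\<in>spx (sprod A (Delta n)) k. e0 k (fopr k n \<beta> v, tr n v k \<beta> k (h k (a, \<beta>), Did k))),
      (\<lambda>k. \<lambda>(c, \<beta>)\<in>spx (sprod pt (Delta n)) k. e1 k (fopr k n \<beta> v)))"

lemma mk_app [simp]:
  "a \<in> spx A k \<Longrightarrow> \<beta> \<in> Dmap k n \<Longrightarrow>
     fst (mk A n v h) k (a, \<beta>) = e0 k (fopr k n \<beta> v, tr n v k \<beta> k (h k (a, \<beta>), Did k))"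
  "\<beta> \<in> Dmap k n \<Longrightarrow> snd (mk A n v h) k (undefined, \<beta>) = e1 k (fopr k n \<beta> v)"
  by (simp_all add: mk_def)

lemma mk_raw:
  assumes v: "v \<in> F n" and h: "h \<in> smap (sprod A (Delta n)) (vtop n v)" and a: "a \<in> spx A k" and b: "\<beta> \<in> Dmap k n"
  shows "(fopr k n \<beta> v, tr n v k \<beta> k (h k (a, \<beta>), Did k)) \<in> spx (X0raw \<C> Y) k"
  using fopr_fams[OF v b] tr_in[OF v b shom_in[OF h a b]] b by (simp add: spx_X0raw)

lemma mk_pts:
  assumes A: "simplicial_set A" and v: "v \<in> F n" and h: "h \<in> smap (sprod A (Delta n)) (vtop n v)"
  shows "mk A n v h \<in> pts A X n"
proof -
  have "(fst (mk A n v h), snd (mk A n v h)) \<in> pts A X n"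
  proof (rule ptsI)
    fix k a \<beta> assume a: "a \<in> spx A k" and b: "\<beta> \<in> Dmap k n"
    note m = mk_raw[OF v h a b] and hc = shom_in[OF h a b]
    show "fst (mk A n v h) k (a, \<beta>) \<in> spx (src X) k" using m a b by simp
    show "arr X k (fst (mk A n v h) k (a, \<beta>)) = snd (mk A n v h) k (undefined, \<beta>)"
      using m a b by simp
    fix j \<gamma> assume g: "\<gamma> \<in> Dmap j k"
    have "fst (mk A n v h) j (opr A j k \<gamma> a, compose {..j} \<beta> \<gamma>)
      = e0 j (fopr j n (compose {..j} \<beta> \<gamma>) v, tr n v j (compose {..j} \<beta> \<gamma>) j (opr (vtop n v) j k \<gamma> (h k (a, \<beta>)), Did j))"
      if "opr A j k \<gamma> a \<in> spx A j" using that a b g shom_opr[OF h g a b] by simp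
    moreover have "opr (src X) j k \<gamma> (fst (mk A n v h) k (a, \<beta>))
      = e0 j (fopr j n (compose {..j} \<beta> \<gamma>) v, tr n v j (compose {..j} \<beta> \<gamma>) j (opr (vtop n v) j k \<gamma> (h k (a, \<beta>)), Did j))"
      using m a b g tr_opr[OF v b g hc] by (simp add: fopr_fopr[OF v b g])
    moreover have "opr A j k \<gamma> a \<in> spx A j" using A g a by simp
    ultimately show "fst (mk A n v h) j (opr A j k \<gamma> a, compose {..j} \<beta> \<gamma>) = opr (src X) j k \<gamma> (fst (mk A n v h) k (a, \<beta>))"
      by simp
  next
    fix k \<beta> assume b: "\<beta> \<in> Dmap k n"
    show "snd (mk A n v h) k (undefined, \<beta>) \<in> spx (tgt X) k" using fopr_fams[OF v b] b by simp
    fix j \<gamma> assume g: "\<gamma> \<in> Dmap j k"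
    show "snd (mk A n v h) j (undefined, compose {..j} \<beta> \<gamma>) = opr (tgt X) j k \<gamma> (snd (mk A n v h) k (undefined, \<beta>))"
      using b g fopr_fams[OF v b] by (simp add: fopr_fopr[OF v b g])
  qed (auto simp: mk_def)
  then show ?thesis by simp
qed

text \<open>The target component at \<open>Did n\<close> recovers \<open>v\<close>. Over surjective
  \<beta> the transition is the identity, so \<open>h\<close> is visible there, and
  \<open>interior_unique\<close> gives the rest.\<close>

lemma mk_inj:
  assumes A: "simplicial_set A"
    and v: "v \<in> F n" "v' \<in> F n" and h: "h \<in> smap (sprod A (Delta n)) (vtop n v)" "h' \<in> smap (sprod A (Delta n)) (vtop n v')"
    and e: "mk A n v h = mk A n v' h'"
  shows "v = v'" "h = h'"
proof -
  have "snd (mk A n v h) n (undefined, Did n) = snd (mk A n v' h') n (undefined, Did n)" using e by simp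
  then have "e1 n v = e1 n v'" by (simp add: fopr_Did[OF v(1)] fopr_Did[OF v(2)])
  then show vv: "v = v'" by (rule e1_eq[OF v])
  show "h = h'"
  proof (rule interior_unique[OF A h])
    fix k a \<beta> assume a: "a \<in> spx A k" and b: "\<beta> \<in> Dmap k n" and s: "dsurj k n \<beta>"
    have hd: "tr n v k \<beta> = hid (vtop n v) k" by (rule famsD(8)[OF v(1) Did_Dmap b s])
    have "e0 k (fopr k n \<beta> v, tr n v k \<beta> k (h k (a, \<beta>), Did k)) = e0 k (fopr k n \<beta> v', tr n v' k \<beta> k (h' k (a, \<beta>), Did k))"
      using arg_cong[OF e, of "\<lambda>s. fst s k (a, \<beta>)"] a b by simp
    then have "(fopr k n \<beta> v, tr n v k \<beta> k (h k (a, \<beta>), Did k)) = (fopr k n \<beta> v', tr n v' k \<beta> k (h' k (a, \<beta>), Did k))"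
      by (rule e0_eq[OF mk_raw[OF v(1) h(1) a b] mk_raw[OF v(2) h(2) a b]])
    then show "h k (a, \<beta>) = h' k (a, \<beta>)"
      using shom_in[OF h(1) a b] shom_in[OF h(2) a b] hd vv by simp
  qed (simp add: vv)
qed

text \<open>Over surjective \<beta> every object is the top one and every transition is an identity,
  so the source component is interior data with values in a single simplicial set, and
  \<open>interior_extension\<close> produces \<open>h\<close>. The remaining values are forced,
  because every simplex is a face of an interior one.\<close>

lemma mk_surj:
  assumes A: "simplicial_set A" and s: "s \<in> pts A X n"
  obtains v h where "v \<in> F n" "h \<in> smap (sprod A (Delta n)) (vtop n v)" "s = mk A n v h"
proof -
  have "snd s n (undefined, Did n) \<in> spx (tgt X) n" using shom_in[OF ptsD(2)[OF s], of undefined n "Did n"] by simp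
  then obtain v where v: "v \<in> F n" and sv: "snd s n (undefined, Did n) = e1 n v" by auto
  have svb: "snd s k (undefined, \<beta>) = e1 k (fopr k n \<beta> v)" if b: "\<beta> \<in> Dmap k n" for k \<beta>
    using shom_opr[OF ptsD(2)[OF s] b _ Did_Dmap, of undefined] b v by (simp add: sv)
  define u where "u k a \<beta> = snd (dec (X0raw \<C> Y) k (fst s k (a, \<beta>)))" for k a \<beta>
  have su: "fst s k (a, \<beta>) = e0 k (fopr k n \<beta> v, u k a \<beta>)" and u: "u k a \<beta> \<in> spx (fC v k \<beta>) k"
    if a: "a \<in> spx A k" and b: "\<beta> \<in> Dmap k n" for k a \<beta>
  proof -
    have "fst s k (a, \<beta>) \<in> spx (src X) k" by (rule shom_in[OF ptsD(1)[OF s] a b])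
    then obtain v' c where x: "(v', c) \<in> spx (X0raw \<C> Y) k" "fst s k (a, \<beta>) = e0 k (v', c)" by auto
    have "e1 k v' = e1 k (fopr k n \<beta> v)" using ptsD(3)[OF s a b] svb[OF b] x by simp
    moreover have "v' \<in> F k" using x(1) by (simp add: spx_X0raw)
    ultimately have v': "v' = fopr k n \<beta> v" using e1_eq[OF _ fopr_fams[OF v b]] by blast
    have "u k a \<beta> = c" unfolding u_def x(2) using x(1) by simp
    then show "fst s k (a, \<beta>) = e0 k (fopr k n \<beta> v, u k a \<beta>)" "u k a \<beta> \<in> spx (fC v k \<beta>) k"
      using x v' b by (auto simp: spx_X0raw)
  qed
  have raw: "(fopr k n \<beta> v, u k a \<beta>) \<in> spx (X0raw \<C> Y) k" if "a \<in> spx A k" "\<beta> \<in> Dmap k n" for k a \<beta>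
    using u[OF that] fopr_fams[OF v that(2)] that by (simp add: spx_X0raw)
  have uo: "u j (opr A j k \<gamma> a) (compose {..j} \<beta> \<gamma>) = fF v k \<beta> j \<gamma> j (opr (fC v k \<beta>) j k \<gamma> (u k a \<beta>), Did j)"
    if a: "a \<in> spx A k" and b: "\<beta> \<in> Dmap k n" and g: "\<gamma> \<in> Dmap j k" for j k a \<beta> \<gamma>
  proof -
    have ga: "opr A j k \<gamma> a \<in> spx A j" and gb: "compose {..j} \<beta> \<gamma> \<in> Dmap j n" using A a b g by auto
    have "e0 j (fopr j n (compose {..j} \<beta> \<gamma>) v, u j (opr A j k \<gamma> a) (compose {..j} \<beta> \<gamma>))
        = e0 j (opr (X0raw \<C> Y) j k \<gamma> (fopr k n \<beta> v, u k a \<beta>))"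
      using shom_opr[OF ptsD(1)[OF s] g a b] raw[OF a b] unfolding su[OF a b] su[OF ga gb] by simp
    then have "(fopr j n (compose {..j} \<beta> \<gamma>) v, u j (opr A j k \<gamma> a) (compose {..j} \<beta> \<gamma>))
        = opr (X0raw \<C> Y) j k \<gamma> (fopr k n \<beta> v, u k a \<beta>)"
      by (rule e0_eq[OF raw[OF ga gb] opr_in[OF simplicial_set_X0raw g raw[OF a b]]])
    then show ?thesis using b g by simp
  qed
  have T: "simplicial_set (vtop n v)" using v by simp
  have sC: "fC v k \<beta> = vtop n v" if "\<beta> \<in> Dmap k n" "dsurj k n \<beta>" for k \<beta>
    using famsD(7)[OF v Did_Dmap that] that(1) by simp
  \<comment> \<open>Here \<gamma> itself need not be surjective: the transitions from the top to
    \<beta> and to \<open>\<beta> \<gamma>\<close> are identities, and the composition law makes the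
    one between them an identity too.\<close>
  have sF: "fF v k \<beta> j \<gamma> = hid (vtop n v) j"
    if b: "\<beta> \<in> Dmap k n" "dsurj k n \<beta>" and g: "\<gamma> \<in> Dmap j k" "dsurj j n (compose {..j} \<beta> \<gamma>)" for j k \<beta> \<gamma>
  proof -
    have bg: "compose {..j} \<beta> \<gamma> \<in> Dmap j n" using b g by simp
    have "hcomp (vtop n v) j (fF v k \<beta> j \<gamma>) (pull (vtop n v) j \<gamma> (tr n v k \<beta>)) = tr n v j (compose {..j} \<beta> \<gamma>)"
      using famsD(10)[OF v Did_Dmap b(1) g(1)] b(1) by simp
    then have "hcomp (vtop n v) j (fF v k \<beta> j \<gamma>) (hid (vtop n v) j) = hid (vtop n v) j"
      using g(1) by (simp add: famsD(8)[OF v Did_Dmap b] famsD(8)[OF v Did_Dmap bg g(2)])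
    moreover have "fF v k \<beta> j \<gamma> \<in> smap (sprod (vtop n v) (Delta j)) (fC v j (compose {..j} \<beta> \<gamma>))"
      using famsD(6)[OF v b(1) g(1)] sC[OF b] by simp
    ultimately show ?thesis by simp
  qed
  have w: "u k a \<beta> \<in> spx (vtop n v) k" if "a \<in> spx A k" "\<beta> \<in> Dmap k n" "dsurj k n \<beta>" for k a \<beta>
    using u[OF that(1,2)] sC[OF that(2,3)] by simp
  have wo: "u j (opr A j k \<gamma> a) (compose {..j} \<beta> \<gamma>) = opr (vtop n v) j k \<gamma> (u k a \<beta>)"
    if "\<gamma> \<in> Dmap j k" "a \<in> spx A k" "\<beta> \<in> Dmap k n" "dsurj k n \<beta>" "dsurj j n (compose {..j} \<beta> \<gamma>)" for j k \<gamma> a \<beta>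
    using uo[OF that(2,3,1)] sF[OF that(3,4,1,5)] sC[OF that(3,4)] w[OF that(2-4)] T that(1) by simp
  obtain h where h: "h \<in> smap (sprod A (Delta n)) (vtop n v)"
      "\<forall>k. \<forall>a\<in>spx A k. \<forall>\<beta>\<in>Dmap k n. dsurj k n \<beta> \<longrightarrow> h k (a, \<beta>) = u k a \<beta>"
    using interior_extension[OF A T w wo] .
  have "s = mk A n v h"
  proof (rule pts_eqI[OF s mk_pts[OF A v h(1)]])
    show "snd s k (undefined, \<beta>) = snd (mk A n v h) k (undefined, \<beta>)" if "\<beta> \<in> Dmap k n" for k \<beta>
      using svb[OF that] that by simp
    fix k a \<beta> assume a: "a \<in> spx A k" and b: "\<beta> \<in> Dmap k n"
    note S = stair[OF b]
    let ?a = "opr A (k + n) k (stair_x k n \<beta>) a" and ?K = "stair_y k n \<beta>" and ?d = "stair_graph k \<beta>"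
    have a': "?a \<in> spx A (k + n)" "opr A k (k + n) ?d ?a = a" using A S a by (auto simp: opr_opr)
    have hK: "h (k + n) (?a, ?K) = u (k + n) ?a ?K" using h(2) a'(1) S(2,4) by blast
    have wK: "u (k + n) ?a ?K \<in> spx (vtop n v) (k + n)" by (rule w[OF a'(1) S(2,4)])
    have "h k (a, \<beta>) = opr (vtop n v) k (k + n) ?d (u (k + n) ?a ?K)"
      using shom_opr[OF h(1) S(3) a'(1) S(2)] a'(2) S(6) hK by simp
    then have "tr n v k \<beta> k (h k (a, \<beta>), Did k) = u k a \<beta>"
      using tr_opr[OF v S(2,3) wK] uo[OF a'(1) S(2,3)] a'(2) S(6) famsD(8)[OF v Did_Dmap S(2,4)] sC[OF S(2,4)] wK
      by simp
    then show "fst s k (a, \<beta>) = fst (mk A n v h) k (a, \<beta>)" using a b su[OF a b] by simp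
  qed
  with v h(1) show thesis by (rule that)
qed

lemma hcomp_tr:
  assumes v: "v \<in> F n" and A: "simplicial_set A" and h: "h \<in> smap (sprod A (Delta n)) (vtop n v)" and a: "\<alpha> \<in> Dmap m n"
  shows "hcomp A m (tr n v m \<alpha>) (pull A m \<alpha> h) \<in> smap (sprod A (Delta m)) (vtop m (fopr m n \<alpha> v))"
  using hcomp_smap[OF pull_smap[OF h a A] tr_smap[OF v a] A] a by simp

text \<open>The operators of \<open>X\<^sup>\<O>\<close> in coordinates: the diagram is restricted,
  and \<open>h\<close> is followed by the transition to the new top object. The composition law of
  the diagram is used at every \<beta>.\<close>

lemma pull_mk:
  assumes v: "v \<in> F n" and A: "simplicial_set A" and h: "h \<in> smap (sprod A (Delta n)) (vtop n v)" and a: "\<alpha> \<in> Dmap m n"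
  shows "(pull A m \<alpha> (fst (mk A n v h)), pull pt m \<alpha> (snd (mk A n v h)))
    = mk A m (fopr m n \<alpha> v) (hcomp A m (tr n v m \<alpha>) (pull A m \<alpha> h))"
proof (rule pts_eqI[OF pull_pts[OF A mk_pts[OF A v h] a] mk_pts[OF A fopr_fams[OF v a] hcomp_tr[OF v A h a]]])
  fix k x \<beta> assume x: "x \<in> spx A k" and b: "\<beta> \<in> Dmap k m"
  have ab: "compose {..k} \<alpha> \<beta> \<in> Dmap k n" using a b by simp
  note hx = shom_in[OF h x ab]
  have "hcomp (vtop n v) k (fF v m \<alpha> k \<beta>) (pull (vtop n v) k \<beta> (tr n v m \<alpha>)) = tr n v k (compose {..k} \<alpha> \<beta>)"
    using famsD(10)[OF v Did_Dmap a b] a by simp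
  then have "hcomp (vtop n v) k (fF v m \<alpha> k \<beta>) (pull (vtop n v) k \<beta> (tr n v m \<alpha>)) k (h k (x, compose {..k} \<alpha> \<beta>), Did k)
      = tr n v k (compose {..k} \<alpha> \<beta>) k (h k (x, compose {..k} \<alpha> \<beta>), Did k)" by simp
  then have "fF v m \<alpha> k \<beta> k (tr n v m \<alpha> k (h k (x, compose {..k} \<alpha> \<beta>), \<beta>), Did k)
      = tr n v k (compose {..k} \<alpha> \<beta>) k (h k (x, compose {..k} \<alpha> \<beta>), Did k)"
    using hx b by simp
  then show "fst (pull A m \<alpha> (fst (mk A n v h)), pull pt m \<alpha> (snd (mk A n v h))) k (x, \<beta>)
     = fst (mk A m (fopr m n \<alpha> v) (hcomp A m (tr n v m \<alpha>) (pull A m \<alpha> h))) k (x, \<beta>)"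
    using x b ab a by (simp add: fopr_fopr[OF v a b])
next
  fix k \<beta> assume b: "\<beta> \<in> Dmap k m"
  show "snd (pull A m \<alpha> (fst (mk A n v h)), pull pt m \<alpha> (snd (mk A n v h))) k (undefined, \<beta>)
     = snd (mk A m (fopr m n \<alpha> v) (hcomp A m (tr n v m \<alpha>) (pull A m \<alpha> h))) k (undefined, \<beta>)"
    using b a by (simp add: fopr_fopr[OF v a b])
qed

lemma hcomp_mk:
  assumes v: "v \<in> F n" and A: "simplicial_set A" "simplicial_set B" and h: "h \<in> smap (sprod B (Delta n)) (vtop n v)"
    and f: "f \<in> smap (sprod A (Delta n)) B"
  shows "(hcomp A n (fst (mk B n v h)) f, snd (mk B n v h)) = mk A n v (hcomp A n h f)"
  by (rule pts_eqI[OF hcomp_pts[OF mk_pts[OF A(2) v h] f A(1)] mk_pts[OF A(1) v hcomp_smap[OF f h A(1)]]])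
    (simp_all add: shom_in[OF f])

section \<open>Evaluation and its lifting property\<close>

definition ev :: "'u simp \<Rightarrow> nat \<Rightarrow> 'u \<Rightarrow> 'u" where
  "ev = (\<lambda>A\<in>SS. \<lambda>n. \<lambda>z\<in>spx (HOM (orbit A) X) n.
     case (SOME (v, h). v \<in> F n \<and> h \<in> smap (sprod A (Delta n)) (vtop n v) \<and> z = enc (ahom (orbit A) X) n (mk A n v h)) of
       (v, h) \<Rightarrow> act Y A (vtop n v) n h (fY v n (Did n)))"

lemma enc_mk_inj:
  assumes A: "A \<in> SS"
    and v: "v \<in> F n" "v' \<in> F n" and h: "h \<in> smap (sprod A (Delta n)) (vtop n v)" "h' \<in> smap (sprod A (Delta n)) (vtop n v')"
    and e: "enc (ahom (orbit A) X) n (mk A n v h) = (enc (ahom (orbit A) X) n (mk A n v' h') :: 'u)"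
  shows "v = v'" "h = h'"
proof -
  have "mk A n v h = mk A n v' h'"
    using dec_enc_pts[OF X_Ob A mk_pts[OF SS_simplicial[OF A] v(1) h(1)]]
      dec_enc_pts[OF X_Ob A mk_pts[OF SS_simplicial[OF A] v(2) h(2)]] e by metis
  then show "v = v'" "h = h'" using mk_inj[OF SS_simplicial[OF A] v h] by auto
qed

lemma HOM_X_cases:
  assumes A: "A \<in> SS" and z: "z \<in> spx (HOM (orbit A) X) n"
  obtains v h where "v \<in> F n" "h \<in> smap (sprod A (Delta n)) (vtop n v)" "z = enc (ahom (orbit A) X) n (mk A n v h)"
proof -
  obtain s where s: "s \<in> pts A X n" "z = enc (ahom (orbit A) X) n s" using HOM_cases[OF X_Ob A z] .
  obtain v h where "v \<in> F n" "h \<in> smap (sprod A (Delta n)) (vtop n v)" "s = mk A n v h"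
    using mk_surj[OF SS_simplicial[OF A] s(1)] .
  then show thesis using that s(2) by blast
qed

text \<open>Injectivity of \<open>mk\<close> leaves only one pair for the choice in
  \<open>ev\<close>. The value is the element of \<open>Y\<close> at the top position, restricted
  along \<open>h\<close>, as for a map out of a representable.\<close>

lemma ev_mk:
  assumes A: "A \<in> SS" and v: "v \<in> F n" and h: "h \<in> smap (sprod A (Delta n)) (vtop n v)"
  shows "ev A n (enc (ahom (orbit A) X) n (mk A n v h)) = act Y A (vtop n v) n h (fY v n (Did n))"
proof -
  let ?P = "\<lambda>(v', h'). v' \<in> F n \<and> h' \<in> smap (sprod A (Delta n)) (vtop n v') \<and>
    enc (ahom (orbit A) X) n (mk A n v h) = (enc (ahom (orbit A) X) n (mk A n v' h') :: 'u)"
  have "?P (v, h)" using v h by simp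
  then have "?P (Eps ?P)" by (rule someI)
  then have "Eps ?P = (v, h)" using enc_mk_inj[OF A v _ h] by (auto split: prod.splits)
  then show ?thesis
    using A mk_pts[OF SS_simplicial[OF A] v h] unfolding ev_def by simp
qed

text \<open>Compatibility with operators is the clause of \<open>fams\<close> that relates the
  elements \<open>fY\<close> along transitions; compatibility with maps between the objects
  \<open>A\<close> is functoriality of \<open>act\<close>.\<close>

lemma ev_nat_trans: "ev \<in> nat_trans (orbit_points X) Y"
proof (rule nat_transI[OF simplicial_functor_orbit_points[OF X_Ob] Y])
  show "ev A = undefined" if "A \<notin> SS" for A :: "'u simp" using that by (simp add: ev_def)
  have in_top: "fY v n (Did n) \<in> spx (fob Y (vtop n v)) n" if "v \<in> F n" for v n by (rule famsD(5)[OF that Did_Dmap])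
  show "ev A \<in> smap (fob (orbit_points X) A) (fob Y A)" if A: "A \<in> SS" for A
    unfolding fob_orbit_points
  proof (rule smapI)
    fix n z assume z: "z \<in> spx (HOM (orbit A) X) n"
    obtain v h where v: "v \<in> F n" and h: "h \<in> smap (sprod A (Delta n)) (vtop n v)"
        and zz: "z = enc (ahom (orbit A) X) n (mk A n v h)" using HOM_X_cases[OF A z] .
    have T: "vtop n v \<in> SS" using v by simp
    show "ev A n z \<in> spx (fob Y A) n"
      unfolding zz ev_mk[OF A v h] by (rule act_in[OF Y A T h in_top[OF v]])
    fix m \<alpha> assume a: "\<alpha> \<in> Dmap m n"
    note AS = SS_simplicial[OF A]
    have Ca: "fC v m \<alpha> \<in> SS" using v a by simp
    have y: "fY v m \<alpha> \<in> spx (fob Y (fC v m \<alpha>)) m" by (rule famsD(5)[OF v a])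
    have c: "opr (fob Y (vtop n v)) m n \<alpha> (fY v n (Did n)) = act Y (vtop n v) (fC v m \<alpha>) m (tr n v m \<alpha>) (fY v m \<alpha>)"
      using famsD(9)[OF v Did_Dmap a] a by simp
    have "opr (HOM (orbit A) X) m n \<alpha> z
      = enc (ahom (orbit A) X) m (mk A m (fopr m n \<alpha> v) (hcomp A m (tr n v m \<alpha>) (pull A m \<alpha> h)))"
      unfolding zz opr_HOM[OF X_Ob A mk_pts[OF AS v h]] pull_mk[OF v AS h a] ..
    then have "ev A m (opr (HOM (orbit A) X) m n \<alpha> z)
      = act Y A (fC v m \<alpha>) m (hcomp A m (tr n v m \<alpha>) (pull A m \<alpha> h)) (fY v m \<alpha>)"
      using ev_mk[OF A fopr_fams[OF v a] hcomp_tr[OF v AS h a]] a by simp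
    also have "\<dots> = act Y A (vtop n v) m (pull A m \<alpha> h) (act Y (vtop n v) (fC v m \<alpha>) m (tr n v m \<alpha>) (fY v m \<alpha>))"
      by (rule act_hcomp[OF Y A T Ca pull_smap[OF h a AS] tr_smap[OF v a] y])
    also have "\<dots> = opr (fob Y A) m n \<alpha> (act Y A (vtop n v) n h (fY v n (Did n)))"
      unfolding act_opr[OF Y A T h in_top[OF v] a] c ..
    finally show "ev A m (opr (HOM (orbit A) X) m n \<alpha> z) = opr (fob Y A) m n \<alpha> (ev A n z)"
      unfolding zz ev_mk[OF A v h] .
  qed (simp add: ev_def A)
  fix A B :: "'u simp" and n f y assume A: "A \<in> SS" and B: "B \<in> SS" and f: "f \<in> smap (sprod A (Delta n)) B"
    and "y \<in> spx (fob (orbit_points X) B) n"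
  then have y: "y \<in> spx (HOM (orbit B) X) n" by simp
  obtain v h where v: "v \<in> F n" and h: "h \<in> smap (sprod B (Delta n)) (vtop n v)"
      and yy: "y = enc (ahom (orbit B) X) n (mk B n v h)" using HOM_X_cases[OF B y] .
  have T: "vtop n v \<in> SS" using v by simp
  note AS = SS_simplicial[OF A] and BS = SS_simplicial[OF B]
  show "ev A n (act (orbit_points X) A B n f y) = act Y A B n f (ev B n y)"
    unfolding yy act_orbit_points[OF X_Ob A B f mk_pts[OF BS v h]] hcomp_mk[OF v AS BS h f]
      ev_mk[OF A v hcomp_smap[OF f h AS]] ev_mk[OF B v h]
    by (rule act_hcomp[OF Y A B T f h in_top[OF v]])
qed

text \<open>Elements of the coend that agree in \<open>Y A\<close> are connected by finitely many steps; these
  steps survive on every quotient of \<open>A\<close> to which the finitely many maps involved descend.\<close>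

lemma zigzag:
  assumes A: "A \<in> SS" and p: "p \<in> coend_pts \<C>\<^sub>0 Y A n" and p': "p' \<in> coend_pts \<C>\<^sub>0 Y A n"
    and e: "coend_eval Y A n p = coend_eval Y A n p'"
  obtains H where "finite H" "\<forall>f\<in>H. \<exists>C\<in>\<C>\<^sub>0. f \<in> smap (sprod A (Delta n)) C"
    "fst (snd p) \<in> H" "fst (snd p') \<in> H"
    "\<forall>D q. D \<in> SS \<longrightarrow> quot A D q \<longrightarrow> (\<forall>f\<in>H. descends A q n f) \<longrightarrow>
       act Y D (fst p) n (desc A D q n (fst (snd p))) (snd (snd p))
         = act Y D (fst p') n (desc A D q n (fst (snd p'))) (snd (snd p'))"
proof -
  let ?S = "coend_step \<C>\<^sub>0 Y A n"
  let ?Q = "\<lambda>p'. \<exists>H. finite H \<and> (\<forall>f\<in>H. \<exists>C\<in>\<C>\<^sub>0. f \<in> smap (sprod A (Delta n)) C) \<and> fst (snd p) \<in> H \<and> fst (snd p') \<in> H \<and>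
    (\<forall>D q. D \<in> SS \<longrightarrow> quot A D q \<longrightarrow> (\<forall>f\<in>H. descends A q n f) \<longrightarrow>
       act Y D (fst p) n (desc A D q n (fst (snd p))) (snd (snd p))
         = act Y D (fst p') n (desc A D q n (fst (snd p'))) (snd (snd p')))"
  have st: "fst (snd r) \<in> smap (sprod A (Delta n)) (fst r)" "fst r \<in> \<C>\<^sub>0"
      "fst (snd r') \<in> smap (sprod A (Delta n)) (fst r')" "fst r' \<in> \<C>\<^sub>0"
    and st': "D \<in> SS \<Longrightarrow> quot A D q \<Longrightarrow> descends A q n (fst (snd r)) \<Longrightarrow> descends A q n (fst (snd r')) \<Longrightarrow>
      act Y D (fst r) n (desc A D q n (fst (snd r))) (snd (snd r))
        = act Y D (fst r') n (desc A D q n (fst (snd r'))) (snd (snd r'))"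
    if "(r, r') \<in> ?S" for r r' D q
  proof -
    from that obtain C E h g x where r: "r = (C, h, act Y C E n g x)" "r' = (E, hcomp A n g h, x)"
      and C: "C \<in> \<C>\<^sub>0" "E \<in> \<C>\<^sub>0" and h: "h \<in> smap (sprod A (Delta n)) C" and g: "g \<in> smap (sprod C (Delta n)) E"
      and x: "x \<in> spx (fob Y E) n" unfolding coend_step_def by auto
    have gh: "hcomp A n g h \<in> smap (sprod A (Delta n)) E" using A h g by simp
    show "fst (snd r) \<in> smap (sprod A (Delta n)) (fst r)" "fst r \<in> \<C>\<^sub>0"
      "fst (snd r') \<in> smap (sprod A (Delta n)) (fst r')" "fst r' \<in> \<C>\<^sub>0"
      using r C h gh by auto
    assume D: "D \<in> SS" and q: "quot A D q" and "descends A q n (fst (snd r))" "descends A q n (fst (snd r'))"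
    then have d: "descends A q n h" "descends A q n (hcomp A n g h)" by (auto simp: r)
    note dh = desc_smap[OF q d(1) h] and dgh = desc_smap[OF q d(2) gh]
    \<comment> \<open>A coend step over \<open>A\<close> stays a coend step over \<open>D\<close>,
      because descending commutes with composition with \<open>g\<close>.\<close>
    have "desc A D q n (hcomp A n g h) = hcomp D n g (desc A D q n h)"
    proof (rule desc_unique[OF q dgh hcomp_smap[OF dh g SS_simplicial[OF D]]])
      show "hcomp A n (desc A D q n (hcomp A n g h)) (hconst A n q) = hcomp A n (hcomp D n g (desc A D q n h)) (hconst A n q)"
        unfolding hcomp_desc[OF q d(2) gh] hcomp_assoc[OF quotD(6)[OF q], symmetric] hcomp_desc[OF q d(1) h] ..
    qed
    then show "act Y D (fst r) n (desc A D q n (fst (snd r))) (snd (snd r))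
        = act Y D (fst r') n (desc A D q n (fst (snd r'))) (snd (snd r'))"
      using act_hcomp[OF Y D subsetD[OF C0 C(1)] subsetD[OF C0 C(2)] dh g x] by (simp add: r)
  qed
  have "(p, p') \<in> (?S \<union> ?S\<inverse>)\<^sup>*"
    using kan A p p' e unfolding kan_extended_from_def by blast
  then have "?Q p'"
  proof induction
    case base
    show ?case using p by (intro exI[of _ "{fst (snd p)}"]) (auto simp: coend_pts_def)
  next
    case (step r r')
    from step.IH obtain H where H: "finite H" "\<forall>f\<in>H. \<exists>C\<in>\<C>\<^sub>0. f \<in> smap (sprod A (Delta n)) C" "fst (snd p) \<in> H" "fst (snd r) \<in> H"
      "\<forall>D q. D \<in> SS \<longrightarrow> quot A D q \<longrightarrow> (\<forall>f\<in>H. descends A q n f) \<longrightarrow>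
       act Y D (fst p) n (desc A D q n (fst (snd p))) (snd (snd p))
         = act Y D (fst r) n (desc A D q n (fst (snd r))) (snd (snd r))" by blast
    have m: "\<exists>C\<in>\<C>\<^sub>0. fst (snd r') \<in> smap (sprod A (Delta n)) C" using step.hyps(2) st by blast
    have eq: "act Y D (fst r) n (desc A D q n (fst (snd r))) (snd (snd r))
         = act Y D (fst r') n (desc A D q n (fst (snd r'))) (snd (snd r'))"
      if "D \<in> SS" "quot A D q" "descends A q n (fst (snd r))" "descends A q n (fst (snd r'))" for D q
      using step.hyps(2) st'[OF _ that] st'[OF _ that(1,2,4,3)] by (metis Un_iff converse_iff)
    show ?case
    proof (intro exI[of _ "insert (fst (snd r')) H"] conjI allI impI)
      fix D q assume D: "D \<in> SS" "quot A D q" and d: "\<forall>f\<in>insert (fst (snd r')) H. descends A q n f"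
      have "act Y D (fst p) n (desc A D q n (fst (snd p))) (snd (snd p))
         = act Y D (fst r) n (desc A D q n (fst (snd r))) (snd (snd r))" using H(5) D d by blast
      also have "\<dots> = act Y D (fst r') n (desc A D q n (fst (snd r'))) (snd (snd r'))"
        by (rule eq[OF D]) (use d H(4) in auto)
      finally show "act Y D (fst p) n (desc A D q n (fst (snd p))) (snd (snd p))
         = act Y D (fst r') n (desc A D q n (fst (snd r'))) (snd (snd r'))" .
    qed (use H m in auto)
  qed
  then show thesis using that by blast
qed

text \<open>The filler is a diagram with the given boundary and a bounded quotient \<open>D\<close>
  of \<open>A\<close> at the top, and its map is the quotient map \<open>A \<rightarrow> D\<close>.
  The boundary maps \<open>hh\<close> must descend to \<open>D\<close>, so must a map \<kappa>
  presenting \<open>y\<close>, and so must the maps in the chains that identify the faces of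
  \<open>y\<close> with the given elements; the latter turn equalities in \<open>Y A\<close> into
  equalities in \<open>Y D\<close>.\<close>

lemma ev_bdry_lift:
  assumes A: "A \<in> SS"
  shows "bdry_lift (HOM (orbit A) X) (fob Y A) (ev A)"
  unfolding bdry_lift_def
proof (intro allI ballI impI)
  note AS = SS_simplicial[OF A]
  fix n u y assume y: "y \<in> spx (fob Y A) n"
    and asm: "\<forall>k. \<forall>\<theta>\<in>Dmap k n. \<not> dsurj k n \<theta> \<longrightarrow>
       u k \<theta> \<in> spx (HOM (orbit A) X) k \<and> ev A k (u k \<theta>) = opr (fob Y A) k n \<theta> y \<and>
       (\<forall>j. \<forall>\<gamma>\<in>Dmap j k. u j (compose {..j} \<theta> \<gamma>) = opr (HOM (orbit A) X) j k \<gamma> (u k \<theta>))"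
  define bd where "bd k \<theta> \<longleftrightarrow> \<theta> \<in> Dmap k n \<and> \<not> dsurj k n \<theta>" for k \<theta>
  have bdD: "bd k \<theta> \<Longrightarrow> \<theta> \<in> Dmap k n" for k \<theta> by (simp add: bd_def)
  have bd_comp: "bd j (compose {..j} \<theta> \<gamma>)" if "bd k \<theta>" "\<gamma> \<in> Dmap j k" for j k \<theta> \<gamma>
    using that dsurj_comp_left[OF that(2)] by (auto simp: bd_def)
  have "\<exists>v h. bd k \<theta> \<longrightarrow> v \<in> F k \<and> h \<in> smap (sprod A (Delta k)) (vtop k v) \<and> u k \<theta> = enc (ahom (orbit A) X) k (mk A k v h)" for k \<theta>
  proof (cases "bd k \<theta>")
    case True
    then have "u k \<theta> \<in> spx (HOM (orbit A) X) k" using asm by (auto simp: bd_def)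
    then show ?thesis using HOM_X_cases[OF A] by metis
  qed simp
  then obtain vv hh where "\<And>k \<theta>. bd k \<theta> \<longrightarrow> vv k \<theta> \<in> F k \<and> hh k \<theta> \<in> smap (sprod A (Delta k)) (vtop k (vv k \<theta>)) \<and>
      u k \<theta> = enc (ahom (orbit A) X) k (mk A k (vv k \<theta>) (hh k \<theta>))" by metis
  then have vv: "vv k \<theta> \<in> F k" and hh: "hh k \<theta> \<in> smap (sprod A (Delta k)) (vtop k (vv k \<theta>))"
    and u: "u k \<theta> = enc (ahom (orbit A) X) k (mk A k (vv k \<theta>) (hh k \<theta>))" if "bd k \<theta>" for k \<theta>
    using that by blast+
  define T where "T k \<theta> = vtop k (vv k \<theta>)" for k \<theta>
  define yy where "yy k \<theta> = fY (vv k \<theta>) k (Did k)" for k \<theta>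
  have TC: "T k \<theta> \<in> \<C>" and TS: "T k \<theta> \<in> SS" and yyT: "yy k \<theta> \<in> spx (fob Y (T k \<theta>)) k"
    and hT: "hh k \<theta> \<in> smap (sprod A (Delta k)) (T k \<theta>)" if "bd k \<theta>" for k \<theta>
    using famsD(4,5)[OF vv[OF that] Did_Dmap] CSS hh[OF that] by (auto simp: T_def yy_def)
  \<comment> \<open>By uniqueness of coordinates, compatibility of the points \<open>u\<close>
    becomes compatibility of the diagrams \<open>vv\<close> and of the maps
    \<open>hh\<close>.\<close>
  have nat: "vv j (compose {..j} \<theta> \<gamma>) = fopr j k \<gamma> (vv k \<theta>)"
      "hh j (compose {..j} \<theta> \<gamma>) = hcomp A j (tr k (vv k \<theta>) j \<gamma>) (pull A j \<gamma> (hh k \<theta>))"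
    if b: "bd k \<theta>" and g: "\<gamma> \<in> Dmap j k" for j k \<theta> \<gamma>
  proof -
    have "u j (compose {..j} \<theta> \<gamma>) = opr (HOM (orbit A) X) j k \<gamma> (u k \<theta>)"
      using asm b g by (auto simp: bd_def)
    then have "enc (ahom (orbit A) X) j (mk A j (vv j (compose {..j} \<theta> \<gamma>)) (hh j (compose {..j} \<theta> \<gamma>)))
      = (enc (ahom (orbit A) X) j (mk A j (fopr j k \<gamma> (vv k \<theta>)) (hcomp A j (tr k (vv k \<theta>) j \<gamma>) (pull A j \<gamma> (hh k \<theta>)))) :: 'u)"
      unfolding u[OF b] u[OF bd_comp[OF b g]] opr_HOM[OF X_Ob A mk_pts[OF AS vv[OF b] hh[OF b]]] pull_mk[OF vv[OF b] AS hh[OF b] g] .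
    from enc_mk_inj[OF A vv[OF bd_comp[OF b g]] fopr_fams[OF vv[OF b] g] hh[OF bd_comp[OF b g]] hcomp_tr[OF vv[OF b] AS hh[OF b] g] this]
    show "vv j (compose {..j} \<theta> \<gamma>) = fopr j k \<gamma> (vv k \<theta>)"
      "hh j (compose {..j} \<theta> \<gamma>) = hcomp A j (tr k (vv k \<theta>) j \<gamma>) (pull A j \<gamma> (hh k \<theta>))" by blast+
  qed
  have TT: "T j (compose {..j} \<theta> \<gamma>) = fC (vv k \<theta>) j \<gamma>" if "bd k \<theta>" "\<gamma> \<in> Dmap j k" for j k \<theta> \<gamma>
    using nat(1)[OF that] that(2) by (simp add: T_def)
  have yT: "yy j (compose {..j} \<theta> \<gamma>) = fY (vv k \<theta>) j \<gamma>" if "bd k \<theta>" "\<gamma> \<in> Dmap j k" for j k \<theta> \<gamma>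
    using nat(1)[OF that] that(2) by (simp add: yy_def)
  have acty: "act Y A (T k \<theta>) k (hh k \<theta>) (yy k \<theta>) = opr (fob Y A) k n \<theta> y" if b: "bd k \<theta>" for k \<theta>
  proof -
    have "ev A k (u k \<theta>) = opr (fob Y A) k n \<theta> y" using asm b by (auto simp: bd_def)
    then show ?thesis unfolding u[OF b] ev_mk[OF A vv[OF b] hh[OF b]] T_def yy_def .
  qed
  have ext: "\<exists>C\<in>\<C>\<^sub>0. \<exists>h z. h \<in> smap (sprod B (Delta k)) C \<and> z \<in> spx (fob Y C) k \<and> x = act Y B C k h z"
    if B: "B \<in> SS" and x: "x \<in> spx (fob Y B) k" for B k x
  proof -
    have "x \<in> coend_eval Y B k ` coend_pts \<C>\<^sub>0 Y B k" using kan B x unfolding kan_extended_from_def by blast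
    then show ?thesis unfolding coend_eval_def coend_pts_def by auto
  qed
  \<comment> \<open>A presentation of \<open>y\<close> by an element \<open>z\<close> over a
    generating object. Once \<kappa> descends to \<open>D\<close>, it yields the element
    \<open>x0\<close> of \<open>Y D\<close> that restricts to \<open>y\<close>.\<close>
  obtain C\<^sub>y \<kappa> z where C: "C\<^sub>y \<in> \<C>\<^sub>0" and \<kappa>: "\<kappa> \<in> smap (sprod A (Delta n)) C\<^sub>y" and z: "z \<in> spx (fob Y C\<^sub>y) n"
    and yz: "y = act Y A C\<^sub>y n \<kappa> z" using ext[OF A y] by blast
  have CS: "C\<^sub>y \<in> SS" using C C0 by blast
  \<comment> \<open>The data for one boundary simplex: a presentation of its element
    \<open>yy\<close> by \<open>E\<close>, \<open>l\<close> and \<open>x\<close>, and the finite set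
    \<open>H\<close> of maps in a chain between two presentations of the face of \<open>y\<close>,
    one through \<open>hh\<close> and \<open>l\<close>, the other through \<kappa>.\<close>
  define good where "good k \<theta> E l x H \<longleftrightarrow> E \<in> \<C>\<^sub>0 \<and> l \<in> smap (sprod (T k \<theta>) (Delta k)) E \<and> x \<in> spx (fob Y E) k \<and>
      yy k \<theta> = act Y (T k \<theta>) E k l x \<and>
      finite H \<and> (\<forall>f\<in>H. \<exists>C\<in>\<C>\<^sub>0. f \<in> smap (sprod A (Delta k)) C) \<and> hcomp A k l (hh k \<theta>) \<in> H \<and> pull A k \<theta> \<kappa> \<in> H \<and>
      (\<forall>D q. D \<in> SS \<longrightarrow> quot A D q \<longrightarrow> (\<forall>f\<in>H. descends A q k f) \<longrightarrow>
         act Y D E k (desc A D q k (hcomp A k l (hh k \<theta>))) x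
           = act Y D C\<^sub>y k (desc A D q k (pull A k \<theta> \<kappa>)) (opr (fob Y C\<^sub>y) k n \<theta> z))" for k \<theta> E l x H
  have "\<exists>E l x H. bd k \<theta> \<longrightarrow> good k \<theta> E l x H" for k \<theta>
  proof (cases "bd k \<theta>")
    case b: True
    note t = bdD[OF b]
    obtain E l x where E: "E \<in> \<C>\<^sub>0" and l: "l \<in> smap (sprod (T k \<theta>) (Delta k)) E" and x: "x \<in> spx (fob Y E) k"
      and yx: "yy k \<theta> = act Y (T k \<theta>) E k l x" using ext[OF TS[OF b] yyT[OF b]] by blast
    have ES: "E \<in> SS" using E C0 by blast
    have lh: "hcomp A k l (hh k \<theta>) \<in> smap (sprod A (Delta k)) E" using hT[OF b] l AS by simp
    have pk: "pull A k \<theta> \<kappa> \<in> smap (sprod A (Delta k)) C\<^sub>y" using \<kappa> t AS by simp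
    have tz: "opr (fob Y C\<^sub>y) k n \<theta> z \<in> spx (fob Y C\<^sub>y) k" using SS_simplicial[OF Y_SS[OF CS]] t z by simp
    let ?p = "(E, hcomp A k l (hh k \<theta>), x)" and ?p' = "(C\<^sub>y, pull A k \<theta> \<kappa>, opr (fob Y C\<^sub>y) k n \<theta> z)"
    have p: "?p \<in> coend_pts \<C>\<^sub>0 Y A k" "?p' \<in> coend_pts \<C>\<^sub>0 Y A k"
      unfolding coend_pts_def using E x lh C pk tz by auto
    have e: "coend_eval Y A k ?p = coend_eval Y A k ?p'"
      using act_hcomp[OF Y A TS[OF b] ES hT[OF b] l x] acty[OF b] act_opr[OF Y A CS \<kappa> z t]
      by (simp add: coend_eval_def yx[symmetric] yz)
    obtain H where "finite H" "\<forall>f\<in>H. \<exists>C\<in>\<C>\<^sub>0. f \<in> smap (sprod A (Delta k)) C"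
      "fst (snd ?p) \<in> H" "fst (snd ?p') \<in> H"
      "\<forall>D q. D \<in> SS \<longrightarrow> quot A D q \<longrightarrow> (\<forall>f\<in>H. descends A q k f) \<longrightarrow>
         act Y D (fst ?p) k (desc A D q k (fst (snd ?p))) (snd (snd ?p))
           = act Y D (fst ?p') k (desc A D q k (fst (snd ?p'))) (snd (snd ?p'))"
      using zigzag[OF A p e] .
    then have "good k \<theta> E l x H" unfolding good_def using E l x yx by simp
    then show ?thesis by blast
  qed simp
  then obtain E l x H where gd: "\<And>k \<theta>. bd k \<theta> \<Longrightarrow> good k \<theta> (E k \<theta>) (l k \<theta>) (x k \<theta>) (H k \<theta>)" by metis
  \<comment> \<open>Everything that has to descend. There are countably many boundary simplices,
    each with finitely many maps, so \<open>ex_quotient\<close> applies.\<close>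
  define G where "G = insert (n, \<kappa>) (\<Union>k. \<Union>\<theta>\<in>{\<theta> \<in> Dmap k n. bd k \<theta>}. Pair k ` insert (hh k \<theta>) (H k \<theta>))"
  have cG: "countable G" unfolding G_def
    by (intro countable_insert countable_UN[OF countableI_type] countable_UN countable_finite)
      (use gd in \<open>auto simp: good_def finite_Dmap\<close>)
  have GB: "\<exists>B. f \<in> smap (sprod A (Delta m)) B \<and> (\<forall>k. spx B k \<subseteq> U\<^sub>0)" if "(m, f) \<in> G" for m f
  proof -
    have "(m, f) = (n, \<kappa>) \<or> (\<exists>\<theta>. bd m \<theta> \<and> (f = hh m \<theta> \<or> f \<in> H m \<theta>))" using that by (auto simp: G_def)
    then consider "(m, f) = (n, \<kappa>)" | \<theta> where "bd m \<theta>" "f = hh m \<theta>" | \<theta> where "bd m \<theta>" "f \<in> H m \<theta>" by blast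
    then show ?thesis
    proof cases
      case 1 then show ?thesis using \<kappa> C0U0[OF C] by auto
    next
      case 2
      have "spx (T m \<theta>) k \<subseteq> U\<^sub>0" for k using TC[OF 2(1)] by (simp add: bounded_simps_def)
      then show ?thesis using hT[OF 2(1)] 2(2) by blast
    next
      case 3 then obtain B where "B \<in> \<C>\<^sub>0" "f \<in> smap (sprod A (Delta m)) B" using gd[OF 3(1)] unfolding good_def by blast
      then show ?thesis using C0U0 by blast
    qed
  qed
  obtain D q where D: "D \<in> \<C>" and q: "quot A D q" and dG: "\<forall>(m, f)\<in>G. descends A q m f"
    using ex_quotient[OF U0 A cG GB] .
  have DS: "D \<in> SS" by (rule CSS[OF D])
  note DSS = SS_simplicial[OF DS] and hq = quotD(6)[OF q]
  have d\<kappa>: "descends A q n \<kappa>" using dG by (auto simp: G_def)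
  have dh: "descends A q k (hh k \<theta>)" and dH: "\<forall>f\<in>H k \<theta>. descends A q k f" if "bd k \<theta>" for k \<theta>
    using dG that by (auto simp: G_def bd_def)
  define hb where "hb k \<theta> = desc A D q k (hh k \<theta>)" for k \<theta>
  have hb: "hb k \<theta> \<in> smap (sprod D (Delta k)) (T k \<theta>)" "hcomp A k (hb k \<theta>) (hconst A k q) = hh k \<theta>" if "bd k \<theta>" for k \<theta>
    unfolding hb_def using desc_smap[OF q dh[OF that] hT[OF that]] hcomp_desc[OF q dh[OF that] hT[OF that]] .
  define kb where "kb = desc A D q n \<kappa>"
  have kb: "kb \<in> smap (sprod D (Delta n)) C\<^sub>y" "hcomp A n kb (hconst A n q) = \<kappa>"
    unfolding kb_def using desc_smap[OF q d\<kappa> \<kappa>] hcomp_desc[OF q d\<kappa> \<kappa>] .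
  define x0 where "x0 = act Y D C\<^sub>y n kb z"
  have x0: "x0 \<in> spx (fob Y D) n" unfolding x0_def by (rule act_in[OF Y DS CS kb(1) z])
  note YDS = SS_simplicial[OF Y_SS[OF DS]]
  \<comment> \<open>The elements agree already over \<open>D\<close>, which is where the chains are
    used. This is the condition on \<open>fY\<close> for transitions from the new top object to the
    boundary.\<close>
  have x0b: "opr (fob Y D) k n \<theta> x0 = act Y D (T k \<theta>) k (hb k \<theta>) (yy k \<theta>)" if b: "bd k \<theta>" for k \<theta>
  proof -
    note t = bdD[OF b]
    have g: "E k \<theta> \<in> \<C>\<^sub>0" "l k \<theta> \<in> smap (sprod (T k \<theta>) (Delta k)) (E k \<theta>)" "x k \<theta> \<in> spx (fob Y (E k \<theta>)) k"
      "yy k \<theta> = act Y (T k \<theta>) (E k \<theta>) k (l k \<theta>) (x k \<theta>)"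
      "hcomp A k (l k \<theta>) (hh k \<theta>) \<in> H k \<theta>" "pull A k \<theta> \<kappa> \<in> H k \<theta>"
      and z2: "act Y D (E k \<theta>) k (desc A D q k (hcomp A k (l k \<theta>) (hh k \<theta>))) (x k \<theta>)
           = act Y D C\<^sub>y k (desc A D q k (pull A k \<theta> \<kappa>)) (opr (fob Y C\<^sub>y) k n \<theta> z)"
      using gd[OF b] DS q dH[OF b] unfolding good_def by blast+
    have ES: "E k \<theta> \<in> SS" using g(1) C0 by blast
    have d1: "descends A q k (hcomp A k (l k \<theta>) (hh k \<theta>))" "descends A q k (pull A k \<theta> \<kappa>)" using dH[OF b] g(5,6) by auto
    have m1: "hcomp A k (l k \<theta>) (hh k \<theta>) \<in> smap (sprod A (Delta k)) (E k \<theta>)" using hT[OF b] g(2) AS by simp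
    have m2: "pull A k \<theta> \<kappa> \<in> smap (sprod A (Delta k)) C\<^sub>y" using \<kappa> t AS by simp
    have e1: "desc A D q k (hcomp A k (l k \<theta>) (hh k \<theta>)) = hcomp D k (l k \<theta>) (hb k \<theta>)"
    proof (rule desc_unique[OF q desc_smap[OF q d1(1) m1] hcomp_smap[OF hb(1)[OF b] g(2) DSS]])
      show "hcomp A k (desc A D q k (hcomp A k (l k \<theta>) (hh k \<theta>))) (hconst A k q) = hcomp A k (hcomp D k (l k \<theta>) (hb k \<theta>)) (hconst A k q)"
        unfolding hcomp_desc[OF q d1(1) m1] hcomp_assoc[OF hq, symmetric] hb(2)[OF b] ..
    qed
    have e2: "desc A D q k (pull A k \<theta> \<kappa>) = pull D k \<theta> kb"
    proof (rule desc_unique[OF q desc_smap[OF q d1(2) m2] pull_smap[OF kb(1) t DSS]])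
      have "hcomp A k (pull D k \<theta> kb) (hconst A k q) = pull A k \<theta> (hcomp A n kb (hconst A n q))"
        using pull_hcomp[OF hq[of n] t, of kb] t by simp
      then show "hcomp A k (desc A D q k (pull A k \<theta> \<kappa>)) (hconst A k q) = hcomp A k (pull D k \<theta> kb) (hconst A k q)"
        unfolding hcomp_desc[OF q d1(2) m2] kb(2) by simp
    qed
    have "opr (fob Y D) k n \<theta> x0 = act Y D C\<^sub>y k (pull D k \<theta> kb) (opr (fob Y C\<^sub>y) k n \<theta> z)"
      unfolding x0_def by (rule act_opr[OF Y DS CS kb(1) z t])
    also have "\<dots> = act Y D (E k \<theta>) k (hcomp D k (l k \<theta>) (hb k \<theta>)) (x k \<theta>)" using z2 unfolding e1 e2 by simp
    also have "\<dots> = act Y D (T k \<theta>) k (hb k \<theta>) (yy k \<theta>)"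
      unfolding g(4) by (rule act_hcomp[OF Y DS TS[OF b] ES hb(1)[OF b] g(2,3)])
    finally show ?thesis .
  qed
  have hbc: "hcomp D i (fF (vv j \<theta>) j (Did j) i \<delta>) (pull D i \<delta> (hb j \<theta>)) = hb i (compose {..i} \<theta> \<delta>)"
    if b: "bd j \<theta>" and d: "\<delta> \<in> Dmap i j" for i j \<theta> \<delta>
  proof (rule desc_unique[OF q])
    have m: "pull D i \<delta> (hb j \<theta>) \<in> smap (sprod D (Delta i)) (T j \<theta>)" by (rule pull_smap[OF hb(1)[OF b] d DSS])
    have t: "fF (vv j \<theta>) j (Did j) i \<delta> \<in> smap (sprod (T j \<theta>) (Delta i)) (fC (vv j \<theta>) i \<delta>)"
      using tr_smap[OF vv[OF b] d] by (simp add: T_def)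
    show "hcomp D i (fF (vv j \<theta>) j (Did j) i \<delta>) (pull D i \<delta> (hb j \<theta>)) \<in> smap (sprod D (Delta i)) (fC (vv j \<theta>) i \<delta>)"
      by (rule hcomp_smap[OF m t DSS])
    show "hb i (compose {..i} \<theta> \<delta>) \<in> smap (sprod D (Delta i)) (T i (compose {..i} \<theta> \<delta>))"
      by (rule hb(1)[OF bd_comp[OF b d]])
    have "hcomp A i (pull D i \<delta> (hb j \<theta>)) (hconst A i q) = pull A i \<delta> (hh j \<theta>)"
      using pull_hcomp[OF hq[of j] d, of "hb j \<theta>"] d by (simp add: hb(2)[OF b])
    then show "hcomp A i (hcomp D i (fF (vv j \<theta>) j (Did j) i \<delta>) (pull D i \<delta> (hb j \<theta>))) (hconst A i q)
        = hcomp A i (hb i (compose {..i} \<theta> \<delta>)) (hconst A i q)"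
      unfolding hb(2)[OF bd_comp[OF b d]] nat(2)[OF b d] hcomp_assoc[OF hq, symmetric] by simp
  qed
  \<comment> \<open>Positions over surjective \<theta> are degeneracies of the new simplex: they
    carry \<open>D\<close>, degeneracies of \<open>x0\<close>, and identities between them. Boundary
    positions keep the given diagram, and \<open>hb\<close> leads from the former to the
    latter.\<close>
  define w where "w = \<lparr>
     fC = (\<lambda>k \<theta>. if \<theta> \<in> Dmap k n then if dsurj k n \<theta> then D else T k \<theta> else undefined),
     fF = (\<lambda>k \<theta> j \<gamma>. if \<theta> \<in> Dmap k n \<and> \<gamma> \<in> Dmap j k then
       if dsurj j n (compose {..j} \<theta> \<gamma>) then hid D j
       else if dsurj k n \<theta> then hb j (compose {..j} \<theta> \<gamma>) else fF (vv k \<theta>) k (Did k) j \<gamma> else undefined),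
     fY = (\<lambda>k \<theta>. if \<theta> \<in> Dmap k n then if dsurj k n \<theta> then opr (fob Y D) k n \<theta> x0 else yy k \<theta> else undefined)\<rparr>"
  have wC: "fC w k \<theta> = D" "fY w k \<theta> = opr (fob Y D) k n \<theta> x0" if "\<theta> \<in> Dmap k n" "dsurj k n \<theta>" for k \<theta>
    using that by (simp_all add: w_def)
  have wT: "fC w k \<theta> = T k \<theta>" "fY w k \<theta> = yy k \<theta>" if "bd k \<theta>" for k \<theta>
    using that by (simp_all add: w_def bd_def)
  have wFs: "fF w k \<theta> j \<gamma> = hid D j" if "\<theta> \<in> Dmap k n" "\<gamma> \<in> Dmap j k" "dsurj j n (compose {..j} \<theta> \<gamma>)" for k \<theta> j \<gamma>
    using that by (simp add: w_def)
  have wFm: "fF w k \<theta> j \<gamma> = hb j (compose {..j} \<theta> \<gamma>)"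
    if "\<theta> \<in> Dmap k n" "dsurj k n \<theta>" "\<gamma> \<in> Dmap j k" "bd j (compose {..j} \<theta> \<gamma>)" for k \<theta> j \<gamma>
    using that by (simp add: w_def bd_def)
  have wFb: "fF w k \<theta> j \<gamma> = fF (vv k \<theta>) k (Did k) j \<gamma>" if b: "bd k \<theta>" and g: "\<gamma> \<in> Dmap j k" for k \<theta> j \<gamma>
    using bd_comp[OF b g] b g by (simp add: w_def bd_def)
  \<comment> \<open>No transition leads from a boundary position to a surjective one, so three cases
    suffice.\<close>
  have cases: "(dsurj k n \<theta> \<and> dsurj j n (compose {..j} \<theta> \<gamma>)) \<or> (dsurj k n \<theta> \<and> bd j (compose {..j} \<theta> \<gamma>)) \<or> bd k \<theta>"
    if "\<theta> \<in> Dmap k n" "\<gamma> \<in> Dmap j k" for k \<theta> j \<gamma> using that by (auto simp: bd_def)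
  have w: "w \<in> F n"
    unfolding fams_def
  proof (intro CollectI conjI allI ballI impI)
    fix k \<theta> assume t: "\<theta> \<in> Dmap k n"
    have sb: "dsurj k n \<theta> \<or> bd k \<theta>" using t by (auto simp: bd_def)
    show "fC w k \<theta> \<in> \<C>" using sb wC[OF t] wT[of k \<theta>] D TC by auto
    show "fY w k \<theta> \<in> spx (fob Y (fC w k \<theta>)) k" using sb wC[OF t] wT[of k \<theta>] yyT YDS t x0 by auto
    fix j \<gamma> assume g: "\<gamma> \<in> Dmap j k"
    have tg: "compose {..j} \<theta> \<gamma> \<in> Dmap j n" using t g by simp
    show "fF w k \<theta> j \<gamma> \<in> smap (sprod (fC w k \<theta>) (Delta j)) (fC w j (compose {..j} \<theta> \<gamma>))"
      using cases[OF t g]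
    proof (elim disjE conjE)
      assume s: "dsurj k n \<theta>" "dsurj j n (compose {..j} \<theta> \<gamma>)"
      show ?thesis using wFs[OF t g s(2)] wC[OF t s(1)] wC[OF tg s(2)] DSS by simp
    next
      assume s: "dsurj k n \<theta>" "bd j (compose {..j} \<theta> \<gamma>)"
      show ?thesis using wFm[OF t s(1) g s(2)] wC[OF t s(1)] wT[OF s(2)] hb(1)[OF s(2)] by simp
    next
      assume b: "bd k \<theta>"
      show ?thesis using wFb[OF b g] wT[OF b] wT[OF bd_comp[OF b g]] tr_smap[OF vv[OF b] g] TT[OF b g] by (simp add: T_def)
    qed
    show "fC w j (compose {..j} \<theta> \<gamma>) = fC w k \<theta>" "fF w k \<theta> j \<gamma> = hid (fC w k \<theta>) j" if gs: "dsurj j k \<gamma>"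
    proof -
      have "fC w j (compose {..j} \<theta> \<gamma>) = fC w k \<theta> \<and> fF w k \<theta> j \<gamma> = hid (fC w k \<theta>) j"
      proof (cases "dsurj k n \<theta>")
        case True
        then have "dsurj j n (compose {..j} \<theta> \<gamma>)" by (rule dsurj_comp[OF gs])
        then show ?thesis using wFs[OF t g] wC[OF t True] wC[OF tg] by simp
      next
        case False
        then have b: "bd k \<theta>" using t by (simp add: bd_def)
        show ?thesis
          using wFb[OF b g] wT[OF b] wT[OF bd_comp[OF b g]] TT[OF b g] famsD(7,8)[OF vv[OF b] Did_Dmap g gs] g by (simp add: T_def)
      qed
      then show "fC w j (compose {..j} \<theta> \<gamma>) = fC w k \<theta>" "fF w k \<theta> j \<gamma> = hid (fC w k \<theta>) j" by blast+
    qed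
    show "opr (fob Y (fC w k \<theta>)) j k \<gamma> (fY w k \<theta>)
        = act Y (fC w k \<theta>) (fC w j (compose {..j} \<theta> \<gamma>)) j (fF w k \<theta> j \<gamma>) (fY w j (compose {..j} \<theta> \<gamma>))"
      using cases[OF t g]
    proof (elim disjE conjE)
      assume s: "dsurj k n \<theta>" "dsurj j n (compose {..j} \<theta> \<gamma>)"
      show ?thesis
        using wFs[OF t g s(2)] wC[OF t s(1)] wC[OF tg s(2)] opr_opr[OF YDS g t x0] act_hid[OF Y DS opr_in[OF YDS tg x0]] by simp
    next
      assume s: "dsurj k n \<theta>" "bd j (compose {..j} \<theta> \<gamma>)"
      show ?thesis using wFm[OF t s(1) g s(2)] wC[OF t s(1)] wT[OF s(2)] opr_opr[OF YDS g t x0] x0b[OF s(2)] by simp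
    next
      assume b: "bd k \<theta>"
      show ?thesis
        using wFb[OF b g] wT[OF b] wT[OF bd_comp[OF b g]] famsD(9)[OF vv[OF b] Did_Dmap g] g TT[OF b g] yT[OF b g]
        by (simp add: T_def yy_def)
    qed
    fix i \<delta> assume d: "\<delta> \<in> Dmap i j"
    have gd': "compose {..i} \<gamma> \<delta> \<in> Dmap i k" using g d by simp
    have cc: "compose {..i} \<theta> (compose {..i} \<gamma> \<delta>) = compose {..i} (compose {..j} \<theta> \<gamma>) \<delta>"
      by (rule comp_comp_Dmap[OF d, symmetric])
    show "hcomp (fC w k \<theta>) i (fF w j (compose {..j} \<theta> \<gamma>) i \<delta>) (pull (fC w k \<theta>) i \<delta> (fF w k \<theta> j \<gamma>))
        = fF w k \<theta> i (compose {..i} \<gamma> \<delta>)"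
      using cases[OF t g]
    proof (elim disjE conjE)
      assume s: "dsurj k n \<theta>" "dsurj j n (compose {..j} \<theta> \<gamma>)"
      show ?thesis
        using cases[OF tg d]
      proof (elim disjE conjE)
        assume "dsurj i n (compose {..i} (compose {..j} \<theta> \<gamma>) \<delta>)"
        then show ?thesis
          using wFs[OF t g s(2)] wFs[OF tg d] wFs[OF t gd'] wC[OF t s(1)] d DSS by (simp add: cc)
      next
        assume b: "bd i (compose {..i} (compose {..j} \<theta> \<gamma>) \<delta>)"
        then show ?thesis
          using wFs[OF t g s(2)] wFm[OF tg s(2) d b] wFm[OF t s(1) gd'] wC[OF t s(1)] d hb(1)[OF b] by (simp add: cc)
      next
        assume "bd j (compose {..j} \<theta> \<gamma>)" then show ?thesis using s(2) by (simp add: bd_def)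
      qed
    next
      assume s: "dsurj k n \<theta>" "bd j (compose {..j} \<theta> \<gamma>)"
      show ?thesis
        using wFm[OF t s(1) g s(2)] wFb[OF s(2) d] wFm[OF t s(1) gd'] wC[OF t s(1)] bd_comp[OF s(2) d] hbc[OF s(2) d]
        by (simp add: cc)
    next
      assume b: "bd k \<theta>"
      have "fF w j (compose {..j} \<theta> \<gamma>) i \<delta> = fF (vv k \<theta>) j \<gamma> i \<delta>"
        using wFb[OF bd_comp[OF b g] d] nat(1)[OF b g] g d by simp
      then show ?thesis
        using wFb[OF b g] wFb[OF b gd'] wT[OF b] famsD(10)[OF vv[OF b] Did_Dmap g d] g by (simp add: T_def)
    qed
  qed (auto simp: w_def)
  have wt: "vtop n w = D" "fY w n (Did n) = x0" using wC[OF Did_Dmap dsurj_Did] YDS x0 by auto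
  have hw: "hconst A n q \<in> smap (sprod A (Delta n)) (vtop n w)" using hq wt by simp
  let ?e = "enc (ahom (orbit A) X) n (mk A n w (hconst A n q))"
  have e1: "?e \<in> spx (HOM (orbit A) X) n" using mk_pts[OF AS w hw] by simp
  have "ev A n ?e = act Y A D n (hconst A n q) (act Y D C\<^sub>y n kb z)" unfolding ev_mk[OF A w hw] wt x0_def ..
  also have "\<dots> = y" unfolding yz using act_hcomp[OF Y A DS CS hq kb(1) z] kb(2) by simp
  finally have e2: "ev A n ?e = y" .
  have e3: "opr (HOM (orbit A) X) k n \<theta> ?e = u k \<theta>" if t: "\<theta> \<in> Dmap k n" and ns: "\<not> dsurj k n \<theta>" for k \<theta>
  proof -
    have b: "bd k \<theta>" using t ns by (simp add: bd_def)
    have "fopr k n \<theta> w = vv k \<theta>"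
    proof (rule family_eqI[OF fopr_fams[OF w t] vv[OF b]])
      fix k' \<theta>' assume t': "\<theta>' \<in> Dmap k' k"
      note b' = bd_comp[OF b t']
      show "fC (fopr k n \<theta> w) k' \<theta>' = fC (vv k \<theta>) k' \<theta>'" using t' wT[OF b'] TT[OF b t'] by simp
      show "fY (fopr k n \<theta> w) k' \<theta>' = fY (vv k \<theta>) k' \<theta>'" using t' wT[OF b'] yT[OF b t'] by simp
      fix j \<gamma> assume g: "\<gamma> \<in> Dmap j k'"
      show "fF (fopr k n \<theta> w) k' \<theta>' j \<gamma> = fF (vv k \<theta>) k' \<theta>' j \<gamma>" using t' g wFb[OF b' g] nat(1)[OF b t'] by simp
    qed
    moreover have "tr n w k \<theta> = hb k \<theta>" using wFm[OF Did_Dmap dsurj_Did t] b t by simp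
    ultimately show ?thesis
      unfolding opr_HOM[OF X_Ob A mk_pts[OF AS w hw]] pull_mk[OF w AS hw t] u[OF b] using hb(2)[OF b] t by simp
  qed
  show "\<exists>e\<in>spx (HOM (orbit A) X) n. ev A n e = y \<and> (\<forall>k. \<forall>\<theta>\<in>Dmap k n. \<not> dsurj k n \<theta> \<longrightarrow> opr (HOM (orbit A) X) k n \<theta> e = u k \<theta>)"
    using e1 e2 e3 by blast
qed

end

section \<open>The unit on orbit points\<close>

lemma bij_bdry_lift:
  assumes E: "simplicial_set E" and p: "p \<in> smap E B"
    and b: "\<And>n. bij_betw (p n) (spx E n) (spx B n)"
  shows "bdry_lift E B p"
  unfolding bdry_lift_def
proof (intro allI ballI impI)
  fix n u y assume y: "y \<in> spx B n" and asm: "\<forall>k. \<forall>\<theta>\<in>Dmap k n. \<not> dsurj k n \<theta> \<longrightarrow>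
     u k \<theta> \<in> spx E k \<and> p k (u k \<theta>) = opr B k n \<theta> y \<and> (\<forall>j. \<forall>\<gamma>\<in>Dmap j k. u j (compose {..j} \<theta> \<gamma>) = opr E j k \<gamma> (u k \<theta>))"
  obtain e where e: "e \<in> spx E n" "p n e = y" using b[of n] y by (metis bij_betw_imp_surj_on imageE)
  have "opr E k n \<theta> e = u k \<theta>" if t: "\<theta> \<in> Dmap k n" "\<not> dsurj k n \<theta>" for k \<theta>
  proof -
    have "p k (opr E k n \<theta> e) = p k (u k \<theta>)" using smap_opr[OF p t(1) e(1)] e(2) asm t by simp
    then show ?thesis
      using inj_onD[OF bij_betw_imp_inj_on[OF b], of k] opr_in[OF E t(1) e(1)] asm t by blast
  qed
  then show "\<exists>e\<in>spx E n. p n e = y \<and> (\<forall>k. \<forall>\<theta>\<in>Dmap k n. \<not> dsurj k n \<theta> \<longrightarrow> opr E k n \<theta> e = u k \<theta>)"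
    using e by blast
qed

text \<open>An isomorphism lifts against boundary inclusions, so this is an instance of
  \<open>bdry_lift_weak_equivalence\<close>.\<close>

lemma inverse_weak_equivalence:
  fixes E B :: "'u simp"
  assumes E: "simplicial_set E" and B: "simplicial_set B" and p: "p \<in> smap E B" and q: "q \<in> smap B E"
    and qp: "\<And>n x. x \<in> spx E n \<Longrightarrow> q n (p n x) = x" and pq: "\<And>n y. y \<in> spx B n \<Longrightarrow> p n (q n y) = y"
  shows "weak_equivalence E B p"
proof (rule bdry_lift_weak_equivalence[OF E B p bij_bdry_lift[OF E p]])
  show "bij_betw (p n) (spx E n) (spx B n)" for n
    by (rule bij_betwI[where g = "q n"]) (use p q qp pq in auto)
qed

context universe begin

definition src_pt :: "'u arrow \<Rightarrow> nat \<Rightarrow> 'u \<Rightarrow> 'u" where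
  "src_pt X = (\<lambda>n. \<lambda>z\<in>spx (HOM (orbit pt) X) n. fst (dec (ahom (orbit pt) X) n z) n (undefined, Did n))"

definition tgt_pt :: "'u arrow \<Rightarrow> nat \<Rightarrow> 'u \<Rightarrow> 'u" where
  "tgt_pt X = (\<lambda>n. \<lambda>z\<in>spx (HOM (orbit empty_simp) X) n. snd (dec (ahom (orbit empty_simp) X) n z) n (undefined, Did n))"

lemma src_pt_enc [simp]:
  "X \<in> Ob Map_cat \<Longrightarrow> s \<in> pts pt X n \<Longrightarrow> src_pt X n (enc (ahom (orbit pt) X) n s) = fst s n (undefined, Did n)"
  by (simp add: src_pt_def dec_enc_pts del: dec_enc)

lemma tgt_pt_enc [simp]:
  "X \<in> Ob Map_cat \<Longrightarrow> s \<in> pts empty_simp X n \<Longrightarrow>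
   tgt_pt X n (enc (ahom (orbit empty_simp) X) n s) = snd s n (undefined, Did n)"
  by (simp add: tgt_pt_def dec_enc_pts del: dec_enc)

text \<open>A point at \<open>pt\<close> is a simplex of \<open>src X\<close>, its target component
  being the image in \<open>tgt X\<close>; a point at the empty simplicial set is a simplex of
  \<open>tgt X\<close>. Evaluation at \<open>Did n\<close> gives both identifications.\<close>

lemma is_coend_orbit_points:
  assumes X: "(X :: 'u arrow) \<in> Ob Map_cat"
  shows "is_coend (orbit_points X) X (iota (orbit_points X) (src_pt X) (tgt_pt X))"
proof (rule is_coend_iota[OF simplicial_functor_orbit_points[OF X] X])
  have XS: "simplicial_set (src X)" "simplicial_set (tgt X)" and arr: "arr X \<in> smap (src X) (tgt X)"
    using X by (auto simp: Ob_Map_cat)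
  show "src_pt X \<in> smap (fob (orbit_points X) pt) (src X)"
    unfolding fob_orbit_points
  proof (rule smapI)
    fix n z assume z: "z \<in> spx (HOM (orbit pt) X) n"
    obtain s where s: "s \<in> pts pt X n" "z = enc (ahom (orbit pt) X) n s" using HOM_cases[OF X pt_SS z] .
    note f = ptsD(1)[OF s(1)]
    show "src_pt X n z \<in> spx (src X) n" using shom_in[OF f, of undefined n "Did n"] s X by simp
    fix m \<alpha> assume a: "\<alpha> \<in> Dmap m n"
    show "src_pt X m (opr (HOM (orbit pt) X) m n \<alpha> z) = opr (src X) m n \<alpha> (src_pt X n z)"
      using a s X pull_pts[OF simplicial_set_pt s(1) a] shom_opr[OF f a _ Did_Dmap, of undefined]
      by (simp add: opr_HOM[OF X pt_SS s(1)])
  qed (simp add: src_pt_def)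
  show "tgt_pt X \<in> smap (fob (orbit_points X) empty_simp) (tgt X)"
    unfolding fob_orbit_points
  proof (rule smapI)
    fix n z assume z: "z \<in> spx (HOM (orbit empty_simp) X) n"
    obtain s where s: "s \<in> pts empty_simp X n" "z = enc (ahom (orbit empty_simp) X) n s"
      using HOM_cases[OF X empty_SS z] .
    note f = ptsD(2)[OF s(1)]
    show "tgt_pt X n z \<in> spx (tgt X) n" using shom_in[OF f, of undefined n "Did n"] s X by simp
    fix m \<alpha> assume a: "\<alpha> \<in> Dmap m n"
    show "tgt_pt X m (opr (HOM (orbit empty_simp) X) m n \<alpha> z) = opr (tgt X) m n \<alpha> (tgt_pt X n z)"
      using a s X pull_pts[OF empty_simplicial s(1) a] shom_opr[OF f a _ Did_Dmap, of undefined]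
      by (simp add: opr_HOM[OF X empty_SS s(1)])
  qed (simp add: tgt_pt_def)
  fix n
  show "bij_betw (src_pt X n) (spx (fob (orbit_points X) pt) n) (spx (src X) n)"
    unfolding fob_orbit_points
  proof (rule bij_betwI')
    fix z z' assume z: "z \<in> spx (HOM (orbit pt) X) n" "z' \<in> spx (HOM (orbit pt) X) n"
    obtain s where s: "s \<in> pts pt X n" "z = enc (ahom (orbit pt) X) n s" using HOM_cases[OF X pt_SS z(1)] .
    obtain s' where s': "s' \<in> pts pt X n" "z' = enc (ahom (orbit pt) X) n s'" using HOM_cases[OF X pt_SS z(2)] .
    show "(src_pt X n z = src_pt X n z') = (z = z')"
    proof
      assume e: "src_pt X n z = src_pt X n z'"
      have f: "fst s k (undefined, \<beta>) = fst s' k (undefined, \<beta>)" if b: "\<beta> \<in> Dmap k n" for k \<beta>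
        using shom_opr[OF ptsD(1)[OF s(1)] b _ Did_Dmap, of undefined] shom_opr[OF ptsD(1)[OF s'(1)] b _ Did_Dmap, of undefined]
          e s s' b X by simp
      have "s = s'"
        by (rule pts_eqI[OF s(1) s'(1)])
          (use f ptsD(3)[OF s(1), of undefined, symmetric] ptsD(3)[OF s'(1), of undefined, symmetric] in auto)
      then show "z = z'" using s s' by simp
    qed simp
    show "src_pt X n z \<in> spx (src X) n"
      using shom_in[OF ptsD(1)[OF s(1)], of undefined n "Did n"] s X by simp
  next
    fix x assume x: "x \<in> spx (src X) n"
    note ax = smap_in[OF arr x]
    have p: "(point (src X) n x, point (tgt X) n (arr X n x)) \<in> pts pt X n"
      unfolding pts_iff using XS x ax smap_opr[OF arr _ x] by auto
    show "\<exists>z\<in>spx (HOM (orbit pt) X) n. x = src_pt X n z"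
      using p X x XS by (intro bexI[OF _ enc_HOM[OF p]]) simp
  qed
  show "bij_betw (tgt_pt X n) (spx (fob (orbit_points X) empty_simp) n) (spx (tgt X) n)"
    unfolding fob_orbit_points
  proof (rule bij_betwI')
    fix z z' assume z: "z \<in> spx (HOM (orbit empty_simp) X) n" "z' \<in> spx (HOM (orbit empty_simp) X) n"
    obtain s where s: "s \<in> pts empty_simp X n" "z = enc (ahom (orbit empty_simp) X) n s" using HOM_cases[OF X empty_SS z(1)] .
    obtain s' where s': "s' \<in> pts empty_simp X n" "z' = enc (ahom (orbit empty_simp) X) n s'" using HOM_cases[OF X empty_SS z(2)] .
    show "(tgt_pt X n z = tgt_pt X n z') = (z = z')"
    proof
      assume e: "tgt_pt X n z = tgt_pt X n z'"
      have f: "snd s k (undefined, \<beta>) = snd s' k (undefined, \<beta>)" if b: "\<beta> \<in> Dmap k n" for k \<beta>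
        using shom_opr[OF ptsD(2)[OF s(1)] b _ Did_Dmap, of undefined] shom_opr[OF ptsD(2)[OF s'(1)] b _ Did_Dmap, of undefined]
          e s s' b X by simp
      have "s = s'" by (rule pts_eqI[OF s(1) s'(1)]) (use f in auto)
      then show "z = z'" using s s' by simp
    qed simp
    show "tgt_pt X n z \<in> spx (tgt X) n"
      using shom_in[OF ptsD(2)[OF s(1)], of undefined n "Did n"] s X by simp
  next
    fix x assume x: "x \<in> spx (tgt X) n"
    have p: "(from_empty, point (tgt X) n x) \<in> pts empty_simp X n"
      unfolding pts_iff using XS x by auto
    show "\<exists>z\<in>spx (HOM (orbit empty_simp) X) n. x = tgt_pt X n z"
      using p X x XS by (intro bexI[OF _ enc_HOM[OF p]]) simp
  qed
  fix y assume "y \<in> spx (fob (orbit_points X) pt) n"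
  then have y: "y \<in> spx (HOM (orbit pt) X) n" by simp
  obtain s where s: "s \<in> pts pt X n" "y = enc (ahom (orbit pt) X) n s" using HOM_cases[OF X pt_SS y] .
  have h: "(from_empty, snd s) \<in> pts empty_simp X n"
    using hcomp_pts[OF s(1) from_empty_smap empty_simplicial] by simp
  show "arr X n (src_pt X n y) = tgt_pt X n (act (orbit_points X) empty_simp pt n from_empty y)"
    using ptsD(3)[OF s(1), of undefined n "Did n"] X s h
    by (simp add: act_orbit_points[OF X empty_SS pt_SS from_empty_smap s(1)])
qed

text \<open>Restricting a point of \<open>X\<close> along \<open>a : pt \<rightarrow> A\<close> and
  evaluating gives the value of the point at \<open>a\<close>. The canonical cowedge thus transposes
  to the identity and plays the part of the counit.\<close>

lemma transp_iota:
  assumes X: "(X :: 'u arrow) \<in> Ob Map_cat" and A: "A \<in> SS" and z: "z \<in> spx (HOM (orbit A) X) n"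
  shows "transp (orbit_points X) X (iota (orbit_points X) (src_pt X) (tgt_pt X)) A n z = z"
proof -
  note R = simplicial_functor_orbit_points[OF X] and AS = SS_simplicial[OF A]
  have cw: "is_cowedge (orbit_points X) X (iota (orbit_points X) (src_pt X) (tgt_pt X))"
    using is_coend_orbit_points[OF X] by (simp add: is_coend_def)
  obtain s where s: "s \<in> pts A X n" "z = enc (ahom (orbit A) X) n s" using HOM_cases[OF X A z] .
  have z': "z \<in> spx (fob (orbit_points X) A) n" using z by simp
  have "transp_pt (orbit_points X) A (iota (orbit_points X) (src_pt X) (tgt_pt X) A) n z = s"
  proof (rule pts_eqI[OF transp_pt_pts[OF R cw A z'] s(1)])
    fix k \<beta> assume b: "\<beta> \<in> Dmap k n"
    note ps = pull_pts[OF AS s(1) b]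
    have oz: "opr (HOM (orbit A) X) k n \<beta> z = enc (ahom (orbit A) X) k (pull A k \<beta> (fst s), pull pt k \<beta> (snd s))"
      unfolding s(2) by (rule opr_HOM[OF X A s(1)])
    have oi: "opr (HOM (orbit A) X) k n \<beta> z \<in> spx (fob (orbit_points X) A) k" unfolding oz using ps by simp
    show "fst (transp_pt (orbit_points X) A (iota (orbit_points X) (src_pt X) (tgt_pt X) A) n z) k (a, \<beta>) = fst s k (a, \<beta>)"
      if a: "a \<in> spx A k" for a
      using a b oi act_orbit_points[OF X pt_SS A point_smap[OF AS a] ps] hcomp_pts[OF ps point_smap[OF AS a] simplicial_set_pt] X AS
      by (simp add: oz)
    have h: "(from_empty, pull pt k \<beta> (snd s)) \<in> pts empty_simp X k"
      using hcomp_pts[OF ps from_empty_smap empty_simplicial] by simp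
    show "snd (transp_pt (orbit_points X) A (iota (orbit_points X) (src_pt X) (tgt_pt X) A) n z) k (undefined, \<beta>) = snd s k (undefined, \<beta>)"
      using b oi act_orbit_points[OF X empty_SS A from_empty_smap ps] h X by (simp add: oz)
  qed
  then show ?thesis using A z by (simp add: transp_def s(2))
qed

text \<open>Needed because \<open>realization\<close> is an arbitrary choice of coend, which for
  \<open>X\<^sup>\<O>\<close> is compared with \<open>X\<close> itself.\<close>

lemma coend_iso:
  fixes R R' :: "'u arrow"
  assumes Y: "simplicial_functor Y" and c: "is_coend Y R \<iota>" "is_coend Y R' \<iota>'"
  obtains k l where "k \<in> squares R R'" "l \<in> squares R' R"
    "\<forall>A\<in>SS. sqcomp (tensor (orbit A) (fob Y A)) k (\<iota> A) = \<iota>' A"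
    "sqcomp R l k = sqid R" "sqcomp R' k l = sqid R'"
proof -
  have R: "R \<in> Ob Map_cat" "R' \<in> Ob Map_cat" and w: "is_cowedge Y R \<iota>" "is_cowedge Y R' \<iota>'"
    using c by (auto simp: is_coend_def)
  let ?c = "\<lambda>g w A. sqcomp (tensor (orbit A) (fob Y A)) g (w A)"
  have u: "\<exists>!g. g \<in> squares R X \<and> (\<forall>A\<in>SS. ?c g \<iota> A = w A)" if "X \<in> Ob Map_cat" "is_cowedge Y X w" for X w
    using c(1) that unfolding is_coend_def by blast
  have u': "\<exists>!g. g \<in> squares R' X \<and> (\<forall>A\<in>SS. ?c g \<iota>' A = w A)" if "X \<in> Ob Map_cat" "is_cowedge Y X w" for X w
    using c(2) that unfolding is_coend_def by blast
  obtain k where k: "k \<in> squares R R'" "\<forall>A\<in>SS. ?c k \<iota> A = \<iota>' A" using u[OF R(2) w(2)] by blast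
  obtain l where l: "l \<in> squares R' R" "\<forall>A\<in>SS. ?c l \<iota>' A = \<iota> A" using u'[OF R(1) w(1)] by blast
  have comp: "?c (sqcomp Z g f) v A = ?c g (?c f v) A" if "is_cowedge Y Z v" "f \<in> squares Z Z'" "A \<in> SS"
    for f v A and g :: "(nat \<Rightarrow> 'u \<Rightarrow> 'u) \<times> (nat \<Rightarrow> 'u \<Rightarrow> 'u)" and Z Z' :: "'u arrow"
    unfolding prod_eq_iff sqcomp_sel
    by (intro conjI scomp_eqI) (use smap_in[OF cowedgeD(2)[OF that(1,3)]] smap_in[OF cowedgeD(3)[OF that(1,3)]] in auto)
  have idc: "?c (sqid Z) v A = v A" if "is_cowedge Y Z v" "A \<in> SS" for Z v A
    unfolding prod_eq_iff sqcomp_sel sqid_def using cowedgeD(2,3)[OF that] by simp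
  have sq: "sqcomp Z g f \<in> squares Z W" "sqid Z \<in> squares Z Z"
    if "Z \<in> Ob Map_cat" "f \<in> squares Z V" "g \<in> squares V W" for Z V W :: "'u arrow" and f g
  proof -
    show "sqcomp Z g f \<in> squares Z W" by (rule sqcomp_squares[OF that(2,3)]) (use that(1) in \<open>auto simp: Ob_Map_cat\<close>)
    show "sqid Z \<in> squares Z Z" unfolding sqid_def by (rule squaresI) (use that(1) in \<open>auto simp: Ob_Map_cat\<close>)
  qed
  have "sqcomp R l k = sqid R"
  proof -
    have "\<forall>A\<in>SS. ?c (sqcomp R l k) \<iota> A = \<iota> A" using comp[OF w(1) k(1)] k(2) l(2) by (intro ballI) simp
    moreover have "\<forall>A\<in>SS. ?c (sqid R) \<iota> A = \<iota> A" using idc[OF w(1)] by (intro ballI) simp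
    ultimately show ?thesis using u[OF R(1) w(1)] sq[OF R(1) k(1) l(1)] by blast
  qed
  moreover have "sqcomp R' k l = sqid R'"
  proof -
    have "\<forall>A\<in>SS. ?c (sqcomp R' k l) \<iota>' A = \<iota>' A" using comp[OF w(2) l(1)] k(2) l(2) by (intro ballI) simp
    moreover have "\<forall>A\<in>SS. ?c (sqid R') \<iota>' A = \<iota>' A" using idc[OF w(2)] by (intro ballI) simp
    ultimately show ?thesis using u'[OF R(2) w(2)] sq[OF R(2) l(1) k(1)] by blast
  qed
  ultimately show thesis using that k l by blast
qed

text \<open>Orbit points of the comparison \<open>k\<close> from the realization to
  \<open>X\<close>, composed with the unit, are the transpose of the canonical cowedge and hence the
  identity. As \<open>k\<close> is invertible, its orbit points are a weak equivalence, and two out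
  of three applies.\<close>

lemma unit_orbit_points:
  assumes cF: "is_category (Fun_model :: ('u sfunctor, _) model)" and cM: "is_category (Map_eq :: ('u arrow, _) model)"
    and two: "two_of_three (Fun_model :: ('u sfunctor, _) model) (weq Fun_model)"
    and X: "(X :: 'u arrow) \<in> Ob Map_cat"
  defines "P \<equiv> orbit_points X"
  shows "adjunct P (realization P) (sqid (realization P)) \<in> weq Fun_model P (orbit_points (realization P))"
proof -
  note adj = adjunction[OF cF cM]
  note fR = functorD[OF functor_orbit_points[OF cF]]
  have OR: "onO orbit_points_functor Z = orbit_points Z" for Z :: "'u arrow" by (simp add: orbit_points_functor_def)
  have OL: "onO realization_functor Z = realization Z" for Z :: "'u sfunctor" by (simp add: realization_functor_def)
  have P: "simplicial_functor P" "P \<in> Ob Fun_model"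
    unfolding P_def using simplicial_functor_orbit_points[OF X] small_functor_orbit_points[OF X] by auto
  let ?L = "realization P"
  note oL = realization_props(1)[OF P(1)]
  have L: "?L \<in> Ob Map_eq" and XM: "X \<in> Ob Map_eq" using oL X by auto
  have RL: "orbit_points ?L \<in> Ob Fun_model" using small_functor_orbit_points[OF oL] by simp
  obtain k l where k: "k \<in> squares ?L X" and l: "l \<in> squares X ?L"
    and ki: "\<forall>A\<in>SS. sqcomp (tensor (orbit A) (fob P A)) k (realization_in P A) = iota P (src_pt X) (tgt_pt X) A"
    and lk: "sqcomp ?L l k = sqid ?L" and kl: "sqcomp X k l = sqid X"
    using coend_iso[OF P(1) is_coend_realization[OF P(1)] is_coend_orbit_points[OF X, folded P_def]] .
  let ?\<eta> = "adjunct P ?L (sqid ?L)" and ?Rk = "onM orbit_points_functor ?L X k" and ?Rl = "onM orbit_points_functor X ?L l"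
  have idL: "sqid ?L \<in> squares ?L ?L" using cat_id[OF cM L] by simp
  have \<eta>: "?\<eta> \<in> nat_trans P (orbit_points ?L)" using adjunct_bij[OF P(1) oL] idL by (meson bij_betwE)
  have Rk: "?Rk \<in> nat_trans (orbit_points ?L) P" and Rl: "?Rl \<in> nat_trans P (orbit_points ?L)"
    using onM_orbit_points[OF oL X k] onM_orbit_points[OF X oL l] by (auto simp: P_def)
  have idw: "\<eta> \<in> weq Fun_model Z Z" if "Z \<in> Ob Fun_model" "\<eta> = Idm Fun_model Z" for Z :: "'u sfunctor" and \<eta>
  proof -
    have n: "Idm Fun_model Z \<in> nat_trans Z Z" using cat_id[OF cF that(1)] by simp
    have "weak_equivalence (fob Z A) (fob Z A) (Idm Fun_model Z A)" if A: "A \<in> SS" for A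
    proof -
      have S: "simplicial_set (fob Z A)" using \<open>Z \<in> Ob Fun_model\<close> A sfunD(1)[OF small_functorD, of Z A] by simp
      show ?thesis using A S by (auto intro!: inverse_weak_equivalence[where q = "sid (fob Z A)"])
    qed
    with n that(2) show ?thesis by simp
  qed
  have RkRl: "Cmp Fun_model P (orbit_points ?L) P ?Rk ?Rl = Idm Fun_model P"
    using fR(4)[OF XM L XM, of l k] fR(3)[OF XM] k l kl by (simp add: OR P_def)
  have RlRk: "Cmp Fun_model (orbit_points ?L) P (orbit_points ?L) ?Rl ?Rk = Idm Fun_model (orbit_points ?L)"
    using fR(4)[OF L XM L, of k l] fR(3)[OF L] k l lk by (simp add: OR P_def)
  have wRk: "?Rk \<in> weq Fun_model (orbit_points ?L) P"
  proof -
    have "weak_equivalence (fob (orbit_points ?L) A) (fob P A) (?Rk A)" if A: "A \<in> SS" for A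
    proof (rule inverse_weak_equivalence[OF _ _ nat_transD(1)[OF Rk A] nat_transD(1)[OF Rl A]])
      show "simplicial_set (fob (orbit_points ?L) A)" "simplicial_set (fob P A)"
        using sfunD(1)[OF simplicial_functor_orbit_points[OF oL] A] sfunD(1)[OF P(1) A] by auto
      show "?Rl A n (?Rk A n x) = x" if "x \<in> spx (fob (orbit_points ?L) A) n" for n x
        using fun_cong[OF fun_cong[OF fun_cong[OF RlRk, of A], of n], of x] A that by simp
      show "?Rk A n (?Rl A n y) = y" if "y \<in> spx (fob P A) n" for n y
        using fun_cong[OF fun_cong[OF fun_cong[OF RkRl, of A], of n], of y] A that by simp
    qed
    then show ?thesis using Rk by simp
  qed
  have "Cmp Fun_model P (orbit_points ?L) P ?Rk ?\<eta> = adjunct P X (sqcomp ?L k (sqid ?L))"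
    using adjD(5)[OF adj P(2) L XM, of "sqid ?L" k] idL k by (simp add: OL OR P_def)
  also have "sqcomp ?L k (sqid ?L) = k" using cat_id_right[OF cM L XM, of k] k by simp
  also have "adjunct P X k = Idm Fun_model P"
  proof (rule nat_trans_eqI)
    show "adjunct P X k \<in> nat_trans P (orbit_points X)" using adjunct_bij[OF P(1) X] k by (meson bij_betwE)
    show "Idm Fun_model P \<in> nat_trans P P" using cat_id[OF cF P(2)] by simp
    fix A :: "'u simp" and n y assume A: "A \<in> SS" and y: "y \<in> spx (fob P A) n"
    have "adjunct P X k A n y = transp P X (iota P (src_pt X) (tgt_pt X)) A n y"
      unfolding adjunct_transp[OF P(1) k] transp_def using ki A by simp
    then show "adjunct P X k A n y = Idm Fun_model P A n y"
      using transp_iota[OF X A, of y n] A y by (simp add: P_def)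
  qed
  finally have e: "Cmp Fun_model P (orbit_points ?L) P ?Rk ?\<eta> = Idm Fun_model P" .
  have "Cmp Fun_model P (orbit_points ?L) P ?Rk ?\<eta> \<in> weq Fun_model P P" by (rule idw[OF P(2) e])
  moreover have "?\<eta> \<in> Hm Fun_model P (orbit_points ?L)" "?Rk \<in> Hm Fun_model (orbit_points ?L) P" using \<eta> Rk by auto
  ultimately show ?thesis
    using two P(2) RL wRk unfolding two_of_three_def by blast
qed

lemma ex_resolution:
  assumes Y: "small_functor (Y :: 'u sfunctor)"
  obtains X p where "X \<in> Ob Map_cat" "p \<in> fib Fun_model (orbit_points X) Y" "p \<in> weq Fun_model (orbit_points X) Y"
proof -
  obtain \<C>\<^sub>0 where C: "\<C>\<^sub>0 \<subseteq> SS" "|\<C>\<^sub>0| <o |UNIV :: 'u set|" "kan_extended_from \<C>\<^sub>0 Y"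
    using Y by (auto simp: small_functor_def)
  have "small \<C>\<^sub>0" using C(2) unfolding small_def unfolding U_UNIV .
  moreover have "small (\<Union>n. spx C n)" if "C \<in> \<C>\<^sub>0" for C
    using that C(1) by (intro small_UN[OF small_countable[OF countableI_type]] SS_small) auto
  ultimately have "small (\<Union>C\<in>\<C>\<^sub>0. \<Union>n. spx C n)" by (rule small_UN)
  \<comment> \<open>\<open>U\<^sub>0\<close> contains all simplices of the generating objects, so
    maps into these objects are admissible in \<open>ex_quotient\<close>.\<close>
  then obtain U\<^sub>0 where U0: "absorbing U\<^sub>0" "(\<Union>C\<in>\<C>\<^sub>0. \<Union>n. spx C n) \<subseteq> U\<^sub>0" using ex_absorbing by blast
  have "spx C n \<subseteq> U\<^sub>0" if "C \<in> \<C>\<^sub>0" for C n using that U0(2) by blast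
  then interpret resolution U Y \<C>\<^sub>0 U\<^sub>0
    by unfold_locales (use small_functorD[OF Y] C U0 in auto)
  show thesis
  proof (rule that[OF X_Ob])
    have S: "simplicial_set (HOM (orbit A) X)" "simplicial_set (fob Y A)" "ev A \<in> smap (HOM (orbit A) X) (fob Y A)"
      if A: "A \<in> SS" for A
      using nat_transD(1)[OF ev_nat_trans A] Y_SS[OF A] HOM_SS[OF X_Ob A] by auto
    show "ev \<in> fib Fun_model (orbit_points X) Y"
      using ev_nat_trans bdry_lift_kan_fibration[OF S(1,2,3) ev_bdry_lift] by simp
    show "ev \<in> weq Fun_model (orbit_points X) Y"
      using ev_nat_trans bdry_lift_weak_equivalence[OF S(1,2,3) ev_bdry_lift] by simp
  qed
qed

end

theorem proposition4p3:
  assumes "inaccessible (UNIV :: 'u set)"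
    and "model_category TYPE('u) (Fun_model :: ('u sfunctor, _) model)"
    and "model_category TYPE('u) (Map_eq :: ('u arrow, _) model)"
  shows "quillen_pair TYPE('u) (Fun_model :: ('u sfunctor, _) model) Map_eq
             realization_functor orbit_points_functor adjunct \<and>
         quillen_equivalence TYPE('u) (Fun_model :: ('u sfunctor, _) model) Map_eq
             realization_functor orbit_points_functor adjunct"
proof -
  interpret universe "UNIV :: 'u set" by unfold_locales (use assms(1) in auto)
  note cF = modelD(1)[OF assms(2)] and cM = modelD(1)[OF assms(3)]
  have OR: "onO orbit_points_functor Z = orbit_points Z" for Z :: "'u arrow" by (simp add: orbit_points_functor_def)
  have OL: "onO realization_functor Z = realization Z" for Z :: "'u sfunctor" by (simp add: realization_functor_def)
  have OM: "onM orbit_points_functor X Y f A = HOM_map (orbit A) X Y f" if "A \<in> SS" for X Y :: "'u arrow" and f A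
    using that by (simp add: orbit_points_functor_def)
  have R: "onM orbit_points_functor X Y f \<in> nat_trans (orbit_points X) (orbit_points Y)"
    if "X \<in> Ob Map_eq" "Y \<in> Ob Map_eq" "f \<in> squares X Y" for X Y :: "'u arrow" and f
    using onM_orbit_points[OF _ _ that(3)] that by simp
  have pair: "quillen_pair TYPE('u) (Fun_model :: ('u sfunctor, _) model) Map_eq
      realization_functor orbit_points_functor adjunct"
  proof (rule quillen_pairI[OF assms(2,3) adjunction[OF cF cM]])
    fix A B :: "'u arrow" and i
    assume "i \<in> Hm Map_eq A B"
      "\<And>X Y p. X \<in> Ob Map_eq \<Longrightarrow> Y \<in> Ob Map_eq \<Longrightarrow> p \<in> fib Map_eq X Y \<Longrightarrow> p \<in> weq Map_eq X Y \<Longrightarrow> has_lifting Map_eq A B i X Y p"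
    \<comment> \<open>Cofibrations of \<open>Map_eq\<close> are defined by this lifting
      property.\<close>
    then show "i \<in> cof Map_eq A B" by (auto simp: Map_eq_def model_of_def has_lifting_def)
  next
    fix X Y :: "'u arrow" and f assume X: "X \<in> Ob Map_eq" "Y \<in> Ob Map_eq"
    show "onM orbit_points_functor X Y f \<in> fib Fun_model (onO orbit_points_functor X) (onO orbit_points_functor Y)"
      if "f \<in> fib Map_eq X Y" using that R[OF X] OM by (simp add: OR)
    show "onM orbit_points_functor X Y f \<in> weq Fun_model (onO orbit_points_functor X) (onO orbit_points_functor Y)"
      if "f \<in> weq Map_eq X Y" using that R[OF X] OM by (simp add: OR)
  qed
  have "quillen_equivalence TYPE('u) (Fun_model :: ('u sfunctor, _) model) Map_eq
      realization_functor orbit_points_functor adjunct"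
  proof (rule quillen_equivalenceI[OF pair])
    show "f \<in> weq Map_eq X Y \<longleftrightarrow> onM orbit_points_functor X Y f \<in> weq Fun_model (onO orbit_points_functor X) (onO orbit_points_functor Y)"
      if "X \<in> Ob Map_eq" "Y \<in> Ob Map_eq" "f \<in> Hm Map_eq X Y" for X Y :: "'u arrow" and f
      using that R[OF that(1,2)] OM by (simp add: OR)
    fix Y :: "'u sfunctor" assume "Y \<in> Ob Fun_model"
    then have "small_functor Y" by simp
    then obtain X p where X: "X \<in> Ob Map_cat" and p: "p \<in> fib Fun_model (orbit_points X) Y" "p \<in> weq Fun_model (orbit_points X) Y"
      using ex_resolution by blast
    let ?P = "orbit_points X"
    have "adjunct ?P (onO realization_functor ?P) (Idm Map_eq (onO realization_functor ?P))
        \<in> weq Fun_model ?P (onO orbit_points_functor (onO realization_functor ?P))"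
      using unit_orbit_points[OF cF cM modelD(5)[OF assms(2)] X] unfolding OR OL Map_eq_simps .
    moreover have "?P \<in> Ob Fun_model" using small_functor_orbit_points[OF X] by simp
    ultimately show "\<exists>P\<in>Ob Fun_model. \<exists>p. p \<in> fib Fun_model P Y \<and> p \<in> weq Fun_model P Y \<and>
        adjunct P (onO realization_functor P) (Idm Map_eq (onO realization_functor P))
          \<in> weq Fun_model P (onO orbit_points_functor (onO realization_functor P))"
      using p by blast
  qed
  with pair show ?thesis by blast
qed

end
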